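(* Let $\mathcal{O}$ be a complete discrete valuation ring with finite residue field and let $n\in\mathbb{N}$. Suppose that the characteristic of $\mathcal{O}$ does not divide $n$. Then the abscissa of convergence of the twist zeta function $\tilde{\zeta}_{\mathrm{GL}_n(\mathcal{O})}$ exists and is equal to the abscissa of convergence of the representation zeta function $\zeta_{\mathrm{SL}_n(\mathcal{O})}$.
   Context: All groups carry their profinite topology and representations are continuous and complex. For a group $G$, $r_i(G)$ is the number of isomorphism classes of irreducible representations of $G$ of dimension $i$, and $\zeta_G(s)=\sum_{i\ge1}r_i(G)i^{-s}$. Two representations $\rho,\sigma$ of $G$ are twist equivalent if $\rho\cong\sigma\otimes\chi$ for some one-dimensional representation $\chi$ of $G$; the equivalence classes are called twist isoclasses, and the dimension of a twist isoclass is the dimension of any of its members. $\tilde r_i(G)$ is the number of twist isoclasses of irreducible representations of $G$ of dimension $i$ (this is finite for $G=\mathrm{GL}_n(\mathcal{O})$), and $\tilde\zeta_G(s)=\sum_{i\ge1}\tilde r_i(G)i^{-s}$. The abscissa of convergence of a Dirichlet series is the infimum of the real $s$ for which it converges. If $\mathrm{char}\,\mathcal{O}=0$, the characteristic does not divide any $n\ge1$. *)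

theory Defs
  imports
    "HOL-Analysis.Analysis"
    "HOL-Algebra.Algebra"
    "Jordan_Normal_Form.VS_Connect"
    "Jordan_Normal_Form.Determinant"
begin

hide_const (open) Determinants.det

section \<open>Complete discrete valuation rings\<close>

definition discrete_valuation_ring :: "('a, 'b) ring_scheme \<Rightarrow> bool" where
  "discrete_valuation_ring R \<longleftrightarrow>
     principal_domain R \<and> (\<exists>!P. primeideal P R \<and> P \<noteq> {\<zero>\<^bsub>R\<^esub>})"

definition dvr_max_ideal :: "('a, 'b) ring_scheme \<Rightarrow> 'a set" where
  "dvr_max_ideal R = (THE P. primeideal P R \<and> P \<noteq> {\<zero>\<^bsub>R\<^esub>})"

primrec ideal_power :: "('a, 'b) ring_scheme \<Rightarrow> 'a set \<Rightarrow> nat \<Rightarrow> 'a set" where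
  "ideal_power R I 0 = carrier R"
| "ideal_power R I (Suc k) = ideal_prod R I (ideal_power R I k)"

text \<open>Separatedness need not be required: it holds in every discrete valuation ring by
  Krull's intersection theorem.\<close>

definition adically_complete :: "('a, 'b) ring_scheme \<Rightarrow> 'a set \<Rightarrow> bool" where
  "adically_complete R I \<longleftrightarrow>
     (\<forall>s :: nat \<Rightarrow> 'a. range s \<subseteq> carrier R \<and>
          (\<forall>k. \<exists>N. \<forall>i\<ge>N. \<forall>j\<ge>N. s i \<ominus>\<^bsub>R\<^esub> s j \<in> ideal_power R I k) \<longrightarrow>
        (\<exists>x\<in>carrier R. \<forall>k. \<exists>N. \<forall>i\<ge>N. s i \<ominus>\<^bsub>R\<^esub> x \<in> ideal_power R I k))"

definition complete_dvr_finite_residue_field :: "('a, 'b) ring_scheme \<Rightarrow> bool" where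
  "complete_dvr_finite_residue_field R \<longleftrightarrow>
     discrete_valuation_ring R \<and>
     adically_complete R (dvr_max_ideal R) \<and>
     finite (carrier (R Quot dvr_max_ideal R))"

definition adic_topology :: "('a, 'b) ring_scheme \<Rightarrow> 'a set \<Rightarrow> 'a topology" where
  "adic_topology R I = topology (\<lambda>U. U \<subseteq> carrier R \<and>
     (\<forall>x\<in>U. \<exists>k. ideal_power R I k +>\<^bsub>R\<^esub> x \<subseteq> U))"


section \<open>Matrix groups and their topologies\<close>

definition mat_topology :: "'a topology \<Rightarrow> nat \<Rightarrow> 'a mat topology" where
  "mat_topology T n =
     pullback_topology (carrier_mat n n)
       (\<lambda>A. \<lambda>(i, j)\<in>{..<n} \<times> {..<n}. A $$ (i, j))
       (product_topology (\<lambda>_. T) ({..<n} \<times> {..<n}))"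

definition GL :: "nat \<Rightarrow> 'a :: comm_ring_1 mat monoid" where
  "GL n = units_of (ring_mat TYPE('a) n ())"

definition SL :: "nat \<Rightarrow> 'a :: comm_ring_1 mat monoid" where
  "SL n = (GL n)\<lparr>carrier := {A \<in> carrier (GL n). det A = 1}\<rparr>"

text \<open>For a complete discrete valuation ring with finite residue field, the profinite topology
  of \<open>GL n\<close> and \<open>SL n\<close> is the one induced by the entrywise adic topology.\<close>

definition GL_topology :: "nat \<Rightarrow> 'a :: comm_ring_1 mat topology" where
  "GL_topology n =
     subtopology (mat_topology (adic_topology class_ring (dvr_max_ideal class_ring)) n)
       (carrier (GL n))"

definition SL_topology :: "nat \<Rightarrow> 'a :: comm_ring_1 mat topology" where
  "SL_topology n = subtopology (GL_topology n) (carrier (SL n))"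


section \<open>Continuous complex representations\<close>

definition representation ::
  "('g, 'b) monoid_scheme \<Rightarrow> 'g topology \<Rightarrow> nat \<Rightarrow> ('g \<Rightarrow> complex mat) \<Rightarrow> bool" where
  "representation G T d \<rho> \<longleftrightarrow>
     \<rho> \<in> hom G (GL d) \<and> continuous_map T (mat_topology euclidean d) \<rho>"

definition irreducible_representation ::
  "('g, 'b) monoid_scheme \<Rightarrow> 'g topology \<Rightarrow> nat \<Rightarrow> ('g \<Rightarrow> complex mat) \<Rightarrow> bool" where
  "irreducible_representation G T d \<rho> \<longleftrightarrow>
     representation G T d \<rho> \<and> d > 0 \<and>
     (\<forall>W. VectorSpace.subspace class_ring W (module_vec TYPE(complex) d) \<and>
          (\<forall>g\<in>carrier G. \<forall>w\<in>W. \<rho> g *\<^sub>v w \<in> W) \<longrightarrow>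
        W = {0\<^sub>v d} \<or> W = carrier_vec d)"

definition irreps ::
  "('g, 'b) monoid_scheme \<Rightarrow> 'g topology \<Rightarrow> nat \<Rightarrow> ('g \<Rightarrow> complex mat) set" where
  "irreps G T d = {\<rho>. irreducible_representation G T d \<rho>}"

definition rep_iso ::
  "('g, 'b) monoid_scheme \<Rightarrow> nat \<Rightarrow> ('g \<Rightarrow> complex mat) \<Rightarrow> ('g \<Rightarrow> complex mat) \<Rightarrow> bool" where
  "rep_iso G d \<rho> \<sigma> \<longleftrightarrow>
     (\<exists>P\<in>carrier (GL d). \<forall>g\<in>carrier G. P * \<rho> g = \<sigma> g * P)"

text \<open>The tensor product \<open>\<sigma> \<otimes> \<psi>\<close> with a one-dimensional representation \<open>\<psi>\<close>: the Kronecker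
  product with a 1-by-1 matrix is multiplication by its only entry.\<close>

definition twist ::
  "('g \<Rightarrow> complex mat) \<Rightarrow> ('g \<Rightarrow> complex mat) \<Rightarrow> 'g \<Rightarrow> complex mat" where
  "twist \<sigma> \<psi> = (\<lambda>g. \<psi> g $$ (0, 0) \<cdot>\<^sub>m \<sigma> g)"

definition twist_equivalent ::
  "('g, 'b) monoid_scheme \<Rightarrow> 'g topology \<Rightarrow> nat \<Rightarrow>
     ('g \<Rightarrow> complex mat) \<Rightarrow> ('g \<Rightarrow> complex mat) \<Rightarrow> bool" where
  "twist_equivalent G T d \<rho> \<sigma> \<longleftrightarrow>
     (\<exists>\<psi>. representation G T 1 \<psi> \<and> rep_iso G d \<rho> (twist \<sigma> \<psi>))"

definition isoclasses ::
  "('g, 'b) monoid_scheme \<Rightarrow> 'g topology \<Rightarrow> nat \<Rightarrow> ('g \<Rightarrow> complex mat) set set" where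
  "isoclasses G T d =
     irreps G T d // {(\<rho>, \<sigma>) \<in> irreps G T d \<times> irreps G T d. rep_iso G d \<rho> \<sigma>}"

definition twist_isoclasses ::
  "('g, 'b) monoid_scheme \<Rightarrow> 'g topology \<Rightarrow> nat \<Rightarrow> ('g \<Rightarrow> complex mat) set set" where
  "twist_isoclasses G T d =
     irreps G T d // {(\<rho>, \<sigma>) \<in> irreps G T d \<times> irreps G T d. twist_equivalent G T d \<rho> \<sigma>}"


section \<open>Zeta functions and abscissae of convergence\<close>

text \<open>The number of classes is taken in \<open>ennreal\<close>, so that an infinite set of classes counts as
  \<open>\<infinity>\<close> and not as \<open>0\<close>.  As all terms are nonnegative, a Dirichlet series converges at a real
  point iff its value there is finite.\<close>

definition num_classes :: "'c set \<Rightarrow> ennreal" where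
  "num_classes C = emeasure (count_space UNIV) C"

definition dirichlet_series :: "(nat \<Rightarrow> ennreal) \<Rightarrow> real \<Rightarrow> ennreal" where
  "dirichlet_series a s = suminf (\<lambda>i. a (Suc i) * ennreal (real (Suc i) powr (- s)))"

definition rep_zeta :: "('g, 'b) monoid_scheme \<Rightarrow> 'g topology \<Rightarrow> real \<Rightarrow> ennreal" where
  "rep_zeta G T = dirichlet_series (\<lambda>i. num_classes (isoclasses G T i))"

definition twist_zeta :: "('g, 'b) monoid_scheme \<Rightarrow> 'g topology \<Rightarrow> real \<Rightarrow> ennreal" where
  "twist_zeta G T = dirichlet_series (\<lambda>i. num_classes (twist_isoclasses G T i))"

text \<open>The infimum is taken in \<open>ereal\<close>: it is \<open>\<infinity>\<close> if the series converges nowhere, and \<open>-\<infinity>\<close> if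
  it converges everywhere (as for a series with finitely many terms, e.g. for \<open>SL 1\<close>).\<close>

definition abscissa_of_convergence :: "(real \<Rightarrow> ennreal) \<Rightarrow> ereal" where
  "abscissa_of_convergence Z = (INF s\<in>{s. Z s < \<infinity>}. ereal s)"

end

theory Submission
  imports Defs "Jordan_Normal_Form.Spectral_Radius"
begin

text \<open>Write \<open>G\<close> for \<open>GL n\<close> and \<open>S\<close> for \<open>SL n\<close> over the ring \<open>O\<close> with uniformizer \<open>\<pi>\<close>.  The two abscissae agree
  because twist isoclasses of \<open>G\<close> and isoclasses of \<open>S\<close> correspond to each other with bounded fibres
  and with dimensions that agree up to a bounded factor.

  Clifford theory gives the correspondence.  As \<open>S\<close> contains all commutators, \<open>G\<close> acts on the space of
  \<open>S\<close>-intertwiners between two irreducible representations of \<open>G\<close> through commuting operators, and a common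
  eigenvector exhibits one of them as a twist of the other (\<open>common_constituent_twist\<close>): so twist
  isoclasses are disjoint when restricted to \<open>S\<close>.  As the characteristic does not divide \<open>n\<close>, Hensel's
  lemma (\<open>nth_roots\<close>) shows that the \<open>n\<close>-th powers have finite index in the unit group, and therefore that \<open>S\<close> and the
  scalar matrices generate a subgroup of finite index \<open>e\<close>.  Scalar matrices act by scalars,
  so a constituent on \<open>S\<close> of an \<open>m\<close>-dimensional irreducible representation of \<open>G\<close> has dimension at least
  \<open>m / e\<close> (\<open>constituent_dim_bound\<close>), and all constituents are conjugate under \<open>e\<close> fixed elements
  (\<open>constituents_conjugate\<close>).  Conversely every irreducible representation of \<open>S\<close> is a constituent of
  one of \<open>G\<close>; up to isomorphism it is determined by the twist isoclass of the latter, by one of the \<open>e\<close>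
  conjugations, and by the restriction to \<open>S\<close> of a character of \<open>G\<close>.  Only finitely many such restrictions
  exist (\<open>finite_SL_restrictions\<close>), so the two zeta functions are finite at the same points
  (\<open>twist_zeta_finite_iff\<close>).

  For finiteness at some point, a representation of \<open>G\<close> of dimension \<open>d < |O / \<pi>\<^sup>k|\<close> turns out to be, up to twist,
  trivial on the congruence subgroup of level \<open>2 k\<close> (\<open>twist_level_bound\<close>).  If it is trivial at level \<open>l > 2 k\<close>, it has an
  eigencharacter \<open>\<theta>\<close> on the congruence subgroup of level \<open>l - k\<close>, which is abelian modulo level \<open>l\<close>.  There are more
  elementary matrices \<open>1 + x e\<^sub>i\<^sub>j\<close> modulo \<open>\<pi>\<^sup>k\<close> than the dimension allows distinct conjugates of \<open>\<theta>\<close>, so two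
  conjugates agree; this forces \<open>\<theta>\<close> on level \<open>l - 1\<close> to factor through the determinant, and a twist
  lowers the level (\<open>level_reduction\<close>).  The index of the congruence subgroup of level \<open>2 k\<close>, with \<open>k\<close> chosen least,
  bounds the number of twist isoclasses of dimension \<open>d\<close> by a polynomial in \<open>d\<close>.  The case \<open>d = k = 1\<close> also
  yields \<open>finite_SL_restrictions\<close>.\<close>

(* Vectors and matrices are the ones whose dimensions are explicit, not type-indexed ones. *)
unbundle no vec_syntax
hide_const (open) Finite_Cartesian_Product.vec Finite_Cartesian_Product.mat Finite_Cartesian_Product.row
  Finite_Cartesian_Product.rows Finite_Cartesian_Product.transpose

section \<open>Subspaces and matrices over the complex numbers\<close>

text \<open>Linear subspaces of the space of complex vectors of length \<open>d\<close>.\<close>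

definition vec_subspace :: "nat \<Rightarrow> complex vec set \<Rightarrow> bool" where
  "vec_subspace d W \<longleftrightarrow> W \<subseteq> carrier_vec d \<and> 0\<^sub>v d \<in> W \<and>
     (\<forall>x\<in>W. \<forall>y\<in>W. x + y \<in> W) \<and> (\<forall>c. \<forall>x\<in>W. c \<cdot>\<^sub>v x \<in> W)"

lemma subspace_module_vec_iff:
  "VectorSpace.subspace class_ring W (module_vec TYPE(complex) d) \<longleftrightarrow> vec_subspace d W"
  unfolding VectorSpace.subspace_def LinearCombinations.submodule_def vec_subspace_def
  using vec_vs[where ?'a = complex] vec_module[where ?'a = complex] by (auto simp: module_vec_simps)

text \<open>If \<open>d < r\<close>, padding \<open>P\<close> with zero rows gives a singular square matrix.\<close>

lemma injective_mat_dim_le: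
  fixes P :: "complex mat"
  assumes P: "P \<in> carrier_mat d r"
    and inj: "\<And>x. x \<in> carrier_vec r \<Longrightarrow> P *\<^sub>v x = 0\<^sub>v d \<Longrightarrow> x = 0\<^sub>v r"
  shows "r \<le> d"
proof (rule ccontr)
  assume "\<not> r \<le> d"
  define Q where "Q = Matrix.mat r r (\<lambda>(i, j). if i < d then P $$ (i, j) else 0)"
  have Q: "Q \<in> carrier_mat r r" by (simp add: Q_def)
  have "Q\<^sup>T *\<^sub>v unit_vec r d = 0\<^sub>v r"
    using \<open>\<not> r \<le> d\<close> by (intro eq_vecI) (auto simp: Q_def scalar_prod_def)
  then have "det Q\<^sup>T = 0"
    using det_0_iff_vec_prod_zero[of "Q\<^sup>T" r] Q \<open>\<not> r \<le> d\<close>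
    by (metis linorder_not_le transpose_carrier_mat unit_vec_carrier unit_vec_nonzero)
  then have "det Q = 0" using det_transpose[OF Q] by simp
  then obtain v where v: "v \<in> carrier_vec r" "v \<noteq> 0\<^sub>v r" "Q *\<^sub>v v = 0\<^sub>v r"
    using det_0_iff_vec_prod_zero[OF Q] by auto
  have "P *\<^sub>v v = 0\<^sub>v d"
  proof (rule eq_vecI)
    fix i assume "i < dim_vec (0\<^sub>v d :: complex vec)"
    then have i: "i < d" "i < r" using \<open>\<not> r \<le> d\<close> by auto
    have "row P i = row Q i" using i P by (auto simp: Q_def)
    then have "(P *\<^sub>v v) $ i = (Q *\<^sub>v v) $ i" using i P Q by simp
    then show "(P *\<^sub>v v) $ i = 0\<^sub>v d $ i" using v i by simp
  qed (use P in auto)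
  then show False using inj v by blast
qed

lemma left_inverse_dim_le:
  fixes P L :: "complex mat"
  assumes P: "P \<in> carrier_mat d r" and L: "L \<in> carrier_mat r d" and LP: "L * P = 1\<^sub>m r"
  shows "r \<le> d"
proof (rule injective_mat_dim_le[OF P])
  fix x :: "complex vec" assume x: "x \<in> carrier_vec r" "P *\<^sub>v x = 0\<^sub>v d"
  have "x = (L * P) *\<^sub>v x" using x LP by simp
  also have "\<dots> = L *\<^sub>v (P *\<^sub>v x)" using P L x by (intro assoc_mult_mat_vec)
  also have "\<dots> = 0\<^sub>v r" using x L by (auto intro!: eq_vecI)
  finally show "x = 0\<^sub>v r" .
qed

text \<open>Every subspace is the column space of a matrix with a left inverse.\<close>

lemma subspace_param:
  assumes W: "vec_subspace d W"
  obtains r P L where "P \<in> carrier_mat d r" "L \<in> carrier_mat r d" "L * P = (1\<^sub>m r :: complex mat)"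
     "W = {P *\<^sub>v x | x. x \<in> carrier_vec r}"
proof -
  define S where "S = {r. \<exists>P L. P \<in> carrier_mat d r \<and> L \<in> carrier_mat r d \<and> L * P = (1\<^sub>m r :: complex mat)
     \<and> {P *\<^sub>v x | x. x \<in> carrier_vec r} \<subseteq> W}"
  have bd: "r \<le> d" if "r \<in> S" for r using that left_inverse_dim_le unfolding S_def by blast
  have "0 \<in> S"
  proof -
    have "{0\<^sub>m d 0 *\<^sub>v x | x. x \<in> carrier_vec 0} \<subseteq> W"
    proof clarify
      fix x :: "complex vec" assume "x \<in> carrier_vec 0"
      then have "0\<^sub>m d 0 *\<^sub>v x = 0\<^sub>v d" by (auto intro!: eq_vecI simp: scalar_prod_def)
      then show "0\<^sub>m d 0 *\<^sub>v x \<in> W" using W unfolding vec_subspace_def by simp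
    qed
    then show ?thesis unfolding S_def
      by (intro CollectI exI[of _ "0\<^sub>m d 0"] exI[of _ "0\<^sub>m 0 d"]) auto
  qed
  define r where "r = Max S"
  have fS: "finite S" using bd by (meson finite_nat_set_iff_bounded_le)
  have "r \<in> S" using \<open>0 \<in> S\<close> fS unfolding r_def by (intro Max_in) auto
  then obtain P L where P: "P \<in> carrier_mat d r" and L: "L \<in> carrier_mat r d"
    and LP: "L * P = (1\<^sub>m r :: complex mat)" and sub: "{P *\<^sub>v x | x. x \<in> carrier_vec r} \<subseteq> W"
    unfolding S_def by blast
  have "W \<subseteq> {P *\<^sub>v x | x. x \<in> carrier_vec r}"
  proof (rule ccontr)
    assume "\<not> ?thesis"
    then obtain w where w: "w \<in> W" "w \<notin> {P *\<^sub>v x | x. x \<in> carrier_vec r}" by blast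
    have wc: "w \<in> carrier_vec d" using W w unfolding vec_subspace_def by auto
    define u where "u = w - P *\<^sub>v (L *\<^sub>v w)"
    have Lw: "L *\<^sub>v w \<in> carrier_vec r" using L wc by simp
    have PLw: "P *\<^sub>v (L *\<^sub>v w) \<in> carrier_vec d" using P Lw by simp
    have u: "u \<in> carrier_vec d" using PLw wc by (simp add: u_def)
    have "u = w + (-1) \<cdot>\<^sub>v (P *\<^sub>v (L *\<^sub>v w))" using PLw wc by (auto simp: u_def)
    moreover have "P *\<^sub>v (L *\<^sub>v w) \<in> W" using sub Lw by blast
    ultimately have uW: "u \<in> W" using W w unfolding vec_subspace_def by metis
    have "u \<noteq> 0\<^sub>v d"
    proof
      assume u0: "u = 0\<^sub>v d"
      have "w = P *\<^sub>v (L *\<^sub>v w)"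
      proof (rule eq_vecI)
        fix i assume "i < dim_vec (P *\<^sub>v (L *\<^sub>v w))"
        then have i: "i < d" using P by auto
        then have "u $ i = w $ i - (P *\<^sub>v (L *\<^sub>v w)) $ i" unfolding u_def using PLw wc
          by (metis carrier_vecD index_minus_vec(1))
        then show "w $ i = (P *\<^sub>v (L *\<^sub>v w)) $ i" using u0 i by simp
      qed (use wc P in simp)
      then show False using w Lw by blast
    qed
    then obtain k where k: "k < d" "u $ k \<noteq> 0" using u
      by (metis carrier_vecD eq_vecI index_zero_vec(1) index_zero_vec(2))
    have Lu: "L *\<^sub>v u = 0\<^sub>v r"
    proof -
      have "L *\<^sub>v u = L *\<^sub>v w - L *\<^sub>v (P *\<^sub>v (L *\<^sub>v w))" unfolding u_def
        by (rule mult_minus_distrib_mat_vec[OF L wc PLw])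
      also have "L *\<^sub>v (P *\<^sub>v (L *\<^sub>v w)) = (L * P) *\<^sub>v (L *\<^sub>v w)"
        using L P Lw by (intro assoc_mult_mat_vec[symmetric])
      also have "\<dots> = L *\<^sub>v w" using LP Lw by simp
      finally show ?thesis using Lw by simp
    qed
    define P' where "P' = Matrix.mat d (Suc r) (\<lambda>(i, j). if j < r then P $$ (i, j) else u $ i)"
    define e where "e = (\<lambda>j. (1 / u $ k) * ((if j = k then 1 else 0) - (\<Sum>b<r. P $$ (k, b) * L $$ (b, j))))"
    define L' where "L' = Matrix.mat (Suc r) d (\<lambda>(i, j). if i < r then L $$ (i, j) else e j)"
    have P'c: "P' \<in> carrier_mat d (Suc r)" and L'c: "L' \<in> carrier_mat (Suc r) d"
      by (auto simp: P'_def L'_def)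
    have LPe: "(\<Sum>c<d. L $$ (a, c) * P $$ (c, b)) = (if a = b then 1 else 0)" if "a < r" "b < r" for a b
    proof -
      have "(L * P) $$ (a, b) = (\<Sum>c<d. L $$ (a, c) * P $$ (c, b))"
        using that L P by (simp add: scalar_prod_def lessThan_atLeast0)
      then show ?thesis using LP that by simp
    qed
    have Lue: "(\<Sum>c<d. L $$ (a, c) * u $ c) = 0" if "a < r" for a
    proof -
      have "(L *\<^sub>v u) $ a = (\<Sum>c<d. L $$ (a, c) * u $ c)"
        using that L u by (simp add: scalar_prod_def lessThan_atLeast0)
      then show ?thesis using Lu that by simp
    qed
    have eP: "(\<Sum>c<d. e c * P $$ (c, b)) = 0" if b: "b < r" for b
    proof -
      have "(\<Sum>c<d. e c * P $$ (c, b)) = (1 / u $ k) * ((\<Sum>c<d. (if c = k then 1 else 0) * P $$ (c, b))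
          - (\<Sum>c<d. (\<Sum>a<r. P $$ (k, a) * L $$ (a, c)) * P $$ (c, b)))"
        unfolding e_def by (simp add: sum_distrib_left algebra_simps sum_subtractf sum_divide_distrib diff_divide_distrib)
      also have "(\<Sum>c<d. (if c = k then 1 else 0) * P $$ (c, b)) = P $$ (k, b)"
        using k by (simp add: if_distrib[where f = "\<lambda>x. x * _"] cong: if_cong)
      also have "(\<Sum>c<d. (\<Sum>a<r. P $$ (k, a) * L $$ (a, c)) * P $$ (c, b))
          = (\<Sum>a<r. P $$ (k, a) * (\<Sum>c<d. L $$ (a, c) * P $$ (c, b)))"
        by (simp add: sum_distrib_left sum_distrib_right mult.assoc) (rule sum.swap)
      also have "\<dots> = (\<Sum>a<r. P $$ (k, a) * (if a = b then 1 else 0))"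
        using LPe b by (intro sum.cong) auto
      also have "\<dots> = P $$ (k, b)" using b by (simp add: if_distrib cong: if_cong)
      finally show ?thesis by simp
    qed
    have eu: "(\<Sum>c<d. e c * u $ c) = 1"
    proof -
      have "(\<Sum>c<d. e c * u $ c) = (1 / u $ k) * ((\<Sum>c<d. (if c = k then 1 else 0) * u $ c)
          - (\<Sum>c<d. (\<Sum>a<r. P $$ (k, a) * L $$ (a, c)) * u $ c))"
        unfolding e_def by (simp add: sum_distrib_left algebra_simps sum_subtractf sum_divide_distrib diff_divide_distrib)
      also have "(\<Sum>c<d. (if c = k then 1 else 0) * u $ c) = u $ k"
        using k by (simp add: if_distrib[where f = "\<lambda>x. x * _"] cong: if_cong)
      also have "(\<Sum>c<d. (\<Sum>a<r. P $$ (k, a) * L $$ (a, c)) * u $ c)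
          = (\<Sum>a<r. P $$ (k, a) * (\<Sum>c<d. L $$ (a, c) * u $ c))"
        by (simp add: sum_distrib_left sum_distrib_right mult.assoc) (rule sum.swap)
      also have "\<dots> = 0" using Lue by simp
      finally show ?thesis using k by simp
    qed
    have "L' * P' = 1\<^sub>m (Suc r)"
    proof (rule eq_matI)
      fix i j assume "i < dim_row (1\<^sub>m (Suc r) :: complex mat)" "j < dim_col (1\<^sub>m (Suc r) :: complex mat)"
      then have ij: "i < Suc r" "j < Suc r" by auto
      have "(L' * P') $$ (i, j) = (\<Sum>c<d. L' $$ (i, c) * P' $$ (c, j))"
        using ij L'c P'c by (simp add: scalar_prod_def lessThan_atLeast0)
      also have "\<dots> = (\<Sum>c<d. (if i < r then L $$ (i, c) else e c) * (if j < r then P $$ (c, j) else u $ c))"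
        using ij by (intro sum.cong) (auto simp: L'_def P'_def)
      also have "\<dots> = (if i = j then 1 else 0)"
        using ij LPe Lue eP eu by (auto simp: less_Suc_eq)
      finally show "(L' * P') $$ (i, j) = 1\<^sub>m (Suc r) $$ (i, j)" using ij by simp
    qed (use L'c P'c in auto)
    moreover have "{P' *\<^sub>v x | x. x \<in> carrier_vec (Suc r)} \<subseteq> W"
    proof clarify
      fix x :: "complex vec" assume x: "x \<in> carrier_vec (Suc r)"
      define y where "y = vec r (\<lambda>i. x $ i)"
      have y: "y \<in> carrier_vec r" by (simp add: y_def)
      have "P' *\<^sub>v x = P *\<^sub>v y + (x $ r) \<cdot>\<^sub>v u"
        using P u x by (intro eq_vecI) (auto simp: P'_def y_def scalar_prod_def)
      moreover have "P *\<^sub>v y \<in> W" using sub y by blast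
      ultimately show "P' *\<^sub>v x \<in> W" using W uW unfolding vec_subspace_def by simp
    qed
    ultimately have "Suc r \<in> S" using P'c L'c unfolding S_def by blast
    then have "Suc r \<le> r" using fS unfolding r_def by (metis Max_ge)
    then show False by simp
  qed
  then show thesis using that[OF P L LP] sub by blast
qed

lemma mat_eqI_mult_vec:
  fixes A B :: "complex mat"
  assumes A: "A \<in> carrier_mat d r" and B: "B \<in> carrier_mat d r"
    and eq: "\<And>x. x \<in> carrier_vec r \<Longrightarrow> A *\<^sub>v x = B *\<^sub>v x"
  shows "A = B"
proof (rule eq_matI)
  fix i j assume ij: "i < dim_row B" "j < dim_col B"
  have "(A *\<^sub>v unit_vec r j) $ i = (B *\<^sub>v unit_vec r j) $ i" using eq[of "unit_vec r j"] by simp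
  then show "A $$ (i, j) = B $$ (i, j)" using A B ij by simp
qed (use A B in auto)

lemma mat_mult_zero_vec:
  fixes A :: "'c :: semiring_0 mat"
  assumes "A \<in> carrier_mat m d"
  shows "A *\<^sub>v 0\<^sub>v d = 0\<^sub>v m"
  using assms by (intro eq_vecI) (auto simp: scalar_prod_def)

lemma scalar_mat_mult_vec:
  assumes "v \<in> carrier_vec m"
  shows "(c \<cdot>\<^sub>m 1\<^sub>m m) *\<^sub>v v = c \<cdot>\<^sub>v (v :: 'b :: comm_ring_1 vec)"
  using assms
  by (intro eq_vecI) (auto simp: scalar_prod_def mult.assoc if_distrib if_distribR sum.delta cong: if_cong)

lemma surjective_mat_right_inverse:
  fixes T :: "complex mat"
  assumes T: "T \<in> carrier_mat e d" and surj: "\<And>y. y \<in> carrier_vec e \<Longrightarrow> \<exists>x\<in>carrier_vec d. T *\<^sub>v x = y"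
  obtains S where "S \<in> carrier_mat d e" "T * S = 1\<^sub>m e"
proof -
  have "\<exists>x\<in>carrier_vec d. T *\<^sub>v x = unit_vec e j" for j using surj by simp
  then obtain f where f: "\<And>j. f j \<in> carrier_vec d \<and> T *\<^sub>v f j = unit_vec e j" by metis
  define S where "S = Matrix.mat d e (\<lambda>(i, j). f j $ i)"
  have S: "S \<in> carrier_mat d e" by (simp add: S_def)
  have "T * S = 1\<^sub>m e"
  proof (rule eq_matI)
    fix i j assume "i < dim_row (1\<^sub>m e :: complex mat)" "j < dim_col (1\<^sub>m e :: complex mat)"
    then have ij: "i < e" "j < e" by auto
    have "col S j = f j" using ij f[of j] by (intro eq_vecI) (auto simp: S_def)
    then have "(T * S) $$ (i, j) = (T *\<^sub>v f j) $ i" using ij T S by simp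
    then show "(T * S) $$ (i, j) = 1\<^sub>m e $$ (i, j)" using f[of j] ij by simp
  qed (use T S in auto)
  then show thesis using that S by blast
qed

lemma nonzero_mat_mult_vec:
  fixes T :: "complex mat"
  assumes T: "T \<in> carrier_mat e d" "T \<noteq> 0\<^sub>m e d"
  obtains x where "x \<in> carrier_vec d" "T *\<^sub>v x \<noteq> 0\<^sub>v e"
proof -
  have "\<exists>x0 \<in> carrier_vec d. T *\<^sub>v x0 \<noteq> 0\<^sub>v e"
  proof (rule ccontr)
    assume a: "\<not> ?thesis"
    have "T = 0\<^sub>m e d"
    proof (rule mat_eqI_mult_vec[OF T(1)])
      fix x :: "complex vec" assume "x \<in> carrier_vec d"
      then show "T *\<^sub>v x = 0\<^sub>m e d *\<^sub>v x" using a by auto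
    qed auto
    then show False using T by simp
  qed
  then show thesis using that by blast
qed

lemma smult_smult_mat: "k \<cdot>\<^sub>m (l \<cdot>\<^sub>m A) = (k * l :: complex) \<cdot>\<^sub>m A"
  by (intro eq_matI) auto

lemma one_smult_mat: "(1 :: complex) \<cdot>\<^sub>m A = A"
  by (intro eq_matI) auto

lemma vec_subspace_range:
  fixes A :: "complex mat"
  assumes A: "A \<in> carrier_mat d r"
  shows "vec_subspace d {A *\<^sub>v x | x. x \<in> carrier_vec r}"
  unfolding vec_subspace_def
proof (intro conjI ballI allI subsetI)
  show "0\<^sub>v d \<in> {A *\<^sub>v x | x. x \<in> carrier_vec r}"
  proof -
    have "A *\<^sub>v 0\<^sub>v r = 0\<^sub>v d" using A by (auto intro!: eq_vecI)
    then show ?thesis by (metis (mono_tags, lifting) mem_Collect_eq zero_carrier_vec)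
  qed
next
  fix x y assume "x \<in> {A *\<^sub>v x | x. x \<in> carrier_vec r}" "y \<in> {A *\<^sub>v x | x. x \<in> carrier_vec r}"
  then obtain a b where "x = A *\<^sub>v a" "y = A *\<^sub>v b" "a \<in> carrier_vec r" "b \<in> carrier_vec r" by auto
  then show "x + y \<in> {A *\<^sub>v x | x. x \<in> carrier_vec r}"
    using mult_add_distrib_mat_vec[OF A, of a b] by (metis (mono_tags, lifting) add_carrier_vec mem_Collect_eq)
next
  fix c x assume "x \<in> {A *\<^sub>v x | x. x \<in> carrier_vec r}"
  then obtain a where "x = A *\<^sub>v a" "a \<in> carrier_vec r" by auto
  then show "c \<cdot>\<^sub>v x \<in> {A *\<^sub>v x | x. x \<in> carrier_vec r}"
    using mult_mat_vec[OF A, of a c] by (metis (mono_tags, lifting) smult_carrier_vec mem_Collect_eq)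
qed (use A in auto)

lemma vec_subspace_kernel:
  fixes A :: "complex mat"
  assumes A: "A \<in> carrier_mat d r"
  shows "vec_subspace r {x \<in> carrier_vec r. A *\<^sub>v x = 0\<^sub>v d}"
proof -
  have "A *\<^sub>v 0\<^sub>v r = 0\<^sub>v d" using A by (intro eq_vecI) auto
  then show ?thesis
    unfolding vec_subspace_def by (auto simp: mult_add_distrib_mat_vec[OF A] mult_mat_vec[OF A])
qed

text \<open>Dually, every subspace is the kernel of a matrix with a right inverse.\<close>

lemma subspace_kernel_param:
  assumes W: "vec_subspace d W"
  obtains s L P where "L \<in> carrier_mat s d" "P \<in> carrier_mat d s" "L * P = (1\<^sub>m s :: complex mat)"
     "W = {x \<in> carrier_vec d. L *\<^sub>v x = 0\<^sub>v s}"
proof -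
  obtain r P L where P: "P \<in> carrier_mat d r" and L: "L \<in> carrier_mat r d"
    and LP: "L * P = (1\<^sub>m r :: complex mat)" and Wr: "W = {P *\<^sub>v x | x. x \<in> carrier_vec r}"
    by (rule subspace_param[OF W])
  define E where "E = 1\<^sub>m d - P * L"
  have PL: "P * L \<in> carrier_mat d d" using P L by simp
  have E: "E \<in> carrier_mat d d" using PL by (simp add: E_def minus_carrier_mat)
  have Ex: "E *\<^sub>v x = x - P *\<^sub>v (L *\<^sub>v x)" if "x \<in> carrier_vec d" for x
    unfolding E_def using that P L PL by (subst minus_mult_distrib_mat_vec) auto
  have LE: "L *\<^sub>v (E *\<^sub>v x) = 0\<^sub>v r" if x: "x \<in> carrier_vec d" for x
  proof -
    have c: "L *\<^sub>v x \<in> carrier_vec r" "P *\<^sub>v (L *\<^sub>v x) \<in> carrier_vec d" using L P x by auto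
    have "L *\<^sub>v (E *\<^sub>v x) = L *\<^sub>v x - L *\<^sub>v (P *\<^sub>v (L *\<^sub>v x))" unfolding Ex[OF x]
      by (rule mult_minus_distrib_mat_vec[OF L x c(2)])
    also have "L *\<^sub>v (P *\<^sub>v (L *\<^sub>v x)) = (L * P) *\<^sub>v (L *\<^sub>v x)"
      using L P c by (intro assoc_mult_mat_vec[symmetric])
    also have "\<dots> = L *\<^sub>v x" using LP c by simp
    finally show ?thesis using c by simp
  qed
  have EE: "E *\<^sub>v (E *\<^sub>v x) = E *\<^sub>v x" if x: "x \<in> carrier_vec d" for x
  proof -
    have c: "E *\<^sub>v x \<in> carrier_vec d" using E x by simp
    have "P *\<^sub>v (0\<^sub>v r) = 0\<^sub>v d" using P by (auto intro!: eq_vecI)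
    then show ?thesis using Ex[OF c] LE[OF x] c by simp
  qed
  obtain s P' L0 where P': "P' \<in> carrier_mat d s" and L0: "L0 \<in> carrier_mat s d"
    and LP': "L0 * P' = (1\<^sub>m s :: complex mat)"
    and Er: "{E *\<^sub>v x | x. x \<in> carrier_vec d} = {P' *\<^sub>v x | x. x \<in> carrier_vec s}"
    by (rule subspace_param[OF vec_subspace_range[OF E]])
  have EP': "E * P' = P'"
  proof (rule mat_eqI_mult_vec)
    fix x :: "complex vec" assume x: "x \<in> carrier_vec s"
    then obtain z where z: "z \<in> carrier_vec d" "P' *\<^sub>v x = E *\<^sub>v z" using Er by blast
    have "(E * P') *\<^sub>v x = E *\<^sub>v (P' *\<^sub>v x)" using E P' x by (intro assoc_mult_mat_vec)
    then show "(E * P') *\<^sub>v x = P' *\<^sub>v x" using z EE by simp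
  qed (use E P' in auto)
  define L' where "L' = L0 * E"
  have L': "L' \<in> carrier_mat s d" using L0 E by (simp add: L'_def)
  have "L' * P' = L0 * (E * P')" unfolding L'_def using L0 E P' by (intro assoc_mult_mat)
  then have one: "L' * P' = 1\<^sub>m s" using EP' LP' by simp
  have "W = {x \<in> carrier_vec d. L' *\<^sub>v x = 0\<^sub>v s}"
  proof (intro subset_antisym subsetI)
    fix w assume "w \<in> W"
    then obtain x where x: "x \<in> carrier_vec r" "w = P *\<^sub>v x" using Wr by auto
    have w: "w \<in> carrier_vec d" using x P by simp
    have "L *\<^sub>v w = (L * P) *\<^sub>v x" using x L P by simp
    then have "L *\<^sub>v w = x" using LP x by simp
    then have "E *\<^sub>v w = 0\<^sub>v d" using Ex[OF w] x w by simp
    then have "L' *\<^sub>v w = 0\<^sub>v s" unfolding L'_def using L0 E w by (auto intro!: eq_vecI)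
    then show "w \<in> {x \<in> carrier_vec d. L' *\<^sub>v x = 0\<^sub>v s}" using w by simp
  next
    fix x assume "x \<in> {x \<in> carrier_vec d. L' *\<^sub>v x = 0\<^sub>v s}"
    then have x: "x \<in> carrier_vec d" "L' *\<^sub>v x = 0\<^sub>v s" by auto
    obtain y where y: "y \<in> carrier_vec s" "E *\<^sub>v x = P' *\<^sub>v y" using Er x by blast
    have "L' *\<^sub>v x = L0 *\<^sub>v (P' *\<^sub>v y)" unfolding L'_def using L0 E x y by simp
    also have "\<dots> = (L0 * P') *\<^sub>v y" using L0 P' y by (intro assoc_mult_mat_vec[symmetric])
    also have "\<dots> = y" using LP' y by simp
    finally have "y = 0\<^sub>v s" using x by simp
    then have "E *\<^sub>v x = 0\<^sub>v d" using y P' by (auto intro!: eq_vecI)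
    then have 0: "x - P *\<^sub>v (L *\<^sub>v x) = 0\<^sub>v d" using Ex x by simp
    have "x = P *\<^sub>v (L *\<^sub>v x)"
    proof (rule eq_vecI)
      fix i assume "i < dim_vec (P *\<^sub>v (L *\<^sub>v x))"
      then have i: "i < d" using P by simp
      have "(x - P *\<^sub>v (L *\<^sub>v x)) $ i = 0" using 0 i by simp
      then show "x $ i = (P *\<^sub>v (L *\<^sub>v x)) $ i" using i P by simp
    qed (use P x in simp)
    moreover have "L *\<^sub>v x \<in> carrier_vec r" using L x by simp
    ultimately show "x \<in> W" using Wr by blast
  qed
  then show thesis using that[OF L' P' one] by blast
qed

section \<open>Irreducible families of matrices\<close>

text \<open>The family \<open>\<rho>\<close> acts irreducibly on a nonzero space.  Multiplicativity of \<open>\<rho>\<close> is not required: only the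
  set of operators matters, and \<open>U\<close> can be a group, a subgroup or just an index set.\<close>

definition mat_irreducible :: "'g set \<Rightarrow> nat \<Rightarrow> ('g \<Rightarrow> complex mat) \<Rightarrow> bool" where
  "mat_irreducible U d \<rho> \<longleftrightarrow> d > 0 \<and> (\<forall>g\<in>U. \<rho> g \<in> carrier_mat d d) \<and>
     (\<forall>W. vec_subspace d W \<and> (\<forall>g\<in>U. \<forall>w\<in>W. \<rho> g *\<^sub>v w \<in> W) \<longrightarrow> W = {0\<^sub>v d} \<or> W = carrier_vec d)"

text \<open>\<open>T\<close> is a linear map from \<open>(complex\<^sup>d, \<rho>)\<close> to \<open>(complex\<^sup>e, \<sigma>)\<close> that commutes with the action of \<open>U\<close>.\<close>

definition intertwines :: "'g set \<Rightarrow> nat \<Rightarrow> nat \<Rightarrow> ('g \<Rightarrow> complex mat) \<Rightarrow> ('g \<Rightarrow> complex mat) \<Rightarrow> complex mat \<Rightarrow> bool" where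
  "intertwines U d e \<rho> \<sigma> T \<longleftrightarrow> T \<in> carrier_mat e d \<and> (\<forall>g\<in>U. T * \<rho> g = \<sigma> g * T)"

text \<open>An invariant subspace carries a subrepresentation \<open>\<tau>\<close>: in the coordinates given by \<open>P\<close>, it is \<open>L \<rho> P\<close>.\<close>

lemma invariant_subspace_param:
  assumes \<rho>: "\<And>g. g \<in> U \<Longrightarrow> \<rho> g \<in> carrier_mat d d"
    and W: "vec_subspace d W" and inv: "\<And>g w. g \<in> U \<Longrightarrow> w \<in> W \<Longrightarrow> \<rho> g *\<^sub>v w \<in> W"
  obtains r P L \<tau> where "P \<in> carrier_mat d r" "L \<in> carrier_mat r d" "L * P = (1\<^sub>m r :: complex mat)"
     "W = {P *\<^sub>v x | x. x \<in> carrier_vec r}"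
     "\<forall>g\<in>U. \<tau> g \<in> carrier_mat r r" "intertwines U r d \<tau> \<rho> P"
proof -
  obtain r P L where P: "P \<in> carrier_mat d r" and L: "L \<in> carrier_mat r d"
    and LP: "L * P = (1\<^sub>m r :: complex mat)" and Wr: "W = {P *\<^sub>v x | x. x \<in> carrier_vec r}"
    by (rule subspace_param[OF W])
  define \<tau> where "\<tau> = (\<lambda>g. L * (\<rho> g * P))"
  have \<tau>: "\<tau> g \<in> carrier_mat r r" if "g \<in> U" for g using \<rho>[OF that] P L by (auto simp: \<tau>_def)
  have "P * \<tau> g = \<rho> g * P" if g: "g \<in> U" for g
  proof (rule mat_eqI_mult_vec)
    fix x :: "complex vec" assume x: "x \<in> carrier_vec r"
    have "P *\<^sub>v x \<in> W" using Wr x by blast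
    then obtain y where y: "y \<in> carrier_vec r" "\<rho> g *\<^sub>v (P *\<^sub>v x) = P *\<^sub>v y" using inv g Wr by blast
    have c: "\<rho> g * P \<in> carrier_mat d r" using \<rho>[OF g] P by simp
    have e1: "(\<rho> g * P) *\<^sub>v x = P *\<^sub>v y" using y \<rho>[OF g] P x by simp
    have "(P * \<tau> g) *\<^sub>v x = P *\<^sub>v (\<tau> g *\<^sub>v x)" using P \<tau>[OF g] x by (intro assoc_mult_mat_vec)
    also have "\<tau> g *\<^sub>v x = L *\<^sub>v ((\<rho> g * P) *\<^sub>v x)" unfolding \<tau>_def using L c x by (intro assoc_mult_mat_vec)
    also have "\<dots> = (L * P) *\<^sub>v y" unfolding e1 using L P y by simp
    also have "\<dots> = y" using LP y by simp
    finally show "(P * \<tau> g) *\<^sub>v x = (\<rho> g * P) *\<^sub>v x" using e1 by simp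
  qed (use P \<tau>[OF g] \<rho>[OF g] in auto)
  then have "intertwines U r d \<tau> \<rho> P" using P unfolding intertwines_def by auto
  moreover have "\<forall>g\<in>U. \<tau> g \<in> carrier_mat r r" using \<tau> by blast
  ultimately show thesis by (rule that[OF P L LP Wr, rotated])
qed

text \<open>The quotient by an invariant subspace, again in coordinates: \<open>\<tau>\<close> is \<open>L \<rho> P\<close>.\<close>

lemma invariant_quotient_param:
  assumes \<rho>: "\<And>g. g \<in> U \<Longrightarrow> \<rho> g \<in> carrier_mat d d"
    and W: "vec_subspace d W" and inv: "\<And>g w. g \<in> U \<Longrightarrow> w \<in> W \<Longrightarrow> \<rho> g *\<^sub>v w \<in> W"
  obtains s L P \<tau> where "L \<in> carrier_mat s d" "P \<in> carrier_mat d s" "L * P = (1\<^sub>m s :: complex mat)"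
     "W = {x \<in> carrier_vec d. L *\<^sub>v x = 0\<^sub>v s}"
     "\<forall>g\<in>U. \<tau> g \<in> carrier_mat s s" "intertwines U d s \<rho> \<tau> L"
proof -
  obtain s L P where P: "P \<in> carrier_mat d s" and L: "L \<in> carrier_mat s d"
    and LP: "L * P = (1\<^sub>m s :: complex mat)" and Wr: "W = {x \<in> carrier_vec d. L *\<^sub>v x = 0\<^sub>v s}"
    by (rule subspace_kernel_param[OF W])
  define \<tau> where "\<tau> = (\<lambda>g. (L * \<rho> g) * P)"
  have \<tau>: "\<tau> g \<in> carrier_mat s s" if "g \<in> U" for g using \<rho>[OF that] P L by (auto simp: \<tau>_def)
  have "L * \<rho> g = \<tau> g * L" if g: "g \<in> U" for g
  proof (rule mat_eqI_mult_vec)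
    fix x :: "complex vec" assume x: "x \<in> carrier_vec d"
    define z where "z = x - P *\<^sub>v (L *\<^sub>v x)"
    have c: "L *\<^sub>v x \<in> carrier_vec s" "P *\<^sub>v (L *\<^sub>v x) \<in> carrier_vec d" using L P x by auto
    have z: "z \<in> carrier_vec d" using c x by (simp add: z_def)
    have "L *\<^sub>v z = L *\<^sub>v x - L *\<^sub>v (P *\<^sub>v (L *\<^sub>v x))" unfolding z_def
      by (rule mult_minus_distrib_mat_vec[OF L x c(2)])
    also have "L *\<^sub>v (P *\<^sub>v (L *\<^sub>v x)) = (L * P) *\<^sub>v (L *\<^sub>v x)"
      using L P c by (intro assoc_mult_mat_vec[symmetric])
    also have "\<dots> = L *\<^sub>v x" using LP c by simp
    finally have "z \<in> W" using Wr z c by simp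
    then have "\<rho> g *\<^sub>v z \<in> W" using inv g by blast
    then have 0: "L *\<^sub>v (\<rho> g *\<^sub>v z) = 0\<^sub>v s" using Wr by simp
    have c2: "L * \<rho> g \<in> carrier_mat s d" using L \<rho>[OF g] by simp
    have e: "(L * \<rho> g) *\<^sub>v z = 0\<^sub>v s" using 0 L \<rho>[OF g] z by simp
    have xz: "x = z + P *\<^sub>v (L *\<^sub>v x)" unfolding z_def using x c P by (auto intro!: eq_vecI)
    have "(L * \<rho> g) *\<^sub>v x = (L * \<rho> g) *\<^sub>v z + (L * \<rho> g) *\<^sub>v (P *\<^sub>v (L *\<^sub>v x))"
      by (subst xz) (rule mult_add_distrib_mat_vec[OF c2 z c(2)])
    also have "\<dots> = (L * \<rho> g) *\<^sub>v (P *\<^sub>v (L *\<^sub>v x))" unfolding e using c2 c by simp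
    also have "\<dots> = \<tau> g *\<^sub>v (L *\<^sub>v x)" unfolding \<tau>_def using c2 P c by (intro assoc_mult_mat_vec[symmetric])
    also have "\<dots> = (\<tau> g * L) *\<^sub>v x" using \<tau>[OF g] L x by simp
    finally show "(L * \<rho> g) *\<^sub>v x = (\<tau> g * L) *\<^sub>v x" .
  qed (use L \<tau>[OF g] \<rho>[OF g] in auto)
  then have "intertwines U d s \<rho> \<tau> L" using L unfolding intertwines_def by auto
  moreover have "\<forall>g\<in>U. \<tau> g \<in> carrier_mat s s" using \<tau> by blast
  ultimately show thesis by (rule that[OF L P LP Wr, rotated])
qed

lemma mat_irreducibleD:
  assumes "mat_irreducible U d \<rho>"
  shows "d > 0" "\<And>g. g \<in> U \<Longrightarrow> \<rho> g \<in> carrier_mat d d"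
    "\<And>W. vec_subspace d W \<Longrightarrow> (\<And>g w. g \<in> U \<Longrightarrow> w \<in> W \<Longrightarrow> \<rho> g *\<^sub>v w \<in> W) \<Longrightarrow>
       W \<noteq> {0\<^sub>v d} \<Longrightarrow> W = carrier_vec d"
  using assms unfolding mat_irreducible_def by blast+

lemma intertwinesD:
  assumes "intertwines U d e \<rho> \<sigma> T"
  shows "T \<in> carrier_mat e d" "\<And>g. g \<in> U \<Longrightarrow> T * \<rho> g = \<sigma> g * T"
  using assms unfolding intertwines_def by auto

lemma intertwines_comp:
  assumes S: "intertwines U e f \<sigma> \<tau> S" and T: "intertwines U d e \<rho> \<sigma> T"
    and \<rho>: "\<And>g. g \<in> U \<Longrightarrow> \<rho> g \<in> carrier_mat d d"
    and \<sigma>: "\<And>g. g \<in> U \<Longrightarrow> \<sigma> g \<in> carrier_mat e e"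
    and \<tau>: "\<And>g. g \<in> U \<Longrightarrow> \<tau> g \<in> carrier_mat f f"
  shows "intertwines U d f \<rho> \<tau> (S * T)"
  unfolding intertwines_def
proof (intro conjI ballI)
  show "S * T \<in> carrier_mat f d" using intertwinesD(1)[OF S] intertwinesD(1)[OF T] by simp
  fix g assume g: "g \<in> U"
  note c = intertwinesD(1)[OF S] intertwinesD(1)[OF T] \<rho>[OF g] \<sigma>[OF g] \<tau>[OF g]
  have "S * T * \<rho> g = S * (T * \<rho> g)" using c by (intro assoc_mult_mat)
  also have "\<dots> = S * \<sigma> g * T" unfolding intertwinesD(2)[OF T g]
    using c by (intro assoc_mult_mat[symmetric])
  also have "\<dots> = \<tau> g * (S * T)" unfolding intertwinesD(2)[OF S g] using c by (intro assoc_mult_mat)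
  finally show "S * T * \<rho> g = \<tau> g * (S * T)" .
qed

text \<open>An irreducible subrepresentation, found as an invariant subspace of least positive dimension.\<close>

lemma irreducible_sub:
  assumes \<rho>: "\<And>g. g \<in> U \<Longrightarrow> \<rho> g \<in> carrier_mat d d" and d: "d > 0"
  obtains r P L \<tau> where "mat_irreducible U r \<tau>" "P \<in> carrier_mat d r" "L \<in> carrier_mat r d"
    "L * P = (1\<^sub>m r :: complex mat)" "intertwines U r d \<tau> \<rho> P"
proof -
  define good where "good = (\<lambda>r P L \<tau>. r > 0 \<and> P \<in> carrier_mat d r \<and> L \<in> carrier_mat r d \<and>
    L * P = (1\<^sub>m r :: complex mat) \<and> (\<forall>g\<in>U. \<tau> g \<in> carrier_mat r r) \<and> intertwines U r d \<tau> \<rho> P)"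
  define Q where "Q = (\<lambda>r. \<exists>P L \<tau>. good r P L \<tau>)"
  have "good d (1\<^sub>m d) (1\<^sub>m d) \<rho>"
    unfolding good_def intertwines_def using d \<rho>
    by (auto simp: left_mult_one_mat[of _ d d] right_mult_one_mat[of _ d d])
  then have "Q d" unfolding Q_def by blast
  define r where "r = (LEAST r. Q r)"
  have "Q r" unfolding r_def using \<open>Q d\<close> by (rule LeastI)
  have least: "r \<le> r'" if "Q r'" for r' unfolding r_def using that by (rule Least_le)
  obtain P L \<tau> where "good r P L \<tau>" using \<open>Q r\<close> unfolding Q_def by blast
  then have r: "r > 0" and P: "P \<in> carrier_mat d r" and L: "L \<in> carrier_mat r d"
    and LP: "L * P = 1\<^sub>m r" and \<tau>: "\<And>g. g \<in> U \<Longrightarrow> \<tau> g \<in> carrier_mat r r" and i: "intertwines U r d \<tau> \<rho> P"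
    unfolding good_def by auto
  have "mat_irreducible U r \<tau>"
    unfolding mat_irreducible_def
  proof (intro conjI ballI allI impI)
    fix W assume "vec_subspace r W \<and> (\<forall>g\<in>U. \<forall>w\<in>W. \<tau> g *\<^sub>v w \<in> W)"
    then have W: "vec_subspace r W" and inv: "\<And>g w. g \<in> U \<Longrightarrow> w \<in> W \<Longrightarrow> \<tau> g *\<^sub>v w \<in> W" by auto
    obtain s P' L' \<tau>' where P': "P' \<in> carrier_mat r s" and L': "L' \<in> carrier_mat s r"
      and LP': "L' * P' = (1\<^sub>m s :: complex mat)" and Wr: "W = {P' *\<^sub>v x | x. x \<in> carrier_vec s}"
      and \<tau>'0: "\<forall>g\<in>U. \<tau>' g \<in> carrier_mat s s" and i': "intertwines U s r \<tau>' \<tau> P'"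
      by (rule invariant_subspace_param[OF \<tau> W inv])
    have \<tau>': "\<And>g. g \<in> U \<Longrightarrow> \<tau>' g \<in> carrier_mat s s" using \<tau>'0 by blast
    show "W = {0\<^sub>v r} \<or> W = carrier_vec r"
    proof (cases "s = 0")
      case True
      have "P' *\<^sub>v x = 0\<^sub>v r" if "x \<in> carrier_vec s" for x
        using that True P' by (intro eq_vecI) (auto simp: scalar_prod_def)
      then have "W \<subseteq> {0\<^sub>v r}" using Wr by auto
      then show ?thesis using W unfolding vec_subspace_def by auto
    next
      case False
      have "(L' * L) * (P * P') = L' * ((L * P) * P')"
        using L' L P P' by (simp add: assoc_mult_mat[of _ _ _ _ _ _ s])
      also have "\<dots> = 1\<^sub>m s" using LP LP' P' by simp
      finally have "good s (P * P') (L' * L) \<tau>'"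
        unfolding good_def using False P P' L L' \<tau>' intertwines_comp[OF i i' \<tau>' \<tau> \<rho>] by auto
      then have "r \<le> s" using least unfolding Q_def by blast
      moreover have "s \<le> r" by (rule left_inverse_dim_le[OF P' L' LP'])
      ultimately have sr: "s = r" by simp
      then have PL': "P' * L' = 1\<^sub>m r" using mat_mult_left_right_inverse[of L' r P'] P' L' LP' by simp
      have "x \<in> W" if x: "x \<in> carrier_vec r" for x
      proof -
        have "x = P' *\<^sub>v (L' *\<^sub>v x)" using PL' x P' L' by (metis assoc_mult_mat_vec one_mult_mat_vec)
        moreover have "L' *\<^sub>v x \<in> carrier_vec s" using L' x by simp
        ultimately show ?thesis using Wr by blast
      qed
      then show ?thesis using W unfolding vec_subspace_def by auto
    qed
  qed (use r \<tau> in auto)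
  then show thesis using P L LP i by (rule that)
qed

text \<open>An irreducible quotient, found as a quotient of least positive dimension.\<close>

lemma irreducible_quotient:
  assumes \<rho>: "\<And>g. g \<in> U \<Longrightarrow> \<rho> g \<in> carrier_mat d d" and d: "d > 0"
  obtains s L P \<tau> where "mat_irreducible U s \<tau>" "L \<in> carrier_mat s d" "P \<in> carrier_mat d s"
    "L * P = (1\<^sub>m s :: complex mat)" "intertwines U d s \<rho> \<tau> L"
proof -
  define good where "good = (\<lambda>s P L \<tau>. s > 0 \<and> P \<in> carrier_mat d s \<and> L \<in> carrier_mat s d \<and>
    L * P = (1\<^sub>m s :: complex mat) \<and> (\<forall>g\<in>U. \<tau> g \<in> carrier_mat s s) \<and> intertwines U d s \<rho> \<tau> L)"
  define Q where "Q = (\<lambda>r. \<exists>P L \<tau>. good r P L \<tau>)"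
  have "good d (1\<^sub>m d) (1\<^sub>m d) \<rho>"
    unfolding good_def intertwines_def using d \<rho>
    by (auto simp: left_mult_one_mat[of _ d d] right_mult_one_mat[of _ d d])
  then have "Q d" unfolding Q_def by blast
  define r where "r = (LEAST r. Q r)"
  have "Q r" unfolding r_def using \<open>Q d\<close> by (rule LeastI)
  have least: "r \<le> r'" if "Q r'" for r' unfolding r_def using that by (rule Least_le)
  obtain P L \<tau> where "good r P L \<tau>" using \<open>Q r\<close> unfolding Q_def by blast
  then have r: "r > 0" and P: "P \<in> carrier_mat d r" and L: "L \<in> carrier_mat r d"
    and LP: "L * P = 1\<^sub>m r" and \<tau>: "\<And>g. g \<in> U \<Longrightarrow> \<tau> g \<in> carrier_mat r r" and i: "intertwines U d r \<rho> \<tau> L"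
    unfolding good_def by auto
  have "mat_irreducible U r \<tau>"
    unfolding mat_irreducible_def
  proof (intro conjI ballI allI impI)
    fix W assume "vec_subspace r W \<and> (\<forall>g\<in>U. \<forall>w\<in>W. \<tau> g *\<^sub>v w \<in> W)"
    then have W: "vec_subspace r W" and inv: "\<And>g w. g \<in> U \<Longrightarrow> w \<in> W \<Longrightarrow> \<tau> g *\<^sub>v w \<in> W" by auto
    obtain s L' P' \<tau>' where L': "L' \<in> carrier_mat s r" and P': "P' \<in> carrier_mat r s"
      and LP': "L' * P' = (1\<^sub>m s :: complex mat)" and Wr: "W = {x \<in> carrier_vec r. L' *\<^sub>v x = 0\<^sub>v s}"
      and \<tau>'0: "\<forall>g\<in>U. \<tau>' g \<in> carrier_mat s s" and i': "intertwines U r s \<tau> \<tau>' L'"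
      by (rule invariant_quotient_param[OF \<tau> W inv])
    have \<tau>': "\<And>g. g \<in> U \<Longrightarrow> \<tau>' g \<in> carrier_mat s s" using \<tau>'0 by blast
    show "W = {0\<^sub>v r} \<or> W = carrier_vec r"
    proof (cases "s = 0")
      case True
      have "L' *\<^sub>v x = 0\<^sub>v s" if "x \<in> carrier_vec r" for x
        using that True L' by (intro eq_vecI) auto
      then show ?thesis using Wr by auto
    next
      case False
      have "(L' * L) * (P * P') = L' * ((L * P) * P')"
        using L' L P P' by (simp add: assoc_mult_mat[of _ _ _ _ _ _ s])
      also have "\<dots> = 1\<^sub>m s" using LP LP' P' by simp
      finally have "good s (P * P') (L' * L) \<tau>'"
        unfolding good_def using False P P' L L' \<tau>' intertwines_comp[OF i' i \<rho> \<tau> \<tau>'] by auto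
      then have "r \<le> s" using least unfolding Q_def by blast
      moreover have "s \<le> r" by (rule left_inverse_dim_le[OF P' L' LP'])
      ultimately have sr: "s = r" by simp
      then have PL': "P' * L' = 1\<^sub>m r" using mat_mult_left_right_inverse[of L' r P'] P' L' LP' by simp
      have "x = 0\<^sub>v r" if x: "x \<in> W" for x
      proof -
        have c: "x \<in> carrier_vec r" "L' *\<^sub>v x = 0\<^sub>v s" using x Wr by auto
        have "x = P' *\<^sub>v (L' *\<^sub>v x)" using PL' c(1) P' L' by (metis assoc_mult_mat_vec one_mult_mat_vec)
        then show ?thesis unfolding c(2) using P' by (auto intro!: eq_vecI)
      qed
      then show ?thesis using W unfolding vec_subspace_def by auto
    qed
  qed (use r \<tau> in auto)
  then show thesis using L P LP i by (rule that)
qed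

text \<open>Subrepresentations and quotients inherit the multiplicative relations and the kernel of \<open>\<rho>\<close>; the family
  \<open>\<rho>\<close> itself need not be a homomorphism.\<close>

lemma intertwines_sub_mult:
  assumes i: "intertwines U r d \<tau> \<rho> P" and L: "L \<in> carrier_mat r d" "L * P = (1\<^sub>m r :: complex mat)"
    and U: "g \<in> U" "h \<in> U" "k \<in> U"
    and \<rho>: "\<And>g. g \<in> U \<Longrightarrow> \<rho> g \<in> carrier_mat d d" and \<tau>: "\<And>g. g \<in> U \<Longrightarrow> \<tau> g \<in> carrier_mat r r"
    and m: "\<rho> k = \<rho> g * \<rho> h"
  shows "\<tau> k = \<tau> g * \<tau> h"
proof -
  note P = intertwinesD(1)[OF i]
  have key: "\<tau> x = L * (\<rho> x * P)" if "x \<in> U" for x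
    using intertwinesD(2)[OF i that] assoc_mult_mat[OF L(1) P \<tau>[OF that]] L(2) left_mult_one_mat[OF \<tau>[OF that]]
    by metis
  have "\<tau> k = L * (\<rho> g * (\<rho> h * P))" unfolding key[OF U(3)] m
    using assoc_mult_mat[OF \<rho>[OF U(1)] \<rho>[OF U(2)] P] by simp
  also have "\<rho> h * P = P * \<tau> h" using intertwinesD(2)[OF i U(2)] by simp
  also have "\<rho> g * (P * \<tau> h) = (\<rho> g * P) * \<tau> h"
    using assoc_mult_mat[OF \<rho>[OF U(1)] P \<tau>[OF U(2)]] by simp
  also have "\<dots> = P * \<tau> g * \<tau> h" using intertwinesD(2)[OF i U(1)] by simp
  also have "\<dots> = P * (\<tau> g * \<tau> h)" using P \<tau> U by (intro assoc_mult_mat) auto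
  also have "L * (P * (\<tau> g * \<tau> h)) = L * P * (\<tau> g * \<tau> h)"
    using P mult_carrier_mat[OF \<tau>[OF U(1)] \<tau>[OF U(2)]] L(1) by (intro assoc_mult_mat[symmetric])
  finally show ?thesis using L(2) \<tau>[OF U(1)] \<tau>[OF U(2)] by simp
qed

lemma intertwines_sub_one:
  assumes i: "intertwines U r d \<tau> \<rho> P" and L: "L \<in> carrier_mat r d" "L * P = (1\<^sub>m r :: complex mat)"
    and g: "g \<in> U" and \<tau>: "\<tau> g \<in> carrier_mat r r" and one: "\<rho> g = 1\<^sub>m d"
  shows "\<tau> g = 1\<^sub>m r"
proof -
  note P = intertwinesD(1)[OF i]
  have "\<tau> g = L * P * \<tau> g" using L \<tau> by simp
  also have "\<dots> = L * (P * \<tau> g)" using L P \<tau> by (intro assoc_mult_mat)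
  also have "\<dots> = 1\<^sub>m r" using intertwinesD(2)[OF i g] one P L by simp
  finally show ?thesis .
qed

lemma intertwines_quotient_mult:
  assumes i: "intertwines U d s \<rho> \<tau> L" and P: "P \<in> carrier_mat d s" "L * P = (1\<^sub>m s :: complex mat)"
    and U: "g \<in> U" "h \<in> U" "k \<in> U"
    and \<rho>: "\<And>g. g \<in> U \<Longrightarrow> \<rho> g \<in> carrier_mat d d" and \<tau>: "\<And>g. g \<in> U \<Longrightarrow> \<tau> g \<in> carrier_mat s s"
    and m: "\<rho> k = \<rho> g * \<rho> h"
  shows "\<tau> k = \<tau> g * \<tau> h"
proof -
  note L = intertwinesD(1)[OF i]
  have key: "\<tau> x = (L * \<rho> x) * P" if "x \<in> U" for x
    using intertwinesD(2)[OF i that] assoc_mult_mat[OF \<tau>[OF that] L P(1)] P(2) right_mult_one_mat[OF \<tau>[OF that]]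
    by metis
  have "\<tau> k = (L * \<rho> g * \<rho> h) * P" unfolding key[OF U(3)] m
    using assoc_mult_mat[OF L \<rho>[OF U(1)] \<rho>[OF U(2)]] by simp
  also have "L * \<rho> g = \<tau> g * L" using intertwinesD(2)[OF i U(1)] by simp
  also have "\<tau> g * L * \<rho> h = \<tau> g * (L * \<rho> h)"
    using assoc_mult_mat[OF \<tau>[OF U(1)] L \<rho>[OF U(2)]] by simp
  also have "\<tau> g * (L * \<rho> h) * P = \<tau> g * (L * \<rho> h * P)"
    by (rule assoc_mult_mat[OF \<tau>[OF U(1)] mult_carrier_mat[OF L \<rho>[OF U(2)]] P(1)])
  finally show ?thesis using key[OF U(2)] by simp
qed

lemma intertwines_quotient_one:
  assumes i: "intertwines U d s \<rho> \<tau> L" and P: "P \<in> carrier_mat d s" "L * P = (1\<^sub>m s :: complex mat)"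
    and g: "g \<in> U" and \<tau>: "\<tau> g \<in> carrier_mat s s" and one: "\<rho> g = 1\<^sub>m d"
  shows "\<tau> g = 1\<^sub>m s"
proof -
  note L = intertwinesD(1)[OF i]
  have "\<tau> g = \<tau> g * (L * P)" using P \<tau> by simp
  also have "\<dots> = \<tau> g * L * P" using L P \<tau> by (intro assoc_mult_mat[symmetric])
  also have "\<dots> = 1\<^sub>m s" using intertwinesD(2)[OF i g] one P L by (metis right_mult_one_mat)
  finally show ?thesis .
qed

section \<open>Schur's lemma\<close>

lemma schur_iso:
  assumes \<rho>: "mat_irreducible U d \<rho>" and \<sigma>: "mat_irreducible U e \<sigma>"
    and T: "intertwines U d e \<rho> \<sigma> T" and nz: "T \<noteq> 0\<^sub>m e d"
  shows "d = e" "\<exists>S\<in>carrier_mat d d. S * T = 1\<^sub>m d \<and> T * S = 1\<^sub>m d"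
proof -
  note Tc = intertwinesD(1)[OF T] and \<rho>c = mat_irreducibleD(2)[OF \<rho>] and \<sigma>c = mat_irreducibleD(2)[OF \<sigma>]
  have comm: "T *\<^sub>v (\<rho> g *\<^sub>v x) = \<sigma> g *\<^sub>v (T *\<^sub>v x)" if "g \<in> U" "x \<in> carrier_vec d" for g x
    using intertwinesD(2)[OF T that(1)] Tc \<rho>c[OF that(1)] \<sigma>c[OF that(1)] that(2)
    by (metis assoc_mult_mat_vec)
  obtain x0 where x0: "x0 \<in> carrier_vec d" "T *\<^sub>v x0 \<noteq> 0\<^sub>v e" by (rule nonzero_mat_mult_vec[OF Tc nz])
  let ?K = "{x \<in> carrier_vec d. T *\<^sub>v x = 0\<^sub>v e}"
  have K: "?K = {0\<^sub>v d}"
  proof (rule ccontr)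
    assume "?K \<noteq> {0\<^sub>v d}"
    have z: "\<sigma> g *\<^sub>v 0\<^sub>v e = 0\<^sub>v e" if "g \<in> U" for g using \<sigma>c[OF that] by (intro eq_vecI) auto
    have "?K = carrier_vec d"
      using vec_subspace_kernel[OF Tc] _ \<open>?K \<noteq> {0\<^sub>v d}\<close>
    proof (rule mat_irreducibleD(3)[OF \<rho>])
      fix g w assume g: "g \<in> U" and w: "w \<in> ?K"
      then show "\<rho> g *\<^sub>v w \<in> ?K" using comm[OF g, of w] z[OF g] \<rho>c[OF g] by auto
    qed
    then show False using x0 by auto
  qed
  let ?R = "{T *\<^sub>v x | x. x \<in> carrier_vec d}"
  have R: "?R = carrier_vec e"
    using vec_subspace_range[OF Tc]
  proof (rule mat_irreducibleD(3)[OF \<sigma>])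
    fix g w assume g: "g \<in> U" and w: "w \<in> ?R"
    then obtain x where x: "x \<in> carrier_vec d" "w = T *\<^sub>v x" by auto
    then have "\<sigma> g *\<^sub>v w = T *\<^sub>v (\<rho> g *\<^sub>v x)" using comm[OF g] by simp
    moreover have "\<rho> g *\<^sub>v x \<in> carrier_vec d" using \<rho>c[OF g] x by simp
    ultimately show "\<sigma> g *\<^sub>v w \<in> ?R" by blast
  next
    show "?R \<noteq> {0\<^sub>v e}" using x0 by blast
  qed
  have "\<exists>x\<in>carrier_vec d. T *\<^sub>v x = y" if "y \<in> carrier_vec e" for y
  proof -
    have "y \<in> ?R" unfolding R by (rule that)
    then show ?thesis by auto
  qed
  then obtain S where S: "S \<in> carrier_mat d e" and TS: "T * S = 1\<^sub>m e"
    using surjective_mat_right_inverse[OF Tc] by metis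
  have "d \<le> e" using K by (intro injective_mat_dim_le[OF Tc]) blast
  moreover have "e \<le> d" by (rule left_inverse_dim_le[OF S Tc TS])
  ultimately show de: "d = e" by simp
  have "S * T = 1\<^sub>m d" using mat_mult_left_right_inverse[of T d S] Tc S TS de by simp
  then show "\<exists>S\<in>carrier_mat d d. S * T = 1\<^sub>m d \<and> T * S = 1\<^sub>m d" using S TS de by auto
qed

lemma intertwines_inverse:
  assumes T: "intertwines U d d \<rho> \<sigma> T" and R: "R \<in> carrier_mat d d" "R * T = 1\<^sub>m d" "T * R = 1\<^sub>m d"
    and \<rho>: "\<And>g. g \<in> U \<Longrightarrow> \<rho> g \<in> carrier_mat d d" and \<sigma>: "\<And>g. g \<in> U \<Longrightarrow> \<sigma> g \<in> carrier_mat d d"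
  shows "intertwines U d d \<sigma> \<rho> R"
  unfolding intertwines_def
proof (intro conjI ballI R(1))
  note Tc = intertwinesD(1)[OF T]
  fix g assume g: "g \<in> U"
  have "R * \<sigma> g = R * \<sigma> g * (T * R)" unfolding R(3) by (rule right_mult_one_mat[OF mult_carrier_mat[OF R(1) \<sigma>[OF g]], symmetric])
  also have "\<dots> = R * \<sigma> g * T * R" by (rule assoc_mult_mat[OF mult_carrier_mat[OF R(1) \<sigma>[OF g]] Tc R(1), symmetric])
  also have "R * \<sigma> g * T = R * (\<sigma> g * T)" by (rule assoc_mult_mat[OF R(1) \<sigma>[OF g] Tc])
  also have "\<sigma> g * T = T * \<rho> g" using intertwinesD(2)[OF T g] by simp
  also have "R * (T * \<rho> g) = R * T * \<rho> g" by (rule assoc_mult_mat[OF R(1) Tc \<rho>[OF g], symmetric])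
  also have "\<dots> = \<rho> g" unfolding R(2) by (rule left_mult_one_mat[OF \<rho>[OF g]])
  finally show "R * \<sigma> g = \<rho> g * R" .
qed

lemma schur_inverse:
  assumes \<rho>: "mat_irreducible U d \<rho>" and \<sigma>: "mat_irreducible U e \<sigma>"
    and T: "intertwines U d e \<rho> \<sigma> T" and nz: "T \<noteq> 0\<^sub>m e d"
  obtains R where "d = e" "intertwines U e d \<sigma> \<rho> R" "R * T = 1\<^sub>m d" "T * R = 1\<^sub>m d" "R \<noteq> 0\<^sub>m d e"
proof -
  have de: "d = e" by (rule schur_iso(1)[OF \<rho> \<sigma> T nz])
  obtain R where R: "R \<in> carrier_mat d d" "R * T = 1\<^sub>m d" "T * R = 1\<^sub>m d"
    using schur_iso(2)[OF \<rho> \<sigma> T nz] by blast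
  have Tc: "T \<in> carrier_mat d d" using intertwinesD(1)[OF T] de by simp
  have "R \<noteq> 0\<^sub>m d d"
  proof
    assume "R = 0\<^sub>m d d"
    then have "(1\<^sub>m d :: complex mat) $$ (0, 0) = (0\<^sub>m d d :: complex mat) $$ (0, 0)" using R(2) Tc by simp
    then show False using mat_irreducibleD(1)[OF \<rho>] by simp
  qed
  moreover have "intertwines U d d \<sigma> \<rho> R"
    by (rule intertwines_inverse[OF T[folded de] R mat_irreducibleD(2)[OF \<rho>] mat_irreducibleD(2)[OF \<sigma>, folded de]])
  ultimately show thesis using that[OF de _ R(2,3)] de by simp
qed

lemma intertwines_comp_nonzero:
  assumes \<rho>: "mat_irreducible U d \<rho>" and \<sigma>: "mat_irreducible U e \<sigma>"
    and T: "intertwines U d e \<rho> \<sigma> T" "T \<noteq> 0\<^sub>m e d" and S: "S \<in> carrier_mat f e" "S \<noteq> 0\<^sub>m f e"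
  shows "S * T \<noteq> 0\<^sub>m f d"
proof
  assume 0: "S * T = 0\<^sub>m f d"
  obtain R where R: "d = e" "intertwines U e d \<sigma> \<rho> R" "R * T = 1\<^sub>m d" "T * R = 1\<^sub>m d" "R \<noteq> 0\<^sub>m d e"
    by (rule schur_inverse[OF \<rho> \<sigma> T])
  note Tc = intertwinesD(1)[OF T(1)] and Rc = intertwinesD(1)[OF R(2)]
  have "S = S * (T * R)" unfolding R(4) R(1) using S(1) by simp
  also have "\<dots> = S * T * R" by (rule assoc_mult_mat[OF S(1) Tc Rc, symmetric])
  also have "\<dots> = 0\<^sub>m f e" unfolding 0 using Rc by simp
  finally show False using S(2) by simp
qed

lemma schur_scalar:
  assumes \<rho>: "mat_irreducible U d \<rho>" and T: "T \<in> carrier_mat d d"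
    and comm: "\<And>g. g \<in> U \<Longrightarrow> T * \<rho> g = \<rho> g * T"
  obtains c where "T = c \<cdot>\<^sub>m 1\<^sub>m d"
proof -
  note d = mat_irreducibleD(1)[OF \<rho>] and \<rho>c = mat_irreducibleD(2)[OF \<rho>]
  obtain c where "eigenvalue T c" using spectrum_non_empty[OF T d] by (auto simp: spectrum_def)
  then obtain v where v: "v \<in> carrier_vec d" "v \<noteq> 0\<^sub>v d" "T *\<^sub>v v = c \<cdot>\<^sub>v v"
    unfolding eigenvalue_def eigenvector_def using T by auto
  define S where "S = T - c \<cdot>\<^sub>m 1\<^sub>m d"
  have S: "S \<in> carrier_mat d d" using T by (auto simp: S_def)
  have "intertwines U d d \<rho> \<rho> S"
    unfolding intertwines_def
  proof (intro conjI ballI S)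
    fix g assume g: "g \<in> U"
    have "S * \<rho> g = T * \<rho> g - c \<cdot>\<^sub>m 1\<^sub>m d * \<rho> g" unfolding S_def using T \<rho>c[OF g] by (intro minus_mult_distrib_mat) auto
    also have "c \<cdot>\<^sub>m 1\<^sub>m d * \<rho> g = \<rho> g * (c \<cdot>\<^sub>m 1\<^sub>m d)" using \<rho>c[OF g]
      by (simp add: mult_smult_assoc_mat[of _ d d] mult_smult_distrib[of _ d d _ d])
    also have "T * \<rho> g - \<dots> = \<rho> g * S" unfolding S_def comm[OF g] using T \<rho>c[OF g]
      by (intro mult_minus_distrib_mat[symmetric]) auto
    finally show "S * \<rho> g = \<rho> g * S" .
  qed
  have Sv: "S *\<^sub>v v = 0\<^sub>v d"
  proof -
    have "S *\<^sub>v v = T *\<^sub>v v - (c \<cdot>\<^sub>m 1\<^sub>m d) *\<^sub>v v" unfolding S_def using T v by (intro minus_mult_distrib_mat_vec) auto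
    also have "(c \<cdot>\<^sub>m 1\<^sub>m d) *\<^sub>v v = c \<cdot>\<^sub>v v" using v(1)
      by (intro eq_vecI) (auto simp: scalar_prod_def mult.assoc if_distrib if_distribR sum.delta cong: if_cong)
    finally show ?thesis using v by simp
  qed
  have "S = 0\<^sub>m d d"
  proof (rule ccontr)
    assume "S \<noteq> 0\<^sub>m d d"
    then obtain R where R: "R \<in> carrier_mat d d" "R * S = 1\<^sub>m d"
      using schur_iso(2)[OF \<rho> \<rho> \<open>intertwines U d d \<rho> \<rho> S\<close>] by blast
    have "v = R *\<^sub>v (S *\<^sub>v v)" using R S v(1) by (metis assoc_mult_mat_vec one_mult_mat_vec)
    also have "\<dots> = 0\<^sub>v d" unfolding Sv using R(1) by (intro eq_vecI) auto
    finally show False using v by simp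
  qed
  have "T = c \<cdot>\<^sub>m 1\<^sub>m d"
  proof (rule eq_matI)
    fix i j assume ij: "i < dim_row (c \<cdot>\<^sub>m 1\<^sub>m d)" "j < dim_col (c \<cdot>\<^sub>m 1\<^sub>m d)"
    have "S $$ (i, j) = 0" using ij \<open>S = 0\<^sub>m d d\<close> by simp
    then show "T $$ (i, j) = (c \<cdot>\<^sub>m 1\<^sub>m d) $$ (i, j)" using ij T unfolding S_def by simp
  qed (use T in auto)
  then show thesis by (rule that)
qed

section \<open>Finite-dimensional complex representations of groups\<close>

text \<open>Matrix representations without a continuity condition; the values outside the carrier are arbitrary.\<close>

definition mat_rep :: "('g, 'b) monoid_scheme \<Rightarrow> nat \<Rightarrow> ('g \<Rightarrow> complex mat) \<Rightarrow> bool" where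
  "mat_rep G d \<rho> \<longleftrightarrow> (\<forall>g\<in>carrier G. \<rho> g \<in> carrier_mat d d) \<and> \<rho> \<one>\<^bsub>G\<^esub> = 1\<^sub>m d \<and>
     (\<forall>g\<in>carrier G. \<forall>h\<in>carrier G. \<rho> (g \<otimes>\<^bsub>G\<^esub> h) = \<rho> g * \<rho> h)"

lemma mat_repD:
  assumes "mat_rep G d \<rho>"
  shows "\<And>g. g \<in> carrier G \<Longrightarrow> \<rho> g \<in> carrier_mat d d" "\<rho> \<one>\<^bsub>G\<^esub> = 1\<^sub>m d"
    "\<And>g h. g \<in> carrier G \<Longrightarrow> h \<in> carrier G \<Longrightarrow> \<rho> (g \<otimes>\<^bsub>G\<^esub> h) = \<rho> g * \<rho> h"
  using assms unfolding mat_rep_def by auto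

lemma (in group) mat_rep_inv:
  assumes "mat_rep G d \<rho>" "g \<in> carrier G"
  shows "\<rho> (inv g) * \<rho> g = 1\<^sub>m d" "\<rho> g * \<rho> (inv g) = 1\<^sub>m d"
  using mat_repD(3)[OF assms(1), of "inv g" g] mat_repD(3)[OF assms(1), of g "inv g"] assms(2)
    mat_repD(2)[OF assms(1)] by auto

lemma GL_carrier_iff:
  "A \<in> carrier (GL n) \<longleftrightarrow> A \<in> carrier_mat n n \<and> (\<exists>B\<in>carrier_mat n n. A * B = 1\<^sub>m n \<and> B * A = 1\<^sub>m n)"
  unfolding GL_def units_of_def Units_def by (auto simp: ring_mat_simps)

lemma GL_mult: "mult (GL n) = (*)" and GL_one: "one (GL n) = 1\<^sub>m n"
  by (auto simp: GL_def units_of_def ring_mat_simps)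

lemma GL_group: "group (GL n :: 'a :: comm_ring_1 mat monoid)"
proof -
  have "ring (ring_mat TYPE('a) n ())" by (rule ring_mat)
  then have "monoid (ring_mat TYPE('a) n ())" by (rule ring.is_monoid)
  then show ?thesis unfolding GL_def by (rule monoid.units_group)
qed

lemma (in group) hom_GL_iff: "\<rho> \<in> hom G (GL d) \<longleftrightarrow> mat_rep G d \<rho>"
proof
  assume h: "\<rho> \<in> hom G (GL d)"
  have "\<rho> \<one> = \<one>\<^bsub>GL d\<^esub>"
    using h GL_group by (metis group_hom.hom_one group_hom.intro group_hom_axioms.intro is_group)
  with h show "mat_rep G d \<rho>"
    unfolding mat_rep_def hom_def by (auto simp: GL_mult GL_one GL_carrier_iff Pi_iff)
next
  assume m: "mat_rep G d \<rho>"
  show "\<rho> \<in> hom G (GL d)"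
  proof (rule homI)
    fix g assume g: "g \<in> carrier G"
    then show "\<rho> g \<in> carrier (GL d)"
      unfolding GL_carrier_iff using mat_rep_inv[OF m g] mat_repD(1)[OF m] inv_closed[OF g] by blast
  qed (use mat_repD(3)[OF m] in \<open>simp add: GL_mult\<close>)
qed

lemma index_mult_mat_sum:
  assumes "A \<in> carrier_mat a b" "B \<in> carrier_mat b c" "i < a" "j < c"
  shows "(A * B) $$ (i, j) = (\<Sum>k<b. A $$ (i, k) * B $$ (k, j))"
  using assms by (simp add: scalar_prod_def lessThan_atLeast0)

text \<open>The products \<open>A B\<close> and \<open>B A\<close> have the same trace.\<close>

lemma mult_nonzero_comm_trace:
  fixes A B :: "complex mat"
  assumes "A \<in> carrier_mat a b" "B \<in> carrier_mat b a" "(\<Sum>i<a. (A * B) $$ (i, i)) \<noteq> 0"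
  shows "A * B \<noteq> 0\<^sub>m a a" "B * A \<noteq> 0\<^sub>m b b"
proof -
  show "A * B \<noteq> 0\<^sub>m a a" using assms(3) by auto
  have "(\<Sum>i<a. (A * B) $$ (i, i)) = (\<Sum>i<a. \<Sum>k<b. A $$ (i, k) * B $$ (k, i))"
    using index_mult_mat_sum[OF assms(1,2)] by simp
  also have "\<dots> = (\<Sum>k<b. \<Sum>i<a. B $$ (k, i) * A $$ (i, k))"
    by (subst sum.swap) (simp add: mult.commute)
  also have "\<dots> = (\<Sum>k<b. (B * A) $$ (k, k))"
    using index_mult_mat_sum[OF assms(2,1)] by simp
  finally show "B * A \<noteq> 0\<^sub>m b b" using assms(3) by auto
qed

text \<open>Averaging over the image reverses a nonzero intertwiner.\<close>

lemma (in group) intertwiner_reverse: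
  assumes \<rho>: "mat_rep G d \<rho>" and \<sigma>: "mat_rep G e \<sigma>"
    and fin: "finite (\<rho> ` carrier G)" "finite (\<sigma> ` carrier G)"
    and T: "intertwines (carrier G) d e \<rho> \<sigma> T" and nz: "T \<noteq> 0\<^sub>m e d"
  obtains A where "intertwines (carrier G) e d \<sigma> \<rho> A" "T * A \<noteq> 0\<^sub>m e e" "A * T \<noteq> 0\<^sub>m d d"
proof -
  define \<Phi> where "\<Phi> = (\<lambda>g. (\<rho> g, \<sigma> (inv g))) ` carrier G"
  have fin\<Phi>: "finite \<Phi>"
  proof (rule finite_subset)
    show "\<Phi> \<subseteq> \<rho> ` carrier G \<times> \<sigma> ` carrier G" unfolding \<Phi>_def by auto
    show "finite (\<rho> ` carrier G \<times> \<sigma> ` carrier G)" using fin by simp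
  qed
  have \<Phi>c: "a \<in> carrier_mat d d" "b \<in> carrier_mat e e" if "(a, b) \<in> \<Phi>" for a b
    using that mat_repD(1)[OF \<rho>] mat_repD(1)[OF \<sigma>] unfolding \<Phi>_def by auto
  note Tc = intertwinesD(1)[OF T]
  obtain p q where pq: "p < e" "q < d" "T $$ (p, q) \<noteq> 0"
  proof -
    have "\<exists>p q. p < e \<and> q < d \<and> T $$ (p, q) \<noteq> 0"
    proof (rule ccontr)
      assume "\<not> ?thesis"
      then have "T = 0\<^sub>m e d" using Tc by (intro eq_matI) auto
      then show False using nz by simp
    qed
    then show ?thesis using that by blast
  qed
  define A where "A = Matrix.mat d e (\<lambda>(i, j). \<Sum>(a, b)\<in>\<Phi>. a $$ (i, q) * b $$ (p, j))"
  have Ac: "A \<in> carrier_mat d e" by (simp add: A_def)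
  have Ai: "A $$ (i, j) = (\<Sum>(a, b)\<in>\<Phi>. a $$ (i, q) * b $$ (p, j))" if "i < d" "j < e" for i j
    using that by (simp add: A_def)
  have "A * \<sigma> h = \<rho> h * A" if h: "h \<in> carrier G" for h
  proof (rule eq_matI)
    note \<rho>h = mat_repD(1)[OF \<rho> h] and \<sigma>h = mat_repD(1)[OF \<sigma> h]
    fix i j assume "i < dim_row (\<rho> h * A)" "j < dim_col (\<rho> h * A)"
    then have ij: "i < d" "j < e" using \<rho>h Ac by auto
    have "(A * \<sigma> h) $$ (i, j) = (\<Sum>k<e. A $$ (i, k) * \<sigma> h $$ (k, j))"
      by (rule index_mult_mat_sum[OF Ac \<sigma>h ij])
    also have "\<dots> = (\<Sum>k<e. \<Sum>(a, b)\<in>\<Phi>. a $$ (i, q) * (b $$ (p, k) * \<sigma> h $$ (k, j)))"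
      using Ai ij by (intro sum.cong) (auto simp: sum_distrib_right mult.assoc case_prod_beta)
    also have "\<dots> = (\<Sum>(a, b)\<in>\<Phi>. a $$ (i, q) * (\<Sum>k<e. b $$ (p, k) * \<sigma> h $$ (k, j)))"
      by (subst sum.swap) (simp add: case_prod_beta sum_distrib_left)
    also have "\<dots> = (\<Sum>(a, b)\<in>\<Phi>. a $$ (i, q) * (b * \<sigma> h) $$ (p, j))"
      using \<Phi>c(2) \<sigma>h pq ij by (intro sum.cong) (auto simp: index_mult_mat_sum[of _ e e _ e])
    also have "\<dots> = (\<Sum>(a, b)\<in>\<Phi>. (\<rho> h * a) $$ (i, q) * b $$ (p, j))"
    proof (rule sum.reindex_bij_witness[where i = "\<lambda>(a, b). (\<rho> h * a, b * \<sigma> (inv h))"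
          and j = "\<lambda>(a, b). (\<rho> (inv h) * a, b * \<sigma> h)"])
      have step: "(\<rho> x * a, b * \<sigma> (inv x)) \<in> \<Phi>" if ab: "(a, b) \<in> \<Phi>" and x: "x \<in> carrier G" for a b x
      proof -
        obtain g where g: "g \<in> carrier G" "a = \<rho> g" "b = \<sigma> (inv g)" using ab unfolding \<Phi>_def by auto
        have "\<rho> x * a = \<rho> (x \<otimes> g)" "b * \<sigma> (inv x) = \<sigma> (inv (x \<otimes> g))"
          using g x mat_repD(3)[OF \<rho>] mat_repD(3)[OF \<sigma>] by (auto simp: inv_mult_group)
        moreover have "x \<otimes> g \<in> carrier G" using g x by simp
        ultimately show ?thesis unfolding \<Phi>_def by blast
      qed
      have canc: "\<rho> x * (\<rho> (inv x) * a) = a" "b * \<sigma> x * \<sigma> (inv x) = b"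
        if "(a, b) \<in> \<Phi>" and x: "x \<in> carrier G" for a b x
      proof -
        have "\<rho> x * (\<rho> (inv x) * a) = \<rho> x * \<rho> (inv x) * a"
          using \<Phi>c[OF that(1)] mat_repD(1)[OF \<rho>] x by (intro assoc_mult_mat[symmetric]) auto
        then show "\<rho> x * (\<rho> (inv x) * a) = a" using mat_rep_inv[OF \<rho> x] \<Phi>c[OF that(1)] by simp
        have "b * \<sigma> x * \<sigma> (inv x) = b * (\<sigma> x * \<sigma> (inv x))"
          using \<Phi>c[OF that(1)] mat_repD(1)[OF \<sigma>] x by (intro assoc_mult_mat) auto
        then show "b * \<sigma> x * \<sigma> (inv x) = b" using mat_rep_inv[OF \<sigma> x] \<Phi>c[OF that(1)] by simp
      qed
      fix z assume z: "z \<in> \<Phi>"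
      obtain a b where ab: "z = (a, b)" by fastforce
      show "(case case z of (a, b) \<Rightarrow> (\<rho> (inv h) * a, b * \<sigma> h) of (a, b) \<Rightarrow> (\<rho> h * a, b * \<sigma> (inv h))) = z"
        using canc[of a b h] z h ab by simp
      show "(case z of (a, b) \<Rightarrow> (\<rho> (inv h) * a, b * \<sigma> h)) \<in> \<Phi>"
        using step[of a b "inv h"] z h ab by simp
      show "(case case z of (a, b) \<Rightarrow> (\<rho> h * a, b * \<sigma> (inv h)) of (a, b) \<Rightarrow> (\<rho> (inv h) * a, b * \<sigma> h)) = z"
        using canc[of a b "inv h"] z h ab by simp
      show "(case z of (a, b) \<Rightarrow> (\<rho> h * a, b * \<sigma> (inv h))) \<in> \<Phi>"
        using step[of a b h] z h ab by simp
      show "(case case z of (a, b) \<Rightarrow> (\<rho> (inv h) * a, b * \<sigma> h) of (a, b) \<Rightarrow> (\<rho> h * a) $$ (i, q) * b $$ (p, j)) =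
        (case z of (a, b) \<Rightarrow> a $$ (i, q) * (b * \<sigma> h) $$ (p, j))"
        using canc[of a b h] z h ab by simp
    qed
    also have "\<dots> = (\<Sum>(a, b)\<in>\<Phi>. \<Sum>k<d. \<rho> h $$ (i, k) * (a $$ (k, q) * b $$ (p, j)))"
      using \<Phi>c(1) \<rho>h pq ij
      by (intro sum.cong) (auto simp: index_mult_mat_sum[of _ d d _ d] sum_distrib_right mult.assoc)
    also have "\<dots> = (\<Sum>k<d. \<rho> h $$ (i, k) * A $$ (k, j))"
      unfolding case_prod_beta
      by (subst sum.swap) (use Ai ij in \<open>auto simp: case_prod_beta sum_distrib_left intro!: sum.cong\<close>)
    also have "\<dots> = (\<rho> h * A) $$ (i, j)"
      by (rule index_mult_mat_sum[OF \<rho>h Ac ij, symmetric])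
    finally show "(A * \<sigma> h) $$ (i, j) = (\<rho> h * A) $$ (i, j)" .
  qed (use mat_repD(1)[OF \<rho> h] mat_repD(1)[OF \<sigma> h] Ac in auto)
  then have Ai': "intertwines (carrier G) e d \<sigma> \<rho> A" using Ac unfolding intertwines_def by auto
  have "(\<Sum>i<e. (T * A) $$ (i, i)) = (\<Sum>i<e. \<Sum>k<d. T $$ (i, k) * A $$ (k, i))"
    using index_mult_mat_sum[OF Tc Ac] by simp
  also have "\<dots> = (\<Sum>i<e. \<Sum>k<d. \<Sum>(a, b)\<in>\<Phi>. T $$ (i, k) * a $$ (k, q) * b $$ (p, i))"
    using Ai by (intro sum.cong refl) (auto simp: case_prod_beta sum_distrib_left mult.assoc)
  also have "\<dots> = (\<Sum>i<e. \<Sum>(a, b)\<in>\<Phi>. (T * a) $$ (i, q) * b $$ (p, i))"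
  proof (intro sum.cong refl)
    fix i assume i: "i \<in> {..<e}"
    have "(\<Sum>k<d. \<Sum>(a, b)\<in>\<Phi>. T $$ (i, k) * a $$ (k, q) * b $$ (p, i))
      = (\<Sum>(a, b)\<in>\<Phi>. \<Sum>k<d. T $$ (i, k) * a $$ (k, q) * b $$ (p, i))"
      by (subst sum.swap) (simp add: case_prod_beta)
    also have "\<dots> = (\<Sum>(a, b)\<in>\<Phi>. (T * a) $$ (i, q) * b $$ (p, i))"
      using \<Phi>c(1) Tc i pq by (intro sum.cong) (auto simp: index_mult_mat_sum[of _ e d _ d] sum_distrib_right)
    finally show "(\<Sum>k<d. \<Sum>(a, b)\<in>\<Phi>. T $$ (i, k) * a $$ (k, q) * b $$ (p, i))
      = (\<Sum>(a, b)\<in>\<Phi>. (T * a) $$ (i, q) * b $$ (p, i))" .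
  qed
  also have "\<dots> = (\<Sum>(a, b)\<in>\<Phi>. \<Sum>i<e. b $$ (p, i) * (T * a) $$ (i, q))"
    by (subst sum.swap) (simp add: case_prod_beta mult.commute)
  also have "\<dots> = (\<Sum>(a, b)\<in>\<Phi>. T $$ (p, q))"
  proof (intro sum.cong refl, clarify)
    fix a b assume ab: "(a, b) \<in> \<Phi>"
    then obtain g where g: "g \<in> carrier G" "a = \<rho> g" "b = \<sigma> (inv g)" unfolding \<Phi>_def by auto
    have Ta: "T * a \<in> carrier_mat e d" using Tc \<Phi>c[OF ab] by simp
    have "(\<Sum>i<e. b $$ (p, i) * (T * a) $$ (i, q)) = (b * (T * a)) $$ (p, q)"
      by (rule index_mult_mat_sum[OF \<Phi>c(2)[OF ab] Ta pq(1,2), symmetric])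
    also have "b * (T * a) = b * (\<sigma> g * T)" using intertwinesD(2)[OF T g(1)] g by simp
    also have "b * (\<sigma> g * T) = b * \<sigma> g * T"
      using \<Phi>c[OF ab] mat_repD(1)[OF \<sigma>] g Tc by (intro assoc_mult_mat[symmetric]) auto
    also have "\<dots> = T" using mat_rep_inv[OF \<sigma> g(1)] g Tc by simp
    finally show "(\<Sum>i<e. b $$ (p, i) * (T * a) $$ (i, q)) = T $$ (p, q)" .
  qed
  also have "\<dots> = of_nat (card \<Phi>) * T $$ (p, q)" by simp
  finally have "(\<Sum>i<e. (T * A) $$ (i, i)) = of_nat (card \<Phi>) * T $$ (p, q)" .
  moreover have "card \<Phi> > 0" using fin\<Phi> one_closed unfolding \<Phi>_def by (metis card_gt_0_iff empty_iff imageI)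
  ultimately have "(\<Sum>i<e. (T * A) $$ (i, i)) \<noteq> 0" using pq by simp
  from mult_nonzero_comm_trace[OF Tc Ac this] show thesis by (intro that[OF Ai'])
qed

text \<open>A nonzero intertwiner on a subset \<open>V\<close> stays nonzero on some subquotient that is irreducible under
  all of \<open>U\<close>: restrict to an invariant subspace of least dimension on which it does not vanish, and pass to an
  irreducible quotient of that subspace.\<close>

lemma irreducible_subquotient:
  assumes \<rho>: "\<And>g. g \<in> U \<Longrightarrow> \<rho> g \<in> carrier_mat d d"
    and \<sigma>: "\<And>g. g \<in> V \<Longrightarrow> \<sigma> g \<in> carrier_mat e e" and VU: "V \<subseteq> U"
    and T: "intertwines V d e \<rho> \<sigma> T" and nz: "T \<noteq> 0\<^sub>m e d"
  obtains r \<tau> T' where "mat_irreducible U r \<tau>" "intertwines V r e \<tau> \<sigma> T'" "T' \<noteq> 0\<^sub>m e r"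
    "\<forall>g\<in>U. \<rho> g = 1\<^sub>m d \<longrightarrow> \<tau> g = 1\<^sub>m r"
    "\<forall>g\<in>U. \<forall>h\<in>U. \<forall>k\<in>U. \<rho> k = \<rho> g * \<rho> h \<longrightarrow> \<tau> k = \<tau> g * \<tau> h"
proof -
  note Tc = intertwinesD(1)[OF T]
  define good where "good = (\<lambda>r P L \<tau>. T * P \<noteq> 0\<^sub>m e r \<and> P \<in> carrier_mat d r \<and> L \<in> carrier_mat r d \<and>
    L * P = (1\<^sub>m r :: complex mat) \<and> (\<forall>g\<in>U. \<tau> g \<in> carrier_mat r r) \<and> intertwines U r d \<tau> \<rho> P)"
  define Q where "Q = (\<lambda>r. \<exists>P L \<tau>. good r P L \<tau>)"
  have "good d (1\<^sub>m d) (1\<^sub>m d) \<rho>"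
    unfolding good_def intertwines_def using \<rho> nz Tc
    by (auto simp: left_mult_one_mat[of _ d d] right_mult_one_mat[of _ d d])
  then have "Q d" unfolding Q_def by blast
  define r where "r = (LEAST r. Q r)"
  have "Q r" unfolding r_def using \<open>Q d\<close> by (rule LeastI)
  have least: "r \<le> r'" if "Q r'" for r' unfolding r_def using that by (rule Least_le)
  obtain P L \<tau> where "good r P L \<tau>" using \<open>Q r\<close> unfolding Q_def by blast
  then have TP: "T * P \<noteq> 0\<^sub>m e r" and P: "P \<in> carrier_mat d r" and L: "L \<in> carrier_mat r d"
    and LP: "L * P = 1\<^sub>m r" and \<tau>: "\<And>g. g \<in> U \<Longrightarrow> \<tau> g \<in> carrier_mat r r" and i: "intertwines U r d \<tau> \<rho> P"
    unfolding good_def by auto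
  have TPc: "T * P \<in> carrier_mat e r" using Tc P by simp
  have r0: "r > 0"
  proof (rule ccontr)
    assume "\<not> r > 0"
    then have "T * P = 0\<^sub>m e r" using TPc by (intro eq_matI) auto
    then show False using TP by simp
  qed
  have iV: "intertwines V r d \<tau> \<rho> P" using i VU unfolding intertwines_def by auto
  have TPi: "intertwines V r e \<tau> \<sigma> (T * P)"
    by (rule intertwines_comp[OF T iV]) (use \<rho> \<sigma> \<tau> VU in auto)
  obtain s L2 P2 \<tau>2 where irr: "mat_irreducible U s \<tau>2" and L2: "L2 \<in> carrier_mat s r"
    and P2: "P2 \<in> carrier_mat r s" and LP2: "L2 * P2 = (1\<^sub>m s :: complex mat)" and i2: "intertwines U r s \<tau> \<tau>2 L2"
    using \<tau> r0 by (rule irreducible_quotient)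
  note \<tau>2 = mat_irreducibleD(2)[OF irr]
  \<comment> \<open>\<open>T * P\<close> kills the kernel of \<open>L2\<close> by minimality of \<open>r\<close>.\<close>
  define W where "W = {x \<in> carrier_vec r. L2 *\<^sub>v x = 0\<^sub>v s}"
  have W: "vec_subspace r W" unfolding W_def by (rule vec_subspace_kernel[OF L2])
  have Winv: "\<tau> g *\<^sub>v w \<in> W" if g: "g \<in> U" and w: "w \<in> W" for g w
  proof -
    have wc: "w \<in> carrier_vec r" "L2 *\<^sub>v w = 0\<^sub>v s" using w unfolding W_def by auto
    have "L2 *\<^sub>v (\<tau> g *\<^sub>v w) = (L2 * \<tau> g) *\<^sub>v w" using L2 \<tau>[OF g] wc by simp
    also have "\<dots> = \<tau>2 g *\<^sub>v (L2 *\<^sub>v w)" unfolding intertwinesD(2)[OF i2 g] using L2 \<tau>2[OF g] wc by simp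
    also have "\<dots> = 0\<^sub>v s" unfolding wc(2) using \<tau>2[OF g] by (intro eq_vecI) auto
    finally show ?thesis using \<tau>[OF g] wc unfolding W_def by simp
  qed
  obtain w P' L' \<tau>' where P': "P' \<in> carrier_mat r w" and L': "L' \<in> carrier_mat w r"
    and LP': "L' * P' = (1\<^sub>m w :: complex mat)" and Wr: "W = {P' *\<^sub>v x | x. x \<in> carrier_vec w}"
    and \<tau>'0: "\<forall>g\<in>U. \<tau>' g \<in> carrier_mat w w" and i': "intertwines U w r \<tau>' \<tau> P'"
    by (rule invariant_subspace_param[OF \<tau> W Winv])
  have \<tau>': "\<And>g. g \<in> U \<Longrightarrow> \<tau>' g \<in> carrier_mat w w" using \<tau>'0 by blast
  have "T * P * P' = 0\<^sub>m e w"
  proof (rule ccontr)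
    assume nz': "\<not> ?thesis"
    have "(L' * L) * (P * P') = L' * ((L * P) * P')"
      using L' L P P' by (simp add: assoc_mult_mat[of _ _ _ _ _ _ w])
    also have "\<dots> = 1\<^sub>m w" using LP LP' P' by simp
    finally have "good w (P * P') (L' * L) \<tau>'"
      unfolding good_def using nz' P P' L L' \<tau>' intertwines_comp[OF i i' \<tau>' \<tau> \<rho>]
        assoc_mult_mat[OF Tc P P'] by auto
    then have "r \<le> w" using least unfolding Q_def by blast
    moreover have "w \<le> r" by (rule left_inverse_dim_le[OF P' L' LP'])
    ultimately have wr: "w = r" by simp
    then have PL': "P' * L' = 1\<^sub>m r" using mat_mult_left_right_inverse[of L' r P'] P' L' LP' by simp
    have "L2 = 0\<^sub>m s r"
    proof (rule mat_eqI_mult_vec[OF L2])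
      fix x :: "complex vec" assume x: "x \<in> carrier_vec r"
      have "x = P' *\<^sub>v (L' *\<^sub>v x)" using PL' x P' L' by (metis assoc_mult_mat_vec one_mult_mat_vec)
      moreover have "L' *\<^sub>v x \<in> carrier_vec w" using L' x by simp
      ultimately have "x \<in> W" using Wr by blast
      then show "L2 *\<^sub>v x = 0\<^sub>m s r *\<^sub>v x" using x unfolding W_def by auto
    qed simp
    then have "L2 * P2 = 0\<^sub>m s s" using P2 by simp
    then have "(1\<^sub>m s :: complex mat) $$ (0, 0) = 0\<^sub>m s s $$ (0, 0)" using LP2 by simp
    then show False using mat_irreducibleD(1)[OF irr] by simp
  qed
  then have kill: "(T * P) *\<^sub>v x = 0\<^sub>v e" if xW: "x \<in> W" for x
  proof -
    obtain y where y: "y \<in> carrier_vec w" "x = P' *\<^sub>v y" using xW Wr by auto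
    then have "(T * P) *\<^sub>v x = (T * P * P') *\<^sub>v y"
      using assoc_mult_mat_vec[OF TPc P' y(1)] by simp
    also have "\<dots> = 0\<^sub>v e" unfolding \<open>T * P * P' = 0\<^sub>m e w\<close> using y by (intro eq_vecI) auto
    finally show ?thesis .
  qed
  define T' where "T' = T * P * P2"
  have T': "T' \<in> carrier_mat e s" using TPc P2 by (simp add: T'_def)
  have fac: "T' * L2 = T * P"
  proof (rule mat_eqI_mult_vec)
    fix x :: "complex vec" assume x: "x \<in> carrier_vec r"
    define z where "z = x - P2 *\<^sub>v (L2 *\<^sub>v x)"
    have c: "L2 *\<^sub>v x \<in> carrier_vec s" "P2 *\<^sub>v (L2 *\<^sub>v x) \<in> carrier_vec r" using L2 P2 x by auto
    have zc: "z \<in> carrier_vec r" using c x by (simp add: z_def)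
    have "L2 *\<^sub>v z = L2 *\<^sub>v x - L2 *\<^sub>v (P2 *\<^sub>v (L2 *\<^sub>v x))" unfolding z_def
      by (rule mult_minus_distrib_mat_vec[OF L2 x c(2)])
    also have "L2 *\<^sub>v (P2 *\<^sub>v (L2 *\<^sub>v x)) = (L2 * P2) *\<^sub>v (L2 *\<^sub>v x)"
      using L2 P2 c by (intro assoc_mult_mat_vec[symmetric])
    also have "\<dots> = L2 *\<^sub>v x" using LP2 c by simp
    finally have "z \<in> W" using zc c unfolding W_def by simp
    have xz: "x = z + P2 *\<^sub>v (L2 *\<^sub>v x)" unfolding z_def using x c P2 by (auto intro!: eq_vecI)
    have "(T * P) *\<^sub>v x = (T * P) *\<^sub>v z + (T * P) *\<^sub>v (P2 *\<^sub>v (L2 *\<^sub>v x))"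
      by (subst xz) (rule mult_add_distrib_mat_vec[OF TPc zc c(2)])
    also have "\<dots> = (T * P) *\<^sub>v (P2 *\<^sub>v (L2 *\<^sub>v x))" unfolding kill[OF \<open>z \<in> W\<close>] using TPc c by simp
    also have "\<dots> = T' *\<^sub>v (L2 *\<^sub>v x)" unfolding T'_def using TPc P2 c by (intro assoc_mult_mat_vec[symmetric])
    also have "\<dots> = (T' * L2) *\<^sub>v x" using T' L2 x by simp
    finally show "(T' * L2) *\<^sub>v x = (T * P) *\<^sub>v x" by simp
  qed (use T' L2 TPc in auto)
  have "T' \<noteq> 0\<^sub>m e s"
  proof
    assume "T' = 0\<^sub>m e s"
    then show False using fac TP L2 by simp
  qed
  moreover have "intertwines V s e \<tau>2 \<sigma> T'"
    unfolding intertwines_def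
  proof (intro conjI ballI T')
    fix g assume g: "g \<in> V"
    then have gU: "g \<in> U" using VU by auto
    have "T' * \<tau>2 g * L2 = T' * (\<tau>2 g * L2)" using T' \<tau>2[OF gU] L2 by (intro assoc_mult_mat)
    also have "\<dots> = T' * (L2 * \<tau> g)" using intertwinesD(2)[OF i2 gU] by simp
    also have "\<dots> = T' * L2 * \<tau> g" using T' \<tau>[OF gU] L2 by (intro assoc_mult_mat[symmetric])
    also have "\<dots> = \<sigma> g * (T' * L2)" unfolding fac by (rule intertwinesD(2)[OF TPi g])
    also have "\<dots> = \<sigma> g * T' * L2" using T' \<sigma>[OF g] L2 by (intro assoc_mult_mat[symmetric])
    finally have e: "T' * \<tau>2 g * L2 = \<sigma> g * T' * L2" .
    have c: "T' * \<tau>2 g \<in> carrier_mat e s" "\<sigma> g * T' \<in> carrier_mat e s" using T' \<tau>2[OF gU] \<sigma>[OF g] by auto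
    have "T' * \<tau>2 g * L2 * P2 = \<sigma> g * T' * L2 * P2" using e by simp
    then show "T' * \<tau>2 g = \<sigma> g * T'"
      unfolding assoc_mult_mat[OF c(1) L2 P2] assoc_mult_mat[OF c(2) L2 P2] LP2
        right_mult_one_mat[OF c(1)] right_mult_one_mat[OF c(2)] .
  qed
  moreover have "\<forall>g\<in>U. \<rho> g = 1\<^sub>m d \<longrightarrow> \<tau>2 g = 1\<^sub>m s"
  proof (intro ballI impI)
    fix g assume g: "g \<in> U" "\<rho> g = 1\<^sub>m d"
    show "\<tau>2 g = 1\<^sub>m s"
      by (rule intertwines_quotient_one[OF i2 P2 LP2 g(1) \<tau>2[OF g(1)]
            intertwines_sub_one[OF i L LP g(1) \<tau>[OF g(1)] g(2)]])
  qed
  moreover have "\<forall>g\<in>U. \<forall>h\<in>U. \<forall>k\<in>U. \<rho> k = \<rho> g * \<rho> h \<longrightarrow> \<tau>2 k = \<tau>2 g * \<tau>2 h"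
  proof (intro ballI impI)
    fix g h k assume g: "g \<in> U" "h \<in> U" "k \<in> U" "\<rho> k = \<rho> g * \<rho> h"
    show "\<tau>2 k = \<tau>2 g * \<tau>2 h"
      by (rule intertwines_quotient_mult[OF i2 P2 LP2 g(1-3) \<tau> \<tau>2
            intertwines_sub_mult[OF i L LP g(1-3) \<rho> \<tau> g(4)]])
  qed
  ultimately show thesis using irr by (intro that)
qed

section \<open>The regular representation of a finite quotient\<close>

text \<open>The left cosets of \<open>K\<close> in \<open>G\<close>.\<close>

definition lcosets_of :: "('g, 'b) monoid_scheme \<Rightarrow> 'g set \<Rightarrow> 'g set set" where
  "lcosets_of G K = (\<lambda>g. l_coset G g K) ` carrier G"

lemma (in group) lcoset_eq_iff:
  assumes K: "subgroup K G" and "g \<in> carrier G" "h \<in> carrier G"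
  shows "l_coset G g K = l_coset G h K \<longleftrightarrow> inv g \<otimes> h \<in> K"
proof
  assume e: "l_coset G g K = l_coset G h K"
  have "h \<otimes> \<one> \<in> l_coset G h K" using subgroup.one_closed[OF K] unfolding l_coset_def by blast
  then obtain k where "k \<in> K" "h = g \<otimes> k" using e assms unfolding l_coset_def by auto
  then show "inv g \<otimes> h \<in> K" using assms subgroup.mem_carrier[OF K] by (simp add: m_assoc[symmetric])
next
  assume k: "inv g \<otimes> h \<in> K"
  then have k': "inv h \<otimes> g \<in> K" using subgroup.m_inv_closed[OF K k] assms by (simp add: inv_mult_group)
  have "x \<otimes> a \<in> l_coset G y K" if "a \<in> K" "inv y \<otimes> x \<in> K" "x \<in> carrier G" "y \<in> carrier G" for x y a
  proof -
    have ac: "a \<in> carrier G" using subgroup.mem_carrier[OF K] that by auto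
    have "x \<otimes> a = y \<otimes> (inv y \<otimes> x \<otimes> a)" using that ac by (simp add: m_assoc[symmetric])
    moreover have "inv y \<otimes> x \<otimes> a \<in> K" using that subgroup.m_closed[OF K] by auto
    ultimately show ?thesis unfolding l_coset_def by blast
  qed
  then show "l_coset G g K = l_coset G h K" using k k' assms unfolding l_coset_def by blast
qed

text \<open>The cosets of \<open>K\<close>, numbered: \<open>c g\<close> is the number of the coset of \<open>g\<close>.\<close>

lemma (in group) finite_index_enum:
  assumes K: "K \<lhd> G" and fin: "finite (lcosets_of G K)"
  obtains c :: "'a \<Rightarrow> nat" and rep where
    "\<forall>g\<in>carrier G. c g < card (lcosets_of G K)"
    "\<forall>i<card (lcosets_of G K). rep i \<in> carrier G \<and> c (rep i) = i"
    "\<forall>g\<in>carrier G. \<forall>h\<in>carrier G. c g = c h \<longleftrightarrow> inv g \<otimes> h \<in> K"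
proof -
  let ?M = "card (lcosets_of G K)"
  obtain f where f: "bij_betw f (lcosets_of G K) {0..<?M}" using ex_bij_betw_finite_nat[OF fin] by auto
  define c where "c = (\<lambda>g. f (l_coset G g K))"
  have 1: "\<forall>g\<in>carrier G. c g < ?M" using f unfolding c_def lcosets_of_def bij_betw_def by auto
  have "\<exists>g\<in>carrier G. c g = i" if "i < ?M" for i
  proof -
    have "i \<in> f ` lcosets_of G K" using f that unfolding bij_betw_def by auto
    then show ?thesis unfolding c_def lcosets_of_def by auto
  qed
  then obtain rep where 2: "\<And>i. i < ?M \<Longrightarrow> rep i \<in> carrier G \<and> c (rep i) = i" by metis
  have 3: "c g = c h \<longleftrightarrow> inv g \<otimes> h \<in> K" if "g \<in> carrier G" "h \<in> carrier G" for g h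
  proof -
    have inj: "inj_on f (lcosets_of G K)" using f unfolding bij_betw_def by auto
    have "l_coset G x K \<in> lcosets_of G K" if "x \<in> carrier G" for x using that unfolding lcosets_of_def by auto
    with inj that have "c g = c h \<longleftrightarrow> l_coset G g K = l_coset G h K"
      unfolding c_def by (simp add: inj_on_eq_iff)
    then show ?thesis using lcoset_eq_iff[OF normal_imp_subgroup[OF K] that] by simp
  qed
  show thesis by (rule that[of c rep]) (use 1 2 3 in blast)+
qed

lemma (in group) mat_rep_finite_image:
  assumes K: "subgroup K G" and fin: "finite (lcosets_of G K)" and \<rho>: "mat_rep G d \<rho>"
    and triv: "\<And>k. k \<in> K \<Longrightarrow> \<rho> k = 1\<^sub>m d"
  shows "finite (\<rho> ` carrier G)"
proof -
  define f where "f = (\<lambda>C. \<rho> (SOME x. x \<in> C))"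
  have "\<rho> g \<in> f ` lcosets_of G K" if g: "g \<in> carrier G" for g
  proof -
    have "g \<otimes> \<one> \<in> l_coset G g K" using subgroup.one_closed[OF K] unfolding l_coset_def by blast
    then have "(SOME x. x \<in> l_coset G g K) \<in> l_coset G g K" by (rule someI)
    then obtain k where k: "k \<in> K" "(SOME x. x \<in> l_coset G g K) = g \<otimes> k" unfolding l_coset_def by auto
    then have "f (l_coset G g K) = \<rho> g * \<rho> k" unfolding f_def
      using mat_repD(3)[OF \<rho> g] subgroup.mem_carrier[OF K] by simp
    then have "f (l_coset G g K) = \<rho> g" using triv[OF k(1)] mat_repD(1)[OF \<rho> g] by simp
    then show ?thesis using g unfolding lcosets_of_def by (metis image_eqI)
  qed
  then show ?thesis using fin by (meson finite_imageI finite_subset image_subsetI)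
qed

text \<open>The regular representation of \<open>G / K\<close>.  Restricted to a subgroup \<open>H\<close>, it has a nonzero intertwiner to
  every nonzero representation of \<open>H\<close> that is trivial on \<open>H \<inter> K\<close>.\<close>

lemma (in group) regular_rep:
  assumes K: "K \<lhd> G" and fin: "finite (lcosets_of G K)"
  obtains R where "mat_rep G (card (lcosets_of G K)) R"
    "\<forall>k\<in>K. R k = 1\<^sub>m (card (lcosets_of G K))"
    "\<forall>H e \<sigma>. subgroup H G \<longrightarrow> e > 0 \<longrightarrow> mat_rep (G\<lparr>carrier := H\<rparr>) e \<sigma> \<longrightarrow> (\<forall>k\<in>H \<inter> K. \<sigma> k = 1\<^sub>m e) \<longrightarrow>
       (\<exists>T. intertwines H (card (lcosets_of G K)) e R \<sigma> T \<and> T \<noteq> 0\<^sub>m e (card (lcosets_of G K)))"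
proof -
  define M where "M = card (lcosets_of G K)"
  obtain c rep where c0: "\<forall>g\<in>carrier G. c g < M"
    and rep0: "\<forall>i<M. rep i \<in> carrier G \<and> c (rep i) = i"
    and ceq0: "\<forall>g\<in>carrier G. \<forall>h\<in>carrier G. c g = c h \<longleftrightarrow> inv g \<otimes> h \<in> K"
    unfolding M_def by (rule finite_index_enum[OF K fin])
  have c: "c g < M" if "g \<in> carrier G" for g using c0 that by blast
  have rep: "rep i \<in> carrier G" "c (rep i) = i" if "i < M" for i using rep0 that by auto
  have ceq: "c g = c h \<longleftrightarrow> inv g \<otimes> h \<in> K" if "g \<in> carrier G" "h \<in> carrier G" for g h using ceq0 that by blast
  have cmul: "c (x \<otimes> g) = c (x \<otimes> h)" if "c g = c h" "x \<in> carrier G" "g \<in> carrier G" "h \<in> carrier G" for x g h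
  proof -
    have "inv (x \<otimes> g) \<otimes> (x \<otimes> h) = inv g \<otimes> h"
      using that by (simp add: inv_mult_group m_assoc) (simp add: m_assoc[symmetric])
    then show ?thesis using that ceq[of g h] ceq[of "x \<otimes> g" "x \<otimes> h"] by simp
  qed
  define R where "R = (\<lambda>g. Matrix.mat M M (\<lambda>(j, i). if c (g \<otimes> rep i) = j then 1 else (0 :: complex)))"
  have Rc: "R g \<in> carrier_mat M M" for g by (simp add: R_def)
  have sumR: "(\<Sum>k<M. x k * R g $$ (k, i)) = x (c (g \<otimes> rep i))" if "g \<in> carrier G" "i < M" for x g i
  proof -
    have "(\<Sum>k<M. x k * R g $$ (k, i)) = (\<Sum>k<M. if k = c (g \<otimes> rep i) then x k else 0)"
      using that by (intro sum.cong) (auto simp: R_def)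
    then show ?thesis using c[of "g \<otimes> rep i"] that rep by simp
  qed
  have RR: "mat_rep G M R"
    unfolding mat_rep_def
  proof (intro conjI ballI Rc)
    show "R \<one> = 1\<^sub>m M" using rep by (intro eq_matI) (auto simp: R_def)
    fix g h assume gh: "g \<in> carrier G" "h \<in> carrier G"
    show "R (g \<otimes> h) = R g * R h"
    proof (rule eq_matI)
      fix j i assume "j < dim_row (R g * R h)" "i < dim_col (R g * R h)"
      then have ij: "j < M" "i < M" by (auto simp: R_def)
      have "(R g * R h) $$ (j, i) = (\<Sum>k<M. R g $$ (j, k) * R h $$ (k, i))"
        by (rule index_mult_mat_sum[OF Rc Rc ij])
      also have "\<dots> = R g $$ (j, c (h \<otimes> rep i))" by (rule sumR[OF gh(2) ij(2)])
      also have "\<dots> = (if c (g \<otimes> rep (c (h \<otimes> rep i))) = j then 1 else 0)"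
        using ij c[of "h \<otimes> rep i"] gh rep by (simp add: R_def)
      also have "c (g \<otimes> rep (c (h \<otimes> rep i))) = c (g \<otimes> (h \<otimes> rep i))"
        using gh rep ij c[of "h \<otimes> rep i"] by (intro cmul) auto
      finally show "R (g \<otimes> h) $$ (j, i) = (R g * R h) $$ (j, i)"
        using ij gh rep by (simp add: R_def m_assoc)
    qed (auto simp: R_def)
  qed
  have RK: "R k = 1\<^sub>m M" if k: "k \<in> K" for k
  proof -
    have kc: "k \<in> carrier G" using k K by (meson normal_imp_subgroup subgroup.mem_carrier)
    have "c (k \<otimes> rep i) = i" if "i < M" for i
    proof -
      have "inv (rep i) \<otimes> (k \<otimes> rep i) \<in> K"
        using normal.inv_op_closed1[OF K rep(1)[OF that] k] rep[OF that] kc by (simp add: m_assoc)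
      then show ?thesis using ceq[of "rep i" "k \<otimes> rep i"] rep[OF that] kc by simp
    qed
    then show ?thesis by (intro eq_matI) (auto simp: R_def)
  qed
  have "\<exists>T. intertwines H M e R \<sigma> T \<and> T \<noteq> 0\<^sub>m e M"
    if H: "subgroup H G" and e: "e > 0" and \<sigma>: "mat_rep (G\<lparr>carrier := H\<rparr>) e \<sigma>"
      and triv: "\<forall>k\<in>H \<inter> K. \<sigma> k = 1\<^sub>m e" for H e \<sigma>
  proof -
    have \<sigma>c: "\<sigma> h \<in> carrier_mat e e" if "h \<in> H" for h using mat_repD(1)[OF \<sigma>] that by simp
    have \<sigma>m: "\<sigma> (g \<otimes> h) = \<sigma> g * \<sigma> h" if "g \<in> H" "h \<in> H" for g h using mat_repD(3)[OF \<sigma>] that by simp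
    have Hc: "h \<in> carrier G" if "h \<in> H" for h using subgroup.mem_carrier[OF H that] .
    have wd: "\<sigma> g = \<sigma> h" if "g \<in> H" "h \<in> H" "c g = c h" for g h
    proof -
      have a: "inv g \<otimes> h \<in> H" using that H by (simp add: subgroup.m_closed subgroup.m_inv_closed)
      have "inv g \<otimes> h \<in> K" using that ceq Hc by simp
      then have "\<sigma> (inv g \<otimes> h) = 1\<^sub>m e" using triv a by blast
      moreover have "h = g \<otimes> (inv g \<otimes> h)" using that Hc by (simp add: m_assoc[symmetric])
      ultimately show ?thesis using \<sigma>m[OF that(1) a] \<sigma>c[OF that(1)] by simp
    qed
    define T where "T = Matrix.mat e M (\<lambda>(a, i). if \<exists>h\<in>H. c h = i then \<sigma> (SOME h. h \<in> H \<and> c h = i) $$ (a, 0) else 0)"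
    have Tc: "T \<in> carrier_mat e M" by (simp add: T_def)
    have T1: "T $$ (a, c h) = \<sigma> h $$ (a, 0)" if "h \<in> H" "a < e" for a h
    proof -
      have "(SOME g. g \<in> H \<and> c g = c h) \<in> H \<and> c (SOME g. g \<in> H \<and> c g = c h) = c h"
        by (rule someI[of _ h]) (use that in auto)
      then have "\<sigma> (SOME g. g \<in> H \<and> c g = c h) = \<sigma> h" using wd that by blast
      then show ?thesis using that c[OF Hc[OF that(1)]] by (auto simp: T_def)
    qed
    have T0: "T $$ (a, i) = 0" if "a < e" "i < M" "\<not> (\<exists>h\<in>H. c h = i)" for a i
      using that by (simp add: T_def)
    have "T * R h = \<sigma> h * T" if h: "h \<in> H" for h
    proof (rule eq_matI)
      fix a i assume "a < dim_row (\<sigma> h * T)" "i < dim_col (\<sigma> h * T)"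
      then have ai: "a < e" "i < M" using \<sigma>c[OF h] Tc by auto
      have "(T * R h) $$ (a, i) = (\<Sum>k<M. T $$ (a, k) * R h $$ (k, i))"
        by (rule index_mult_mat_sum[OF Tc Rc ai])
      also have "\<dots> = T $$ (a, c (h \<otimes> rep i))" by (rule sumR[OF Hc[OF h] ai(2)])
      also have "\<dots> = (\<Sum>b<e. \<sigma> h $$ (a, b) * T $$ (b, i))"
      proof (cases "\<exists>g\<in>H. c g = i")
        case True
        then obtain g where g: "g \<in> H" "c g = i" by auto
        have hg: "h \<otimes> g \<in> H" using g h H by (simp add: subgroup.m_closed)
        have "c (h \<otimes> rep i) = c (h \<otimes> g)" using g rep[OF ai(2)] Hc h by (intro cmul) auto
        then have "T $$ (a, c (h \<otimes> rep i)) = (\<sigma> h * \<sigma> g) $$ (a, 0)" using T1[OF hg ai(1)] \<sigma>m[OF h g(1)] by simp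
        also have "\<dots> = (\<Sum>b<e. \<sigma> h $$ (a, b) * \<sigma> g $$ (b, 0))"
          by (rule index_mult_mat_sum[OF \<sigma>c[OF h] \<sigma>c[OF g(1)] ai(1) e])
        also have "\<dots> = (\<Sum>b<e. \<sigma> h $$ (a, b) * T $$ (b, i))" using T1[OF g(1)] g(2) by (intro sum.cong) auto
        finally show ?thesis .
      next
        case False
        have "\<not> (\<exists>g\<in>H. c g = c (h \<otimes> rep i))"
        proof
          assume "\<exists>g\<in>H. c g = c (h \<otimes> rep i)"
          then obtain g where g: "g \<in> H" "c g = c (h \<otimes> rep i)" by auto
          have "c (inv h \<otimes> g) = c (inv h \<otimes> (h \<otimes> rep i))"
            using g Hc h rep[OF ai(2)] by (intro cmul) auto
          also have "inv h \<otimes> (h \<otimes> rep i) = rep i" using Hc[OF h] rep[OF ai(2)] by (simp add: m_assoc[symmetric])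
          finally have "c (inv h \<otimes> g) = i" using rep ai by simp
          moreover have "inv h \<otimes> g \<in> H" using g h H by (simp add: subgroup.m_closed subgroup.m_inv_closed)
          ultimately show False using False by blast
        qed
        then show ?thesis using T0[OF ai(1)] T0[OF _ ai(2) False] c Hc[OF h] rep[OF ai(2)] by simp
      qed
      also have "\<dots> = (\<sigma> h * T) $$ (a, i)" by (rule index_mult_mat_sum[OF \<sigma>c[OF h] Tc ai, symmetric])
      finally show "(T * R h) $$ (a, i) = (\<sigma> h * T) $$ (a, i)" .
    qed (use \<sigma>c[OF h] Tc Rc in auto)
    then have "intertwines H M e R \<sigma> T" using Tc unfolding intertwines_def by auto
    moreover have "T \<noteq> 0\<^sub>m e M"
    proof
      assume "T = 0\<^sub>m e M"
      moreover have "T $$ (0, c \<one>) = 1" using T1[of \<one> 0] subgroup.one_closed[OF H] mat_repD(2)[OF \<sigma>] e by simp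
      ultimately show False using e c[of \<one>] by simp
    qed
    ultimately show ?thesis by blast
  qed
  then show thesis using RR RK unfolding M_def by (intro that[of R]) blast+
qed

text \<open>Each \<open>\<sigma> a\<close> is both a quotient and, by averaging, a subrepresentation of the regular representation of
  \<open>G / K\<close>.  By Schur's lemma, suitable columns and rows of the intertwiners form an \<open>N\<close>-column matrix with a
  left inverse.\<close>

lemma (in group) noniso_irreducibles_le_index:
  assumes K: "K \<lhd> G" and fin: "finite (lcosets_of G K)"
    and rep: "\<And>a. a < N \<Longrightarrow> mat_rep G (d a) (\<sigma> a)"
    and irr: "\<And>a. a < N \<Longrightarrow> mat_irreducible (carrier G) (d a) (\<sigma> a)"
    and triv: "\<And>a k. a < N \<Longrightarrow> k \<in> K \<Longrightarrow> \<sigma> a k = 1\<^sub>m (d a)"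
    and noniso: "\<And>a b T. a < N \<Longrightarrow> b < N \<Longrightarrow> a \<noteq> b \<Longrightarrow>
       intertwines (carrier G) (d a) (d b) (\<sigma> a) (\<sigma> b) T \<Longrightarrow> T = 0\<^sub>m (d b) (d a)"
  shows "N \<le> card (lcosets_of G K)"
proof -
  define M where "M = card (lcosets_of G K)"
  have Ks: "subgroup K G" using K by (rule normal_imp_subgroup)
  obtain R where R: "mat_rep G M R" and RK: "\<forall>k\<in>K. R k = 1\<^sub>m M"
    and uni: "\<forall>H e \<sigma>. subgroup H G \<longrightarrow> e > 0 \<longrightarrow> mat_rep (G\<lparr>carrier := H\<rparr>) e \<sigma> \<longrightarrow> (\<forall>k\<in>H \<inter> K. \<sigma> k = 1\<^sub>m e) \<longrightarrow>
       (\<exists>T. intertwines H M e R \<sigma> T \<and> T \<noteq> 0\<^sub>m e M)"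
    unfolding M_def by (rule regular_rep[OF K fin])
  have "\<exists>T A. intertwines (carrier G) M (d a) R (\<sigma> a) T \<and> intertwines (carrier G) (d a) M (\<sigma> a) R A
      \<and> T * A \<noteq> 0\<^sub>m (d a) (d a)" if a: "a < N" for a
  proof -
    have "\<exists>T. intertwines (carrier G) M (d a) R (\<sigma> a) T \<and> T \<noteq> 0\<^sub>m (d a) M"
      using uni[rule_format, OF subgroup_self mat_irreducibleD(1)[OF irr[OF a]], of "\<sigma> a"] rep[OF a] triv[OF a] by simp
    then obtain T where T: "intertwines (carrier G) M (d a) R (\<sigma> a) T" "T \<noteq> 0\<^sub>m (d a) M" by auto
    obtain A where "intertwines (carrier G) (d a) M (\<sigma> a) R A" "T * A \<noteq> 0\<^sub>m (d a) (d a)" "A * T \<noteq> 0\<^sub>m M M"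
      using R rep[OF a] mat_rep_finite_image[OF Ks fin R] mat_rep_finite_image[OF Ks fin rep[OF a] triv[OF a]] T
      by (rule intertwiner_reverse) (use RK in auto)
    then show ?thesis using T by blast
  qed
  then obtain T A where T: "\<And>a. a < N \<Longrightarrow> intertwines (carrier G) M (d a) R (\<sigma> a) (T a)"
    and A: "\<And>a. a < N \<Longrightarrow> intertwines (carrier G) (d a) M (\<sigma> a) R (A a)"
    and TA: "\<And>a. a < N \<Longrightarrow> T a * A a \<noteq> 0\<^sub>m (d a) (d a)" by metis
  note Tc = intertwinesD(1)[OF T] and Ac = intertwinesD(1)[OF A]
  have "\<exists>p q. p < d a \<and> q < d a \<and> (T a * A a) $$ (p, q) \<noteq> 0" if a: "a < N" for a
  proof (rule ccontr)
    assume "\<not> ?thesis"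
    then have "T a * A a = 0\<^sub>m (d a) (d a)" using Tc[OF a] Ac[OF a] by (intro eq_matI) auto
    then show False using TA[OF a] by simp
  qed
  then obtain p q where pq: "\<And>a. a < N \<Longrightarrow> p a < d a" "\<And>a. a < N \<Longrightarrow> q a < d a"
    "\<And>a. a < N \<Longrightarrow> (T a * A a) $$ (p a, q a) \<noteq> 0" by metis
  have zero: "T b * A a = 0\<^sub>m (d b) (d a)" if "a < N" "b < N" "a \<noteq> b" for a b
    using noniso[OF that intertwines_comp[OF T[OF that(2)] A[OF that(1)]]]
      mat_repD(1)[OF rep[OF that(1)]] mat_repD(1)[OF rep[OF that(2)]] mat_repD(1)[OF R] by blast
  define P where "P = Matrix.mat M N (\<lambda>(i, a). A a $$ (i, q a))"
  define L where "L = Matrix.mat N M (\<lambda>(b, i). T b $$ (p b, i) / (T b * A b) $$ (p b, q b))"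
  have P: "P \<in> carrier_mat M N" and L: "L \<in> carrier_mat N M" by (auto simp: P_def L_def)
  have "L * P = 1\<^sub>m N"
  proof (rule eq_matI)
    fix b a assume "b < dim_row (1\<^sub>m N :: complex mat)" "a < dim_col (1\<^sub>m N :: complex mat)"
    then have ba: "b < N" "a < N" by auto
    have "(L * P) $$ (b, a) = (\<Sum>k<M. L $$ (b, k) * P $$ (k, a))" by (rule index_mult_mat_sum[OF L P ba])
    also have "\<dots> = (\<Sum>k<M. T b $$ (p b, k) * A a $$ (k, q a)) / (T b * A b) $$ (p b, q b)"
      using ba by (simp add: L_def P_def sum_divide_distrib)
    also have "(\<Sum>k<M. T b $$ (p b, k) * A a $$ (k, q a)) = (T b * A a) $$ (p b, q a)"
      by (rule index_mult_mat_sum[OF Tc[OF ba(1)] Ac[OF ba(2)] pq(1)[OF ba(1)] pq(2)[OF ba(2)], symmetric])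
    also have "\<dots> / (T b * A b) $$ (p b, q b) = (if b = a then 1 else 0)"
      using pq[OF ba(1)] pq[OF ba(2)] zero[OF ba(2,1)] by auto
    finally show "(L * P) $$ (b, a) = 1\<^sub>m N $$ (b, a)" using ba by simp
  qed (use L P in auto)
  then show ?thesis using left_inverse_dim_le[OF P L] unfolding M_def by simp
qed

section \<open>Representations with a common constituent on a subgroup with abelian quotient\<close>

text \<open>Operators that commute on an invariant subspace have a common eigenvector in it.\<close>

lemma common_eigenvector:
  assumes \<rho>: "\<And>g. g \<in> U \<Longrightarrow> \<rho> g \<in> carrier_mat d d"
    and W: "vec_subspace d W" "W \<noteq> {0\<^sub>v d}" and inv: "\<And>g w. g \<in> U \<Longrightarrow> w \<in> W \<Longrightarrow> \<rho> g *\<^sub>v w \<in> W"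
    and comm: "\<And>g h w. g \<in> U \<Longrightarrow> h \<in> U \<Longrightarrow> w \<in> W \<Longrightarrow> \<rho> g *\<^sub>v (\<rho> h *\<^sub>v w) = \<rho> h *\<^sub>v (\<rho> g *\<^sub>v w)"
  obtains w \<chi> where "w \<in> W" "w \<noteq> 0\<^sub>v d" "\<forall>g\<in>U. \<rho> g *\<^sub>v w = \<chi> g \<cdot>\<^sub>v w"
proof -
  obtain r P L \<tau> where P: "P \<in> carrier_mat d r" and L: "L \<in> carrier_mat r d"
    and LP: "L * P = (1\<^sub>m r :: complex mat)" and Wr: "W = {P *\<^sub>v x | x. x \<in> carrier_vec r}"
    and \<tau>0: "\<forall>g\<in>U. \<tau> g \<in> carrier_mat r r" and i: "intertwines U r d \<tau> \<rho> P"
    by (rule invariant_subspace_param[OF \<rho> W(1) inv])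
  have \<tau>: "\<And>g. g \<in> U \<Longrightarrow> \<tau> g \<in> carrier_mat r r" using \<tau>0 by blast
  have r0: "r > 0"
  proof (rule ccontr)
    assume "\<not> r > 0"
    then have "P *\<^sub>v x = 0\<^sub>v d" if "x \<in> carrier_vec r" for x
      using that P by (intro eq_vecI) (auto simp: scalar_prod_def)
    then have "W \<subseteq> {0\<^sub>v d}" using Wr by auto
    then show False using W unfolding vec_subspace_def by auto
  qed
  obtain s P2 L2 \<tau>2 where irr: "mat_irreducible U s \<tau>2" and P2: "P2 \<in> carrier_mat r s" and L2: "L2 \<in> carrier_mat s r"
    and LP2: "L2 * P2 = (1\<^sub>m s :: complex mat)" and i2: "intertwines U s r \<tau>2 \<tau> P2"
    using \<tau> r0 by (rule irreducible_sub)
  note \<tau>2 = mat_irreducibleD(2)[OF irr]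
  define Q where "Q = P * P2"
  define J where "J = L2 * L"
  have Q: "Q \<in> carrier_mat d s" and J: "J \<in> carrier_mat s d" using P P2 L L2 by (auto simp: Q_def J_def)
  have "J * Q = L2 * ((L * P) * P2)"
    unfolding J_def Q_def using L2 L P P2 by (simp add: assoc_mult_mat[of _ _ _ _ _ _ s])
  then have JQ: "J * Q = 1\<^sub>m s" using LP LP2 P2 by simp
  have iQ: "intertwines U s d \<tau>2 \<rho> Q" unfolding Q_def by (rule intertwines_comp[OF i i2 \<tau>2 \<tau> \<rho>])
  have QW: "Q *\<^sub>v x \<in> W" if "x \<in> carrier_vec s" for x
  proof -
    have "Q *\<^sub>v x = P *\<^sub>v (P2 *\<^sub>v x)" unfolding Q_def using P P2 that by (intro assoc_mult_mat_vec)
    moreover have "P2 *\<^sub>v x \<in> carrier_vec r" using P2 that by simp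
    ultimately show ?thesis using Wr by blast
  qed
  have Qinj: "x = y" if "x \<in> carrier_vec s" "y \<in> carrier_vec s" "Q *\<^sub>v x = Q *\<^sub>v y" for x y
  proof -
    have "J *\<^sub>v (Q *\<^sub>v z) = z" if "z \<in> carrier_vec s" for z
      using assoc_mult_mat_vec[OF J Q that] JQ that by simp
    then show ?thesis using that by metis
  qed
  have Qc: "\<rho> g *\<^sub>v (Q *\<^sub>v x) = Q *\<^sub>v (\<tau>2 g *\<^sub>v x)" if "g \<in> U" "x \<in> carrier_vec s" for g x
    using intertwinesD(2)[OF iQ that(1)] assoc_mult_mat_vec[OF \<rho>[OF that(1)] Q that(2)]
      assoc_mult_mat_vec[OF Q \<tau>2[OF that(1)] that(2)] by simp
  have "\<tau>2 g * \<tau>2 h = \<tau>2 h * \<tau>2 g" if g: "g \<in> U" and h: "h \<in> U" for g h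
  proof (rule mat_eqI_mult_vec)
    fix x :: "complex vec" assume x: "x \<in> carrier_vec s"
    have c: "\<tau>2 g *\<^sub>v x \<in> carrier_vec s" "\<tau>2 h *\<^sub>v x \<in> carrier_vec s"
      "\<tau>2 g *\<^sub>v (\<tau>2 h *\<^sub>v x) \<in> carrier_vec s" "\<tau>2 h *\<^sub>v (\<tau>2 g *\<^sub>v x) \<in> carrier_vec s"
      using \<tau>2[OF g] \<tau>2[OF h] x by auto
    have "Q *\<^sub>v (\<tau>2 g *\<^sub>v (\<tau>2 h *\<^sub>v x)) = Q *\<^sub>v (\<tau>2 h *\<^sub>v (\<tau>2 g *\<^sub>v x))"
      using Qc[OF g c(2)] Qc[OF h c(1)] Qc[OF g x] Qc[OF h x] comm[OF g h QW[OF x]] by simp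
    then have "\<tau>2 g *\<^sub>v (\<tau>2 h *\<^sub>v x) = \<tau>2 h *\<^sub>v (\<tau>2 g *\<^sub>v x)" using Qinj c by blast
    then show "(\<tau>2 g * \<tau>2 h) *\<^sub>v x = (\<tau>2 h * \<tau>2 g) *\<^sub>v x" using \<tau>2[OF g] \<tau>2[OF h] x by simp
  qed (use \<tau>2[OF g] \<tau>2[OF h] in auto)
  then have "\<exists>c. \<tau>2 g = c \<cdot>\<^sub>m 1\<^sub>m s" if g: "g \<in> U" for g
    using schur_scalar[OF irr \<tau>2[OF g]] g by metis
  then obtain \<chi> where \<chi>: "\<And>g. g \<in> U \<Longrightarrow> \<tau>2 g = \<chi> g \<cdot>\<^sub>m 1\<^sub>m s" by metis
  define u :: "complex vec" where "u = unit_vec s 0"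
  have u: "u \<in> carrier_vec s" by (simp add: u_def)
  have "Q *\<^sub>v u \<noteq> 0\<^sub>v d"
  proof
    assume "Q *\<^sub>v u = 0\<^sub>v d"
    moreover have "Q *\<^sub>v 0\<^sub>v s = 0\<^sub>v d" using Q by (intro eq_vecI) auto
    ultimately have "u = 0\<^sub>v s" using Qinj[OF u zero_carrier_vec] by simp
    then have "u $ 0 = 0" using mat_irreducibleD(1)[OF irr] by simp
    then show False using mat_irreducibleD(1)[OF irr] by (simp add: u_def)
  qed
  moreover have "\<rho> g *\<^sub>v (Q *\<^sub>v u) = \<chi> g \<cdot>\<^sub>v (Q *\<^sub>v u)" if g: "g \<in> U" for g
  proof -
    have "\<tau>2 g *\<^sub>v u = \<chi> g \<cdot>\<^sub>v u" unfolding \<chi>[OF g] using u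
      by (intro eq_vecI) (auto simp: scalar_prod_def mult.assoc if_distrib if_distribR sum.delta cong: if_cong)
    then show ?thesis using Qc[OF g u] mult_mat_vec[OF Q u] by simp
  qed
  ultimately show thesis using that[OF QW[OF u]] by blast
qed

lemma sum_div_mod:
  fixes f :: "nat \<Rightarrow> nat \<Rightarrow> 'b :: comm_monoid_add"
  shows "(\<Sum>y<m * k. f (y div k) (y mod k)) = (\<Sum>i<m. \<Sum>j<k. f i j)"
proof (cases "k = 0")
  case False
  have "(\<Sum>y<m * k. f (y div k) (y mod k)) = (\<Sum>i<m. \<Sum>y\<in>{i * k..<i * k + k}. f (y div k) (y mod k))"
    by (rule sum.nat_group[symmetric])
  also have "\<dots> = (\<Sum>i<m. \<Sum>j<k. f i j)"
  proof (rule sum.cong[OF refl])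
    fix i
    have dm: "y div k = i \<and> y mod k = y - i * k \<and> y - i * k < k" if "y \<in> {i * k..<i * k + k}" for y
    proof -
      have "y div k = i" using that by (intro div_nat_eqI) (auto simp: mult.commute)
      moreover from this have "y mod k = y - i * k" using minus_div_mult_eq_mod[of y k] by simp
      ultimately show ?thesis using mod_less_divisor[of k y] False by simp
    qed
    show "(\<Sum>y\<in>{i * k..<i * k + k}. f (y div k) (y mod k)) = (\<Sum>j<k. f i j)"
      by (rule sum.reindex_bij_witness[where i = "\<lambda>j. i * k + j" and j = "\<lambda>y. y - i * k"])
        (use dm in auto)
  qed
  finally show ?thesis .
qed simp

lemma div_mod_less_mult: "y < m * k \<Longrightarrow> y div k < m \<and> y mod k < (k :: nat)"
  by (cases "k = 0") (auto simp: less_mult_imp_div_less)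

text \<open>If \<open>\<rho>\<close> and \<open>\<rho>'\<close> share a constituent on restriction to \<open>S\<close> and \<open>G / S\<close> is abelian, then \<open>G\<close> acts on
  the nonzero space of \<open>S\<close>-intertwiners through commuting operators; a common eigenvector
  is an isomorphism of \<open>\<rho>'\<close> with a twist of \<open>\<rho>\<close>.\<close>

lemma (in group) common_constituent_twist:
  assumes \<rho>: "mat_rep G m \<rho>" and \<rho>': "mat_rep G m' \<rho>'"
    and S: "S \<subseteq> carrier G" and ab: "\<And>g h. g \<in> carrier G \<Longrightarrow> h \<in> carrier G \<Longrightarrow> inv (h \<otimes> g) \<otimes> (g \<otimes> h) \<in> S"
    and norm: "\<And>g s. g \<in> carrier G \<Longrightarrow> s \<in> S \<Longrightarrow> inv g \<otimes> s \<otimes> g \<in> S"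
    and T0: "intertwines S m m' \<rho> \<rho>' T0" "T0 \<noteq> 0\<^sub>m m' m"
  obtains T \<chi> where "intertwines S m m' \<rho> \<rho>' T" "T \<noteq> 0\<^sub>m m' m"
    "\<forall>g\<in>carrier G. \<rho>' g * T = \<chi> g \<cdot>\<^sub>m (T * \<rho> g)"
proof -
  note \<rho>c = mat_repD(1)[OF \<rho>] and \<rho>c' = mat_repD(1)[OF \<rho>']
  define act where "act = (\<lambda>g T. \<rho>' g * T * \<rho> (inv g))"
  have actc: "act g T \<in> carrier_mat m' m" if "g \<in> carrier G" "T \<in> carrier_mat m' m" for g T
    unfolding act_def
    by (rule mult_carrier_mat[OF mult_carrier_mat[OF \<rho>c'[OF that(1)] that(2)] \<rho>c[OF inv_closed[OF that(1)]]])
  have act_act: "act g (act h T) = act (g \<otimes> h) T"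
    if g: "g \<in> carrier G" and h: "h \<in> carrier G" and T: "T \<in> carrier_mat m' m" for g h T
  proof -
    note c = \<rho>c'[OF g] \<rho>c'[OF h] \<rho>c[OF inv_closed[OF g]] \<rho>c[OF inv_closed[OF h]] T
    have "act g (act h T) = \<rho>' g * (\<rho>' h * T * \<rho> (inv h)) * \<rho> (inv g)" by (simp add: act_def)
    also have "\<rho>' g * (\<rho>' h * T * \<rho> (inv h)) = \<rho>' g * (\<rho>' h * T) * \<rho> (inv h)"
      using c by (intro assoc_mult_mat[symmetric]) auto
    also have "\<rho>' g * (\<rho>' h * T) = \<rho>' g * \<rho>' h * T" using c by (intro assoc_mult_mat[symmetric]) auto
    also have "\<rho>' g * \<rho>' h * T * \<rho> (inv h) * \<rho> (inv g) = \<rho>' g * \<rho>' h * T * (\<rho> (inv h) * \<rho> (inv g))"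
      by (rule assoc_mult_mat[OF mult_carrier_mat[OF mult_carrier_mat[OF c(1,2)] c(5)] c(4) c(3)])
    finally show ?thesis
      using mat_repD(3)[OF \<rho>' g h] mat_repD(3)[OF \<rho> inv_closed[OF h] inv_closed[OF g]] g h
      by (simp add: act_def inv_mult_group)
  qed
  have act_fix: "act g T = T \<longleftrightarrow> T * \<rho> g = \<rho>' g * T" if g: "g \<in> carrier G" and T: "T \<in> carrier_mat m' m" for g T
  proof
    note c = \<rho>c'[OF g] \<rho>c[OF g] \<rho>c[OF inv_closed[OF g]] T
    assume a: "act g T = T"
    have "T * \<rho> g = \<rho>' g * T * \<rho> (inv g) * \<rho> g" using a by (simp add: act_def)
    also have "\<dots> = \<rho>' g * T * (\<rho> (inv g) * \<rho> g)" by (rule assoc_mult_mat[OF mult_carrier_mat[OF c(1,4)] c(3,2)])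
    also have "\<dots> = \<rho>' g * T" unfolding mat_rep_inv[OF \<rho> g] by (rule right_mult_one_mat[OF mult_carrier_mat[OF c(1,4)]])
    finally show "T * \<rho> g = \<rho>' g * T" .
  next
    note c = \<rho>c'[OF g] \<rho>c[OF g] \<rho>c[OF inv_closed[OF g]] T
    assume a: "T * \<rho> g = \<rho>' g * T"
    have "act g T = T * \<rho> g * \<rho> (inv g)" by (simp add: act_def a)
    also have "\<dots> = T * (\<rho> g * \<rho> (inv g))" by (rule assoc_mult_mat[OF c(4,2,3)])
    finally show "act g T = T" unfolding mat_rep_inv[OF \<rho> g] using T by simp
  qed
  define N where "N = m' * m"
  define unvec :: "complex vec \<Rightarrow> complex mat" where "unvec = (\<lambda>w. Matrix.mat m' m (\<lambda>(i, j). w $ (i * m + j)))"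
  define tovec :: "complex mat \<Rightarrow> complex vec" where "tovec = (\<lambda>T. vec N (\<lambda>y. T $$ (y div m, y mod m)))"
  have idx: "i * m + j < N" "(i * m + j) div m = i" "(i * m + j) mod m = j" if "i < m'" "j < m" for i j
  proof -
    have "i * m + j < Suc i * m" using that by simp
    also have "\<dots> \<le> m' * m" using that by (intro mult_le_mono1) simp
    finally show "i * m + j < N" unfolding N_def .
  qed (use that in auto)
  have uc: "unvec w \<in> carrier_mat m' m" for w by (simp add: unvec_def)
  have uv: "unvec (tovec T) = T" if "T \<in> carrier_mat m' m" for T
    using that idx by (intro eq_matI) (auto simp: unvec_def tovec_def)
  have vc: "tovec T \<in> carrier_vec N" for T by (simp add: tovec_def)
  have u_inj: "w = 0\<^sub>v N" if w: "w \<in> carrier_vec N" "unvec w = 0\<^sub>m m' m" for w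
  proof (rule eq_vecI)
    fix y assume "y < dim_vec (0\<^sub>v N :: complex vec)"
    then have y: "y < N" by simp
    have b: "y div m < m'" "y mod m < m" using div_mod_less_mult y unfolding N_def by blast+
    have "unvec w $$ (y div m, y mod m) = 0" unfolding w(2) using b by simp
    then show "w $ y = 0\<^sub>v N $ y" using b y by (simp add: unvec_def)
  qed (use w in simp)
  define Kr where "Kr = (\<lambda>g. Matrix.mat N N (\<lambda>(x, y). \<rho>' g $$ (x div m, y div m) * \<rho> (inv g) $$ (y mod m, x mod m)))"
  have Krc: "Kr g \<in> carrier_mat N N" for g by (simp add: Kr_def)
  have Kr_act: "unvec (Kr g *\<^sub>v w) = act g (unvec w)" if g: "g \<in> carrier G" and w: "w \<in> carrier_vec N" for g w
  proof (rule eq_matI)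
    note c = \<rho>c'[OF g] \<rho>c[OF inv_closed[OF g]]
    fix i j assume "i < dim_row (act g (unvec w))" "j < dim_col (act g (unvec w))"
    then have ij: "i < m'" "j < m" using carrier_matD[OF actc[OF g uc[of w]]] by simp_all
    have "unvec (Kr g *\<^sub>v w) $$ (i, j) = (\<Sum>y<N. Kr g $$ (i * m + j, y) * w $ y)"
      using ij idx[OF ij] w carrier_matD[OF Krc[of g]] carrier_vecD[OF w]
      by (simp add: unvec_def scalar_prod_def lessThan_atLeast0)
    also have "\<dots> = (\<Sum>y<N. \<rho>' g $$ (i, y div m) * \<rho> (inv g) $$ (y mod m, j) * unvec w $$ (y div m, y mod m))"
    proof (intro sum.cong refl)
      fix y assume "y \<in> {..<N}"
      then have y: "y < N" by simp
      have b: "y div m < m'" "y mod m < m" using div_mod_less_mult y unfolding N_def by blast+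
      show "Kr g $$ (i * m + j, y) * w $ y = \<rho>' g $$ (i, y div m) * \<rho> (inv g) $$ (y mod m, j) * unvec w $$ (y div m, y mod m)"
        using idx[OF ij] y b by (simp add: Kr_def unvec_def)
    qed
    also have "\<dots> = (\<Sum>k<m'. \<Sum>l<m. \<rho>' g $$ (i, k) * \<rho> (inv g) $$ (l, j) * unvec w $$ (k, l))"
      unfolding N_def by (rule sum_div_mod[where f = "\<lambda>k l. \<rho>' g $$ (i, k) * \<rho> (inv g) $$ (l, j) * unvec w $$ (k, l)"])
    also have "\<dots> = (\<Sum>l<m. (\<Sum>k<m'. \<rho>' g $$ (i, k) * unvec w $$ (k, l)) * \<rho> (inv g) $$ (l, j))"
      by (subst sum.swap) (simp add: sum_distrib_left sum_distrib_right mult_ac)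
    also have "\<dots> = (\<Sum>l<m. (\<rho>' g * unvec w) $$ (i, l) * \<rho> (inv g) $$ (l, j))"
      using index_mult_mat_sum[OF c(1) uc ij(1)] by (intro sum.cong) auto
    also have "\<dots> = act g (unvec w) $$ (i, j)"
      unfolding act_def by (rule index_mult_mat_sum[OF mult_carrier_mat[OF c(1) uc] c(2) ij, symmetric])
    finally show "unvec (Kr g *\<^sub>v w) $$ (i, j) = act g (unvec w) $$ (i, j)" .
  qed (use carrier_matD[OF actc[OF g uc[of w]]] carrier_matD[OF uc] in simp_all)
  have u_add: "unvec (v + w) = unvec v + unvec w" if "v \<in> carrier_vec N" "w \<in> carrier_vec N" for v w
    using that idx by (intro eq_matI) (auto simp: unvec_def)
  have u_smult: "unvec (c \<cdot>\<^sub>v w) = c \<cdot>\<^sub>m unvec w" if "w \<in> carrier_vec N" for c w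
    using that idx by (intro eq_matI) (auto simp: unvec_def)
  define W where "W = {w \<in> carrier_vec N. \<forall>s\<in>S. unvec w * \<rho> s = \<rho>' s * unvec w}"
  have W: "vec_subspace N W"
    unfolding vec_subspace_def
  proof (intro conjI ballI allI)
    show "W \<subseteq> carrier_vec N" by (auto simp: W_def)
    have "unvec (0\<^sub>v N) = 0\<^sub>m m' m" using idx by (intro eq_matI) (auto simp: unvec_def)
    then show "0\<^sub>v N \<in> W"
      using \<rho>c \<rho>c' S unfolding W_def
      by (auto simp: subset_iff left_mult_zero_mat[of _ m m] right_mult_zero_mat[of _ m' m'])
  next
    fix x y assume "x \<in> W" "y \<in> W"
    then have xy: "x \<in> carrier_vec N" "y \<in> carrier_vec N"
      "\<And>s. s \<in> S \<Longrightarrow> unvec x * \<rho> s = \<rho>' s * unvec x" "\<And>s. s \<in> S \<Longrightarrow> unvec y * \<rho> s = \<rho>' s * unvec y"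
      by (auto simp: W_def)
    have "unvec (x + y) * \<rho> s = \<rho>' s * unvec (x + y)" if s: "s \<in> S" for s
    proof -
      have sG: "s \<in> carrier G" using s S by auto
      show ?thesis unfolding u_add[OF xy(1,2)] add_mult_distrib_mat[OF uc uc \<rho>c[OF sG]]
          mult_add_distrib_mat[OF \<rho>c'[OF sG] uc uc] using xy(3,4)[OF s] by simp
    qed
    then show "x + y \<in> W" using xy(1,2) by (auto simp: W_def)
  next
    fix c x assume "x \<in> W"
    then have x: "x \<in> carrier_vec N" "\<And>s. s \<in> S \<Longrightarrow> unvec x * \<rho> s = \<rho>' s * unvec x" by (auto simp: W_def)
    have "unvec (c \<cdot>\<^sub>v x) * \<rho> s = \<rho>' s * unvec (c \<cdot>\<^sub>v x)" if s: "s \<in> S" for s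
    proof -
      have sG: "s \<in> carrier G" using s S by auto
      show ?thesis unfolding u_smult[OF x(1)] mult_smult_assoc_mat[OF uc \<rho>c[OF sG]]
          mult_smult_distrib[OF \<rho>c'[OF sG] uc] using x(2)[OF s] by simp
    qed
    then show "c \<cdot>\<^sub>v x \<in> W" using x(1) by (auto simp: W_def)
  qed
  have T0c: "T0 \<in> carrier_mat m' m" using intertwinesD(1)[OF T0(1)] .
  have "tovec T0 \<in> W" using T0(1) uv[OF T0c] vc unfolding W_def intertwines_def by auto
  moreover have "tovec T0 \<noteq> 0\<^sub>v N"
  proof
    assume "tovec T0 = 0\<^sub>v N"
    then have "unvec (tovec T0) = 0\<^sub>m m' m" using idx by (intro eq_matI) (auto simp: unvec_def)
    then show False using uv[OF T0c] T0(2) by simp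
  qed
  ultimately have W0: "W \<noteq> {0\<^sub>v N}" by auto
  have Wact: "w \<in> W \<longleftrightarrow> w \<in> carrier_vec N \<and> (\<forall>s\<in>S. act s (unvec w) = unvec w)" for w
    using act_fix[OF _ uc] S unfolding W_def by blast
  have Krv: "Kr g *\<^sub>v w \<in> carrier_vec N" if "w \<in> carrier_vec N" for g w
    by (rule mult_mat_vec_carrier[OF Krc that])
  have Winv: "Kr g *\<^sub>v w \<in> W" if g: "g \<in> carrier G" and w: "w \<in> W" for g w
  proof -
    have wc: "w \<in> carrier_vec N" using w Wact by blast
    have "act s (act g (unvec w)) = act g (unvec w)" if s: "s \<in> S" for s
    proof -
      have sG: "s \<in> carrier G" using s S by auto
      have e: "s \<otimes> g = g \<otimes> (inv g \<otimes> s \<otimes> g)" using g sG by (simp add: m_assoc[symmetric])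
      have "act s (act g (unvec w)) = act (s \<otimes> g) (unvec w)" by (rule act_act[OF sG g uc])
      also have "\<dots> = act g (act (inv g \<otimes> s \<otimes> g) (unvec w))"
        unfolding e using g sG uc by (intro act_act[symmetric]) auto
      also have "act (inv g \<otimes> s \<otimes> g) (unvec w) = unvec w" using norm[OF g s] w Wact by blast
      finally show ?thesis .
    qed
    then show ?thesis unfolding Wact Kr_act[OF g wc] using Krv[OF wc] by blast
  qed
  have Wcomm: "Kr g *\<^sub>v (Kr h *\<^sub>v w) = Kr h *\<^sub>v (Kr g *\<^sub>v w)"
    if g: "g \<in> carrier G" and h: "h \<in> carrier G" and w: "w \<in> W" for g h w
  proof -
    have wc: "w \<in> carrier_vec N" using w Wact by blast
    have 1: "unvec (Kr x *\<^sub>v (Kr y *\<^sub>v w)) = act (x \<otimes> y) (unvec w)" if "x \<in> carrier G" "y \<in> carrier G" for x y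
      using Kr_act[OF that(1) Krv[OF wc]] Kr_act[OF that(2) wc] act_act[OF that uc] by simp
    have e: "g \<otimes> h = (h \<otimes> g) \<otimes> (inv (h \<otimes> g) \<otimes> (g \<otimes> h))" using g h by (simp add: m_assoc[symmetric])
    have "act (g \<otimes> h) (unvec w) = act ((h \<otimes> g) \<otimes> (inv (h \<otimes> g) \<otimes> (g \<otimes> h))) (unvec w)" using e by simp
    also have "\<dots> = act (h \<otimes> g) (act (inv (h \<otimes> g) \<otimes> (g \<otimes> h)) (unvec w))"
      using g h by (intro act_act[symmetric] uc) auto
    also have "act (inv (h \<otimes> g) \<otimes> (g \<otimes> h)) (unvec w) = unvec w" using ab[OF g h] w Wact by blast
    finally have u: "unvec (Kr g *\<^sub>v (Kr h *\<^sub>v w)) = unvec (Kr h *\<^sub>v (Kr g *\<^sub>v w))" using 1 g h by simp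
    have "(Kr g *\<^sub>v (Kr h *\<^sub>v w)) $ y = (Kr h *\<^sub>v (Kr g *\<^sub>v w)) $ y" if y: "y < N" for y
    proof -
      have b: "y div m < m'" "y mod m < m" using div_mod_less_mult y unfolding N_def by blast+
      have "unvec (Kr g *\<^sub>v (Kr h *\<^sub>v w)) $$ (y div m, y mod m) = unvec (Kr h *\<^sub>v (Kr g *\<^sub>v w)) $$ (y div m, y mod m)"
        unfolding u ..
      then show ?thesis using b by (simp add: unvec_def)
    qed
    then show ?thesis using Krv[OF Krv[OF wc]] Krc by (intro eq_vecI) (auto simp: Kr_def)
  qed
  obtain w \<chi> where w: "w \<in> W" "w \<noteq> 0\<^sub>v N" and ev: "\<forall>g\<in>carrier G. Kr g *\<^sub>v w = \<chi> g \<cdot>\<^sub>v w"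
    by (rule common_eigenvector[OF Krc W W0 Winv Wcomm])
  have wc: "w \<in> carrier_vec N" using w Wact by blast
  have "\<rho>' g * unvec w = \<chi> g \<cdot>\<^sub>m (unvec w * \<rho> g)" if g: "g \<in> carrier G" for g
  proof -
    note c = \<rho>c'[OF g] \<rho>c[OF g] \<rho>c[OF inv_closed[OF g]] uc
    have "\<rho>' g * unvec w = \<rho>' g * unvec w * (\<rho> (inv g) * \<rho> g)"
      unfolding mat_rep_inv[OF \<rho> g] by (rule right_mult_one_mat[OF mult_carrier_mat[OF c(1,4)], symmetric])
    also have "\<dots> = act g (unvec w) * \<rho> g"
      unfolding act_def by (rule assoc_mult_mat[OF mult_carrier_mat[OF c(1,4)] c(3,2), symmetric])
    also have "act g (unvec w) = \<chi> g \<cdot>\<^sub>m unvec w" using Kr_act[OF g wc] ev g u_smult[OF wc] by simp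
    also have "\<dots> * \<rho> g = \<chi> g \<cdot>\<^sub>m (unvec w * \<rho> g)" by (rule mult_smult_assoc_mat[OF c(4,2)])
    finally show ?thesis .
  qed
  moreover have "unvec w \<noteq> 0\<^sub>m m' m" using u_inj[OF wc] w(2) by blast
  moreover have "intertwines S m m' \<rho> \<rho>' (unvec w)" using w(1) uc unfolding W_def intertwines_def by auto
  ultimately show thesis by (intro that[of "unvec w" \<chi>]) auto
qed

section \<open>Clifford theory\<close>

text \<open>An irreducible representation is spanned by the orbit of any nonzero vector.\<close>

lemma (in group) irreducible_cyclic:
  assumes \<rho>: "mat_rep G d \<rho>" and irr: "mat_irreducible (carrier G) d \<rho>"
    and x: "x \<in> carrier_vec d" "x \<noteq> 0\<^sub>v d"
    and V: "vec_subspace d V" "\<And>g. g \<in> carrier G \<Longrightarrow> \<rho> g *\<^sub>v x \<in> V"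
  shows "V = carrier_vec d"
proof -
  note \<rho>c = mat_repD(1)[OF \<rho>]
  define P where "P = (\<lambda>V. vec_subspace d V \<and> (\<forall>g\<in>carrier G. \<rho> g *\<^sub>v x \<in> V))"
  define W where "W = {w \<in> carrier_vec d. \<forall>V. P V \<longrightarrow> w \<in> V}"
  have W: "vec_subspace d W"
    unfolding vec_subspace_def W_def P_def by auto
  have "x \<in> W"
  proof -
    have "x \<in> V" if "P V" for V
    proof -
      have "\<rho> \<one> *\<^sub>v x \<in> V" using that unfolding P_def by blast
      then show ?thesis using mat_repD(2)[OF \<rho>] x by simp
    qed
    then show ?thesis using x unfolding W_def by auto
  qed
  have "W = carrier_vec d"
    using W
  proof (rule mat_irreducibleD(3)[OF irr])
    show "W \<noteq> {0\<^sub>v d}" using \<open>x \<in> W\<close> x by auto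
    fix h w assume h: "h \<in> carrier G" and w: "w \<in> W"
    then have wc: "w \<in> carrier_vec d" by (auto simp: W_def)
    have "\<rho> h *\<^sub>v w \<in> V" if V: "P V" for V
    proof -
      define V' where "V' = {y \<in> carrier_vec d. \<rho> h *\<^sub>v y \<in> V}"
      have z: "\<rho> h *\<^sub>v 0\<^sub>v d = 0\<^sub>v d" using \<rho>c[OF h] by (intro eq_vecI) auto
      have "vec_subspace d V'"
        using V unfolding vec_subspace_def V'_def P_def
        by (auto simp: z mult_add_distrib_mat_vec[OF \<rho>c[OF h]] mult_mat_vec[OF \<rho>c[OF h]])
      moreover have "\<rho> g *\<^sub>v x \<in> V'" if g: "g \<in> carrier G" for g
      proof -
        have "\<rho> h *\<^sub>v (\<rho> g *\<^sub>v x) = \<rho> (h \<otimes> g) *\<^sub>v x"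
          using mat_repD(3)[OF \<rho> h g] \<rho>c[OF h] \<rho>c[OF g] x by simp
        moreover have "\<rho> (h \<otimes> g) *\<^sub>v x \<in> V" using V g h unfolding P_def by auto
        moreover have "\<rho> g *\<^sub>v x \<in> carrier_vec d" using \<rho>c[OF g] x by simp
        ultimately show ?thesis unfolding V'_def by simp
      qed
      ultimately have "P V'" unfolding P_def by blast
      then show ?thesis using w unfolding W_def V'_def by blast
    qed
    then show "\<rho> h *\<^sub>v w \<in> W" using \<rho>c[OF h] wc unfolding W_def by auto
  qed
  moreover have "W \<subseteq> V" using V unfolding W_def P_def by blast
  ultimately show ?thesis using V(1) unfolding vec_subspace_def by auto
qed

text \<open>If \<open>S\<close> and the centre generate a subgroup of finite index, then \<open>G\<close> moves the image of an
  \<open>S\<close>-intertwiner only to its \<open>e\<close> translates under the \<open>\<gamma> i\<close>, as the centre acts by scalars.\<close>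

lemma (in group) irreducible_orbit_in:
  assumes \<rho>: "mat_rep G m \<rho>" and irr: "mat_irreducible (carrier G) m \<rho>" and S: "S \<subseteq> carrier G"
    and gc: "\<And>i. i < e \<Longrightarrow> \<gamma> i \<in> carrier G"
    and dec: "\<And>g. g \<in> carrier G \<Longrightarrow> \<exists>i<e. \<exists>z\<in>carrier G. \<exists>s\<in>S. g = \<gamma> i \<otimes> z \<otimes> s \<and> (\<forall>h\<in>carrier G. z \<otimes> h = h \<otimes> z)"
    and \<sigma>: "\<And>s. s \<in> S \<Longrightarrow> \<sigma> s \<in> carrier_mat d d" and T: "intertwines S d m \<sigma> \<rho> T"
    and y: "y \<in> carrier_vec d" and g: "g \<in> carrier G"
  shows "\<exists>i<e. \<exists>y'\<in>carrier_vec d. \<rho> g *\<^sub>v (T *\<^sub>v y) = \<rho> (\<gamma> i) *\<^sub>v (T *\<^sub>v y')"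
proof -
  note \<rho>c = mat_repD(1)[OF \<rho>] and Tc = intertwinesD(1)[OF T]
  obtain i z s where i: "i < e" and z: "z \<in> carrier G" and s: "s \<in> S" and gi: "g = \<gamma> i \<otimes> z \<otimes> s"
    and cent: "\<forall>h\<in>carrier G. z \<otimes> h = h \<otimes> z" using dec[OF g] by blast
  have sG: "s \<in> carrier G" using s S by auto
  obtain c where c: "\<rho> z = c \<cdot>\<^sub>m 1\<^sub>m m"
  proof (rule schur_scalar[OF irr \<rho>c[OF z]])
    fix h assume h: "h \<in> carrier G"
    show "\<rho> z * \<rho> h = \<rho> h * \<rho> z"
      using mat_repD(3)[OF \<rho> z h] mat_repD(3)[OF \<rho> h z] cent h by simp
  qed
  define y' where "y' = c \<cdot>\<^sub>v (\<sigma> s *\<^sub>v y)"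
  have sy: "\<sigma> s *\<^sub>v y \<in> carrier_vec d" using \<sigma>[OF s] y by simp
  have y': "y' \<in> carrier_vec d" using sy by (simp add: y'_def)
  have Tsy: "T *\<^sub>v (\<sigma> s *\<^sub>v y) \<in> carrier_vec m" using Tc sy by simp
  have "\<rho> g *\<^sub>v (T *\<^sub>v y) = (\<rho> (\<gamma> i) * \<rho> z * \<rho> s) *\<^sub>v (T *\<^sub>v y)"
    unfolding gi using mat_repD(3)[OF \<rho>] gc[OF i] z sG by simp
  also have "\<dots> = \<rho> (\<gamma> i) *\<^sub>v (\<rho> z *\<^sub>v (\<rho> s *\<^sub>v (T *\<^sub>v y)))"
    using \<rho>c[OF gc[OF i]] \<rho>c[OF z] \<rho>c[OF sG] Tc y
    by (simp add: assoc_mult_mat_vec[of _ m m _ m])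
  also have "\<rho> s *\<^sub>v (T *\<^sub>v y) = T *\<^sub>v (\<sigma> s *\<^sub>v y)"
    using intertwinesD(2)[OF T s] assoc_mult_mat_vec[OF Tc \<sigma>[OF s] y] assoc_mult_mat_vec[OF \<rho>c[OF sG] Tc y] by simp
  also have "\<rho> z *\<^sub>v (T *\<^sub>v (\<sigma> s *\<^sub>v y)) = c \<cdot>\<^sub>v (T *\<^sub>v (\<sigma> s *\<^sub>v y))" unfolding c by (rule scalar_mat_mult_vec[OF Tsy])
  also have "\<dots> = T *\<^sub>v y'" unfolding y'_def using mult_mat_vec[OF Tc sy] by simp
  finally show ?thesis using i y' by blast
qed

text \<open>The \<open>e\<close> translates of one constituent span the whole space.\<close>

lemma (in group) constituent_dim_bound:
  assumes \<rho>: "mat_rep G m \<rho>" and irr: "mat_irreducible (carrier G) m \<rho>" and S: "S \<subseteq> carrier G"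
    and gc: "\<And>i. i < e \<Longrightarrow> \<gamma> i \<in> carrier G"
    and dec: "\<And>g. g \<in> carrier G \<Longrightarrow> \<exists>i<e. \<exists>z\<in>carrier G. \<exists>s\<in>S. g = \<gamma> i \<otimes> z \<otimes> s \<and> (\<forall>h\<in>carrier G. z \<otimes> h = h \<otimes> z)"
    and \<sigma>: "\<And>s. s \<in> S \<Longrightarrow> \<sigma> s \<in> carrier_mat d d" and T: "intertwines S d m \<sigma> \<rho> T" and nz: "T \<noteq> 0\<^sub>m m d"
  shows "m \<le> e * d"
proof -
  note \<rho>c = mat_repD(1)[OF \<rho>] and Tc = intertwinesD(1)[OF T]
  obtain y where y: "y \<in> carrier_vec d" "T *\<^sub>v y \<noteq> 0\<^sub>v m" by (rule nonzero_mat_mult_vec[OF Tc nz])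
  define Q where "Q = Matrix.mat m (e * d) (\<lambda>(a, y). (\<rho> (\<gamma> (y div d)) * T) $$ (a, y mod d))"
  have Q: "Q \<in> carrier_mat m (e * d)" by (simp add: Q_def)
  have "\<rho> g *\<^sub>v (T *\<^sub>v y) \<in> {Q *\<^sub>v x | x. x \<in> carrier_vec (e * d)}" if g: "g \<in> carrier G" for g
  proof -
    obtain i y' where i: "i < e" and y': "y' \<in> carrier_vec d" and eq: "\<rho> g *\<^sub>v (T *\<^sub>v y) = \<rho> (\<gamma> i) *\<^sub>v (T *\<^sub>v y')"
      using irreducible_orbit_in[OF \<rho> irr S gc dec \<sigma> T y(1) g] by blast
    define x where "x = vec (e * d) (\<lambda>k. if k div d = i then y' $ (k mod d) else 0)"
    have x: "x \<in> carrier_vec (e * d)" by (simp add: x_def)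
    have gT: "\<rho> (\<gamma> j) * T \<in> carrier_mat m d" if "j < e" for j using \<rho>c[OF gc[OF that]] Tc by simp
    have "Q *\<^sub>v x = (\<rho> (\<gamma> i) * T) *\<^sub>v y'"
    proof (rule eq_vecI)
      fix a assume "a < dim_vec ((\<rho> (\<gamma> i) * T) *\<^sub>v y')"
      then have a: "a < m" using carrier_matD[OF gT[OF i]] by simp
      have "(Q *\<^sub>v x) $ a = (\<Sum>k<e * d. Q $$ (a, k) * x $ k)"
        using a carrier_matD[OF Q] carrier_vecD[OF x] by (simp add: scalar_prod_def lessThan_atLeast0)
      also have "\<dots> = (\<Sum>k<e * d. (\<rho> (\<gamma> (k div d)) * T) $$ (a, k mod d) * (if k div d = i then y' $ (k mod d) else 0))"
        using a by (intro sum.cong refl) (simp add: Q_def x_def)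
      also have "\<dots> = (\<Sum>j<e. \<Sum>l<d. (\<rho> (\<gamma> j) * T) $$ (a, l) * (if j = i then y' $ l else 0))"
        by (rule sum_div_mod[where f = "\<lambda>j l. (\<rho> (\<gamma> j) * T) $$ (a, l) * (if j = i then y' $ l else 0)"])
      also have "\<dots> = (\<Sum>j<e. if j = i then \<Sum>l<d. (\<rho> (\<gamma> i) * T) $$ (a, l) * y' $ l else 0)"
        by (intro sum.cong refl) auto
      also have "\<dots> = (\<Sum>l<d. (\<rho> (\<gamma> i) * T) $$ (a, l) * y' $ l)" using i by simp
      also have "\<dots> = ((\<rho> (\<gamma> i) * T) *\<^sub>v y') $ a"
        using a carrier_matD[OF gT[OF i]] carrier_vecD[OF y'] by (simp add: scalar_prod_def lessThan_atLeast0)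
      finally show "(Q *\<^sub>v x) $ a = ((\<rho> (\<gamma> i) * T) *\<^sub>v y') $ a" .
    qed (use carrier_matD[OF gT[OF i]] carrier_matD[OF Q] in simp)
    also have "\<dots> = \<rho> (\<gamma> i) *\<^sub>v (T *\<^sub>v y')" by (rule assoc_mult_mat_vec[OF \<rho>c[OF gc[OF i]] Tc y'])
    finally have "\<rho> g *\<^sub>v (T *\<^sub>v y) = Q *\<^sub>v x" using eq by simp
    then show ?thesis using x by blast
  qed
  then have "{Q *\<^sub>v x | x. x \<in> carrier_vec (e * d)} = carrier_vec m"
    using Tc y by (intro irreducible_cyclic[OF \<rho> irr _ y(2) vec_subspace_range[OF Q]]) auto
  then have "\<exists>x\<in>carrier_vec (e * d). Q *\<^sub>v x = z" if "z \<in> carrier_vec m" for z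
  proof -
    have "z \<in> {Q *\<^sub>v x | x. x \<in> carrier_vec (e * d)}"
      using \<open>{Q *\<^sub>v x | x. x \<in> carrier_vec (e * d)} = carrier_vec m\<close> that by blast
    then show ?thesis by auto
  qed
  then obtain P where P: "P \<in> carrier_mat (e * d) m" "Q * P = 1\<^sub>m m"
    using surjective_mat_right_inverse[OF Q] by metis
  show ?thesis by (rule left_inverse_dim_le[OF P(1) Q P(2)])
qed

text \<open>If \<open>A\<close> vanished on every translate of the constituent \<open>\<sigma>0\<close>, it would vanish on their span, the whole space.\<close>

lemma (in group) constituents_conjugate:
  assumes \<rho>: "mat_rep G m \<rho>" and irr: "mat_irreducible (carrier G) m \<rho>" and S: "subgroup S G"
    and norm: "\<And>g s. g \<in> carrier G \<Longrightarrow> s \<in> S \<Longrightarrow> inv g \<otimes> s \<otimes> g \<in> S"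
    and gc: "\<And>i. i < e \<Longrightarrow> \<gamma> i \<in> carrier G"
    and dec: "\<And>g. g \<in> carrier G \<Longrightarrow> \<exists>i<e. \<exists>z\<in>carrier G. \<exists>s\<in>S. g = \<gamma> i \<otimes> z \<otimes> s \<and> (\<forall>h\<in>carrier G. z \<otimes> h = h \<otimes> z)"
    and \<sigma>0: "\<And>s. s \<in> S \<Longrightarrow> \<sigma>0 s \<in> carrier_mat d0 d0" and T0: "intertwines S d0 m \<sigma>0 \<rho> T0" "T0 \<noteq> 0\<^sub>m m d0"
    and \<sigma>: "\<And>s. s \<in> S \<Longrightarrow> \<sigma> s \<in> carrier_mat d d" and A: "intertwines S m d \<rho> \<sigma> A" "A \<noteq> 0\<^sub>m d m"
  shows "\<exists>i<e. \<exists>B. B \<noteq> 0\<^sub>m d d0 \<and> intertwines S d0 d (\<lambda>s. \<sigma>0 (inv (\<gamma> i) \<otimes> s \<otimes> \<gamma> i)) \<sigma> B"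
proof -
  note \<rho>c = mat_repD(1)[OF \<rho>] and Tc = intertwinesD(1)[OF T0(1)] and Ac = intertwinesD(1)[OF A(1)]
  have SG: "S \<subseteq> carrier G" using S by (rule subgroup.subset)
  obtain y where y: "y \<in> carrier_vec d0" "T0 *\<^sub>v y \<noteq> 0\<^sub>v m" by (rule nonzero_mat_mult_vec[OF Tc T0(2)])
  have "\<exists>i<e. A * (\<rho> (\<gamma> i) * T0) \<noteq> 0\<^sub>m d d0"
  proof (rule ccontr)
    assume a: "\<not> ?thesis"
    have "\<rho> g *\<^sub>v (T0 *\<^sub>v y) \<in> {x \<in> carrier_vec m. A *\<^sub>v x = 0\<^sub>v d}" if g: "g \<in> carrier G" for g
    proof -
      obtain i y' where i: "i < e" and y': "y' \<in> carrier_vec d0"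
        and eq: "\<rho> g *\<^sub>v (T0 *\<^sub>v y) = \<rho> (\<gamma> i) *\<^sub>v (T0 *\<^sub>v y')"
        using irreducible_orbit_in[OF \<rho> irr SG gc dec \<sigma>0 T0(1) y(1) g] by blast
      note c = \<rho>c[OF gc[OF i]]
      have "A *\<^sub>v (\<rho> (\<gamma> i) *\<^sub>v (T0 *\<^sub>v y')) = A *\<^sub>v ((\<rho> (\<gamma> i) * T0) *\<^sub>v y')"
        using assoc_mult_mat_vec[OF c Tc y'] by simp
      also have "\<dots> = (A * (\<rho> (\<gamma> i) * T0)) *\<^sub>v y'"
        by (rule assoc_mult_mat_vec[OF Ac mult_carrier_mat[OF c Tc] y', symmetric])
      also have "\<dots> = 0\<^sub>m d d0 *\<^sub>v y'" using a i by simp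
      also have "\<dots> = 0\<^sub>v d" using y' by (intro eq_vecI) auto
      finally show ?thesis using eq c Tc y' by simp
    qed
    then have "{x \<in> carrier_vec m. A *\<^sub>v x = 0\<^sub>v d} = carrier_vec m"
      using Tc y by (intro irreducible_cyclic[OF \<rho> irr _ y(2) vec_subspace_kernel[OF Ac]]) auto
    moreover obtain x where "x \<in> carrier_vec m" "A *\<^sub>v x \<noteq> 0\<^sub>v d" by (rule nonzero_mat_mult_vec[OF Ac A(2)])
    ultimately show False by blast
  qed
  then obtain i where i: "i < e" and nz: "A * (\<rho> (\<gamma> i) * T0) \<noteq> 0\<^sub>m d d0" by blast
  define B where "B = A * (\<rho> (\<gamma> i) * T0)"
  note c = \<rho>c[OF gc[OF i]]
  have gT: "\<rho> (\<gamma> i) * T0 \<in> carrier_mat m d0" using c Tc by simp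
  have "B * \<sigma>0 (inv (\<gamma> i) \<otimes> s \<otimes> \<gamma> i) = \<sigma> s * B" if s: "s \<in> S" for s
  proof -
    define t where "t = inv (\<gamma> i) \<otimes> s \<otimes> \<gamma> i"
    have t: "t \<in> S" unfolding t_def using norm[OF gc[OF i] s] .
    have tG: "t \<in> carrier G" "s \<in> carrier G" using t s SG by auto
    have "\<gamma> i \<otimes> t = s \<otimes> \<gamma> i" unfolding t_def using gc[OF i] tG by (simp add: m_assoc[symmetric])
    then have e: "\<rho> (\<gamma> i) * \<rho> t = \<rho> s * \<rho> (\<gamma> i)"
      using mat_repD(3)[OF \<rho> gc[OF i] tG(1)] mat_repD(3)[OF \<rho> tG(2) gc[OF i]] by simp
    have "B * \<sigma>0 t = A * (\<rho> (\<gamma> i) * T0 * \<sigma>0 t)" unfolding B_def by (rule assoc_mult_mat[OF Ac gT \<sigma>0[OF t]])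
    also have "\<rho> (\<gamma> i) * T0 * \<sigma>0 t = \<rho> (\<gamma> i) * (T0 * \<sigma>0 t)" by (rule assoc_mult_mat[OF c Tc \<sigma>0[OF t]])
    also have "T0 * \<sigma>0 t = \<rho> t * T0" by (rule intertwinesD(2)[OF T0(1) t])
    also have "\<rho> (\<gamma> i) * (\<rho> t * T0) = \<rho> (\<gamma> i) * \<rho> t * T0" by (rule assoc_mult_mat[OF c \<rho>c[OF tG(1)] Tc, symmetric])
    also have "\<dots> = \<rho> s * (\<rho> (\<gamma> i) * T0)" unfolding e by (rule assoc_mult_mat[OF \<rho>c[OF tG(2)] c Tc])
    also have "A * (\<rho> s * (\<rho> (\<gamma> i) * T0)) = A * \<rho> s * (\<rho> (\<gamma> i) * T0)"
      by (rule assoc_mult_mat[OF Ac \<rho>c[OF tG(2)] gT, symmetric])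
    also have "A * \<rho> s = \<sigma> s * A" by (rule intertwinesD(2)[OF A(1) s])
    also have "\<sigma> s * A * (\<rho> (\<gamma> i) * T0) = \<sigma> s * B" unfolding B_def by (rule assoc_mult_mat[OF \<sigma>[OF s] Ac gT])
    finally show ?thesis unfolding t_def .
  qed
  moreover have "B \<in> carrier_mat d d0" unfolding B_def using Ac gT by simp
  ultimately show ?thesis using i nz unfolding intertwines_def B_def by blast
qed

section \<open>Groups with a subgroup of finite index modulo the centre\<close>

text \<open>The regular representation of \<open>G / K\<close> maps nontrivially to \<open>\<sigma>\<close>; an irreducible subquotient still does.\<close>

lemma (in group) irreducible_over_subgroup:
  assumes K: "K \<lhd> G" and fin: "finite (lcosets_of G K)" and H: "subgroup H G"
    and \<sigma>: "mat_rep (G\<lparr>carrier := H\<rparr>) e \<sigma>" and e: "e > 0" and triv: "\<And>k. k \<in> H \<Longrightarrow> k \<in> K \<Longrightarrow> \<sigma> k = 1\<^sub>m e"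
  obtains r \<tau> T where "mat_rep G r \<tau>" "mat_irreducible (carrier G) r \<tau>" "\<forall>k\<in>K. \<tau> k = 1\<^sub>m r"
    "intertwines H r e \<tau> \<sigma> T" "T \<noteq> 0\<^sub>m e r"
proof -
  define M where "M = card (lcosets_of G K)"
  have KG: "K \<subseteq> carrier G" using K by (meson normal_imp_subgroup subgroup.subset)
  obtain R where R: "mat_rep G M R" and RK: "\<forall>k\<in>K. R k = 1\<^sub>m M"
    and uni: "\<forall>H e \<sigma>. subgroup H G \<longrightarrow> e > 0 \<longrightarrow> mat_rep (G\<lparr>carrier := H\<rparr>) e \<sigma> \<longrightarrow> (\<forall>k\<in>H \<inter> K. \<sigma> k = 1\<^sub>m e) \<longrightarrow>
       (\<exists>T. intertwines H M e R \<sigma> T \<and> T \<noteq> 0\<^sub>m e M)"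
    unfolding M_def by (rule regular_rep[OF K fin])
  obtain T where T: "intertwines H M e R \<sigma> T" "T \<noteq> 0\<^sub>m e M"
    using uni H e \<sigma> triv by blast
  have HG: "H \<subseteq> carrier G" using H by (rule subgroup.subset)
  have \<sigma>c: "\<And>g. g \<in> H \<Longrightarrow> \<sigma> g \<in> carrier_mat e e" using mat_repD(1)[OF \<sigma>] by simp
  obtain r \<tau> T' where irr: "mat_irreducible (carrier G) r \<tau>" and T': "intertwines H r e \<tau> \<sigma> T'" "T' \<noteq> 0\<^sub>m e r"
    and one: "\<forall>g\<in>carrier G. R g = 1\<^sub>m M \<longrightarrow> \<tau> g = 1\<^sub>m r"
    and mult: "\<forall>g\<in>carrier G. \<forall>h\<in>carrier G. \<forall>k\<in>carrier G. R k = R g * R h \<longrightarrow> \<tau> k = \<tau> g * \<tau> h"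
    by (rule irreducible_subquotient[OF mat_repD(1)[OF R] \<sigma>c HG T])
  have "mat_rep G r \<tau>"
    unfolding mat_rep_def
  proof (intro conjI ballI)
    show "\<tau> \<one> = 1\<^sub>m r" using one mat_repD(2)[OF R] by simp
    fix g h assume gh: "g \<in> carrier G" "h \<in> carrier G"
    then show "\<tau> (g \<otimes> h) = \<tau> g * \<tau> h"
      by (intro mult[rule_format] mat_repD(3)[OF R]) auto
  qed (use mat_irreducibleD(2)[OF irr] in blast)
  moreover have "\<forall>k\<in>K. \<tau> k = 1\<^sub>m r" using one RK KG by auto
  ultimately show thesis using irr T' by (intro that)
qed

lemma irreducible_representation_iff:
  assumes "\<And>d \<rho>. representation G T d \<rho> \<Longrightarrow> mat_rep G d \<rho>"
  shows "irreducible_representation G T d \<rho> \<longleftrightarrow> representation G T d \<rho> \<and> mat_irreducible (carrier G) d \<rho>"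
  unfolding irreducible_representation_def mat_irreducible_def subspace_module_vec_iff
  using assms[of d \<rho>] by (auto simp: mat_rep_def)

lemma twist_intertwiner:
  assumes T: "T \<in> carrier_mat e d" and \<rho>: "\<And>g. g \<in> U \<Longrightarrow> \<rho> g \<in> carrier_mat d d"
    and eq: "\<And>g. g \<in> U \<Longrightarrow> \<sigma> g * T = \<chi> g \<cdot>\<^sub>m (T * \<rho> g)"
  shows "intertwines U d e (\<lambda>g. \<chi> g \<cdot>\<^sub>m \<rho> g) \<sigma> T"
  unfolding intertwines_def using eq mult_smult_distrib[OF T \<rho>] T by auto

lemma mat_irreducible_smult:
  assumes \<rho>: "mat_irreducible U d \<rho>" and \<chi>: "\<And>g. g \<in> U \<Longrightarrow> \<chi> g \<noteq> 0"
  shows "mat_irreducible U d (\<lambda>g. \<chi> g \<cdot>\<^sub>m \<rho> g)"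
proof -
  note c = mat_irreducibleD(2)[OF \<rho>]
  show ?thesis
    unfolding mat_irreducible_def
  proof (intro conjI ballI allI impI)
    show "0 < d" using mat_irreducibleD(1)[OF \<rho>] .
    show "\<chi> g \<cdot>\<^sub>m \<rho> g \<in> carrier_mat d d" if "g \<in> U" for g using c[OF that] by simp
    fix W assume a: "vec_subspace d W \<and> (\<forall>g\<in>U. \<forall>w\<in>W. (\<chi> g \<cdot>\<^sub>m \<rho> g) *\<^sub>v w \<in> W)"
    then have W: "vec_subspace d W" by blast
    have "\<rho> g *\<^sub>v w \<in> W" if g: "g \<in> U" and w: "w \<in> W" for g w
    proof -
      have wc: "w \<in> carrier_vec d" using w W unfolding vec_subspace_def by auto
      have "(1 / \<chi> g) \<cdot>\<^sub>v ((\<chi> g \<cdot>\<^sub>m \<rho> g) *\<^sub>v w) \<in> W" using a g w W unfolding vec_subspace_def by blast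
      moreover have "(1 / \<chi> g) \<cdot>\<^sub>v ((\<chi> g \<cdot>\<^sub>m \<rho> g) *\<^sub>v w) = \<rho> g *\<^sub>v w"
        using c[OF g] wc \<chi>[OF g]
        by (intro eq_vecI) (auto simp: scalar_prod_def sum_distrib_left intro!: sum.cong)
      ultimately show ?thesis by simp
    qed
    then show "W = {0\<^sub>v d} \<or> W = carrier_vec d" using mat_irreducibleD(3)[OF \<rho> W] by blast
  qed
qed

lemma mat_rep_smult:
  assumes \<rho>: "mat_rep G d \<rho>" and \<chi>: "\<chi> \<one>\<^bsub>G\<^esub> = 1"
    "\<And>g h. g \<in> carrier G \<Longrightarrow> h \<in> carrier G \<Longrightarrow> \<chi> (g \<otimes>\<^bsub>G\<^esub> h) = \<chi> g * \<chi> h"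
  shows "mat_rep G d (\<lambda>g. \<chi> g \<cdot>\<^sub>m \<rho> g)"
  unfolding mat_rep_def
proof (intro conjI ballI)
  note c = mat_repD(1)[OF \<rho>]
  show "\<chi> g \<cdot>\<^sub>m \<rho> g \<in> carrier_mat d d" if "g \<in> carrier G" for g using c[OF that] by simp
  show "\<chi> \<one>\<^bsub>G\<^esub> \<cdot>\<^sub>m \<rho> \<one>\<^bsub>G\<^esub> = 1\<^sub>m d" using mat_repD(2)[OF \<rho>] \<chi>(1) by (simp add: one_smult_mat)
  fix g h assume gh: "g \<in> carrier G" "h \<in> carrier G"
  note cg = c[OF gh(1)] and ch = c[OF gh(2)]
  have "\<chi> g \<cdot>\<^sub>m \<rho> g * (\<chi> h \<cdot>\<^sub>m \<rho> h) = \<chi> g \<cdot>\<^sub>m (\<rho> g * (\<chi> h \<cdot>\<^sub>m \<rho> h))"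
    by (rule mult_smult_assoc_mat[OF cg smult_carrier_mat[OF ch]])
  also have "\<rho> g * (\<chi> h \<cdot>\<^sub>m \<rho> h) = \<chi> h \<cdot>\<^sub>m (\<rho> g * \<rho> h)" by (rule mult_smult_distrib[OF cg ch])
  finally show "\<chi> (g \<otimes>\<^bsub>G\<^esub> h) \<cdot>\<^sub>m \<rho> (g \<otimes>\<^bsub>G\<^esub> h) = \<chi> g \<cdot>\<^sub>m \<rho> g * (\<chi> h \<cdot>\<^sub>m \<rho> h)"
    using mat_repD(3)[OF \<rho> gh] \<chi>(2)[OF gh] by (simp add: smult_smult_mat)
qed

text \<open>The abstract situation of the general and the special linear group.  The normal subgroups \<open>K l\<close> are the
  congruence subgroups, and continuity means being trivial on one of them.  The subgroup \<open>S\<close> contains all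
  commutators; together with the centre of \<open>G\<close> it generates a subgroup of finite index, of which
  \<open>\<gamma> 0, \<dots>, \<gamma> (e - 1)\<close> meet all cosets; and only finitely many functions on \<open>S\<close> are restrictions of continuous
  characters of \<open>G\<close>.\<close>

locale twist_setting = group G for G :: "('g, 'b) monoid_scheme" (structure) +
  fixes TG :: "'g topology" and S :: "'g set" and TS :: "'g topology" and K :: "nat \<Rightarrow> 'g set"
    and \<gamma> :: "nat \<Rightarrow> 'g" and e :: nat
  assumes rep_G_iff: "\<And>d \<rho>. representation G TG d \<rho> \<longleftrightarrow> mat_rep G d \<rho> \<and> (\<exists>l. \<forall>k\<in>K l. \<rho> k = 1\<^sub>m d)"
    and rep_S_iff: "\<And>d \<rho>. representation (G\<lparr>carrier := S\<rparr>) TS d \<rho> \<longleftrightarrow>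
          mat_rep (G\<lparr>carrier := S\<rparr>) d \<rho> \<and> (\<exists>l. \<forall>k\<in>S \<inter> K l. \<rho> k = 1\<^sub>m d)"
    and K_normal: "\<And>l. K l \<lhd> G" and K_finite: "\<And>l. finite (lcosets_of G (K l))"
    and K_antimono: "\<And>l m. l \<le> m \<Longrightarrow> K m \<subseteq> K l"
    and S_subgroup: "subgroup S G"
    and S_comm: "\<And>g h. g \<in> carrier G \<Longrightarrow> h \<in> carrier G \<Longrightarrow> inv (h \<otimes> g) \<otimes> (g \<otimes> h) \<in> S"
    and \<gamma>: "\<And>i. i < e \<Longrightarrow> \<gamma> i \<in> carrier G"
    and decomp: "\<And>g. g \<in> carrier G \<Longrightarrow> \<exists>i<e. \<exists>z\<in>carrier G. \<exists>s\<in>S. g = \<gamma> i \<otimes> z \<otimes> s \<and> (\<forall>h\<in>carrier G. z \<otimes> h = h \<otimes> z)"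
    and finite_chars: "finite ((\<lambda>\<psi>. restrict (\<lambda>g. \<psi> g $$ (0, 0)) S) ` {\<psi>. representation G TG 1 \<psi>})"
begin

abbreviation "SG \<equiv> G\<lparr>carrier := S\<rparr>"

lemma S_subset: "S \<subseteq> carrier G" using S_subgroup by (rule subgroup.subset)

lemma S_group: "group SG" using S_subgroup by (rule subgroup_imp_group)

lemma S_normal: "g \<in> carrier G \<Longrightarrow> s \<in> S \<Longrightarrow> inv g \<otimes> s \<otimes> g \<in> S"
proof -
  assume g: "g \<in> carrier G" and s: "s \<in> S"
  have sG: "s \<in> carrier G" using s S_subset by auto
  have "inv (g \<otimes> (inv g \<otimes> s)) \<otimes> ((inv g \<otimes> s) \<otimes> g) \<in> S" using g sG by (intro S_comm) auto
  then have "inv s \<otimes> (inv g \<otimes> s \<otimes> g) \<in> S" using g sG by (simp add: m_assoc[symmetric])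
  then have "s \<otimes> (inv s \<otimes> (inv g \<otimes> s \<otimes> g)) \<in> S" by (rule subgroup.m_closed[OF S_subgroup s])
  then show ?thesis using g sG by (simp add: m_assoc[symmetric])
qed

lemma irreps_G_iff: "\<rho> \<in> irreps G TG d \<longleftrightarrow>
    mat_rep G d \<rho> \<and> (\<exists>l. \<forall>k\<in>K l. \<rho> k = 1\<^sub>m d) \<and> mat_irreducible (carrier G) d \<rho>"
  unfolding irreps_def using irreducible_representation_iff[of G TG] rep_G_iff by auto

lemma irreps_S_iff: "\<rho> \<in> irreps SG TS d \<longleftrightarrow>
    mat_rep SG d \<rho> \<and> (\<exists>l. \<forall>k\<in>S \<inter> K l. \<rho> k = 1\<^sub>m d) \<and> mat_irreducible S d \<rho>"
  unfolding irreps_def using irreducible_representation_iff[of SG TS] rep_S_iff by auto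

lemma finite_image_S:
  assumes "mat_rep SG d \<sigma>" "\<forall>k\<in>S \<inter> K l. \<sigma> k = 1\<^sub>m d"
  shows "finite (\<sigma> ` S)"
proof -
  have Ks: "subgroup (K l) G" using K_normal by (rule normal_imp_subgroup)
  define f where "f = (\<lambda>C. \<sigma> (SOME x. x \<in> C \<inter> S))"
  have "\<sigma> g \<in> f ` lcosets_of G (K l)" if g: "g \<in> S" for g
  proof -
    have gG: "g \<in> carrier G" using g S_subset by auto
    have "g \<otimes> \<one> \<in> l_coset G g (K l)" using subgroup.one_closed[OF Ks] unfolding l_coset_def by blast
    then have "g \<in> l_coset G g (K l) \<inter> S" using g gG by simp
    then have 1: "(SOME x. x \<in> l_coset G g (K l) \<inter> S) \<in> l_coset G g (K l) \<inter> S" by (rule someI)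
    then obtain k where k: "k \<in> K l" "(SOME x. x \<in> l_coset G g (K l) \<inter> S) = g \<otimes> k"
      unfolding l_coset_def by auto
    have kG: "k \<in> carrier G" using k subgroup.mem_carrier[OF Ks] by auto
    have gk: "g \<otimes> k \<in> S" using 1 k by simp
    have "inv g \<otimes> (g \<otimes> k) \<in> S"
      by (rule subgroup.m_closed[OF S_subgroup subgroup.m_inv_closed[OF S_subgroup g] gk])
    then have kS: "k \<in> S" using gG kG by (simp add: m_assoc[symmetric])
    have "f (l_coset G g (K l)) = \<sigma> g * \<sigma> k" unfolding f_def k(2)
      using mat_repD(3)[OF assms(1), of g k] g kS by simp
    then have "f (l_coset G g (K l)) = \<sigma> g" using assms(2) k kS mat_repD(1)[OF assms(1), of g] g by simp
    then show ?thesis using gG unfolding lcosets_of_def by (metis image_eqI)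
  qed
  then show ?thesis using K_finite by (meson finite_imageI finite_subset image_subsetI)
qed

lemma restrict_S: "mat_rep G d \<rho> \<Longrightarrow> mat_rep SG d \<rho>"
  using S_subset unfolding mat_rep_def by auto

text \<open>Nonzero \<open>S\<close>-intertwiners between smooth representations can be reversed.\<close>

lemma reverse_S:
  assumes "mat_rep SG d \<rho>" "\<exists>l. \<forall>k\<in>S \<inter> K l. \<rho> k = 1\<^sub>m d"
    and "mat_rep SG d' \<sigma>" "\<exists>l. \<forall>k\<in>S \<inter> K l. \<sigma> k = 1\<^sub>m d'"
    and "intertwines S d d' \<rho> \<sigma> T" "T \<noteq> 0\<^sub>m d' d"
  obtains A where "intertwines S d' d \<sigma> \<rho> A" "T * A \<noteq> 0\<^sub>m d' d'" "A * T \<noteq> 0\<^sub>m d d"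
proof -
  interpret SG: group SG by (rule S_group)
  obtain l l' where l: "\<forall>k\<in>S \<inter> K l. \<rho> k = 1\<^sub>m d" "\<forall>k\<in>S \<inter> K l'. \<sigma> k = 1\<^sub>m d'" using assms by blast
  have f: "finite (\<rho> ` carrier SG)" "finite (\<sigma> ` carrier SG)"
    using finite_image_S[OF assms(1) l(1)] finite_image_S[OF assms(3) l(2)] by auto
  obtain A where "intertwines (carrier SG) d' d \<sigma> \<rho> A" "T * A \<noteq> 0\<^sub>m d' d'" "A * T \<noteq> 0\<^sub>m d d"
    by (rule SG.intertwiner_reverse[OF assms(1,3) f _ assms(6)]) (use assms(5) in simp_all)
  then show thesis using that by simp
qed

lemma exists_constituent:
  assumes "\<rho> \<in> irreps G TG m"
  obtains d \<sigma> T where "\<sigma> \<in> irreps SG TS d" "intertwines S d m \<sigma> \<rho> T" "T \<noteq> 0\<^sub>m m d" "m \<le> e * d" "d \<le> m"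
proof -
  obtain l where \<rho>: "mat_rep G m \<rho>" and irr: "mat_irreducible (carrier G) m \<rho>" and l: "\<forall>k\<in>K l. \<rho> k = 1\<^sub>m m"
    using assms irreps_G_iff by blast
  have \<rho>c: "\<And>g. g \<in> S \<Longrightarrow> \<rho> g \<in> carrier_mat m m" using mat_repD(1)[OF \<rho>] S_subset by auto
  obtain d P L \<sigma> where ir: "mat_irreducible S d \<sigma>" and P: "P \<in> carrier_mat m d" and L: "L \<in> carrier_mat d m"
    and LP: "L * P = (1\<^sub>m d :: complex mat)" and i: "intertwines S d m \<sigma> \<rho> P"
    using \<rho>c mat_irreducibleD(1)[OF irr] by (rule irreducible_sub)
  note \<sigma>c = mat_irreducibleD(2)[OF ir]
  have one: "\<sigma> g = 1\<^sub>m d" if "g \<in> S" "\<rho> g = 1\<^sub>m m" for g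
    by (rule intertwines_sub_one[OF i L LP that(1) \<sigma>c[OF that(1)] that(2)])
  have mult: "\<sigma> (g \<otimes> h) = \<sigma> g * \<sigma> h" if "g \<in> S" "h \<in> S" for g h
  proof (rule intertwines_sub_mult[OF i L LP that _ \<rho>c \<sigma>c])
    show "g \<otimes> h \<in> S" using that S_subgroup by (simp add: subgroup.m_closed)
    show "\<rho> (g \<otimes> h) = \<rho> g * \<rho> h" using mat_repD(3)[OF \<rho>] that S_subset by auto
  qed
  have oS: "\<one> \<in> S" using S_subgroup by (rule subgroup.one_closed)
  have "mat_rep SG d \<sigma>" unfolding mat_rep_def using \<sigma>c mult one[OF oS mat_repD(2)[OF \<rho>]] by auto
  moreover have "\<forall>k\<in>S \<inter> K l. \<sigma> k = 1\<^sub>m d" using one l by auto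
  ultimately have si: "\<sigma> \<in> irreps SG TS d" using ir irreps_S_iff by blast
  have nz: "P \<noteq> 0\<^sub>m m d"
  proof
    assume "P = 0\<^sub>m m d"
    then have "(1\<^sub>m d :: complex mat) $$ (0, 0) = (0\<^sub>m d d :: complex mat) $$ (0, 0)" using LP L by simp
    then show False using mat_irreducibleD(1)[OF ir] by simp
  qed
  have "m \<le> e * d" by (rule constituent_dim_bound[OF \<rho> irr S_subset \<gamma> decomp \<sigma>c i nz])
  moreover have "d \<le> m" by (rule left_inverse_dim_le[OF P L LP])
  ultimately show thesis using that[OF si i nz] by blast
qed

lemma exists_over:
  assumes "\<sigma> \<in> irreps SG TS d"
  obtains m \<rho> T where "\<rho> \<in> irreps G TG m" "intertwines S m d \<rho> \<sigma> T" "T \<noteq> 0\<^sub>m d m"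
proof -
  obtain l where \<sigma>: "mat_rep SG d \<sigma>" and irr: "mat_irreducible S d \<sigma>" and l: "\<forall>k\<in>S \<inter> K l. \<sigma> k = 1\<^sub>m d"
    using assms irreps_S_iff by blast
  obtain m \<rho> T where "mat_rep G m \<rho>" "mat_irreducible (carrier G) m \<rho>" "\<forall>k\<in>K l. \<rho> k = 1\<^sub>m m"
    "intertwines S m d \<rho> \<sigma> T" "T \<noteq> 0\<^sub>m d m"
    by (rule irreducible_over_subgroup[OF K_normal K_finite S_subgroup \<sigma> mat_irreducibleD(1)[OF irr], of l])
      (use l in auto)
  then show thesis using irreps_G_iff by (intro that) auto
qed

text \<open>The continuous one-dimensional representations of \<open>G\<close>, as complex-valued functions.\<close>

definition smooth_char :: "('g \<Rightarrow> complex) \<Rightarrow> bool" where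
  "smooth_char \<chi> \<longleftrightarrow> \<chi> \<one> = 1 \<and> (\<forall>g\<in>carrier G. \<forall>h\<in>carrier G. \<chi> (g \<otimes> h) = \<chi> g * \<chi> h) \<and> (\<exists>l. \<forall>k\<in>K l. \<chi> k = 1)"

lemma rep_1_iff: "representation G TG 1 \<psi> \<longleftrightarrow> (\<forall>g\<in>carrier G. \<psi> g \<in> carrier_mat 1 1) \<and> smooth_char (\<lambda>g. \<psi> g $$ (0, 0))"
proof -
  have eq: "A = B \<longleftrightarrow> A $$ (0, 0) = B $$ (0, 0)" if "A \<in> carrier_mat 1 1" "B \<in> carrier_mat 1 1" for A B :: "complex mat"
    using that by (auto intro!: eq_matI)
  have m: "(A * B) $$ (0, 0) = A $$ (0, 0) * B $$ (0, 0)" if "A \<in> carrier_mat 1 1" "B \<in> carrier_mat 1 1" for A B :: "complex mat"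
    using that by (simp add: scalar_prod_def)
  have KG: "k \<in> carrier G" if "k \<in> K l" for k l using K_normal that by (meson normal_imp_subgroup subgroup.mem_carrier)
  show ?thesis
  proof (cases "\<forall>g\<in>carrier G. \<psi> g \<in> carrier_mat 1 1")
    case True
    have 1: "\<psi> (g \<otimes> h) = \<psi> g * \<psi> h \<longleftrightarrow> \<psi> (g \<otimes> h) $$ (0, 0) = \<psi> g $$ (0, 0) * \<psi> h $$ (0, 0)"
      if "g \<in> carrier G" "h \<in> carrier G" for g h
    proof -
      have c: "\<psi> g \<in> carrier_mat 1 1" "\<psi> h \<in> carrier_mat 1 1" "\<psi> (g \<otimes> h) \<in> carrier_mat 1 1"
        using True that by blast+
      show ?thesis using eq[OF c(3) mult_carrier_mat[OF c(1,2)]] m[OF c(1,2)] by simp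
    qed
    have 2: "\<psi> k = 1\<^sub>m 1 \<longleftrightarrow> \<psi> k $$ (0, 0) = 1" if "k \<in> carrier G" for k
      using eq[OF _ one_carrier_mat[of 1], of "\<psi> k"] True that by simp
    show ?thesis
      unfolding rep_G_iff mat_rep_def smooth_char_def using True 1 2[OF one_closed] 2[OF KG] by (simp cong: ball_cong)
  next
    case False
    then show ?thesis unfolding rep_G_iff mat_rep_def by blast
  qed
qed

lemma smooth_char_nonzero: "smooth_char \<chi> \<Longrightarrow> g \<in> carrier G \<Longrightarrow> \<chi> g \<noteq> 0"
  unfolding smooth_char_def by (metis inv_closed mult_zero_left r_inv zero_neq_one)

end

section \<open>Twist equivalence\<close>

context twist_setting
begin

lemma smooth_charD:
  assumes "smooth_char \<chi>"
  shows "\<chi> \<one> = 1" "\<And>g h. g \<in> carrier G \<Longrightarrow> h \<in> carrier G \<Longrightarrow> \<chi> (g \<otimes> h) = \<chi> g * \<chi> h"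
  using assms unfolding smooth_char_def by auto

lemma smooth_char_one: "smooth_char (\<lambda>_. 1)"
  unfolding smooth_char_def by auto

lemma smooth_char_inverse: "smooth_char \<chi> \<Longrightarrow> smooth_char (\<lambda>g. inverse (\<chi> g))"
  unfolding smooth_char_def by auto

lemma smooth_char_mult:
  assumes "smooth_char \<chi>" "smooth_char \<psi>"
  shows "smooth_char (\<lambda>g. \<chi> g * \<psi> g)"
proof -
  obtain l l' where l: "\<forall>k\<in>K l. \<chi> k = 1" "\<forall>k\<in>K l'. \<psi> k = 1" using assms unfolding smooth_char_def by blast
  have "\<chi> k * \<psi> k = 1" if "k \<in> K (max l l')" for k
  proof -
    have "k \<in> K l" "k \<in> K l'" using that K_antimono[of l "max l l'"] K_antimono[of l' "max l l'"] by auto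
    then show ?thesis using l by simp
  qed
  then show ?thesis using assms unfolding smooth_char_def by auto
qed

lemma twist_equivalent_iff:
  assumes \<sigma>: "\<And>g. g \<in> carrier G \<Longrightarrow> \<sigma> g \<in> carrier_mat d d"
  shows "twist_equivalent G TG d \<rho> \<sigma> \<longleftrightarrow>
    (\<exists>\<chi>. smooth_char \<chi> \<and> (\<exists>P\<in>carrier (GL d). \<forall>g\<in>carrier G. P * \<rho> g = \<chi> g \<cdot>\<^sub>m (\<sigma> g * P)))"
proof
  assume "twist_equivalent G TG d \<rho> \<sigma>"
  then obtain \<psi> P where \<psi>: "representation G TG 1 \<psi>" and P: "P \<in> carrier (GL d)"
    and eq: "\<forall>g\<in>carrier G. P * \<rho> g = (\<psi> g $$ (0, 0) \<cdot>\<^sub>m \<sigma> g) * P"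
    unfolding twist_equivalent_def rep_iso_def twist_def by auto
  have Pc: "P \<in> carrier_mat d d" using P GL_carrier_iff by blast
  have "\<forall>g\<in>carrier G. P * \<rho> g = \<psi> g $$ (0, 0) \<cdot>\<^sub>m (\<sigma> g * P)"
    using eq mult_smult_assoc_mat[OF \<sigma> Pc] by simp
  then show "\<exists>\<chi>. smooth_char \<chi> \<and> (\<exists>P\<in>carrier (GL d). \<forall>g\<in>carrier G. P * \<rho> g = \<chi> g \<cdot>\<^sub>m (\<sigma> g * P))"
    using P \<psi> rep_1_iff by blast
next
  assume "\<exists>\<chi>. smooth_char \<chi> \<and> (\<exists>P\<in>carrier (GL d). \<forall>g\<in>carrier G. P * \<rho> g = \<chi> g \<cdot>\<^sub>m (\<sigma> g * P))"
  then obtain \<chi> P where \<chi>: "smooth_char \<chi>" and P: "P \<in> carrier (GL d)"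
    and eq: "\<forall>g\<in>carrier G. P * \<rho> g = \<chi> g \<cdot>\<^sub>m (\<sigma> g * P)" by blast
  have Pc: "P \<in> carrier_mat d d" using P GL_carrier_iff by blast
  define \<psi> where "\<psi> = (\<lambda>g. Matrix.mat 1 1 (\<lambda>_. \<chi> g))"
  have "representation G TG 1 \<psi>" unfolding rep_1_iff using \<chi> by (simp add: \<psi>_def)
  moreover have "\<forall>g\<in>carrier G. P * \<rho> g = (\<psi> g $$ (0, 0) \<cdot>\<^sub>m \<sigma> g) * P"
    using eq mult_smult_assoc_mat[OF \<sigma> Pc] by (simp add: \<psi>_def)
  ultimately show "twist_equivalent G TG d \<rho> \<sigma>"
    unfolding twist_equivalent_def rep_iso_def twist_def using P by blast
qed

lemma twist_equivalentI:
  assumes "smooth_char \<chi>" "P \<in> carrier (GL d)" "\<And>g. g \<in> carrier G \<Longrightarrow> \<sigma> g \<in> carrier_mat d d"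
    "\<And>g. g \<in> carrier G \<Longrightarrow> P * \<rho> g = \<chi> g \<cdot>\<^sub>m (\<sigma> g * P)"
  shows "twist_equivalent G TG d \<rho> \<sigma>"
proof -
  have "\<exists>\<chi>. smooth_char \<chi> \<and> (\<exists>P\<in>carrier (GL d). \<forall>g\<in>carrier G. P * \<rho> g = \<chi> g \<cdot>\<^sub>m (\<sigma> g * P))"
    by (intro exI[of _ \<chi>] conjI bexI[of _ P] ballI assms)
  then show ?thesis using iffD2[OF twist_equivalent_iff[of \<sigma> d \<rho>]] assms(3) by simp
qed

lemma twist_equivalentE:
  assumes "twist_equivalent G TG d \<rho> \<sigma>" "\<And>g. g \<in> carrier G \<Longrightarrow> \<sigma> g \<in> carrier_mat d d"
  obtains \<chi> P where "smooth_char \<chi>" "P \<in> carrier (GL d)" "\<forall>g\<in>carrier G. P * \<rho> g = \<chi> g \<cdot>\<^sub>m (\<sigma> g * P)"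
proof -
  have "\<exists>\<chi>. smooth_char \<chi> \<and> (\<exists>P\<in>carrier (GL d). \<forall>g\<in>carrier G. P * \<rho> g = \<chi> g \<cdot>\<^sub>m (\<sigma> g * P))"
    using iffD1[OF twist_equivalent_iff[of \<sigma> d \<rho>]] assms by simp
  then show thesis using that by auto
qed

lemma irreps_GD:
  assumes "\<rho> \<in> irreps G TG d"
  shows "mat_rep G d \<rho>" "\<exists>l. \<forall>k\<in>K l. \<rho> k = 1\<^sub>m d" "mat_irreducible (carrier G) d \<rho>"
    "\<And>g. g \<in> carrier G \<Longrightarrow> \<rho> g \<in> carrier_mat d d" "d > 0" "\<And>g. g \<in> S \<Longrightarrow> \<rho> g \<in> carrier_mat d d"
    "mat_rep SG d \<rho>" "\<exists>l. \<forall>k\<in>S \<inter> K l. \<rho> k = 1\<^sub>m d"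
proof -
  show r: "mat_rep G d \<rho>" "\<exists>l. \<forall>k\<in>K l. \<rho> k = 1\<^sub>m d" and i: "mat_irreducible (carrier G) d \<rho>"
    using assms irreps_G_iff by blast+
  show "\<And>g. g \<in> carrier G \<Longrightarrow> \<rho> g \<in> carrier_mat d d" "\<And>g. g \<in> S \<Longrightarrow> \<rho> g \<in> carrier_mat d d"
    using mat_repD(1)[OF r(1)] S_subset by auto
  show "d > 0" using mat_irreducibleD(1)[OF i] .
  show "mat_rep SG d \<rho>" using restrict_S[OF r(1)] .
  show "\<exists>l. \<forall>k\<in>S \<inter> K l. \<rho> k = 1\<^sub>m d" using r(2) by blast
qed

lemma irreps_SD:
  assumes "\<rho> \<in> irreps SG TS d"
  shows "mat_rep SG d \<rho>" "\<exists>l. \<forall>k\<in>S \<inter> K l. \<rho> k = 1\<^sub>m d" "mat_irreducible S d \<rho>"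
    "\<And>g. g \<in> S \<Longrightarrow> \<rho> g \<in> carrier_mat d d" "d > 0"
proof -
  show r: "mat_rep SG d \<rho>" "\<exists>l. \<forall>k\<in>S \<inter> K l. \<rho> k = 1\<^sub>m d" and i: "mat_irreducible S d \<rho>"
    using assms irreps_S_iff by blast+
  show "\<And>g. g \<in> S \<Longrightarrow> \<rho> g \<in> carrier_mat d d" using mat_repD(1)[OF r(1)] by auto
  show "d > 0" using mat_irreducibleD(1)[OF i] .
qed

lemma equiv_twist:
  "equiv (irreps G TG d) {(\<rho>, \<sigma>) \<in> irreps G TG d \<times> irreps G TG d. twist_equivalent G TG d \<rho> \<sigma>}"
proof (rule equivI)
  have one: "1\<^sub>m d \<in> carrier (GL d)" unfolding GL_carrier_iff by (auto intro!: bexI[of _ "1\<^sub>m d"])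
  show "refl_on (irreps G TG d) {(\<rho>, \<sigma>) \<in> irreps G TG d \<times> irreps G TG d. twist_equivalent G TG d \<rho> \<sigma>}"
  proof (rule refl_onI)
    fix \<rho> assume \<rho>: "\<rho> \<in> irreps G TG d"
    have "1\<^sub>m d * \<rho> g = 1 \<cdot>\<^sub>m (\<rho> g * 1\<^sub>m d)" if "g \<in> carrier G" for g
      using irreps_GD(4)[OF \<rho> that] by (intro eq_matI) auto
    then have "twist_equivalent G TG d \<rho> \<rho>"
      by (intro twist_equivalentI[OF smooth_char_one one irreps_GD(4)[OF \<rho>]])
    then show "(\<rho>, \<rho>) \<in> {(\<rho>, \<sigma>) \<in> irreps G TG d \<times> irreps G TG d. twist_equivalent G TG d \<rho> \<sigma>}" using \<rho> by auto
  qed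
  show "sym {(\<rho>, \<sigma>) \<in> irreps G TG d \<times> irreps G TG d. twist_equivalent G TG d \<rho> \<sigma>}"
  proof (rule symI)
    fix \<rho> \<sigma> assume "(\<rho>, \<sigma>) \<in> {(\<rho>, \<sigma>) \<in> irreps G TG d \<times> irreps G TG d. twist_equivalent G TG d \<rho> \<sigma>}"
    then have \<rho>: "\<rho> \<in> irreps G TG d" and \<sigma>: "\<sigma> \<in> irreps G TG d" and t: "twist_equivalent G TG d \<rho> \<sigma>" by auto
    obtain \<chi> P where \<chi>: "smooth_char \<chi>" and P: "P \<in> carrier (GL d)"
      and eq: "\<forall>g\<in>carrier G. P * \<rho> g = \<chi> g \<cdot>\<^sub>m (\<sigma> g * P)"
      by (rule twist_equivalentE[OF t irreps_GD(4)[OF \<sigma>]])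
    obtain Q where Q: "Q \<in> carrier_mat d d" "P * Q = 1\<^sub>m d" "Q * P = 1\<^sub>m d" and Pc: "P \<in> carrier_mat d d"
      using P GL_carrier_iff by blast
    have "Q * \<sigma> g = inverse (\<chi> g) \<cdot>\<^sub>m (\<rho> g * Q)" if g: "g \<in> carrier G" for g
    proof -
      note c = irreps_GD(4)[OF \<rho> g] irreps_GD(4)[OF \<sigma> g]
      have "Q * (P * \<rho> g) * Q = (Q * P * \<rho> g) * Q" using assoc_mult_mat[OF Q(1) Pc c(1)] by simp
      then have 1: "Q * (P * \<rho> g) * Q = \<rho> g * Q" unfolding Q(3) left_mult_one_mat[OF c(1)] .
      have sP: "\<sigma> g * P \<in> carrier_mat d d" using c Pc by simp
      have "Q * (\<chi> g \<cdot>\<^sub>m (\<sigma> g * P)) * Q = \<chi> g \<cdot>\<^sub>m (Q * (\<sigma> g * P) * Q)"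
        unfolding mult_smult_distrib[OF Q(1) sP] by (rule mult_smult_assoc_mat[OF mult_carrier_mat[OF Q(1) sP] Q(1)])
      also have "Q * (\<sigma> g * P) * Q = Q * \<sigma> g * P * Q" using assoc_mult_mat[OF Q(1) c(2) Pc] by simp
      also have "\<dots> = Q * \<sigma> g * (P * Q)" by (rule assoc_mult_mat[OF mult_carrier_mat[OF Q(1) c(2)] Pc Q(1)])
      also have "\<dots> = Q * \<sigma> g" unfolding Q(2) by (rule right_mult_one_mat[OF mult_carrier_mat[OF Q(1) c(2)]])
      finally have "\<rho> g * Q = \<chi> g \<cdot>\<^sub>m (Q * \<sigma> g)" using 1 eq g by simp
      then have "inverse (\<chi> g) \<cdot>\<^sub>m (\<rho> g * Q) = (inverse (\<chi> g) * \<chi> g) \<cdot>\<^sub>m (Q * \<sigma> g)"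
        by (simp add: smult_smult_mat)
      then show ?thesis using smooth_char_nonzero[OF \<chi> g] mult_carrier_mat[OF Q(1) c(2)] by (simp add: one_smult_mat)
    qed
    moreover have "Q \<in> carrier (GL d)" unfolding GL_carrier_iff using Q Pc by blast
    ultimately have "twist_equivalent G TG d \<sigma> \<rho>"
      by (intro twist_equivalentI[OF smooth_char_inverse[OF \<chi>] _ irreps_GD(4)[OF \<rho>]])
    then show "(\<sigma>, \<rho>) \<in> {(\<rho>, \<sigma>) \<in> irreps G TG d \<times> irreps G TG d. twist_equivalent G TG d \<rho> \<sigma>}" using \<rho> \<sigma> by auto
  qed
  show "trans {(\<rho>, \<sigma>) \<in> irreps G TG d \<times> irreps G TG d. twist_equivalent G TG d \<rho> \<sigma>}"
  proof (rule transI)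
    fix \<rho> \<sigma> \<tau> assume "(\<rho>, \<sigma>) \<in> {(\<rho>, \<sigma>) \<in> irreps G TG d \<times> irreps G TG d. twist_equivalent G TG d \<rho> \<sigma>}" "(\<sigma>, \<tau>) \<in> {(\<rho>, \<sigma>) \<in> irreps G TG d \<times> irreps G TG d. twist_equivalent G TG d \<rho> \<sigma>}"
    then have \<rho>: "\<rho> \<in> irreps G TG d" and \<sigma>: "\<sigma> \<in> irreps G TG d" and \<tau>: "\<tau> \<in> irreps G TG d"
      and t: "twist_equivalent G TG d \<rho> \<sigma>" and t': "twist_equivalent G TG d \<sigma> \<tau>" by auto
    obtain \<chi> P where \<chi>: "smooth_char \<chi>" and P: "P \<in> carrier (GL d)"
      and eq: "\<forall>g\<in>carrier G. P * \<rho> g = \<chi> g \<cdot>\<^sub>m (\<sigma> g * P)"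
      by (rule twist_equivalentE[OF t irreps_GD(4)[OF \<sigma>]])
    obtain \<psi> Q where \<psi>: "smooth_char \<psi>" and Q: "Q \<in> carrier (GL d)"
      and eq': "\<forall>g\<in>carrier G. Q * \<sigma> g = \<psi> g \<cdot>\<^sub>m (\<tau> g * Q)"
      by (rule twist_equivalentE[OF t' irreps_GD(4)[OF \<tau>]])
    have Pc: "P \<in> carrier_mat d d" and Qc: "Q \<in> carrier_mat d d" using P Q GL_carrier_iff by blast+
    have "Q * P * \<rho> g = (\<chi> g * \<psi> g) \<cdot>\<^sub>m (\<tau> g * (Q * P))" if g: "g \<in> carrier G" for g
    proof -
      note c = irreps_GD(4)[OF \<rho> g] irreps_GD(4)[OF \<sigma> g] irreps_GD(4)[OF \<tau> g]
      have "Q * P * \<rho> g = Q * (P * \<rho> g)" by (rule assoc_mult_mat[OF Qc Pc c(1)])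
      also have "\<dots> = Q * (\<chi> g \<cdot>\<^sub>m (\<sigma> g * P))" using eq g by simp
      also have "\<dots> = \<chi> g \<cdot>\<^sub>m (Q * (\<sigma> g * P))" by (rule mult_smult_distrib[OF Qc mult_carrier_mat[OF c(2) Pc]])
      also have "Q * (\<sigma> g * P) = Q * \<sigma> g * P" using assoc_mult_mat[OF Qc c(2) Pc] by simp
      also have "\<dots> = (\<psi> g \<cdot>\<^sub>m (\<tau> g * Q)) * P" using eq' g by simp
      also have "\<dots> = \<psi> g \<cdot>\<^sub>m (\<tau> g * Q * P)" by (rule mult_smult_assoc_mat[OF mult_carrier_mat[OF c(3) Qc] Pc])
      also have "\<tau> g * Q * P = \<tau> g * (Q * P)" by (rule assoc_mult_mat[OF c(3) Qc Pc])
      finally show ?thesis by (simp add: smult_smult_mat)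
    qed
    moreover have "Q * P \<in> carrier (GL d)"
      using group.is_monoid[OF GL_group[where ?'a = complex, of d]] P Q by (metis GL_mult monoid.m_closed)
    ultimately have "twist_equivalent G TG d \<rho> \<tau>"
      by (intro twist_equivalentI[OF smooth_char_mult[OF \<chi> \<psi>] _ irreps_GD(4)[OF \<tau>]])
    then show "(\<rho>, \<tau>) \<in> {(\<rho>, \<sigma>) \<in> irreps G TG d \<times> irreps G TG d. twist_equivalent G TG d \<rho> \<sigma>}" using \<rho> \<tau> by auto
  qed
qed auto

text \<open>The scalars of a twist form a smooth character, which is trivial where both representations agree.\<close>

lemma twist_scalars_smooth:
  assumes \<rho>: "mat_rep G m \<rho>" "\<exists>l. \<forall>k\<in>K l. \<rho> k = 1\<^sub>m m" and \<rho>': "mat_rep G m' \<rho>'" "\<exists>l. \<forall>k\<in>K l. \<rho>' k = 1\<^sub>m m'"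
    and T: "T \<in> carrier_mat m' m" "T \<noteq> 0\<^sub>m m' m"
    and eq: "\<And>g. g \<in> carrier G \<Longrightarrow> \<rho>' g * T = \<chi> g \<cdot>\<^sub>m (T * \<rho> g)"
  shows "smooth_char \<chi>"
proof -
  have KG: "k \<in> carrier G" if "k \<in> K l" for k l using K_normal that by (meson normal_imp_subgroup subgroup.mem_carrier)
  obtain i j where ij: "i < m'" "j < m" "T $$ (i, j) \<noteq> 0"
  proof -
    have "\<exists>i j. i < m' \<and> j < m \<and> T $$ (i, j) \<noteq> 0"
    proof (rule ccontr)
      assume "\<not> ?thesis"
      then have "T = 0\<^sub>m m' m" using T(1) by (intro eq_matI) auto
      then show False using T by simp
    qed
    then show ?thesis using that by blast
  qed
  have canc: "a = b" if "a \<cdot>\<^sub>m T = b \<cdot>\<^sub>m T" for a b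
  proof -
    have "(a \<cdot>\<^sub>m T) $$ (i, j) = (b \<cdot>\<^sub>m T) $$ (i, j)" using that by simp
    then show ?thesis using ij T(1) by simp
  qed
  note c = mat_repD(1)[OF \<rho>(1)] and c' = mat_repD(1)[OF \<rho>'(1)]
  have conj: "\<rho>' g * T * \<rho> (inv g) = \<chi> g \<cdot>\<^sub>m T" if g: "g \<in> carrier G" for g
  proof -
    have "\<rho>' g * T * \<rho> (inv g) = \<chi> g \<cdot>\<^sub>m (T * \<rho> g * \<rho> (inv g))"
      unfolding eq[OF g] by (rule mult_smult_assoc_mat[OF mult_carrier_mat[OF T(1) c[OF g]] c[OF inv_closed[OF g]]])
    also have "T * \<rho> g * \<rho> (inv g) = T * (\<rho> g * \<rho> (inv g))" by (rule assoc_mult_mat[OF T(1) c[OF g] c[OF inv_closed[OF g]]])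
    also have "\<dots> = T" unfolding mat_rep_inv[OF \<rho>(1) g] using T by simp
    finally show ?thesis .
  qed
  have mult: "\<chi> (g \<otimes> h) = \<chi> g * \<chi> h" if g: "g \<in> carrier G" and h: "h \<in> carrier G" for g h
  proof -
    note ig = inv_closed[OF g] and ih = inv_closed[OF h]
    have "\<chi> (g \<otimes> h) \<cdot>\<^sub>m T = \<rho>' (g \<otimes> h) * T * \<rho> (inv (g \<otimes> h))" using conj g h by simp
    also have "\<dots> = \<rho>' g * \<rho>' h * T * (\<rho> (inv h) * \<rho> (inv g))"
      using mat_repD(3)[OF \<rho>'(1) g h] mat_repD(3)[OF \<rho>(1) ih ig] g h by (simp add: inv_mult_group)
    also have "\<rho>' g * \<rho>' h * T = \<rho>' g * (\<rho>' h * T)" by (rule assoc_mult_mat[OF c'[OF g] c'[OF h] T(1)])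
    also have "\<rho>' g * (\<rho>' h * T) * (\<rho> (inv h) * \<rho> (inv g)) = \<rho>' g * (\<rho>' h * T) * \<rho> (inv h) * \<rho> (inv g)"
      by (rule assoc_mult_mat[OF mult_carrier_mat[OF c'[OF g] mult_carrier_mat[OF c'[OF h] T(1)]] c[OF ih] c[OF ig], symmetric])
    also have "\<rho>' g * (\<rho>' h * T) * \<rho> (inv h) = \<rho>' g * (\<rho>' h * T * \<rho> (inv h))"
      by (rule assoc_mult_mat[OF c'[OF g] mult_carrier_mat[OF c'[OF h] T(1)] c[OF ih]])
    also have "\<dots> = \<chi> h \<cdot>\<^sub>m (\<rho>' g * T)" unfolding conj[OF h] by (rule mult_smult_distrib[OF c'[OF g] T(1)])
    also have "\<dots> * \<rho> (inv g) = \<chi> h \<cdot>\<^sub>m (\<rho>' g * T * \<rho> (inv g))"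
      by (rule mult_smult_assoc_mat[OF mult_carrier_mat[OF c'[OF g] T(1)] c[OF ig]])
    also have "\<dots> = (\<chi> g * \<chi> h) \<cdot>\<^sub>m T" unfolding conj[OF g] by (simp add: smult_smult_mat mult.commute)
    finally show ?thesis by (rule canc)
  qed
  have triv: "\<chi> k = 1" if "k \<in> carrier G" "\<rho> k = 1\<^sub>m m" "\<rho>' k = 1\<^sub>m m'" for k
  proof (rule canc)
    show "\<chi> k \<cdot>\<^sub>m T = 1 \<cdot>\<^sub>m T" using eq[OF that(1)] that T by (simp add: one_smult_mat)
  qed
  obtain l l' where l: "\<forall>k\<in>K l. \<rho> k = 1\<^sub>m m" "\<forall>k\<in>K l'. \<rho>' k = 1\<^sub>m m'" using \<rho> \<rho>' by blast
  have "\<forall>k\<in>K (max l l'). \<chi> k = 1"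
    using l triv KG K_antimono[of l "max l l'"] K_antimono[of l' "max l l'"]
    by (meson in_mono max.cobounded1 max.cobounded2)
  then show ?thesis
    unfolding smooth_char_def using mult triv[OF one_closed] mat_repD(2)[OF \<rho>(1)] mat_repD(2)[OF \<rho>'(1)] by blast
qed

text \<open>Two irreducible representations of \<open>G\<close> with a common constituent on \<open>S\<close> are twists of each other.\<close>

lemma common_constituent_twist_equivalent:
  assumes \<rho>: "\<rho> \<in> irreps G TG m" and \<rho>': "\<rho>' \<in> irreps G TG m'" and \<sigma>: "\<sigma> \<in> irreps SG TS d"
    and T: "intertwines S d m \<sigma> \<rho> T" "T \<noteq> 0\<^sub>m m d" and T': "intertwines S d m' \<sigma> \<rho>' T'" "T' \<noteq> 0\<^sub>m m' d"
  shows "m = m'" "twist_equivalent G TG m \<rho> \<rho>'"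
proof -
  note r = irreps_GD[OF \<rho>] and r' = irreps_GD[OF \<rho>'] and s = irreps_SD[OF \<sigma>]
  obtain A where A: "intertwines S m' d \<rho>' \<sigma> A" "T' * A \<noteq> 0\<^sub>m m' m'" "A * T' \<noteq> 0\<^sub>m d d"
    by (rule reverse_S[OF s(1,2) r'(7,8) T'])
  note Tc = intertwinesD(1)[OF T(1)] and Tc' = intertwinesD(1)[OF T'(1)] and Ac = intertwinesD(1)[OF A(1)]
  have TA: "intertwines S m' m \<rho>' \<rho> (T * A)" by (rule intertwines_comp[OF T(1) A(1) r'(6) s(4) r(6)])
  have TAnz: "T * A \<noteq> 0\<^sub>m m m'"
  proof
    assume 0: "T * A = 0\<^sub>m m m'"
    have "intertwines S d d \<sigma> \<sigma> (A * T')" by (rule intertwines_comp[OF A(1) T'(1) s(4) r'(6) s(4)])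
    then obtain R where R: "R \<in> carrier_mat d d" "A * T' * R = 1\<^sub>m d"
      using schur_iso(2)[OF s(3) s(3) _ A(3)] by blast
    have "T = T * (A * T' * R)" unfolding R(2) using Tc by simp
    also have "\<dots> = T * (A * T') * R"
      by (rule assoc_mult_mat[OF Tc mult_carrier_mat[OF Ac Tc'] R(1), symmetric])
    also have "T * (A * T') = T * A * T'" by (rule assoc_mult_mat[OF Tc Ac Tc', symmetric])
    also have "\<dots> = 0\<^sub>m m d" unfolding 0 using Tc' by simp
    finally show False using T(2) R(1) by simp
  qed
  obtain B \<chi> where B: "intertwines S m' m \<rho>' \<rho> B" "B \<noteq> 0\<^sub>m m m'"
    and eq0: "\<forall>g\<in>carrier G. \<rho> g * B = \<chi> g \<cdot>\<^sub>m (B * \<rho>' g)"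
    by (rule common_constituent_twist[OF r'(1) r(1) S_subset S_comm S_normal TA TAnz])
  note Bc = intertwinesD(1)[OF B(1)]
  have eq: "\<And>g. g \<in> carrier G \<Longrightarrow> \<rho> g * B = \<chi> g \<cdot>\<^sub>m (B * \<rho>' g)" using eq0 by blast
  have \<chi>: "smooth_char \<chi>" by (rule twist_scalars_smooth[OF r'(1,2) r(1,2) Bc B(2) eq])
  have iB: "intertwines (carrier G) m' m (\<lambda>g. \<chi> g \<cdot>\<^sub>m \<rho>' g) \<rho> B" by (rule twist_intertwiner[OF Bc r'(4) eq])
  have irr: "mat_irreducible (carrier G) m' (\<lambda>g. \<chi> g \<cdot>\<^sub>m \<rho>' g)"
    by (rule mat_irreducible_smult[OF r'(3) smooth_char_nonzero[OF \<chi>]])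
  show mm: "m = m'" using schur_iso(1)[OF irr r(3) iB B(2)] by simp
  obtain P where P: "P \<in> carrier_mat m m" "P * B = 1\<^sub>m m" "B * P = 1\<^sub>m m"
    using schur_iso(2)[OF irr r(3) iB B(2)] mm by blast
  have "P * \<rho> g = \<chi> g \<cdot>\<^sub>m (\<rho>' g * P)" if g: "g \<in> carrier G" for g
  proof -
    have Bc': "B \<in> carrier_mat m m" and c: "\<rho> g \<in> carrier_mat m m" "\<rho>' g \<in> carrier_mat m m"
      using Bc r(4)[OF g] r'(4)[OF g] mm by auto
    have "P * \<rho> g = P * \<rho> g * (B * P)"
      unfolding P(3) by (rule right_mult_one_mat[OF mult_carrier_mat[OF P(1) c(1)], symmetric])
    also have "\<dots> = P * \<rho> g * B * P" by (rule assoc_mult_mat[OF mult_carrier_mat[OF P(1) c(1)] Bc' P(1), symmetric])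
    also have "P * \<rho> g * B = P * (\<rho> g * B)" by (rule assoc_mult_mat[OF P(1) c(1) Bc'])
    also have "\<dots> = \<chi> g \<cdot>\<^sub>m (P * (B * \<rho>' g))"
      unfolding eq[OF g] by (rule mult_smult_distrib[OF P(1) mult_carrier_mat[OF Bc' c(2)]])
    also have "P * (B * \<rho>' g) = P * B * \<rho>' g" by (rule assoc_mult_mat[OF P(1) Bc' c(2), symmetric])
    also have "\<dots> = \<rho>' g" unfolding P(2) using c(2) by simp
    also have "\<chi> g \<cdot>\<^sub>m \<rho>' g * P = \<chi> g \<cdot>\<^sub>m (\<rho>' g * P)" by (rule mult_smult_assoc_mat[OF c(2) P(1)])
    finally show ?thesis .
  qed
  moreover have "P \<in> carrier (GL m)" unfolding GL_carrier_iff using P Bc mm by auto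
  ultimately show "twist_equivalent G TG m \<rho> \<rho>'"
    by (intro twist_equivalentI[OF \<chi> _ r'(4)[unfolded mm[symmetric]]])
qed

end

section \<open>Comparison of Dirichlet series\<close>

text \<open>A zeta function is a sum over all classes, each class counting with a power of its dimension; classes are paired
  with their dimension minus one, the summation index.\<close>

lemma dirichlet_series_num_classes:
  "dirichlet_series (\<lambda>i. num_classes (C i)) s =
     (\<integral>\<^sup>+ x. ennreal (real (Suc (fst x)) powr - s) \<partial>count_space {(i, A). A \<in> C (Suc i)})"
proof -
  define w where "w = (\<lambda>i. ennreal (real (Suc i) powr - s))"
  have "dirichlet_series (\<lambda>i. num_classes (C i)) s
      = suminf (\<lambda>i. emeasure (count_space UNIV) (C (Suc i)) * w i)"
    unfolding dirichlet_series_def num_classes_def w_def by simp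
  also have "\<dots> = (\<integral>\<^sup>+ i. emeasure (count_space UNIV) (C (Suc i)) * w i \<partial>count_space UNIV)"
    by (rule nn_integral_count_space_nat[symmetric])
  also have "\<dots> = (\<integral>\<^sup>+ i. \<integral>\<^sup>+ A. w i * indicator (C (Suc i)) A \<partial>count_space UNIV \<partial>count_space UNIV)"
    by (intro nn_integral_cong) (simp add: nn_integral_cmult_indicator mult.commute)
  also have "\<dots> = (\<integral>\<^sup>+ i. \<integral>\<^sup>+ A. (w (fst (i, A)) * indicator {(i, A). A \<in> C (Suc i)} (i, A)) \<partial>count_space UNIV \<partial>count_space UNIV)"
    by (intro nn_integral_cong) (auto simp: indicator_def)
  also have "\<dots> = (\<integral>\<^sup>+ x. w (fst x) * indicator {(i, A). A \<in> C (Suc i)} x \<partial>count_space UNIV)"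
    by (rule nn_integral_fst_count_space)
  also have "\<dots> = (\<integral>\<^sup>+ x. w (fst x) \<partial>count_space {(i, A). A \<in> C (Suc i)})"
    by (simp add: nn_integral_count_space_indicator)
  finally show ?thesis unfolding w_def .
qed

lemma nn_integral_count_space_inj_le:
  fixes u :: "'a \<Rightarrow> ennreal"
  assumes inj: "inj_on f A" and f: "\<And>x. x \<in> A \<Longrightarrow> f x \<in> B" and le: "\<And>x. x \<in> A \<Longrightarrow> u x \<le> C * v (f x)"
  shows "(\<integral>\<^sup>+ x. u x \<partial>count_space A) \<le> C * (\<integral>\<^sup>+ y. v y \<partial>count_space B)"
proof -
  have "(\<integral>\<^sup>+ x. u x \<partial>count_space A) \<le> (\<integral>\<^sup>+ x. C * v (f x) \<partial>count_space A)"
    using le by (intro nn_integral_mono) simp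
  also have "\<dots> = C * (\<integral>\<^sup>+ x. v (f x) \<partial>count_space A)" by (simp add: nn_integral_cmult)
  also have "(\<integral>\<^sup>+ x. v (f x) \<partial>count_space A) = (\<integral>\<^sup>+ y. v y \<partial>count_space (f ` A))"
    by (rule nn_integral_bij_count_space) (use inj in \<open>simp add: bij_betw_def\<close>)
  also have "\<dots> = (\<integral>\<^sup>+ y. v y * indicator (f ` A) y \<partial>count_space UNIV)"
    by (simp add: nn_integral_count_space_indicator)
  also have "\<dots> \<le> (\<integral>\<^sup>+ y. v y * indicator B y \<partial>count_space UNIV)"
    using f by (intro nn_integral_mono) (auto simp: indicator_def)
  also have "\<dots> = (\<integral>\<^sup>+ y. v y \<partial>count_space B)" by (simp add: nn_integral_count_space_indicator)
  finally show ?thesis by (simp add: mult_left_mono)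
qed

lemma nn_integral_count_space_fibres_le:
  fixes u :: "'a \<Rightarrow> ennreal"
  assumes fin: "finite Z" and inj: "inj_on (\<lambda>x. (f x, g x)) A"
    and f: "\<And>x. x \<in> A \<Longrightarrow> f x \<in> B" and g: "\<And>x. x \<in> A \<Longrightarrow> g x \<in> Z"
    and le: "\<And>x. x \<in> A \<Longrightarrow> u x \<le> C * v (f x)"
  shows "(\<integral>\<^sup>+ x. u x \<partial>count_space A) \<le> of_nat (card Z) * (C * (\<integral>\<^sup>+ y. v y \<partial>count_space B))"
proof -
  have "(\<integral>\<^sup>+ x. u x \<partial>count_space A) = (\<integral>\<^sup>+ x. (\<Sum>z\<in>Z. u x * indicator {x. g x = z} x) \<partial>count_space A)"
  proof (rule nn_integral_cong)
    fix x assume "x \<in> space (count_space A)"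
    then have "g x \<in> Z" using g by simp
    have "(\<Sum>z\<in>Z. u x * indicator {x. g x = z} x) = (\<Sum>z\<in>Z. if z = g x then u x else 0)"
      by (intro sum.cong) (auto simp: indicator_def)
    then show "u x = (\<Sum>z\<in>Z. u x * indicator {x. g x = z} x)" using fin \<open>g x \<in> Z\<close> by simp
  qed
  also have "\<dots> = (\<Sum>z\<in>Z. \<integral>\<^sup>+ x. u x * indicator {x. g x = z} x \<partial>count_space A)"
    by (rule nn_integral_sum) simp
  also have "\<dots> \<le> (\<Sum>z\<in>Z. C * (\<integral>\<^sup>+ y. v y \<partial>count_space B))"
  proof (rule sum_mono)
    fix z assume "z \<in> Z"
    have "(\<integral>\<^sup>+ x. u x * indicator {x. g x = z} x \<partial>count_space A)
        = (\<integral>\<^sup>+ x. u x * indicator {x. g x = z} x * indicator A x \<partial>count_space UNIV)"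
      by (simp add: nn_integral_count_space_indicator)
    also have "\<dots> = (\<integral>\<^sup>+ x. u x * indicator {x \<in> A. g x = z} x \<partial>count_space UNIV)"
      by (intro nn_integral_cong) (auto simp: indicator_def)
    also have "\<dots> = (\<integral>\<^sup>+ x. u x \<partial>count_space {x \<in> A. g x = z})"
      by (simp add: nn_integral_count_space_indicator)
    also have "\<dots> \<le> C * (\<integral>\<^sup>+ y. v y \<partial>count_space B)"
    proof (rule nn_integral_count_space_inj_le[where f = f])
      show "inj_on f {x \<in> A. g x = z}" using inj by (auto simp: inj_on_def)
    qed (use f le in auto)
    finally show "(\<integral>\<^sup>+ x. u x * indicator {x. g x = z} x \<partial>count_space A) \<le> C * (\<integral>\<^sup>+ y. v y \<partial>count_space B)" .
  qed
  finally show ?thesis by simp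
qed

text \<open>The exponent \<open>\<bar>s\<bar>\<close> makes one constant serve both signs of \<open>s\<close>.\<close>

lemma powr_comparable:
  fixes s :: real and d m e :: nat
  assumes "0 < d" "d \<le> m" "m \<le> e * d"
  shows "real m powr - s \<le> (real e powr \<bar>s\<bar>) * real d powr - s"
    "real d powr - s \<le> (real e powr \<bar>s\<bar>) * real m powr - s"
proof -
  define r where "r = real m / real d"
  have r: "1 \<le> r" "r \<le> real e" and m: "real m = r * real d"
    using assms by (auto simp: r_def field_simps simp flip: of_nat_mult)
  have e1: "r powr t \<le> real e powr \<bar>s\<bar>" if "\<bar>t\<bar> = \<bar>s\<bar>" for t
  proof -
    have "r powr t \<le> r powr \<bar>s\<bar>" using r that by (intro powr_mono) auto
    also have "\<dots> \<le> real e powr \<bar>s\<bar>" using r by (intro powr_mono2) auto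
    finally show ?thesis .
  qed
  have "real m powr - s = r powr - s * real d powr - s" unfolding m using r assms by (simp add: powr_mult)
  also have "\<dots> \<le> real e powr \<bar>s\<bar> * real d powr - s" by (intro mult_right_mono e1) auto
  finally show "real m powr - s \<le> (real e powr \<bar>s\<bar>) * real d powr - s" .
  have "real d powr - s = r powr s * real m powr - s" unfolding m using r assms
    by (simp add: powr_mult powr_minus field_simps)
  also have "\<dots> \<le> real e powr \<bar>s\<bar> * real m powr - s" by (intro mult_right_mono e1) auto
  finally show "real d powr - s \<le> (real e powr \<bar>s\<bar>) * real m powr - s" .
qed

section \<open>Twist isoclasses and isoclasses of the subgroup\<close>

context twist_setting
begin

lemma rep_iso_S_iff:
  assumes \<sigma>: "\<sigma> \<in> irreps SG TS d" and \<sigma>': "\<sigma>' \<in> irreps SG TS d"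
  shows "rep_iso SG d \<sigma> \<sigma>' \<longleftrightarrow> (\<exists>T. intertwines S d d \<sigma> \<sigma>' T \<and> T \<noteq> 0\<^sub>m d d)"
proof
  assume "rep_iso SG d \<sigma> \<sigma>'"
  then obtain P where P: "P \<in> carrier (GL d)" "\<forall>g\<in>S. P * \<sigma> g = \<sigma>' g * P" unfolding rep_iso_def by auto
  obtain Q where Q: "P \<in> carrier_mat d d" "Q \<in> carrier_mat d d" "P * Q = 1\<^sub>m d" using P(1) GL_carrier_iff by blast
  have "P \<noteq> 0\<^sub>m d d"
  proof
    assume "P = 0\<^sub>m d d"
    then have "(1\<^sub>m d :: complex mat) $$ (0, 0) = (0\<^sub>m d d :: complex mat) $$ (0, 0)" using Q by simp
    then show False using irreps_SD(5)[OF \<sigma>] by simp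
  qed
  then show "\<exists>T. intertwines S d d \<sigma> \<sigma>' T \<and> T \<noteq> 0\<^sub>m d d" using P(2) Q(1) unfolding intertwines_def by blast
next
  assume "\<exists>T. intertwines S d d \<sigma> \<sigma>' T \<and> T \<noteq> 0\<^sub>m d d"
  then obtain T where T: "intertwines S d d \<sigma> \<sigma>' T" "T \<noteq> 0\<^sub>m d d" by blast
  obtain R where R: "intertwines S d d \<sigma>' \<sigma> R" "R * T = 1\<^sub>m d" "T * R = 1\<^sub>m d"
    by (rule schur_inverse[OF irreps_SD(3)[OF \<sigma>] irreps_SD(3)[OF \<sigma>'] T])
  have "T \<in> carrier (GL d)"
    unfolding GL_carrier_iff using intertwinesD(1)[OF T(1)] intertwinesD(1)[OF R(1)] R by blast
  then show "rep_iso SG d \<sigma> \<sigma>'" unfolding rep_iso_def using intertwinesD(2)[OF T(1)] by auto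
qed

lemma equiv_iso:
  "equiv (irreps SG TS d) {(\<rho>, \<sigma>) \<in> irreps SG TS d \<times> irreps SG TS d. rep_iso SG d \<rho> \<sigma>}" (is "equiv ?A ?R")
proof (rule equivI)
  show "refl_on ?A ?R"
  proof (rule refl_onI)
    fix \<rho> assume \<rho>: "\<rho> \<in> ?A"
    have "intertwines S d d \<rho> \<rho> (1\<^sub>m d)"
      unfolding intertwines_def using left_mult_one_mat[OF irreps_SD(4)[OF \<rho>]] right_mult_one_mat[OF irreps_SD(4)[OF \<rho>]] by simp
    moreover have "(1\<^sub>m d :: complex mat) \<noteq> 0\<^sub>m d d"
    proof
      assume "(1\<^sub>m d :: complex mat) = 0\<^sub>m d d"
      then have "(1\<^sub>m d :: complex mat) $$ (0, 0) = (0\<^sub>m d d :: complex mat) $$ (0, 0)" by simp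
      then show False using irreps_SD(5)[OF \<rho>] by simp
    qed
    ultimately show "(\<rho>, \<rho>) \<in> ?R" using \<rho> rep_iso_S_iff[OF \<rho> \<rho>] by auto
  qed
  show "sym ?R"
  proof (rule symI)
    fix \<rho> \<sigma> assume "(\<rho>, \<sigma>) \<in> ?R"
    then have \<rho>: "\<rho> \<in> ?A" and \<sigma>: "\<sigma> \<in> ?A" and i: "rep_iso SG d \<rho> \<sigma>" by auto
    obtain T where T: "intertwines S d d \<rho> \<sigma> T" "T \<noteq> 0\<^sub>m d d" using i rep_iso_S_iff[OF \<rho> \<sigma>] by blast
    obtain R where "intertwines S d d \<sigma> \<rho> R" "R \<noteq> 0\<^sub>m d d"
      by (rule schur_inverse[OF irreps_SD(3)[OF \<rho>] irreps_SD(3)[OF \<sigma>] T])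
    then show "(\<sigma>, \<rho>) \<in> ?R" using \<rho> \<sigma> rep_iso_S_iff[OF \<sigma> \<rho>] by auto
  qed
  show "trans ?R"
  proof (rule transI)
    fix \<rho> \<sigma> \<tau> assume "(\<rho>, \<sigma>) \<in> ?R" "(\<sigma>, \<tau>) \<in> ?R"
    then have \<rho>: "\<rho> \<in> ?A" and \<sigma>: "\<sigma> \<in> ?A" and \<tau>: "\<tau> \<in> ?A" and i: "rep_iso SG d \<rho> \<sigma>" "rep_iso SG d \<sigma> \<tau>" by auto
    obtain T where T: "intertwines S d d \<rho> \<sigma> T" "T \<noteq> 0\<^sub>m d d" using i rep_iso_S_iff[OF \<rho> \<sigma>] by blast
    obtain T' where T': "intertwines S d d \<sigma> \<tau> T'" "T' \<noteq> 0\<^sub>m d d" using i rep_iso_S_iff[OF \<sigma> \<tau>] by blast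
    have "intertwines S d d \<rho> \<tau> (T' * T)"
      by (rule intertwines_comp[OF T'(1) T(1) irreps_SD(4)[OF \<rho>] irreps_SD(4)[OF \<sigma>] irreps_SD(4)[OF \<tau>]])
    moreover have "T' * T \<noteq> 0\<^sub>m d d"
      by (rule intertwines_comp_nonzero[OF irreps_SD(3)[OF \<rho>] irreps_SD(3)[OF \<sigma>] T intertwinesD(1)[OF T'(1)] T'(2)])
    ultimately show "(\<rho>, \<tau>) \<in> ?R" using \<rho> \<tau> rep_iso_S_iff[OF \<rho> \<tau>] by auto
  qed
qed auto

lemma irreducible_conjugate:
  assumes irr: "mat_irreducible S d \<sigma>" and g: "g \<in> carrier G"
  shows "mat_irreducible S d (\<lambda>s. \<sigma> (inv g \<otimes> s \<otimes> g))"
  unfolding mat_irreducible_def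
proof (intro conjI ballI allI impI)
  show "0 < d" using mat_irreducibleD(1)[OF irr] .
  show "\<sigma> (inv g \<otimes> s \<otimes> g) \<in> carrier_mat d d" if "s \<in> S" for s
    using mat_irreducibleD(2)[OF irr S_normal[OF g that]] .
  fix W assume a: "vec_subspace d W \<and> (\<forall>s\<in>S. \<forall>w\<in>W. \<sigma> (inv g \<otimes> s \<otimes> g) *\<^sub>v w \<in> W)"
  then have W: "vec_subspace d W" by blast
  have "\<sigma> s *\<^sub>v w \<in> W" if s: "s \<in> S" and w: "w \<in> W" for s w
  proof -
    have sG: "s \<in> carrier G" using s S_subset by auto
    have "g \<otimes> s \<otimes> inv g \<in> S" using S_normal[OF inv_closed[OF g] s] g by simp
    then have "\<sigma> (inv g \<otimes> (g \<otimes> s \<otimes> inv g) \<otimes> g) *\<^sub>v w \<in> W" using a w by blast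
    moreover have "inv g \<otimes> (g \<otimes> s \<otimes> inv g) \<otimes> g = s" using g sG by (simp add: m_assoc) (simp add: m_assoc[symmetric])
    ultimately show ?thesis by simp
  qed
  then show "W = {0\<^sub>v d} \<or> W = carrier_vec d" using mat_irreducibleD(3)[OF irr W] by blast
qed

text \<open>Each twist isoclass is sent to the class of a constituent on \<open>S\<close> of one of its members.  This is
  injective because a common constituent implies twist equivalence.\<close>

lemma twist_isoclasses_to_isoclasses:
  obtains f where
    "inj_on f {(i, B). B \<in> twist_isoclasses G TG (Suc i)}"
    "\<forall>x\<in>{(i, B). B \<in> twist_isoclasses G TG (Suc i)}. f x \<in> {(j, A). A \<in> isoclasses SG TS (Suc j)} \<and>
       Suc (fst (f x)) \<le> Suc (fst x) \<and> Suc (fst x) \<le> e * Suc (fst (f x))"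
proof -
  let ?P = "{(i, B). B \<in> twist_isoclasses G TG (Suc i)}" and ?Q = "{(j, A). A \<in> isoclasses SG TS (Suc j)}"
  define good where "good = (\<lambda>x y. \<exists>\<rho> \<sigma> T. \<rho> \<in> snd x \<and> \<rho> \<in> irreps G TG (Suc (fst x)) \<and>
     \<sigma> \<in> snd y \<and> \<sigma> \<in> irreps SG TS (Suc (fst y)) \<and>
     intertwines S (Suc (fst y)) (Suc (fst x)) \<sigma> \<rho> T \<and> T \<noteq> 0\<^sub>m (Suc (fst x)) (Suc (fst y)))"
  have ex: "\<exists>y. y \<in> ?Q \<and> good x y \<and> Suc (fst y) \<le> Suc (fst x) \<and> Suc (fst x) \<le> e * Suc (fst y)" if x: "x \<in> ?P" for x
  proof -
    obtain i B where xB: "x = (i, B)" and B: "B \<in> twist_isoclasses G TG (Suc i)" using x by auto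
    obtain \<rho> where \<rho>: "\<rho> \<in> B" "\<rho> \<in> irreps G TG (Suc i)"
      using B in_quotient_imp_non_empty[OF equiv_twist] in_quotient_imp_subset[OF equiv_twist]
      unfolding twist_isoclasses_def by blast
    obtain d \<sigma> T where \<sigma>: "\<sigma> \<in> irreps SG TS d" and T: "intertwines S d (Suc i) \<sigma> \<rho> T" "T \<noteq> 0\<^sub>m (Suc i) d"
      and le: "Suc i \<le> e * d" "d \<le> Suc i" by (rule exists_constituent[OF \<rho>(2)])
    define j where "j = d - 1"
    have dj: "d = Suc j" using irreps_SD(5)[OF \<sigma>] by (simp add: j_def)
    define A where "A = {(\<rho>, \<sigma>) \<in> irreps SG TS d \<times> irreps SG TS d. rep_iso SG d \<rho> \<sigma>} `` {\<sigma>}"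
    have A: "A \<in> isoclasses SG TS d" unfolding isoclasses_def A_def by (rule quotientI[OF \<sigma>])
    have "\<sigma> \<in> A" unfolding A_def by (rule equiv_class_self[OF equiv_iso \<sigma>])
    then have "good x (j, A)" unfolding good_def xB fst_conv snd_conv using \<rho> \<sigma> T dj by blast
    then show ?thesis using A le dj xB by (intro exI[of _ "(j, A)"]) auto
  qed
  have "\<forall>x\<in>?P. \<exists>y. y \<in> ?Q \<and> good x y \<and> Suc (fst y) \<le> Suc (fst x) \<and> Suc (fst x) \<le> e * Suc (fst y)"
    by (intro ballI ex)
  from bchoice[OF this] obtain f where
    f0: "\<forall>x\<in>?P. f x \<in> ?Q \<and> good x (f x) \<and> Suc (fst (f x)) \<le> Suc (fst x) \<and> Suc (fst x) \<le> e * Suc (fst (f x))" ..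
  note f = bspec[OF f0]
  have "inj_on f ?P"
  proof (rule inj_onI)
    fix x x' assume x: "x \<in> ?P" and x': "x' \<in> ?P" and eq: "f x = f x'"
    obtain i B i' B' j A where xB: "x = (i, B)" and xB': "x' = (i', B')" and fx: "f x = (j, A)"
      by (metis surj_pair)
    have B: "B \<in> twist_isoclasses G TG (Suc i)" "B' \<in> twist_isoclasses G TG (Suc i')" using x x' xB xB' by auto
    have A: "A \<in> isoclasses SG TS (Suc j)" using f[OF x] fx by auto
    have fx': "f x' = (j, A)" using eq fx by simp
    obtain \<rho> \<sigma> T where r: "\<rho> \<in> B" "\<rho> \<in> irreps G TG (Suc i)" and s: "\<sigma> \<in> A" "\<sigma> \<in> irreps SG TS (Suc j)"
      and T: "intertwines S (Suc j) (Suc i) \<sigma> \<rho> T" "T \<noteq> 0\<^sub>m (Suc i) (Suc j)"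
      using f[OF x] unfolding good_def xB fx[unfolded xB] by auto
    obtain \<rho>' \<sigma>' T' where r': "\<rho>' \<in> B'" "\<rho>' \<in> irreps G TG (Suc i')" and s': "\<sigma>' \<in> A" "\<sigma>' \<in> irreps SG TS (Suc j)"
      and T': "intertwines S (Suc j) (Suc i') \<sigma>' \<rho>' T'" "T' \<noteq> 0\<^sub>m (Suc i') (Suc j)"
      using f[OF x'] unfolding good_def xB' fx'[unfolded xB'] by auto
    have "rep_iso SG (Suc j) \<sigma> \<sigma>'"
      using in_quotient_imp_in_rel[OF equiv_iso A[unfolded isoclasses_def], of \<sigma> \<sigma>'] s s' by auto
    then obtain I where I: "intertwines S (Suc j) (Suc j) \<sigma> \<sigma>' I" "I \<noteq> 0\<^sub>m (Suc j) (Suc j)"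
      using rep_iso_S_iff[OF s(2) s'(2)] by blast
    have "intertwines S (Suc j) (Suc i') \<sigma> \<rho>' (T' * I)"
      by (rule intertwines_comp[OF T'(1) I(1) irreps_SD(4)[OF s(2)] irreps_SD(4)[OF s'(2)] irreps_GD(6)[OF r'(2)]])
    moreover have "T' * I \<noteq> 0\<^sub>m (Suc i') (Suc j)"
      by (rule intertwines_comp_nonzero[OF irreps_SD(3)[OF s(2)] irreps_SD(3)[OF s'(2)] I intertwinesD(1)[OF T'(1)] T'(2)])
    ultimately have c: "Suc i = Suc i'" "twist_equivalent G TG (Suc i) \<rho> \<rho>'"
      using common_constituent_twist_equivalent[OF r(2) r'(2) s(2) T] by blast+
    then have ii: "i = i'" by simp
    have "(\<rho>, \<rho>') \<in> {(\<rho>, \<sigma>) \<in> irreps G TG (Suc i) \<times> irreps G TG (Suc i). twist_equivalent G TG (Suc i) \<rho> \<sigma>}"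
      using r r' c ii by auto
    then have "B = B'"
      using quotient_eqI[OF equiv_twist B(1)[unfolded twist_isoclasses_def] B(2)[folded ii, unfolded twist_isoclasses_def] r(1) r'(1)]
      by blast
    then show "x = x'" using xB xB' ii by simp
  qed
  then show thesis using f by (intro that[of f]) auto
qed

text \<open>The restrictions to \<open>S\<close> of the continuous characters of \<open>G\<close>, as functions that are \<open>undefined\<close> outside \<open>S\<close>.\<close>

definition char_restrictions :: "('g \<Rightarrow> complex) set" where
  "char_restrictions = (\<lambda>\<psi>. restrict (\<lambda>g. \<psi> g $$ (0, 0)) S) ` {\<psi>. representation G TG 1 \<psi>}"

lemma char_restrictionsI: "smooth_char \<chi> \<Longrightarrow> restrict \<chi> S \<in> char_restrictions"
  unfolding char_restrictions_def
  by (rule image_eqI[of _ _ "\<lambda>g. Matrix.mat 1 1 (\<lambda>_. \<chi> g)"]) (auto simp: rep_1_iff[unfolded One_nat_def])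

text \<open>An isoclass of \<open>S\<close> is sent to the twist isoclass of a representation of \<open>G\<close> above it.  It can be recovered
  from a fixed constituent \<open>s0\<close> of that twist isoclass, the index of the conjugating element \<open>\<gamma>\<close>, and the
  restriction to \<open>S\<close> of the twisting character; the last two are the value of \<open>h\<close>.\<close>

lemma isoclasses_to_twist_isoclasses:
  obtains f h where
    "inj_on (\<lambda>y. (f y, h y)) {(j, A). A \<in> isoclasses SG TS (Suc j)}"
    "\<forall>y\<in>{(j, A). A \<in> isoclasses SG TS (Suc j)}. f y \<in> {(i, B). B \<in> twist_isoclasses G TG (Suc i)} \<and>
       h y \<in> {..<e} \<times> char_restrictions \<and>
       Suc (fst y) \<le> Suc (fst (f y)) \<and> Suc (fst (f y)) \<le> e * Suc (fst y)"
proof -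
  let ?P = "{(i, B). B \<in> twist_isoclasses G TG (Suc i)}" and ?Q = "{(j, A). A \<in> isoclasses SG TS (Suc j)}"
  have "\<exists>\<rho> d \<sigma>. \<rho> \<in> snd x \<and> \<rho> \<in> irreps G TG (Suc (fst x)) \<and> \<sigma> \<in> irreps SG TS d \<and>
     (\<exists>T. intertwines S d (Suc (fst x)) \<sigma> \<rho> T \<and> T \<noteq> 0\<^sub>m (Suc (fst x)) d) \<and> Suc (fst x) \<le> e * d \<and> d \<le> Suc (fst x)"
    if x: "x \<in> ?P" for x
  proof -
    obtain i B where xB: "x = (i, B)" and B: "B \<in> twist_isoclasses G TG (Suc i)" using x by auto
    obtain \<rho> where \<rho>: "\<rho> \<in> B" "\<rho> \<in> irreps G TG (Suc i)"
      using B in_quotient_imp_non_empty[OF equiv_twist] in_quotient_imp_subset[OF equiv_twist]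
      unfolding twist_isoclasses_def by blast
    obtain d \<sigma> T where \<sigma>: "\<sigma> \<in> irreps SG TS d" and T: "intertwines S d (Suc i) \<sigma> \<rho> T" "T \<noteq> 0\<^sub>m (Suc i) d"
      and le: "Suc i \<le> e * d" "d \<le> Suc i" by (rule exists_constituent[OF \<rho>(2)])
    show ?thesis unfolding xB fst_conv snd_conv using \<rho> \<sigma> T le by blast
  qed
  then obtain r0 d0 s0 where
    base: "\<And>x. x \<in> ?P \<Longrightarrow> r0 x \<in> snd x \<and> r0 x \<in> irreps G TG (Suc (fst x)) \<and> s0 x \<in> irreps SG TS (d0 x) \<and>
     (\<exists>T. intertwines S (d0 x) (Suc (fst x)) (s0 x) (r0 x) T \<and> T \<noteq> 0\<^sub>m (Suc (fst x)) (d0 x)) \<and>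
     Suc (fst x) \<le> e * d0 x \<and> d0 x \<le> Suc (fst x)" by metis
  define good where "good = (\<lambda>y x k c. \<exists>\<sigma> \<chi> B. \<sigma> \<in> snd y \<and> \<sigma> \<in> irreps SG TS (Suc (fst y)) \<and> smooth_char \<chi> \<and>
     restrict \<chi> S = c \<and> d0 x = Suc (fst y) \<and>
     intertwines S (d0 x) (Suc (fst y)) (\<lambda>s. s0 x (inv (\<gamma> k) \<otimes> s \<otimes> \<gamma> k)) (\<lambda>s. \<chi> s \<cdot>\<^sub>m \<sigma> s) B \<and>
     B \<noteq> 0\<^sub>m (Suc (fst y)) (d0 x))"
  have ex: "\<exists>x k c. x \<in> ?P \<and> k < e \<and> c \<in> char_restrictions \<and> good y x k c" if y: "y \<in> ?Q" for y
  proof -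
    obtain j A where yA: "y = (j, A)" and A: "A \<in> isoclasses SG TS (Suc j)" using y by auto
    obtain \<sigma> where \<sigma>: "\<sigma> \<in> A" "\<sigma> \<in> irreps SG TS (Suc j)"
      using A in_quotient_imp_non_empty[OF equiv_iso] in_quotient_imp_subset[OF equiv_iso]
      unfolding isoclasses_def by blast
    obtain m \<rho> T where \<rho>: "\<rho> \<in> irreps G TG m" and T: "intertwines S m (Suc j) \<rho> \<sigma> T" "T \<noteq> 0\<^sub>m (Suc j) m"
      by (rule exists_over[OF \<sigma>(2)])
    define i where "i = m - 1"
    have mi: "m = Suc i" using irreps_GD(5)[OF \<rho>] by (simp add: i_def)
    define B where "B = {(\<rho>, \<sigma>) \<in> irreps G TG m \<times> irreps G TG m. twist_equivalent G TG m \<rho> \<sigma>} `` {\<rho>}"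
    have B: "B \<in> twist_isoclasses G TG m" unfolding twist_isoclasses_def B_def by (rule quotientI[OF \<rho>])
    have "\<rho> \<in> B" unfolding B_def by (rule equiv_class_self[OF equiv_twist \<rho>])
    define x where "x = (i, B)"
    have x: "x \<in> ?P" using B mi by (simp add: x_def)
    have fx: "Suc (fst x) = m" using mi by (simp add: x_def)
    have r0: "r0 x \<in> B" "r0 x \<in> irreps G TG m" and s0: "s0 x \<in> irreps SG TS (d0 x)"
      using base[OF x] fx by (auto simp: x_def)
    obtain T0 where T0: "intertwines S (d0 x) m (s0 x) (r0 x) T0" "T0 \<noteq> 0\<^sub>m m (d0 x)" using base[OF x] fx by auto
    have "twist_equivalent G TG m (r0 x) \<rho>"
      using in_quotient_imp_in_rel[OF equiv_twist B[unfolded twist_isoclasses_def], of "r0 x" \<rho>] r0 \<open>\<rho> \<in> B\<close> by auto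
    then obtain \<chi> P where \<chi>: "smooth_char \<chi>" and P: "P \<in> carrier (GL m)"
      and eq: "\<forall>g\<in>carrier G. P * r0 x g = \<chi> g \<cdot>\<^sub>m (\<rho> g * P)"
      by (rule twist_equivalentE[OF _ irreps_GD(4)[OF \<rho>]])
    obtain P' where Pc: "P \<in> carrier_mat m m" "P' \<in> carrier_mat m m" "P * P' = 1\<^sub>m m" using P GL_carrier_iff by blast
    note Tc = intertwinesD(1)[OF T(1)]
    note \<sigma>c = irreps_SD(4)[OF \<sigma>(2)]
    have TP: "intertwines S m (Suc j) (r0 x) (\<lambda>s. \<chi> s \<cdot>\<^sub>m \<sigma> s) (T * P)"
      unfolding intertwines_def
    proof (intro conjI ballI)
      show "T * P \<in> carrier_mat (Suc j) m" using Tc Pc by simp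
      fix s assume s: "s \<in> S"
      have sG: "s \<in> carrier G" using s S_subset by auto
      note c = irreps_GD(4)[OF \<rho> sG] irreps_GD(4)[OF r0(2) sG]
      have "T * P * r0 x s = T * (P * r0 x s)" by (rule assoc_mult_mat[OF Tc Pc(1) c(2)])
      also have "\<dots> = T * (\<chi> s \<cdot>\<^sub>m (\<rho> s * P))" using eq sG by simp
      also have "\<dots> = \<chi> s \<cdot>\<^sub>m (T * (\<rho> s * P))" by (rule mult_smult_distrib[OF Tc mult_carrier_mat[OF c(1) Pc(1)]])
      also have "T * (\<rho> s * P) = T * \<rho> s * P" by (rule assoc_mult_mat[OF Tc c(1) Pc(1), symmetric])
      also have "T * \<rho> s = \<sigma> s * T" by (rule intertwinesD(2)[OF T(1) s])
      also have "\<sigma> s * T * P = \<sigma> s * (T * P)" by (rule assoc_mult_mat[OF \<sigma>c[OF s] Tc Pc(1)])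
      also have "\<chi> s \<cdot>\<^sub>m \<dots> = \<chi> s \<cdot>\<^sub>m \<sigma> s * (T * P)"
        by (rule mult_smult_assoc_mat[OF \<sigma>c[OF s] mult_carrier_mat[OF Tc Pc(1)], symmetric])
      finally show "T * P * r0 x s = \<chi> s \<cdot>\<^sub>m \<sigma> s * (T * P)" .
    qed
    have TPnz: "T * P \<noteq> 0\<^sub>m (Suc j) m"
    proof
      assume 0: "T * P = 0\<^sub>m (Suc j) m"
      have "T = T * (P * P')" unfolding Pc(3) using Tc by simp
      also have "\<dots> = T * P * P'" by (rule assoc_mult_mat[OF Tc Pc(1,2), symmetric])
      also have "\<dots> = 0\<^sub>m (Suc j) m" unfolding 0 using Pc by simp
      finally show False using T(2) by simp
    qed
    have \<chi>\<sigma>c: "\<And>s. s \<in> S \<Longrightarrow> \<chi> s \<cdot>\<^sub>m \<sigma> s \<in> carrier_mat (Suc j) (Suc j)" using \<sigma>c by simp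
    have "\<exists>k<e. \<exists>D. D \<noteq> 0\<^sub>m (Suc j) (d0 x) \<and>
       intertwines S (d0 x) (Suc j) (\<lambda>s. s0 x (inv (\<gamma> k) \<otimes> s \<otimes> \<gamma> k)) (\<lambda>s. \<chi> s \<cdot>\<^sub>m \<sigma> s) D"
      by (rule constituents_conjugate[OF irreps_GD(1)[OF r0(2)] irreps_GD(3)[OF r0(2)] S_subgroup S_normal \<gamma> decomp
            irreps_SD(4)[OF s0] T0 \<chi>\<sigma>c TP TPnz])
    then obtain k D where k: "k < e" and D: "D \<noteq> 0\<^sub>m (Suc j) (d0 x)"
      "intertwines S (d0 x) (Suc j) (\<lambda>s. s0 x (inv (\<gamma> k) \<otimes> s \<otimes> \<gamma> k)) (\<lambda>s. \<chi> s \<cdot>\<^sub>m \<sigma> s) D" by blast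
    have "\<chi> s \<noteq> 0" if "s \<in> S" for s using smooth_char_nonzero[OF \<chi>] that S_subset by auto
    then have irr: "mat_irreducible S (Suc j) (\<lambda>s. \<chi> s \<cdot>\<^sub>m \<sigma> s)" by (rule mat_irreducible_smult[OF irreps_SD(3)[OF \<sigma>(2)]])
    have "d0 x = Suc j" by (rule schur_iso(1)[OF irreducible_conjugate[OF irreps_SD(3)[OF s0] \<gamma>[OF k]] irr D(2,1)])
    then have "good y x k (restrict \<chi> S)" unfolding good_def yA fst_conv snd_conv using \<sigma> \<chi> D by blast
    then show ?thesis using x k char_restrictionsI[OF \<chi>] by blast
  qed
  have "\<exists>z. fst z \<in> ?P \<and> fst (snd z) < e \<and> snd (snd z) \<in> char_restrictions \<and> good y (fst z) (fst (snd z)) (snd (snd z))"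
    if "y \<in> ?Q" for y
  proof -
    obtain x k c where "x \<in> ?P" "k < e" "c \<in> char_restrictions" "good y x k c" using ex[OF \<open>y \<in> ?Q\<close>] by blast
    then show ?thesis by (intro exI[of _ "(x, k, c)"]) simp
  qed
  then obtain F where F: "\<And>y. y \<in> ?Q \<Longrightarrow> fst (F y) \<in> ?P \<and> fst (snd (F y)) < e \<and> snd (snd (F y)) \<in> char_restrictions \<and>
     good y (fst (F y)) (fst (snd (F y))) (snd (snd (F y)))" by metis
  have "inj_on F ?Q"
  proof (rule inj_onI)
    fix y y' assume y: "y \<in> ?Q" and y': "y' \<in> ?Q" and eq: "F y = F y'"
    obtain x k c where Fy: "F y = (x, k, c)" by (metis surj_pair)
    have x: "x \<in> ?P" and k: "k < e" using F[OF y] Fy by auto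
    have g: "good y x k c" "good y' x k c" using F[OF y] F[OF y'] Fy eq by auto
    obtain j A j' A' where yA: "y = (j, A)" and yA': "y' = (j', A')" by (metis surj_pair)
    have A: "A \<in> isoclasses SG TS (Suc j)" "A' \<in> isoclasses SG TS (Suc j')" using y y' yA yA' by auto
    define \<tau> where "\<tau> = (\<lambda>s. s0 x (inv (\<gamma> k) \<otimes> s \<otimes> \<gamma> k))"
    obtain \<sigma> \<chi> B where s: "\<sigma> \<in> A" "\<sigma> \<in> irreps SG TS (Suc j)" and \<chi>: "smooth_char \<chi>" "restrict \<chi> S = c" and d: "d0 x = Suc j"
      and B: "intertwines S (d0 x) (Suc j) \<tau> (\<lambda>s. \<chi> s \<cdot>\<^sub>m \<sigma> s) B" "B \<noteq> 0\<^sub>m (Suc j) (d0 x)"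
      using g(1) unfolding good_def yA fst_conv snd_conv \<tau>_def by blast
    obtain \<sigma>' \<chi>' B' where s': "\<sigma>' \<in> A'" "\<sigma>' \<in> irreps SG TS (Suc j')" and \<chi>': "smooth_char \<chi>'" "restrict \<chi>' S = c" and d': "d0 x = Suc j'"
      and B': "intertwines S (d0 x) (Suc j') \<tau> (\<lambda>s. \<chi>' s \<cdot>\<^sub>m \<sigma>' s) B'" "B' \<noteq> 0\<^sub>m (Suc j') (d0 x)"
      using g(2) unfolding good_def yA' fst_conv snd_conv \<tau>_def by blast
    have jj: "j' = j" using d d' by simp
    have s0: "s0 x \<in> irreps SG TS (d0 x)" using base[OF x] by blast
    have irr\<tau>: "mat_irreducible S (d0 x) \<tau>" unfolding \<tau>_def by (rule irreducible_conjugate[OF irreps_SD(3)[OF s0] \<gamma>[OF k]])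
    have \<chi>nz: "\<chi> t \<noteq> 0" if "t \<in> S" for t using smooth_char_nonzero[OF \<chi>(1)] that S_subset by auto
    have \<chi>eq: "\<chi>' t = \<chi> t" if "t \<in> S" for t using \<chi>(2) \<chi>'(2) that by (metis restrict_apply')
    have irr: "mat_irreducible S (Suc j) (\<lambda>s. \<chi> s \<cdot>\<^sub>m \<sigma> s)" using \<chi>nz by (rule mat_irreducible_smult[OF irreps_SD(3)[OF s(2)]])
    obtain R where R: "intertwines S (Suc j) (d0 x) (\<lambda>s. \<chi> s \<cdot>\<^sub>m \<sigma> s) \<tau> R" "R \<noteq> 0\<^sub>m (d0 x) (Suc j)"
      by (rule schur_inverse[OF irr\<tau> irr B])
    note \<sigma>c = irreps_SD(4)[OF s(2)] and \<sigma>c' = irreps_SD(4)[OF s'(2), unfolded jj]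
    have BR: "intertwines S (Suc j) (Suc j) (\<lambda>s. \<chi> s \<cdot>\<^sub>m \<sigma> s) (\<lambda>s. \<chi>' s \<cdot>\<^sub>m \<sigma>' s) (B' * R)"
      by (rule intertwines_comp[OF B'(1)[unfolded jj] R(1)]) (use \<sigma>c \<sigma>c' mat_irreducibleD(2)[OF irr\<tau>] in auto)
    have BRnz: "B' * R \<noteq> 0\<^sub>m (Suc j) (Suc j)"
      by (rule intertwines_comp_nonzero[OF irr irr\<tau> R intertwinesD(1)[OF B'(1)[unfolded jj]] B'(2)[unfolded jj]])
    note BRc = intertwinesD(1)[OF BR]
    have "B' * R * \<sigma> t = \<sigma>' t * (B' * R)" if t: "t \<in> S" for t
    proof -
      have "\<chi> t \<cdot>\<^sub>m (B' * R * \<sigma> t) = \<chi> t \<cdot>\<^sub>m (\<sigma>' t * (B' * R))"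
        using intertwinesD(2)[OF BR t] mult_smult_distrib[OF BRc \<sigma>c[OF t]] mult_smult_assoc_mat[OF \<sigma>c'[OF t] BRc] \<chi>eq[OF t] by simp
      then have "inverse (\<chi> t) \<cdot>\<^sub>m (\<chi> t \<cdot>\<^sub>m (B' * R * \<sigma> t)) = inverse (\<chi> t) \<cdot>\<^sub>m (\<chi> t \<cdot>\<^sub>m (\<sigma>' t * (B' * R)))" by simp
      then show ?thesis unfolding smult_smult_mat using \<chi>nz[OF t] by (simp add: one_smult_mat)
    qed
    then have "intertwines S (Suc j) (Suc j) \<sigma> \<sigma>' (B' * R)" using BRc unfolding intertwines_def by blast
    then have "rep_iso SG (Suc j) \<sigma> \<sigma>'" using rep_iso_S_iff[OF s(2) s'(2)[unfolded jj]] BRnz by blast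
    then have "(\<sigma>, \<sigma>') \<in> {(\<rho>, \<sigma>) \<in> irreps SG TS (Suc j) \<times> irreps SG TS (Suc j). rep_iso SG (Suc j) \<rho> \<sigma>}"
      using s s' jj by auto
    then have "A = A'"
      using quotient_eqI[OF equiv_iso A(1)[unfolded isoclasses_def] A(2)[unfolded jj isoclasses_def] s(1) s'(1)] by blast
    then show "y = y'" using yA yA' jj by simp
  qed
  then have "inj_on (\<lambda>y. (fst (F y), snd (F y))) ?Q" by simp
  moreover have "\<forall>y\<in>?Q. fst (F y) \<in> ?P \<and> snd (F y) \<in> {..<e} \<times> char_restrictions \<and>
       Suc (fst y) \<le> Suc (fst (fst (F y))) \<and> Suc (fst (fst (F y))) \<le> e * Suc (fst y)"
  proof
    fix y assume y: "y \<in> ?Q"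
    have F1: "fst (F y) \<in> ?P" by (rule F[OF y, THEN conjunct1])
    have F2: "snd (F y) \<in> {..<e} \<times> char_restrictions"
      using F[OF y, THEN conjunct2, THEN conjunct1] F[OF y, THEN conjunct2, THEN conjunct2, THEN conjunct1]
      by (simp add: mem_Times_iff)
    have "good y (fst (F y)) (fst (snd (F y))) (snd (snd (F y)))"
      by (rule F[OF y, THEN conjunct2, THEN conjunct2, THEN conjunct2])
    then have "d0 (fst (F y)) = Suc (fst y)" unfolding good_def by (elim exE conjE)
    moreover have "Suc (fst (fst (F y))) \<le> e * d0 (fst (F y))" "d0 (fst (F y)) \<le> Suc (fst (fst (F y)))" using base[OF F1] by blast+
    ultimately show "fst (F y) \<in> ?P \<and> snd (F y) \<in> {..<e} \<times> char_restrictions \<and>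
       Suc (fst y) \<le> Suc (fst (fst (F y))) \<and> Suc (fst (fst (F y))) \<le> e * Suc (fst y)"
      using F1 F2 by simp
  qed
  ultimately show thesis by (rule that)
qed

theorem twist_zeta_finite_iff: "twist_zeta G TG s < \<infinity> \<longleftrightarrow> rep_zeta SG TS s < \<infinity>"
proof -
  let ?P = "{(i, B). B \<in> twist_isoclasses G TG (Suc i)}" and ?Q = "{(j, A). A \<in> isoclasses SG TS (Suc j)}"
  define w where "w = (\<lambda>x :: nat \<times> ('g \<Rightarrow> complex mat) set. ennreal (real (Suc (fst x)) powr - s))"
  define C where "C = ennreal (real e powr \<bar>s\<bar>)"
  have tz: "twist_zeta G TG s = (\<integral>\<^sup>+ x. w x \<partial>count_space ?P)"
    unfolding twist_zeta_def dirichlet_series_num_classes w_def ..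
  have rz: "rep_zeta SG TS s = (\<integral>\<^sup>+ x. w x \<partial>count_space ?Q)"
    unfolding rep_zeta_def dirichlet_series_num_classes w_def ..
  have w1: "w x \<le> C * w y" and w2: "w y \<le> C * w x"
    if "Suc (fst y) \<le> Suc (fst x)" "Suc (fst x) \<le> e * Suc (fst y)" for x y
    using powr_comparable[OF zero_less_Suc that, of s] unfolding w_def C_def
    by (simp_all add: ennreal_mult'[symmetric] ennreal_leI)
  obtain f where f: "inj_on f ?P" "\<forall>x\<in>?P. f x \<in> ?Q \<and> Suc (fst (f x)) \<le> Suc (fst x) \<and> Suc (fst x) \<le> e * Suc (fst (f x))"
    by (rule twist_isoclasses_to_isoclasses)
  have f': "f x \<in> ?Q" "w x \<le> C * w (f x)" if "x \<in> ?P" for x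
  proof -
    note a = bspec[OF f(2) that]
    show "f x \<in> ?Q" by (rule conjunct1[OF a])
    show "w x \<le> C * w (f x)" by (rule w1[OF conjunct1[OF conjunct2[OF a]] conjunct2[OF conjunct2[OF a]]])
  qed
  have 1: "twist_zeta G TG s \<le> C * rep_zeta SG TS s"
    unfolding tz rz by (rule nn_integral_count_space_inj_le[where u = w and v = w, OF f(1) f'])
  obtain f h where fh: "inj_on (\<lambda>y. (f y, h y)) ?Q"
    "\<forall>y\<in>?Q. f y \<in> ?P \<and> h y \<in> {..<e} \<times> char_restrictions \<and> Suc (fst y) \<le> Suc (fst (f y)) \<and> Suc (fst (f y)) \<le> e * Suc (fst y)"
    by (rule isoclasses_to_twist_isoclasses)
  have fh': "f y \<in> ?P" "h y \<in> {..<e} \<times> char_restrictions" "w y \<le> C * w (f y)" if "y \<in> ?Q" for y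
  proof -
    note a = bspec[OF fh(2) that]
    show "f y \<in> ?P" by (rule conjunct1[OF a])
    show "h y \<in> {..<e} \<times> char_restrictions" by (rule conjunct1[OF conjunct2[OF a]])
    show "w y \<le> C * w (f y)"
      by (rule w2[OF conjunct1[OF conjunct2[OF conjunct2[OF a]]] conjunct2[OF conjunct2[OF conjunct2[OF a]]]])
  qed
  have fin: "finite ({..<e} \<times> char_restrictions)" using finite_chars unfolding char_restrictions_def by simp
  have 2: "rep_zeta SG TS s \<le> of_nat (card ({..<e} \<times> char_restrictions)) * (C * twist_zeta G TG s)"
    unfolding tz rz by (rule nn_integral_count_space_fibres_le[where u = w and v = w, OF fin fh(1) fh'])
  have Cf: "C < \<infinity>" unfolding C_def by simp
  show ?thesis
  proof
    assume "twist_zeta G TG s < \<infinity>"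
    then have "of_nat (card ({..<e} \<times> char_restrictions)) * (C * twist_zeta G TG s) < \<infinity>"
      using Cf by (simp add: ennreal_mult_less_top of_nat_less_top)
    then show "rep_zeta SG TS s < \<infinity>" using 2 by (rule le_less_trans[rotated])
  next
    assume "rep_zeta SG TS s < \<infinity>"
    then have "C * rep_zeta SG TS s < \<infinity>" using Cf by (simp add: ennreal_mult_less_top)
    then show "twist_zeta G TG s < \<infinity>" using 1 by (rule le_less_trans[rotated])
  qed
qed

end

section \<open>Complete discrete valuation rings\<close>

text \<open>A complete discrete valuation ring with finite residue field, described by a uniformizer \<open>\<pi>\<close>: the
  elements that \<open>\<pi>\<close> does not divide are units, the \<open>\<pi>\<close>-adic topology is separated and complete, and there are finitely many residue classes
  modulo \<open>\<pi>\<close>.\<close>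

locale complete_dvr =
  fixes \<pi> :: "'a :: idom"
  assumes uniformizer_nonzero: "\<pi> \<noteq> 0"
    and uniformizer_nonunit: "\<not> \<pi> dvd 1"
    and unit: "\<not> \<pi> dvd x \<Longrightarrow> x dvd 1"
    and separated: "(\<And>k. \<pi> ^ k dvd x) \<Longrightarrow> x = 0"
    and finite_residue_field: "finite (range (\<lambda>x. {y. \<pi> dvd y - x}))"
    and complete: "\<And>s :: nat \<Rightarrow> 'a. (\<And>k. \<exists>N. \<forall>i\<ge>N. \<forall>j\<ge>N. \<pi> ^ k dvd s i - s j) \<Longrightarrow> \<exists>x. \<forall>k. \<exists>N. \<forall>i\<ge>N. \<pi> ^ k dvd s i - x"

lemma ideal_power_principal:
  fixes \<pi> :: "'a :: idom"
  shows "ideal_power (class_ring :: 'a ring) {x. \<pi> dvd x} k = {x. \<pi> ^ k dvd x}"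
proof (induction k)
  case (Suc k)
  have "x \<in> ideal_prod class_ring {x. \<pi> dvd x} {x. \<pi> ^ k dvd x} \<longleftrightarrow> \<pi> ^ Suc k dvd x" for x
  proof
    assume "x \<in> ideal_prod class_ring {x. \<pi> dvd x} {x. \<pi> ^ k dvd x}"
    then show "\<pi> ^ Suc k dvd x"
      by (induction rule: ideal_prod.induct) (auto simp: mult_dvd_mono dvd_add)
  next
    assume "\<pi> ^ Suc k dvd x"
    then obtain y where "x = \<pi> ^ Suc k * y" by (rule dvdE)
    then have "x = \<pi> * (\<pi> ^ k * y)" by (simp add: mult.assoc)
    then show "x \<in> ideal_prod class_ring {x. \<pi> dvd x} {x. \<pi> ^ k dvd x}"
      using ideal_prod.prod[of \<pi> "{x. \<pi> dvd x}" "\<pi> ^ k * y" "{x. \<pi> ^ k dvd x}" "class_ring :: 'a ring"] by simp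
  qed
  then show ?case using Suc by auto
qed auto

text \<open>The uniformizer generates the maximal ideal.  Elements outside it are units because an irreducible divisor
  would generate a second nonzero prime ideal; separatedness holds as the intersection \<open>I\<close> of all powers
  is principal and satisfies \<open>I = \<pi> I\<close>.\<close>

lemma complete_dvr_exists:
  assumes "complete_dvr_finite_residue_field (class_ring :: 'a :: idom ring)"
  obtains \<pi> :: "'a :: idom" where "complete_dvr \<pi>" "dvr_max_ideal (class_ring :: ('a :: idom) ring) = {x. \<pi> dvd x}"
proof -
  define R where "R = (class_ring :: 'a ring)"
  have Rs: "carrier R = UNIV" "monoid.mult R = (*)" "ring.add R = (+)" "\<one>\<^bsub>R\<^esub> = 1" "\<zero>\<^bsub>R\<^esub> = 0" by (auto simp: R_def)
  have minus: "a_minus R = (-)" by (simp add: R_def class_ring_simps)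
  have "principal_domain R" and ex1: "\<exists>!P. primeideal P R \<and> P \<noteq> {\<zero>\<^bsub>R\<^esub>}"
    and ac: "adically_complete R (dvr_max_ideal R)" and fin: "finite (carrier (R Quot dvr_max_ideal R))"
    using assms unfolding complete_dvr_finite_residue_field_def discrete_valuation_ring_def R_def by auto
  then interpret R: principal_domain R by blast
  define P where "P = dvr_max_ideal R"
  have P: "primeideal P R" "P \<noteq> {0}"
    using theI'[OF ex1] unfolding P_def dvr_max_ideal_def Rs by auto
  have uniq: "Q = P" if "primeideal Q R" "Q \<noteq> {0}" for Q using ex1 P that unfolding Rs by blast
  interpret P: primeideal P R by (rule P(1))
  have cg: "cgenideal R a = {x. a dvd x}" for a :: 'a
    unfolding cgenideal_def Rs by (auto simp: dvd_def mult.commute)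
  obtain \<pi> where \<pi>: "P = {x. \<pi> dvd x}" using R.exists_gen[OF P.is_ideal] cg by auto
  have nz: "\<pi> \<noteq> 0" using P(2) \<pi> by auto
  have nu: "\<not> \<pi> dvd 1"
  proof
    assume "\<pi> dvd 1"
    then have "P = UNIV" using \<pi> by (auto intro: dvd_trans)
    then show False using P.I_notcarr Rs by simp
  qed
  have un: "x dvd 1" if x: "\<not> \<pi> dvd x" for x
  proof (rule ccontr)
    assume nx: "\<not> x dvd 1"
    have x0: "x \<noteq> 0" using x by auto
    have xU: "x \<notin> Units R" using nx unfolding Units_def Rs by (auto simp: dvd_def mult.commute)
    have xc: "x \<in> carrier R - {\<zero>\<^bsub>R\<^esub>}" using x0 Rs by simp
    obtain p where p: "p \<in> carrier R" "ring_irreducible\<^bsub>R\<^esub> p" "p divides\<^bsub>R\<^esub> x"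
      by (rule R.exists_irreducible_divisor[OF xc xU])
    have "primeideal (cgenideal R p) R"
      by (rule R.maximalideal_prime[OF R.irreducible_imp_maximalideal[OF p(1,2)]])
    moreover have "cgenideal R p \<noteq> {0}"
    proof
      assume "cgenideal R p = {0}"
      moreover have "p \<in> cgenideal R p" unfolding cg by simp
      ultimately have "p = 0" by simp
      then show False using p(2) unfolding ring_irreducible_def Rs by simp
    qed
    ultimately have "{x. p dvd x} = P" using uniq cg by metis
    moreover have "p dvd x" using p(3) unfolding factor_def Rs by (auto simp: dvd_def)
    ultimately show False using x \<pi> by auto
  qed
  have sep: "x = 0" if x: "\<And>k. \<pi> ^ k dvd x" for x
  proof -
    define I where "I = {x. \<forall>k. \<pi> ^ k dvd x}"
    have "ideal I R"
    proof (rule idealI[OF R.ring_axioms])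
      have ainv: "m_inv (add_monoid R) a = - a" for a
      proof -
        have "a_inv R a = - a" by (simp add: R_def class_ring_simps)
        then show ?thesis by (simp add: a_inv_def)
      qed
      show "subgroup I (add_monoid R)"
      proof (rule group.subgroupI[OF R.add.is_group])
        show "I \<subseteq> carrier (add_monoid R)" by (simp add: Rs)
        show "I \<noteq> {}" unfolding I_def by (auto intro: exI[of _ 0])
        show "m_inv (add_monoid R) a \<in> I" if "a \<in> I" for a using that unfolding ainv I_def by simp
        show "a \<otimes>\<^bsub>add_monoid R\<^esub> b \<in> I" if "a \<in> I" "b \<in> I" for a b
          using that by (simp add: I_def Rs dvd_add)
      qed
    qed (auto simp: I_def Rs intro: dvd_mult dvd_mult2)
    then obtain a where a: "I = {x. a dvd x}" using R.exists_gen cg by metis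
    have "a \<in> I" using a by simp
    then obtain b where b: "a = \<pi> * b" unfolding I_def by (metis (mono_tags) dvd_def mem_Collect_eq power_one_right)
    have "\<pi> ^ k dvd b" for k
    proof -
      have "\<pi> ^ Suc k dvd a" using \<open>a \<in> I\<close> unfolding I_def by blast
      then show ?thesis using nz unfolding b by simp
    qed
    then have "a dvd b" using a unfolding I_def by auto
    then obtain c where "b = \<pi> * b * c" using b by (auto simp: dvd_def)
    then have "b * (1 - \<pi> * c) = 0" by (simp add: algebra_simps)
    moreover have "1 - \<pi> * c \<noteq> 0" using nu by (metis dvd_triv_left right_minus_eq)
    ultimately have "a = 0" using b by simp
    moreover have "x \<in> I" using x unfolding I_def by simp
    ultimately show ?thesis using a by simp
  qed
  have rf: "finite (range (\<lambda>x. {y. \<pi> dvd y - x}))"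
  proof -
    have "range (\<lambda>x. {y. \<pi> dvd y - x}) \<subseteq> carrier (R Quot P)"
    proof
      fix C assume "C \<in> range (\<lambda>x. {y. \<pi> dvd y - x})"
      then obtain x where C: "C = {y. \<pi> dvd y - x}" by auto
      have "C = P +>\<^bsub>R\<^esub> x"
      proof -
        have "y \<in> P +>\<^bsub>R\<^esub> x \<longleftrightarrow> \<pi> dvd y - x" for y
          unfolding a_r_coset_def r_coset_def \<pi> by (auto simp: Rs)
        then show ?thesis using C by auto
      qed
      then show "C \<in> carrier (R Quot P)" unfolding FactRing_def A_RCOSETS_def RCOSETS_def a_r_coset_def
        by (auto simp: Rs)
    qed
    then show ?thesis using fin P_def finite_subset by blast
  qed
  have "complete_dvr \<pi>"
  proof
    fix s :: "nat \<Rightarrow> 'a" assume s: "\<And>k. \<exists>N. \<forall>i\<ge>N. \<forall>j\<ge>N. \<pi> ^ k dvd s i - s j"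
    have ip: "ideal_power R P k = {x. \<pi> ^ k dvd x}" for k unfolding R_def \<pi> by (rule ideal_power_principal)
    show "\<exists>x. \<forall>k. \<exists>N. \<forall>i\<ge>N. \<pi> ^ k dvd s i - x"
      using ac[folded P_def, unfolded adically_complete_def ip minus Rs, rule_format, of s] s by auto
  qed (use nz nu un sep rf in auto)
  then show thesis using that \<pi> unfolding P_def R_def by blast
qed

context complete_dvr
begin

lemma pow_nonzero: "\<pi> ^ k \<noteq> 0" using uniformizer_nonzero by simp

lemma pow_dvd_pow_iff: "\<pi> ^ k dvd \<pi> ^ l \<longleftrightarrow> k \<le> l"
proof
  show "\<pi> ^ k dvd \<pi> ^ l" if "k \<le> l" using that by (rule le_imp_power_dvd)
  show "k \<le> l" if d: "\<pi> ^ k dvd \<pi> ^ l"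
  proof (rule ccontr)
    assume "\<not> k \<le> l"
    then have "\<pi> ^ Suc l dvd \<pi> ^ l" using d by (meson dvd_trans le_imp_power_dvd not_less_eq_eq)
    then have "\<pi> ^ l * \<pi> dvd \<pi> ^ l * 1" by (simp add: mult.commute)
    then show False using uniformizer_nonunit pow_nonzero[of l] by (simp only: dvd_mult_cancel_left) simp
  qed
qed

text \<open>Dividing out \<open>\<pi>\<close> as often as possible leaves a unit.\<close>

lemma factorization:
  assumes "x \<noteq> 0"
  obtains k u where "x = \<pi> ^ k * u" "u dvd 1"
proof -
  obtain k where k: "\<not> \<pi> ^ k dvd x" using separated assms by blast
  define m where "m = (LEAST k. \<not> \<pi> ^ k dvd x)"
  have m: "\<not> \<pi> ^ m dvd x" unfolding m_def using k by (rule LeastI)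
  then have "m \<noteq> 0" by (metis one_dvd power_0)
  then obtain j where j: "m = Suc j" by (cases m) auto
  have "\<pi> ^ j dvd x" using not_less_Least[of j "\<lambda>k. \<not> \<pi> ^ k dvd x"] j unfolding m_def[symmetric] by auto
  then obtain u where u: "x = \<pi> ^ j * u" by auto
  have "\<not> \<pi> dvd u"
  proof
    assume "\<pi> dvd u"
    then have "\<pi> ^ m dvd x" unfolding u j by (auto simp: dvd_def mult.assoc mult.commute)
    then show False using m by simp
  qed
  then show thesis using that u unit by blast
qed

lemma dvd_power_of_not_dvd:
  assumes "\<not> \<pi> ^ k dvd x" "k > 0"
  shows "x dvd \<pi> ^ (k - 1)"
proof -
  have "x \<noteq> 0" using assms by auto
  then obtain j u where x: "x = \<pi> ^ j * u" and u: "u dvd 1" by (rule factorization)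
  have "j \<le> k - 1"
  proof (rule ccontr)
    assume "\<not> j \<le> k - 1"
    then have "\<pi> ^ k dvd x" unfolding x by (intro dvd_mult2 le_imp_power_dvd) auto
    then show False using assms by simp
  qed
  then have "\<pi> ^ j * u dvd \<pi> ^ (k - 1) * 1" using u by (intro mult_dvd_mono le_imp_power_dvd)
  then show ?thesis using x by simp
qed

subsection \<open>Residue classes\<close>

text \<open>The residue class of \<open>x\<close> modulo \<open>\<pi>\<^sup>k\<close>.\<close>

definition residue :: "nat \<Rightarrow> 'a \<Rightarrow> 'a set" where
  "residue k x = {y. \<pi> ^ k dvd y - x}"

text \<open>The order of \<open>O / \<pi>\<^sup>k\<close>.\<close>

definition residues_card :: "nat \<Rightarrow> nat" where
  "residues_card k = card (range (residue k))"

lemma residue_eq_iff: "residue k x = residue k y \<longleftrightarrow> \<pi> ^ k dvd x - y"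
proof
  assume "residue k x = residue k y"
  moreover have "x \<in> residue k x" by (simp add: residue_def)
  ultimately show "\<pi> ^ k dvd x - y" by (auto simp: residue_def)
next
  assume d: "\<pi> ^ k dvd x - y"
  have "\<pi> ^ k dvd z - x \<longleftrightarrow> \<pi> ^ k dvd z - y" for z
    using dvd_add[of "\<pi> ^ k" "z - x" "x - y"] dvd_diff[of "\<pi> ^ k" "z - y" "x - y"] d by auto
  then show "residue k x = residue k y" by (auto simp: residue_def)
qed

lemma residues_card_0: "residues_card 0 = 1"
proof -
  have "range (residue 0) = {UNIV}" by (auto simp: residue_def)
  then show ?thesis unfolding residues_card_def by simp
qed

lemma residue_reps:
  obtains r where "\<forall>x. residue k (r (residue k x)) = residue k x"
proof -
  have "\<forall>x. residue k (inv_into UNIV (residue k) (residue k x)) = residue k x"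
    by (simp add: f_inv_into_f)
  then show thesis by (rule that)
qed

text \<open>Residues modulo \<open>\<pi>\<^sup>j\<^sup>+\<^sup>k\<close> are represented by \<open>r + \<pi>\<^sup>j t\<close> with \<open>r\<close> modulo \<open>\<pi>\<^sup>j\<close> and \<open>t\<close> modulo \<open>\<pi>\<^sup>k\<close>.\<close>

lemma residue_add_surj:
  assumes "finite (range (residue j))" "finite (range (residue k))"
  shows "finite (range (residue (j + k)))" "card (range (residue (j + k))) \<le> card (range (residue j)) * card (range (residue k))"
proof -
  obtain r where r: "\<forall>x. residue j (r (residue j x)) = residue j x" by (rule residue_reps)
  obtain t where t: "\<forall>x. residue k (t (residue k x)) = residue k x" by (rule residue_reps)
  define F where "F = (\<lambda>(A, B). residue (j + k) (r A + \<pi> ^ j * t B))"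
  have "range (residue (j + k)) \<subseteq> F ` (range (residue j) \<times> range (residue k))"
  proof clarify
    fix x
    have "\<pi> ^ j dvd x - r (residue j x)" using r residue_eq_iff by metis
    then obtain y where y: "x - r (residue j x) = \<pi> ^ j * y" by (rule dvdE)
    have "\<pi> ^ k dvd y - t (residue k y)" using t residue_eq_iff by metis
    then have "\<pi> ^ j * \<pi> ^ k dvd \<pi> ^ j * (y - t (residue k y))" by (intro mult_dvd_mono) auto
    also have "\<pi> ^ j * (y - t (residue k y)) = x - (r (residue j x) + \<pi> ^ j * t (residue k y))"
      unfolding right_diff_distrib y[symmetric] by simp
    finally have "\<pi> ^ (j + k) dvd x - (r (residue j x) + \<pi> ^ j * t (residue k y))"
      by (simp add: power_add)
    then have "residue (j + k) x = F (residue j x, residue k y)" unfolding F_def by (simp add: residue_eq_iff)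
    then show "residue (j + k) x \<in> F ` (range (residue j) \<times> range (residue k))" by blast
  qed
  moreover have f: "finite (range (residue j) \<times> range (residue k))" using assms by simp
  ultimately show "finite (range (residue (j + k)))" by (meson finite_imageI finite_subset)
  have "card (range (residue (j + k))) \<le> card (range (residue j) \<times> range (residue k))"
    using \<open>range (residue (j + k)) \<subseteq> _\<close> f by (meson surj_card_le)
  then show "card (range (residue (j + k))) \<le> card (range (residue j)) * card (range (residue k))"
    by (simp add: card_cartesian_product)
qed

lemma finite_residues: "finite (range (residue k))"
proof (induction k)
  case 0
  have "range (residue 0) \<subseteq> {UNIV}" by (auto simp: residue_def)
  then show ?case by (rule finite_subset) simp
next
  case (Suc k)
  have "residue 1 = (\<lambda>x. {y. \<pi> dvd y - x})" by (auto simp: residue_def fun_eq_iff)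
  then have "finite (range (residue 1))" using finite_residue_field by simp
  then show ?case using residue_add_surj(1)[of 1 k] Suc by simp
qed

lemma residues_card_add: "residues_card (j + k) \<le> residues_card j * residues_card k"
  unfolding residues_card_def by (rule residue_add_surj(2)[OF finite_residues finite_residues])

text \<open>The elements \<open>0\<close>, \<open>1\<close>, \<open>\<pi>\<close>, \<dots>, \<open>\<pi>\<^sup>k\<^sup>-\<^sup>1\<close> are pairwise incongruent modulo \<open>\<pi>\<^sup>k\<close>.\<close>

lemma residues_card_gt: "k < residues_card k"
proof -
  define f where "f = (\<lambda>i. residue k (if i < k then \<pi> ^ i else 0))"
  have key: "\<not> residue k (\<pi> ^ i) = residue k (\<pi> ^ j)" if "i < j" "j < k" for i j
  proof
    assume "residue k (\<pi> ^ i) = residue k (\<pi> ^ j)"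
    then have "\<pi> ^ k dvd \<pi> ^ i - \<pi> ^ j" by (simp add: residue_eq_iff)
    then have "\<pi> ^ Suc i dvd \<pi> ^ i - \<pi> ^ j" using that by (meson dvd_trans le_imp_power_dvd less_trans_Suc less_or_eq_imp_le Suc_leI)
    moreover have "\<pi> ^ Suc i dvd \<pi> ^ j" using that by (intro le_imp_power_dvd) simp
    ultimately have "\<pi> ^ Suc i dvd \<pi> ^ i" by (metis diff_add_cancel dvd_add)
    then show False using pow_dvd_pow_iff[of "Suc i" i] by simp
  qed
  have key0: "\<not> residue k (\<pi> ^ i) = residue k 0" if "i < k" for i
    using that by (simp add: residue_eq_iff pow_dvd_pow_iff)
  have ne: "f i \<noteq> f j" if "i < j" "j \<le> k" for i j
  proof (cases "j = k")
    case True
    then show ?thesis using key0[of i] that by (simp add: f_def)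
  next
    case False
    then show ?thesis using key[of i j] that by (simp add: f_def)
  qed
  have "inj_on f {..k}"
  proof (rule inj_onI, rule ccontr)
    fix i j assume ij: "i \<in> {..k}" "j \<in> {..k}" "f i = f j" and "i \<noteq> j"
    then show False using ne[of i j] ne[of j i] by (cases "i < j") simp_all
  qed
  then have "card {..k} \<le> card (range (residue k))"
    by (rule card_inj_on_le) (auto simp: f_def finite_residues)
  then show ?thesis unfolding residues_card_def by simp
qed

subsection \<open>Powers of units\<close>

lemma binomial_remainder:
  fixes x t :: "'b :: comm_ring_1"
  shows "\<exists>c. (x + t) ^ n = x ^ n + of_nat n * x ^ (n - 1) * t + t\<^sup>2 * c"
proof (induction n)
  case (Suc n)
  then obtain c where c: "(x + t) ^ n = x ^ n + of_nat n * x ^ (n - 1) * t + t\<^sup>2 * c" by blast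
  have p: "of_nat n * x ^ (n - 1) * x = of_nat n * x ^ n" by (cases n) (auto simp: mult_ac)
  have "(x + t) ^ Suc n = (x ^ n + of_nat n * x ^ (n - 1) * t + t\<^sup>2 * c) * (x + t)" using c by simp
  also have "\<dots> = x ^ Suc n + x ^ n * t + (of_nat n * x ^ (n - 1) * x) * t + t\<^sup>2 * (c * (x + t) + of_nat n * x ^ (n - 1))"
    by (simp add: algebra_simps power2_eq_square)
  also have "\<dots> = x ^ Suc n + of_nat (Suc n) * x ^ (Suc n - 1) * t + t\<^sup>2 * (c * (x + t) + of_nat n * x ^ (n - 1))"
    unfolding p by (simp add: algebra_simps)
  finally show ?case by blast
next
  case 0
  show ?case by (intro exI[of _ 0]) simp
qed

text \<open>Hensel's lemma for \<open>x\<^sup>n = u\<close>: Newton iteration from \<open>x = 1\<close>.  If \<open>\<pi>\<^sup>v\<close> exactly divides \<open>n\<close>, then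
  \<open>N = 2 v + 1\<close> suffices.\<close>

lemma nth_roots:
  assumes n: "of_nat n \<noteq> (0 :: 'a)"
  obtains N where "\<And>u. \<pi> ^ N dvd u - 1 \<Longrightarrow> \<exists>w. w ^ n = u"
proof -
  obtain v \<epsilon> where ve: "(of_nat n :: 'a) = \<pi> ^ v * \<epsilon>" "\<epsilon> dvd 1" using n by (rule factorization)
  obtain \<epsilon>' where \<epsilon>': "\<epsilon> * \<epsilon>' = 1" using ve(2) by (auto simp: dvd_def)
  have "\<exists>w. w ^ n = u" if u: "\<pi> ^ (2 * v + 1) dvd u - 1" for u
  proof -
    define good where "good = (\<lambda>k x. \<not> \<pi> dvd x \<and> \<pi> ^ (2 * v + 1 + k) dvd x ^ n - u)"
    have "\<exists>f. \<forall>k. good k (f k) \<and> \<pi> ^ (v + 1 + k) dvd f (Suc k) - f k"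
    proof (rule dependent_nat_choice)
      have "\<pi> ^ (2 * v + 1) dvd 1 - u" using u by (metis dvd_minus_iff minus_diff_eq)
      then show "\<exists>x. good 0 x" unfolding good_def using uniformizer_nonunit by (intro exI[of _ 1]) simp
      fix x k assume "good k x"
      then have x: "\<not> \<pi> dvd x" and d: "\<pi> ^ (2 * v + 1 + k) dvd x ^ n - u" unfolding good_def by auto
      obtain x' where x': "x * x' = 1" using unit[OF x] by (auto simp: dvd_def)
      obtain a where a: "x ^ n - u = \<pi> ^ (2 * v + 1 + k) * a" using d by (auto simp: dvd_def)
      define m where "m = v + 1 + k"
      \<comment> \<open>The Newton correction \<open>- (x\<^sup>n - u) / (n x\<^sup>n\<^sup>-\<^sup>1)\<close>; the division by \<open>n\<close> costs a factor \<open>\<pi>\<^sup>v\<close>.\<close>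
      define t where "t = \<pi> ^ m * (- a * \<epsilon>' * x' ^ (n - 1))"
      obtain c where c: "(x + t) ^ n = x ^ n + of_nat n * x ^ (n - 1) * t + t\<^sup>2 * c" using binomial_remainder by blast
      have xx: "x ^ (n - 1) * x' ^ (n - 1) = 1" using x' by (metis power_mult_distrib power_one)
      have "of_nat n * x ^ (n - 1) * t = - (\<pi> ^ (v + m) * a) * (\<epsilon> * \<epsilon>') * (x ^ (n - 1) * x' ^ (n - 1))"
        unfolding ve t_def by (simp add: power_add mult_ac)
      also have "\<dots> = - (\<pi> ^ (v + m) * a)" unfolding \<epsilon>' xx by simp
      also have "v + m = 2 * v + 1 + k" by (simp add: m_def)
      finally have "(x + t) ^ n - u = t\<^sup>2 * c" using c a by (simp add: algebra_simps)
      moreover have "\<pi> ^ (2 * v + 1 + Suc k) dvd t\<^sup>2 * c"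
      proof (rule dvd_mult2)
        have "\<pi> ^ (m + m) dvd t\<^sup>2" unfolding t_def power2_eq_square power_add by (intro mult_dvd_mono dvd_triv_left)
        moreover have "\<pi> ^ (2 * v + 1 + Suc k) dvd \<pi> ^ (m + m)" by (rule le_imp_power_dvd) (simp add: m_def)
        ultimately show "\<pi> ^ (2 * v + 1 + Suc k) dvd t\<^sup>2" by (rule dvd_trans[rotated])
      qed
      moreover have "\<not> \<pi> dvd x + t"
      proof
        assume "\<pi> dvd x + t"
        moreover have "\<pi> dvd t" unfolding t_def m_def by (simp add: dvd_mult2)
        ultimately show False using x by (metis add_diff_cancel_right' dvd_diff)
      qed
      moreover have "\<pi> ^ (v + 1 + k) dvd (x + t) - x" unfolding t_def m_def by simp
      ultimately show "\<exists>y. good (Suc k) y \<and> \<pi> ^ (v + 1 + k) dvd y - x"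
        unfolding good_def by (intro exI[of _ "x + t"]) simp
    qed
    then obtain f where f: "\<And>k. good k (f k)" "\<And>k. \<pi> ^ (v + 1 + k) dvd f (Suc k) - f k" by blast
    have step: "\<pi> ^ k dvd f (k + i) - f k" for k i
    proof (induction i)
      case (Suc i)
      have "\<pi> ^ k dvd f (Suc (k + i)) - f (k + i)"
        using f(2)[of "k + i"] by (rule dvd_trans[rotated]) (rule le_imp_power_dvd, simp)
      then have "\<pi> ^ k dvd (f (Suc (k + i)) - f (k + i)) + (f (k + i) - f k)" using Suc by (rule dvd_add)
      then show ?case by simp
    qed simp
    have cauchy: "\<exists>N. \<forall>i\<ge>N. \<forall>j\<ge>N. \<pi> ^ k dvd f i - f j" for k
    proof (intro exI[of _ k] allI impI)
      fix i j assume "k \<le> i" "k \<le> j"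
      then have d: "\<pi> ^ k dvd f i - f k" "\<pi> ^ k dvd f j - f k" using step[of k "i - k"] step[of k "j - k"] by auto
      have "\<pi> ^ k dvd (f i - f k) - (f j - f k)" by (rule dvd_diff[OF d])
      then show "\<pi> ^ k dvd f i - f j" by simp
    qed
    obtain x where x: "\<forall>k. \<exists>N. \<forall>i\<ge>N. \<pi> ^ k dvd f i - x" using complete[OF cauchy] by blast
    have "x ^ n - u = 0"
    proof (rule separated)
      fix k
      obtain N where N: "\<forall>i\<ge>N. \<pi> ^ k dvd f i - x" using x by blast
      define i where "i = max N k"
      have "\<pi> ^ k dvd f i - x" using N by (simp add: i_def)
      moreover have "f i - x dvd f i ^ n - x ^ n"
      proof -
        have "x - f i dvd x ^ n - f i ^ n" by (simp add: power_diff_sumr2)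
        then show ?thesis by (metis minus_diff_eq minus_dvd_iff dvd_minus_iff)
      qed
      ultimately have 1: "\<pi> ^ k dvd f i ^ n - x ^ n" by (rule dvd_trans)
      have "\<pi> ^ (2 * v + 1 + i) dvd f i ^ n - u" using f(1)[of i] unfolding good_def by blast
      then have 2: "\<pi> ^ k dvd f i ^ n - u" by (rule dvd_trans[rotated]) (rule le_imp_power_dvd, simp add: i_def)
      have "\<pi> ^ k dvd (f i ^ n - u) - (f i ^ n - x ^ n)" using 2 1 by (rule dvd_diff)
      then show "\<pi> ^ k dvd x ^ n - u" by simp
    qed
    then show ?thesis by (intro exI[of _ x]) simp
  qed
  then show thesis by (rule that)
qed

end

section \<open>Congruence subgroups of the general linear group\<close>

lemma (in group) subgroup_mult_inv: "subgroup H G \<Longrightarrow> a \<in> H \<Longrightarrow> b \<in> H \<Longrightarrow> inv a \<otimes> b \<in> H"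
  by (simp add: subgroup.m_closed subgroup.m_inv_closed)

lemma GL_inv:
  fixes A :: "'a :: comm_ring_1 mat"
  assumes "A \<in> carrier (GL n)"
  shows "inv\<^bsub>GL n\<^esub> A \<in> carrier_mat n n" "inv\<^bsub>GL n\<^esub> A * A = 1\<^sub>m n" "A * inv\<^bsub>GL n\<^esub> A = 1\<^sub>m n" "A \<in> carrier_mat n n"
proof -
  interpret G: group "GL n :: 'a mat monoid" by (rule GL_group)
  show "inv\<^bsub>GL n\<^esub> A \<in> carrier_mat n n" using G.inv_closed[OF assms] GL_carrier_iff by blast
  show "inv\<^bsub>GL n\<^esub> A * A = 1\<^sub>m n" "A * inv\<^bsub>GL n\<^esub> A = 1\<^sub>m n"
    using G.l_inv[OF assms] G.r_inv[OF assms] by (simp_all add: GL_mult GL_one)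
  show "A \<in> carrier_mat n n" using assms GL_carrier_iff by blast
qed

lemma det_GL_mult:
  fixes g h :: "'a :: comm_ring_1 mat"
  shows "g \<in> carrier (GL n) \<Longrightarrow> h \<in> carrier (GL n) \<Longrightarrow> det (g \<otimes>\<^bsub>GL n\<^esub> h) = det g * det h"
  using det_mult[of g n h] by (simp add: GL_mult GL_carrier_iff)

lemma det_GL_inv:
  fixes g :: "'a :: comm_ring_1 mat"
  assumes "g \<in> carrier (GL n)"
  shows "det (inv\<^bsub>GL n\<^esub> g) * det g = 1"
  using det_mult[OF GL_inv(1,4)[OF assms]] GL_inv(2)[OF assms] by simp

lemma GL_det_iff:
  fixes A :: "'a :: comm_ring_1 mat"
  assumes A: "A \<in> carrier_mat n n"
  shows "A \<in> carrier (GL n) \<longleftrightarrow> det A dvd 1"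
proof
  assume "A \<in> carrier (GL n)"
  then obtain B where B: "B \<in> carrier_mat n n" "A * B = 1\<^sub>m n" using GL_carrier_iff by blast
  have "det A * det B = 1" using det_mult[OF A B(1)] B(2) by simp
  then show "det A dvd 1" by (metis dvd_triv_left)
next
  assume "det A dvd 1"
  then obtain u where u: "1 = det A * u" by (rule dvdE)
  define B where "B = u \<cdot>\<^sub>m adj_mat A"
  have c: "adj_mat A \<in> carrier_mat n n" by (rule adj_mat(1)[OF A])
  have "A * B = u \<cdot>\<^sub>m (det A \<cdot>\<^sub>m 1\<^sub>m n)" unfolding B_def using mult_smult_distrib[OF A c] adj_mat(2)[OF A] by simp
  also have "\<dots> = 1\<^sub>m n" using u by (intro eq_matI) (auto simp: mult.commute)
  finally have 1: "A * B = 1\<^sub>m n" .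
  have "B * A = u \<cdot>\<^sub>m (det A \<cdot>\<^sub>m 1\<^sub>m n)" unfolding B_def using mult_smult_assoc_mat[OF c A] adj_mat(3)[OF A] by simp
  also have "\<dots> = 1\<^sub>m n" using u by (intro eq_matI) (auto simp: mult.commute)
  finally have "B * A = 1\<^sub>m n" .
  then show "A \<in> carrier (GL n)" unfolding GL_carrier_iff using A 1 c by (auto simp: B_def)
qed

lemma dvd_prod_diff:
  fixes f g :: "'i \<Rightarrow> 'b :: comm_ring_1"
  assumes "\<And>i. i \<in> I \<Longrightarrow> d dvd f i - g i"
  shows "d dvd prod f I - prod g I"
  using assms
proof (induction I rule: infinite_finite_induct)
  case (insert i I)
  have "f i * prod f I - g i * prod g I = (f i - g i) * prod f I + g i * (prod f I - prod g I)" by (simp add: algebra_simps)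
  then show ?case using insert by (simp add: dvd_add dvd_mult dvd_mult2)
qed auto

context complete_dvr
begin

text \<open>Congruence modulo \<open>\<pi>\<^sup>l\<close> of the entries of two \<open>n\<close> by \<open>n\<close> matrices.\<close>

definition cong_mat :: "nat \<Rightarrow> nat \<Rightarrow> 'a mat \<Rightarrow> 'a mat \<Rightarrow> bool" where
  "cong_mat n l A B \<longleftrightarrow> (\<forall>i<n. \<forall>j<n. \<pi> ^ l dvd A $$ (i, j) - B $$ (i, j))"

text \<open>The principal congruence subgroup of level \<open>l\<close>: the kernel of reduction modulo \<open>\<pi>\<^sup>l\<close>.\<close>

definition cong_subgroup :: "nat \<Rightarrow> nat \<Rightarrow> 'a mat set" where
  "cong_subgroup n l = {A \<in> carrier (GL n). cong_mat n l A (1\<^sub>m n)}"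

lemma cong_mat_refl: "cong_mat n l A A" by (simp add: cong_mat_def)

lemma cong_mat_sym: "cong_mat n l A B \<Longrightarrow> cong_mat n l B A"
  unfolding cong_mat_def by (metis dvd_minus_iff minus_diff_eq)

lemma cong_mat_mono: "cong_mat n m A B \<Longrightarrow> l \<le> m \<Longrightarrow> cong_mat n l A B"
  unfolding cong_mat_def by (meson dvd_trans le_imp_power_dvd)

lemma cong_mat_mult:
  assumes "A \<in> carrier_mat n n" "A' \<in> carrier_mat n n" "B \<in> carrier_mat n n" "B' \<in> carrier_mat n n"
    and "cong_mat n l A A'" "cong_mat n l B B'"
  shows "cong_mat n l (A * B) (A' * B')"
  unfolding cong_mat_def
proof (intro allI impI)
  fix i j assume ij: "i < n" "j < n"
  have "(A * B) $$ (i, j) - (A' * B') $$ (i, j) = (\<Sum>k<n. A $$ (i, k) * B $$ (k, j) - A' $$ (i, k) * B' $$ (k, j))"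
    using ij index_mult_mat_sum[OF assms(1,3)] index_mult_mat_sum[OF assms(2,4)] by (simp add: sum_subtractf)
  also have "\<dots> = (\<Sum>k<n. (A $$ (i, k) - A' $$ (i, k)) * B $$ (k, j) + A' $$ (i, k) * (B $$ (k, j) - B' $$ (k, j)))"
    by (intro sum.cong) (auto simp: algebra_simps)
  also have "\<pi> ^ l dvd \<dots>"
    using assms(5,6) ij unfolding cong_mat_def by (intro dvd_sum dvd_add dvd_mult dvd_mult2) auto
  finally show "\<pi> ^ l dvd (A * B) $$ (i, j) - (A' * B') $$ (i, j)" .
qed

lemma cong_subgroup_iff:
  assumes g: "g \<in> carrier (GL n)" and h: "h \<in> carrier (GL n)"
  shows "inv\<^bsub>GL n\<^esub> g \<otimes>\<^bsub>GL n\<^esub> h \<in> cong_subgroup n l \<longleftrightarrow> cong_mat n l g h"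
proof -
  interpret G: group "GL n :: 'a mat monoid" by (rule GL_group)
  note gi = GL_inv[OF g] and hi = GL_inv[OF h]
  have c: "inv\<^bsub>GL n\<^esub> g \<otimes>\<^bsub>GL n\<^esub> h \<in> carrier (GL n)" using g h by simp
  show ?thesis
  proof
    assume "inv\<^bsub>GL n\<^esub> g \<otimes>\<^bsub>GL n\<^esub> h \<in> cong_subgroup n l"
    then have a: "cong_mat n l (inv\<^bsub>GL n\<^esub> g * h) (1\<^sub>m n)" unfolding cong_subgroup_def by (simp add: GL_mult)
    have ic: "inv\<^bsub>GL n\<^esub> g * h \<in> carrier_mat n n" using gi hi by simp
    have "cong_mat n l (g * (inv\<^bsub>GL n\<^esub> g * h)) (g * 1\<^sub>m n)"
      by (rule cong_mat_mult[OF gi(4,4) ic one_carrier_mat cong_mat_refl a])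
    moreover have "g * (inv\<^bsub>GL n\<^esub> g * h) = h"
      using assoc_mult_mat[OF gi(4,1) hi(4)] gi(3) left_mult_one_mat[OF hi(4)] by simp
    ultimately show "cong_mat n l g h" using gi(4) by (simp add: cong_mat_sym)
  next
    assume a: "cong_mat n l g h"
    have "cong_mat n l (inv\<^bsub>GL n\<^esub> g * h) (inv\<^bsub>GL n\<^esub> g * g)"
      by (rule cong_mat_mult[OF gi(1,1) hi(4) gi(4) cong_mat_refl cong_mat_sym[OF a]])
    then show "inv\<^bsub>GL n\<^esub> g \<otimes>\<^bsub>GL n\<^esub> h \<in> cong_subgroup n l"
      unfolding cong_subgroup_def using c by (simp add: GL_mult gi(2))
  qed
qed

lemma cong_subgroup_subset: "cong_subgroup n l \<subseteq> carrier (GL n)"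
  unfolding cong_subgroup_def by auto

lemma cong_subgroup_antimono: "l \<le> m \<Longrightarrow> cong_subgroup n m \<subseteq> cong_subgroup n l"
  unfolding cong_subgroup_def using cong_mat_mono by blast

lemma cong_subgroup_mem_iff: "A \<in> carrier (GL n) \<Longrightarrow> A \<in> cong_subgroup n l \<longleftrightarrow> cong_mat n l A (1\<^sub>m n)"
  unfolding cong_subgroup_def by simp

lemma cong_subgroup_normal: "cong_subgroup n l \<lhd> (GL n :: 'a mat monoid)"
proof -
  interpret G: group "GL n :: 'a mat monoid" by (rule GL_group)
  note sub = cong_subgroup_subset[of n l]
  have mc: "A \<in> carrier_mat n n" if "A \<in> carrier (GL n)" for A :: "'a mat" using that GL_carrier_iff by blast
  have s: "subgroup (cong_subgroup n l) (GL n)"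
  proof (rule G.subgroupI[OF sub])
    show "cong_subgroup n l \<noteq> {}"
      using G.one_closed cong_subgroup_mem_iff[OF G.one_closed, of l] cong_mat_refl by (auto simp: GL_one)
    show "inv\<^bsub>GL n\<^esub> a \<in> cong_subgroup n l" if a: "a \<in> cong_subgroup n l" for a
    proof -
      have ac: "a \<in> carrier (GL n)" using a sub by auto
      have "inv\<^bsub>GL n\<^esub> a \<otimes>\<^bsub>GL n\<^esub> \<one>\<^bsub>GL n\<^esub> \<in> cong_subgroup n l"
        unfolding cong_subgroup_iff[OF ac G.one_closed] using a cong_subgroup_mem_iff[OF ac] by (simp add: GL_one)
      then show ?thesis using ac by simp
    qed
    show "a \<otimes>\<^bsub>GL n\<^esub> b \<in> cong_subgroup n l" if "a \<in> cong_subgroup n l" "b \<in> cong_subgroup n l" for a b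
    proof -
      have ac: "a \<in> carrier (GL n)" "b \<in> carrier (GL n)" using that sub by auto
      have "cong_mat n l (a * b) (1\<^sub>m n * 1\<^sub>m n)"
        by (rule cong_mat_mult[OF mc[OF ac(1)] one_carrier_mat mc[OF ac(2)] one_carrier_mat])
          (use that cong_subgroup_mem_iff[OF ac(1)] cong_subgroup_mem_iff[OF ac(2)] in auto)
      then show ?thesis using cong_subgroup_mem_iff[OF G.m_closed[OF ac], of l] by (simp add: GL_mult)
    qed
  qed
  show ?thesis
    unfolding G.normal_inv_iff
  proof (intro conjI ballI s)
    fix x h assume x: "x \<in> carrier (GL n :: 'a mat monoid)" and h: "h \<in> cong_subgroup n l"
    have hc: "h \<in> carrier (GL n)" using h sub by auto
    note xi = GL_inv[OF x]
    have hx: "h * inv\<^bsub>GL n\<^esub> x \<in> carrier_mat n n" using mc[OF hc] xi by simp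
    have 1: "cong_mat n l (x * h * inv\<^bsub>GL n\<^esub> x) (x * 1\<^sub>m n * inv\<^bsub>GL n\<^esub> x)"
    proof (rule cong_mat_mult)
      show "cong_mat n l (x * h) (x * 1\<^sub>m n)"
        by (rule cong_mat_mult[OF xi(4,4) mc[OF hc] one_carrier_mat cong_mat_refl]) (use h cong_subgroup_mem_iff[OF hc] in blast)
    qed (use xi mc[OF hc] cong_mat_refl in auto)
    have "x * 1\<^sub>m n * inv\<^bsub>GL n\<^esub> x = 1\<^sub>m n" using xi by simp
    then show "x \<otimes>\<^bsub>GL n\<^esub> h \<otimes>\<^bsub>GL n\<^esub> inv\<^bsub>GL n\<^esub> x \<in> cong_subgroup n l"
      using cong_subgroup_mem_iff[of "x \<otimes>\<^bsub>GL n\<^esub> h \<otimes>\<^bsub>GL n\<^esub> inv\<^bsub>GL n\<^esub> x" n l] x hc 1 by (simp add: GL_mult[symmetric])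
        (simp add: GL_mult)
  qed
qed

text \<open>Reduction of the entries modulo \<open>\<pi>\<^sup>l\<close> separates the cosets.\<close>

lemma cong_subgroup_index:
  "finite (lcosets_of (GL n) (cong_subgroup n l))"
  "card (lcosets_of (GL n) (cong_subgroup n l)) \<le> residues_card l ^ (n * n)"
proof -
  interpret G: group "GL n :: 'a mat monoid" by (rule GL_group)
  let ?I = "{..<n} \<times> {..<n}" and ?C = "carrier (GL n :: 'a mat monoid)"
  define f where "f = (\<lambda>A :: 'a mat. \<lambda>p\<in>?I. residue l (A $$ p))"
  have f: "f ` ?C \<subseteq> PiE ?I (\<lambda>_. range (residue l))"
    unfolding f_def by (rule image_subsetI) (simp only: restrict_PiE_iff, blast)
  have fin: "finite (PiE ?I (\<lambda>_. range (residue l)))" by (intro finite_PiE) (auto simp: finite_residues)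
  have cf: "finite (f ` ?C)" using f fin finite_subset by blast
  define F where "F = (\<lambda>y. l_coset (GL n) (inv_into ?C f y) (cong_subgroup n l))"
  have "lcosets_of (GL n) (cong_subgroup n l) \<subseteq> F ` f ` ?C"
  proof
    fix C assume "C \<in> lcosets_of (GL n) (cong_subgroup n l)"
    then obtain g where g: "g \<in> ?C" "C = l_coset (GL n) g (cong_subgroup n l)" unfolding lcosets_of_def by auto
    define h where "h = inv_into ?C f (f g)"
    have h: "h \<in> ?C" "f h = f g" using g unfolding h_def by (auto intro: inv_into_into f_inv_into_f)
    have "cong_mat n l h g" unfolding cong_mat_def
    proof (intro allI impI)
      fix i j assume ij: "i < n" "j < n"
      have "f h (i, j) = f g (i, j)" using h by simp
      then show "\<pi> ^ l dvd h $$ (i, j) - g $$ (i, j)" using ij by (simp add: f_def residue_eq_iff)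
    qed
    then have "C = F (f g)"
      unfolding F_def h_def[symmetric] g(2)
      using G.lcoset_eq_iff[OF normal_imp_subgroup[OF cong_subgroup_normal] h(1) g(1), of l] cong_subgroup_iff[OF h(1) g(1)] by simp
    then show "C \<in> F ` f ` ?C" using g by blast
  qed
  then show "finite (lcosets_of (GL n) (cong_subgroup n l))" using cf by (meson finite_imageI finite_subset)
  have "card (lcosets_of (GL n) (cong_subgroup n l)) \<le> card (f ` ?C)"
    using \<open>_ \<subseteq> F ` f ` ?C\<close> cf by (meson surj_card_le)
  also have "\<dots> \<le> card (PiE ?I (\<lambda>_. range (residue l)))" by (rule card_mono[OF fin f])
  also have "\<dots> = residues_card l ^ (n * n)" by (simp add: card_PiE residues_card_def)
  finally show "card (lcosets_of (GL n) (cong_subgroup n l)) \<le> residues_card l ^ (n * n)" .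
qed

lemma det_cong:
  assumes A: "A \<in> carrier_mat n n" and B: "B \<in> carrier_mat n n" and c: "cong_mat n l A B"
  shows "\<pi> ^ l dvd det A - det B"
proof -
  have "det A - det B = (\<Sum>p \<in> {p. p permutes {0..<n}}. signof p * ((\<Prod>i = 0..<n. A $$ (i, p i)) - (\<Prod>i = 0..<n. B $$ (i, p i))))"
    unfolding det_def'[OF A] det_def'[OF B] by (simp add: sum_subtractf[symmetric] right_diff_distrib)
  also have "\<pi> ^ l dvd \<dots>"
  proof (intro dvd_sum dvd_mult dvd_prod_diff)
    fix p i assume "p \<in> {p. p permutes {0..<n}}" "i \<in> {0..<n}"
    then have "i < n" "p i < n" using permutes_in_image[of p "{0..<n}" i] by auto
    then show "\<pi> ^ l dvd A $$ (i, p i) - B $$ (i, p i)" using c unfolding cong_mat_def by blast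
  qed
  finally show ?thesis .
qed

lemma cong_one_GL:
  assumes A: "A \<in> carrier_mat n n" and c: "cong_mat n l A (1\<^sub>m n)" and l: "l > 0"
  shows "A \<in> carrier (GL n)"
proof -
  have "\<pi> ^ l dvd det A - 1" using det_cong[OF A one_carrier_mat c] by simp
  then have d: "\<pi> dvd det A - 1" using l by (meson dvd_power dvd_trans)
  have "\<not> \<pi> dvd det A"
  proof
    assume "\<pi> dvd det A"
    then have "\<pi> dvd det A - (det A - 1)" using d by (rule dvd_diff)
    then show False using uniformizer_nonunit by simp
  qed
  then show ?thesis unfolding GL_det_iff[OF A] by (rule unit)
qed

lemma dvd_prod_one_plus:
  assumes fin: "finite I" and "\<And>i. i \<in> I \<Longrightarrow> d dvd f i - (1 :: 'a)"
  shows "d * d dvd prod f I - (1 + (\<Sum>i\<in>I. f i - 1)) \<and> d dvd (\<Sum>i\<in>I. f i - 1)"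
  using assms
proof (induction I rule: finite_induct)
  case (insert i I)
  have IH: "d * d dvd prod f I - (1 + (\<Sum>i\<in>I. f i - 1))" "d dvd (\<Sum>i\<in>I. f i - 1)" and di: "d dvd f i - 1"
    using insert by auto
  have "prod f (insert i I) - (1 + (\<Sum>i\<in>insert i I. f i - 1))
     = f i * (prod f I - (1 + (\<Sum>i\<in>I. f i - 1))) + (f i - 1) * (\<Sum>i\<in>I. f i - 1)"
    using insert by (simp add: algebra_simps)
  also have "d * d dvd \<dots>" using IH di by (intro dvd_add dvd_mult mult_dvd_mono)
  finally show ?case using IH di insert by (simp add: dvd_add)
qed auto

text \<open>If \<open>Y\<close> is divisible by \<open>\<pi>\<^sup>r\<close>, then the determinant of \<open>1 + Y\<close> is \<open>1\<close> plus the trace of \<open>Y\<close> modulo \<open>\<pi>\<^sup>2\<^sup>r\<close>.\<close>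

lemma det_trace_cong:
  assumes A: "A \<in> carrier_mat n n" and c: "cong_mat n r A (1\<^sub>m n)"
  shows "\<pi> ^ (2 * r) dvd det A - (1 + (\<Sum>i<n. A $$ (i, i) - 1))"
proof -
  let ?P = "{p. p permutes {0..<n}}"
  have fP: "finite ?P" by (simp add: finite_permutations)
  have idP: "id \<in> ?P" by (simp add: permutes_id)
  have diag: "\<pi> ^ r dvd A $$ (i, i) - 1" if "i < n" for i using c that unfolding cong_mat_def by fastforce
  have off: "\<pi> ^ r dvd A $$ (i, j)" if "i < n" "j < n" "i \<noteq> j" for i j using c that unfolding cong_mat_def by fastforce
  have "det A = (\<Sum>p\<in>?P. signof p * (\<Prod>i = 0..<n. A $$ (i, p i)))" by (rule det_def'[OF A])
  also have "\<dots> = signof id * (\<Prod>i = 0..<n. A $$ (i, id i)) + (\<Sum>p\<in>?P - {id}. signof p * (\<Prod>i = 0..<n. A $$ (i, p i)))"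
    by (rule sum.remove[OF fP idP])
  finally have "det A - (1 + (\<Sum>i<n. A $$ (i, i) - 1)) = ((\<Prod>i\<in>{..<n}. A $$ (i, i)) - (1 + (\<Sum>i<n. A $$ (i, i) - 1)))
     + (\<Sum>p\<in>?P - {id}. signof p * (\<Prod>i = 0..<n. A $$ (i, p i)))" by (simp add: lessThan_atLeast0)
  \<comment> \<open>A permutation other than the identity moves at least two indices, so its product has two off-diagonal factors.\<close>
  also have "\<pi> ^ (2 * r) dvd \<dots>"
  proof (rule dvd_add)
    have "\<pi> ^ r * \<pi> ^ r dvd (\<Prod>i\<in>{..<n}. A $$ (i, i)) - (1 + (\<Sum>i<n. A $$ (i, i) - 1))"
      using dvd_prod_one_plus[of "{..<n}" "\<pi> ^ r" "\<lambda>i. A $$ (i, i)"] diag by auto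
    then show "\<pi> ^ (2 * r) dvd (\<Prod>i\<in>{..<n}. A $$ (i, i)) - (1 + (\<Sum>i<n. A $$ (i, i) - 1))"
      by (simp add: power_add[symmetric] mult_2)
    show "\<pi> ^ (2 * r) dvd (\<Sum>p\<in>?P - {id}. signof p * (\<Prod>i = 0..<n. A $$ (i, p i)))"
    proof (intro dvd_sum dvd_mult)
      fix p assume p: "p \<in> ?P - {id}"
      then have pp: "p permutes {0..<n}" by simp
      obtain i where i: "p i \<noteq> i" using p by fastforce
      have iN: "i \<in> {0..<n}" using i pp unfolding permutes_def by blast
      have pi: "p i \<in> {0..<n}" using iN permutes_in_image[OF pp] by blast
      have ppi: "p (p i) \<noteq> p i" using i permutes_inj[OF pp] by (meson injD)
      have ppin: "p (p i) \<in> {0..<n}" using pi permutes_in_image[OF pp] by blast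
      have "(\<Prod>k = 0..<n. A $$ (k, p k)) = A $$ (i, p i) * (A $$ (p i, p (p i)) * (\<Prod>k\<in>{0..<n} - {i} - {p i}. A $$ (k, p k)))"
        using iN pi i by (simp add: prod.remove[of "{0..<n}" i] prod.remove[of "{0..<n} - {i}" "p i"])
      moreover have "\<pi> ^ r * (\<pi> ^ r * 1) dvd A $$ (i, p i) * (A $$ (p i, p (p i)) * (\<Prod>k\<in>{0..<n} - {i} - {p i}. A $$ (k, p k)))"
        using off[of i "p i"] off[of "p i" "p (p i)"] i iN pi ppi ppin by (intro mult_dvd_mono) auto
      ultimately show "\<pi> ^ (2 * r) dvd (\<Prod>k = 0..<n. A $$ (k, p k))" by (simp add: power_add mult_2)
    qed
  qed
  finally show ?thesis .
qed

end

section \<open>Continuity\<close>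

text \<open>The general linear group over the complex numbers has no small subgroups: close to the identity, squaring
  increases the distance \<open>N\<close> to the identity at least by a factor \<open>3 / 2\<close>.\<close>

lemma no_small_subgroups:
  fixes \<rho> :: "'g \<Rightarrow> complex mat"
  assumes c: "\<And>k. k \<in> L \<Longrightarrow> \<rho> k \<in> carrier_mat d d"
    and sq: "\<And>k. k \<in> L \<Longrightarrow> \<exists>k'\<in>L. \<rho> k' = \<rho> k * \<rho> k"
    and small: "\<And>k i j. k \<in> L \<Longrightarrow> i < d \<Longrightarrow> j < d \<Longrightarrow> cmod (\<rho> k $$ (i, j) - 1\<^sub>m d $$ (i, j)) \<le> 1 / (2 * real (d * d))"
    and k: "k \<in> L"
  shows "\<rho> k = 1\<^sub>m d"
proof -
  define E where "E = (\<lambda>k i j. \<rho> k $$ (i, j) - 1\<^sub>m d $$ (i, j))"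
  define N where "N = (\<lambda>k. \<Sum>i<d. \<Sum>j<d. cmod (E k i j))"
  have N0: "0 \<le> N k" for k unfolding N_def by (intro sum_nonneg) auto
  have Nh: "N k \<le> 1 / 2" if "k \<in> L" for k
  proof -
    have "N k \<le> (\<Sum>i<d. \<Sum>j<d. 1 / (2 * real (d * d)))"
      unfolding N_def E_def using small[OF that] by (intro sum_mono) auto
    also have "\<dots> \<le> 1 / 2" by (simp add: field_simps)
    finally show ?thesis .
  qed
  have key: "\<exists>k'\<in>L. (3 / 2) * N k \<le> N k'" if kL: "k \<in> L" for k
  proof -
    obtain k' where k': "k' \<in> L" "\<rho> k' = \<rho> k * \<rho> k" using sq[OF kL] by blast
    have e: "2 * E k i j = E k' i j - (\<Sum>m<d. E k i m * E k m j)" if ij: "i < d" "j < d" for i j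
    proof -
      have "\<rho> k' $$ (i, j) = (\<Sum>m<d. \<rho> k $$ (i, m) * \<rho> k $$ (m, j))"
        unfolding k'(2) by (rule index_mult_mat_sum[OF c[OF kL] c[OF kL] ij])
      also have "\<dots> = (\<Sum>m<d. (E k i m + (if i = m then 1 else 0)) * (E k m j + (if m = j then 1 else 0)))"
        using ij by (intro sum.cong) (auto simp: E_def)
      also have "\<dots> = (\<Sum>m<d. E k i m * E k m j) + (\<Sum>m<d. if m = j then E k i m else 0)
           + (\<Sum>m<d. if i = m then E k m j else 0) + (\<Sum>m<d. if i = m then (if m = j then 1 else 0) else 0)"
        unfolding sum.distrib[symmetric] by (intro sum.cong) (auto simp: algebra_simps)
      also have "\<dots> = (\<Sum>m<d. E k i m * E k m j) + 2 * E k i j + 1\<^sub>m d $$ (i, j)" using ij by simp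
      finally show ?thesis by (simp add: E_def[of ] algebra_simps)
    qed
    have "2 * N k = (\<Sum>i<d. \<Sum>j<d. cmod (2 * E k i j))" by (simp add: N_def sum_distrib_left norm_mult)
    also have "\<dots> \<le> (\<Sum>i<d. \<Sum>j<d. cmod (E k' i j) + (\<Sum>m<d. cmod (E k i m) * cmod (E k m j)))"
    proof (intro sum_mono)
      fix i j assume "i \<in> {..<d}" "j \<in> {..<d}"
      then have "cmod (2 * E k i j) \<le> cmod (E k' i j) + cmod (\<Sum>m<d. E k i m * E k m j)" using e norm_triangle_ineq4 by auto
      also have "cmod (\<Sum>m<d. E k i m * E k m j) \<le> (\<Sum>m<d. cmod (E k i m) * cmod (E k m j))"
        by (rule order_trans[OF norm_sum]) (simp add: norm_mult)
      finally show "cmod (2 * E k i j) \<le> cmod (E k' i j) + (\<Sum>m<d. cmod (E k i m) * cmod (E k m j))" by simp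
    qed
    also have "\<dots> = N k' + (\<Sum>i<d. \<Sum>j<d. \<Sum>m<d. cmod (E k i m) * cmod (E k m j))"
      by (simp add: N_def sum.distrib)
    also have "(\<Sum>i<d. \<Sum>j<d. \<Sum>m<d. cmod (E k i m) * cmod (E k m j)) = (\<Sum>i<d. \<Sum>m<d. cmod (E k i m) * (\<Sum>j<d. cmod (E k m j)))"
      by (subst sum.swap) (simp add: sum_distrib_left)
    also have "\<dots> \<le> (\<Sum>i<d. \<Sum>m<d. cmod (E k i m) * N k)"
    proof (intro sum_mono mult_left_mono)
      fix m assume "m \<in> {..<d}"
      then show "(\<Sum>j<d. cmod (E k m j)) \<le> N k"
        unfolding N_def by (intro member_le_sum[of m "{..<d}" "\<lambda>i. \<Sum>j<d. cmod (E k i j)"]) (auto intro: sum_nonneg)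
    qed auto
    also have "\<dots> = N k * N k" by (simp add: N_def sum_distrib_right)
    also have "N k * N k \<le> 1 / 2 * N k" using Nh[OF kL] N0 by (intro mult_right_mono) auto
    finally have "(3 / 2) * N k \<le> N k'" by simp
    then show ?thesis using k' by blast
  qed
  have bd: "\<exists>k'\<in>L. (3 / 2) ^ m * N k \<le> N k'" for m
  proof (induction m)
    case (Suc m)
    then obtain k' where k': "k' \<in> L" "(3 / 2) ^ m * N k \<le> N k'" by blast
    obtain k'' where k'': "k'' \<in> L" "(3 / 2) * N k' \<le> N k''" using key[OF k'(1)] by blast
    have "(3 / 2) ^ Suc m * N k = (3 / 2) * ((3 / 2) ^ m * N k)" by simp
    also have "\<dots> \<le> (3 / 2) * N k'" using k' by (intro mult_left_mono) auto
    finally show ?case using k'' by (meson order_trans)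
  qed (use k in auto)
  have "N k = 0"
  proof (rule ccontr)
    assume "N k \<noteq> 0"
    then have pos: "N k > 0" using N0[of k] by simp
    obtain m where "1 / N k < (3 / 2) ^ m" using real_arch_pow[of "3 / 2" "1 / N k"] by auto
    then have "1 < (3 / 2) ^ m * N k" using pos by (simp add: field_simps)
    moreover obtain k' where "k' \<in> L" "(3 / 2) ^ m * N k \<le> N k'" using bd by blast
    ultimately show False using Nh[of k'] by simp
  qed
  then have "\<forall>i\<in>{..<d}. (\<Sum>j<d. cmod (E k i j)) = 0"
    unfolding N_def by (subst (asm) sum_nonneg_eq_0_iff) (auto intro: sum_nonneg)
  then have z: "E k i j = 0" if "i < d" "j < d" for i j
    using that by (subst (asm) sum_nonneg_eq_0_iff) auto
  then show ?thesis using c[OF k] by (intro eq_matI) (auto simp: E_def)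
qed

lemma openin_mat_topology:
  "openin (mat_topology T n) U \<longleftrightarrow>
     (\<exists>V. openin (product_topology (\<lambda>_. T) ({..<n} \<times> {..<n})) V \<and>
       U = {A \<in> carrier_mat n n. (\<lambda>(i, j)\<in>{..<n} \<times> {..<n}. A $$ (i, j)) \<in> V})"
  unfolding mat_topology_def openin_pullback_topology by auto

lemma topspace_mat_topology: "topspace T = UNIV \<Longrightarrow> topspace (mat_topology T n) = carrier_mat n n"
  unfolding mat_topology_def topspace_pullback_topology by auto

text \<open>Basic open sets: the matrices whose entries lie in given open sets.\<close>

lemma openin_mat_entries:
  assumes "\<And>p. p \<in> {..<n} \<times> {..<n} \<Longrightarrow> openin T (W p)"
  shows "openin (mat_topology T n) {A \<in> carrier_mat n n. \<forall>i<n. \<forall>j<n. A $$ (i, j) \<in> W (i, j)}"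
  unfolding openin_mat_topology
proof (intro exI conjI)
  show "openin (product_topology (\<lambda>_. T) ({..<n} \<times> {..<n})) (PiE ({..<n} \<times> {..<n}) W)"
    unfolding openin_PiE_gen using assms by (auto intro: finite_subset[of _ "{..<n} \<times> {..<n}"])
  show "{A \<in> carrier_mat n n. \<forall>i<n. \<forall>j<n. A $$ (i, j) \<in> W (i, j)} =
    {A \<in> carrier_mat n n. (\<lambda>(i, j)\<in>{..<n} \<times> {..<n}. A $$ (i, j)) \<in> PiE ({..<n} \<times> {..<n}) W}"
    unfolding restrict_PiE_iff by auto
qed

lemma openin_mat_contains_entries:
  assumes "openin (mat_topology T n) U" "A \<in> U"
  obtains W where "\<forall>p\<in>{..<n} \<times> {..<n}. openin T (W p)" "\<forall>i<n. \<forall>j<n. A $$ (i, j) \<in> W (i, j)"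
    "\<forall>B\<in>carrier_mat n n. (\<forall>i<n. \<forall>j<n. B $$ (i, j) \<in> W (i, j)) \<longrightarrow> B \<in> U"
proof -
  let ?I = "{..<n} \<times> {..<n}"
  obtain V where V: "openin (product_topology (\<lambda>_. T) ?I) V"
    "U = {A \<in> carrier_mat n n. (\<lambda>(i, j)\<in>?I. A $$ (i, j)) \<in> V}"
    using assms(1) unfolding openin_mat_topology by (elim exE conjE)
  have "(\<lambda>(i, j)\<in>?I. A $$ (i, j)) \<in> V" using assms(2) V by simp
  from bspec[OF V(1)[unfolded openin_product_topology_alt] this]
  obtain W where W: "\<forall>p\<in>?I. openin T (W p)" "(\<lambda>(i, j)\<in>?I. A $$ (i, j)) \<in> PiE ?I W" "PiE ?I W \<subseteq> V"
    by (elim exE conjE)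
  show thesis
  proof (rule that[of W])
    show "\<forall>p\<in>?I. openin T (W p)" by (rule W(1))
    show "\<forall>i<n. \<forall>j<n. A $$ (i, j) \<in> W (i, j)" using W(2) unfolding restrict_PiE_iff by fastforce
    show "\<forall>B\<in>carrier_mat n n. (\<forall>i<n. \<forall>j<n. B $$ (i, j) \<in> W (i, j)) \<longrightarrow> B \<in> U"
    proof (intro ballI impI)
      fix B :: "'a mat" assume B: "B \<in> carrier_mat n n" "\<forall>i<n. \<forall>j<n. B $$ (i, j) \<in> W (i, j)"
      have "(\<lambda>(i, j)\<in>?I. B $$ (i, j)) \<in> PiE ?I W" unfolding restrict_PiE_iff using B(2) by auto
      from subsetD[OF W(3) this] show "B \<in> U" unfolding V(2) using B(1) by (intro CollectI conjI)
    qed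
  qed
qed

context complete_dvr
begin

text \<open>The \<open>\<pi>\<close>-adic topology.\<close>

definition adic :: "'a topology" where
  "adic = adic_topology (class_ring :: 'a ring) {x. \<pi> dvd x}"

lemma residue_self: "x \<in> residue k x" by (simp add: residue_def)

lemma residue_antimono: "k \<le> l \<Longrightarrow> residue l x \<subseteq> residue k x"
  unfolding residue_def by (auto intro: dvd_trans le_imp_power_dvd)

lemma openin_adic: "openin adic U \<longleftrightarrow> (\<forall>x\<in>U. \<exists>k. residue k x \<subseteq> U)"
proof -
  have co: "ideal_power (class_ring :: 'a ring) {x. \<pi> dvd x} k +>\<^bsub>(class_ring :: 'a ring)\<^esub> x = residue k x" for k x
  proof -
    have "y \<in> ideal_power (class_ring :: 'a ring) {x. \<pi> dvd x} k +>\<^bsub>(class_ring :: 'a ring)\<^esub> x \<longleftrightarrow> \<pi> ^ k dvd y - x" for y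
      unfolding ideal_power_principal a_r_coset_def r_coset_def by auto
    then show ?thesis unfolding residue_def by auto
  qed
  have ist: "istopology (\<lambda>U :: 'a set. \<forall>x\<in>U. \<exists>k. residue k x \<subseteq> U)"
    unfolding istopology_def
  proof (intro conjI allI impI ballI)
    fix U V :: "'a set" and x assume U: "\<forall>x\<in>U. \<exists>k. residue k x \<subseteq> U" and V: "\<forall>x\<in>V. \<exists>k. residue k x \<subseteq> V" and x: "x \<in> U \<inter> V"
    obtain k l where "residue k x \<subseteq> U" "residue l x \<subseteq> V" using U V x by blast
    then have "residue (max k l) x \<subseteq> U \<inter> V"
      using residue_antimono[of k "max k l" x] residue_antimono[of l "max k l" x] by auto
    then show "\<exists>k. residue k x \<subseteq> U \<inter> V" by blast
  next
    fix \<K> :: "'a set set" and x assume K: "\<forall>U\<in>\<K>. \<forall>x\<in>U. \<exists>k. residue k x \<subseteq> U" and x: "x \<in> \<Union>\<K>"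
    then obtain U where "U \<in> \<K>" "x \<in> U" by blast
    then obtain k where "residue k x \<subseteq> U" using K by blast
    then show "\<exists>k. residue k x \<subseteq> \<Union>\<K>" using \<open>U \<in> \<K>\<close> by blast
  qed
  have "adic = topology (\<lambda>U. \<forall>x\<in>U. \<exists>k. residue k x \<subseteq> U)"
    unfolding adic_def adic_topology_def co by simp
  then show ?thesis using topology_inverse'[OF ist] by simp
qed

lemma openin_residue: "openin adic (residue k x)"
  unfolding openin_adic
proof
  fix y assume "y \<in> residue k x"
  then have "residue k y = residue k x" unfolding residue_eq_iff by (simp add: residue_def)
  then show "\<exists>l. residue l y \<subseteq> residue k x" by blast
qed

lemma topspace_adic: "topspace adic = UNIV"
  using openin_subset[of adic UNIV] openin_adic[of UNIV] by auto

text \<open>A representation is continuous iff it is trivial on a congruence subgroup.  If it is continuous, it maps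
  a congruence subgroup into a small neighbourhood of the identity, which contains no nontrivial subgroup.\<close>

lemma representation_iff_trivial_on_cong_subgroup:
  fixes H :: "'a mat set"
  assumes H: "subgroup H (GL n)"
  shows "representation ((GL n)\<lparr>carrier := H\<rparr>) (subtopology (mat_topology adic n) H) d \<rho> \<longleftrightarrow>
    mat_rep ((GL n)\<lparr>carrier := H\<rparr>) d \<rho> \<and> (\<exists>l. \<forall>k\<in>H \<inter> cong_subgroup n l. \<rho> k = 1\<^sub>m d)"
proof -
  interpret G: group "GL n :: 'a mat monoid" by (rule GL_group)
  let ?H = "(GL n)\<lparr>carrier := H\<rparr> :: 'a mat monoid"
  interpret HG: group ?H using H by (rule G.subgroup_imp_group)
  let ?T = "subtopology (mat_topology adic n) H"
  have HGL: "H \<subseteq> carrier (GL n)" using H by (rule subgroup.subset)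
  have Hc: "A \<in> carrier_mat n n" if "A \<in> H" for A using HGL that GL_carrier_iff by blast
  have tsH: "topspace ?T = H" unfolding topspace_subtopology topspace_mat_topology[OF topspace_adic] using Hc by blast
  have tsE: "topspace (mat_topology (euclidean :: complex topology) d) = carrier_mat d d" by (rule topspace_mat_topology) simp
  have hom: "\<rho> \<in> hom ?H (GL d) \<longleftrightarrow> mat_rep ?H d \<rho>" by (rule HG.hom_GL_iff)
  have "continuous_map ?T (mat_topology euclidean d) \<rho> \<longleftrightarrow> (\<exists>l. \<forall>k\<in>H \<inter> cong_subgroup n l. \<rho> k = 1\<^sub>m d)"
    if \<rho>: "mat_rep ?H d \<rho>"
  proof
    have \<rho>c: "\<rho> h \<in> carrier_mat d d" if "h \<in> H" for h using mat_repD(1)[OF \<rho>] that by simp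
    assume cont: "continuous_map ?T (mat_topology euclidean d) \<rho>"
    define V :: "complex mat set" where "V = {A \<in> carrier_mat d d. \<forall>i<d. \<forall>j<d. A $$ (i, j) \<in> ball (1\<^sub>m d $$ (i, j)) (1 / (2 * real (d * d)))}"
    have "openin (mat_topology (euclidean :: complex topology) d) V"
      unfolding V_def
      using openin_mat_entries[of d euclidean "\<lambda>p. ball (1\<^sub>m d $$ p) (1 / (2 * real (d * d)))"] by simp
    then have "openin ?T {h \<in> topspace ?T. \<rho> h \<in> V}" using cont unfolding continuous_map_def by blast
    then obtain U where U: "openin (mat_topology adic n) U" "{h \<in> H. \<rho> h \<in> V} = U \<inter> H"
      unfolding tsH openin_subtopology by blast
    have oneH: "1\<^sub>m n \<in> H" using subgroup.one_closed[OF H] by (simp add: GL_one)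
    have "\<rho> (1\<^sub>m n) = 1\<^sub>m d" using mat_repD(2)[OF \<rho>] by (simp add: GL_one)
    then have "1\<^sub>m n \<in> {h \<in> H. \<rho> h \<in> V}" using oneH unfolding V_def by auto
    then have "1\<^sub>m n \<in> U" using U by blast
    obtain W where W: "\<forall>p\<in>{..<n} \<times> {..<n}. openin adic (W p)"
      "\<forall>i<n. \<forall>j<n. 1\<^sub>m n $$ (i, j) \<in> W (i, j)"
      "\<forall>B\<in>carrier_mat n n. (\<forall>i<n. \<forall>j<n. B $$ (i, j) \<in> W (i, j)) \<longrightarrow> B \<in> U"
      by (rule openin_mat_contains_entries[OF U(1) \<open>1\<^sub>m n \<in> U\<close>])
    have "\<forall>p\<in>{..<n} \<times> {..<n}. \<exists>k. residue k (1\<^sub>m n $$ p) \<subseteq> W p"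
      using W(1,2) unfolding openin_adic by fastforce
    then obtain f where f: "\<forall>p\<in>{..<n} \<times> {..<n}. residue (f p) (1\<^sub>m n $$ p) \<subseteq> W p" by metis
    define l where "l = Max (insert 0 (f ` ({..<n} \<times> {..<n})))"
    have fl: "f p \<le> l" if "p \<in> {..<n} \<times> {..<n}" for p unfolding l_def using that by (intro Max_ge) auto
    define L where "L = H \<inter> cong_subgroup n l"
    have LU: "\<rho> k \<in> V" if k: "k \<in> L" for k
    proof -
      have kH: "k \<in> H" and kc: "cong_mat n l k (1\<^sub>m n)" using k unfolding L_def cong_subgroup_def by auto
      have "k \<in> U"
      proof (rule W(3)[rule_format, OF Hc[OF kH]])
        fix i j assume ij: "i < n" "j < n"
        then have "k $$ (i, j) \<in> residue l (1\<^sub>m n $$ (i, j))" using kc unfolding cong_mat_def residue_def by blast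
        also have "\<dots> \<subseteq> residue (f (i, j)) (1\<^sub>m n $$ (i, j))" using fl ij by (intro residue_antimono) auto
        also have "\<dots> \<subseteq> W (i, j)" using f ij by blast
        finally show "k $$ (i, j) \<in> W (i, j)" .
      qed
      then show ?thesis using U(2) kH by blast
    qed
    have "\<rho> k = 1\<^sub>m d" if k: "k \<in> L" for k
    proof (rule no_small_subgroups[of L \<rho> d k])
      show "\<rho> k \<in> carrier_mat d d" if "k \<in> L" for k using \<rho>c that unfolding L_def by blast
      show "\<exists>k'\<in>L. \<rho> k' = \<rho> k * \<rho> k" if "k \<in> L" for k
      proof
        have kk: "k \<in> H" "k \<in> cong_subgroup n l" using that unfolding L_def by auto
        show "\<rho> (k \<otimes>\<^bsub>GL n\<^esub> k) = \<rho> k * \<rho> k" using mat_repD(3)[OF \<rho>, of k k] kk by simp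
        show "k \<otimes>\<^bsub>GL n\<^esub> k \<in> L" unfolding L_def
          using subgroup.m_closed[OF H kk(1) kk(1)]
            subgroup.m_closed[OF normal_imp_subgroup[OF cong_subgroup_normal] kk(2) kk(2)] by blast
      qed
      show "cmod (\<rho> k $$ (i, j) - 1\<^sub>m d $$ (i, j)) \<le> 1 / (2 * real (d * d))" if "k \<in> L" "i < d" "j < d" for k i j
        using LU[OF that(1)] that(2,3) unfolding V_def by (auto simp: dist_norm norm_minus_commute less_imp_le)
    qed (rule k)
    then show "\<exists>l. \<forall>k\<in>H \<inter> cong_subgroup n l. \<rho> k = 1\<^sub>m d" unfolding L_def by blast
  next
    have \<rho>c: "\<rho> h \<in> carrier_mat d d" if "h \<in> H" for h using mat_repD(1)[OF \<rho>] that by simp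
    assume "\<exists>l. \<forall>k\<in>H \<inter> cong_subgroup n l. \<rho> k = 1\<^sub>m d"
    then obtain l where l: "\<forall>k\<in>H \<inter> cong_subgroup n l. \<rho> k = 1\<^sub>m d" ..
    have const: "\<rho> B = \<rho> A" if A: "A \<in> H" and B: "B \<in> H" and c: "cong_mat n l A B" for A B
    proof -
      have AG: "A \<in> carrier (GL n)" "B \<in> carrier (GL n)" using A B HGL by auto
      define k where "k = inv\<^bsub>GL n\<^esub> A \<otimes>\<^bsub>GL n\<^esub> B"
      have "k \<in> cong_subgroup n l" unfolding k_def cong_subgroup_iff[OF AG] by (rule c)
      moreover have kH: "k \<in> H" unfolding k_def by (rule G.subgroup_mult_inv[OF H A B])
      ultimately have "\<rho> k = 1\<^sub>m d" using l by blast
      moreover have "B = A \<otimes>\<^bsub>GL n\<^esub> k" unfolding k_def using AG by (simp add: G.m_assoc[symmetric])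
      ultimately show ?thesis using mat_repD(3)[OF \<rho>, of A k] A kH right_mult_one_mat[OF \<rho>c[OF A]] by simp
    qed
    show "continuous_map ?T (mat_topology euclidean d) \<rho>"
      unfolding continuous_map_def tsH tsE
    proof (intro conjI allI impI)
      show "\<rho> \<in> H \<rightarrow> carrier_mat d d" using \<rho>c by blast
      fix U assume "openin (mat_topology (euclidean :: complex topology) d) U"
      show "openin ?T {x \<in> H. \<rho> x \<in> U}"
      proof (subst openin_subopen, intro ballI)
        fix A assume A: "A \<in> {x \<in> H. \<rho> x \<in> U}"
        define N where "N = {B \<in> carrier_mat n n. \<forall>i<n. \<forall>j<n. B $$ (i, j) \<in> residue l (A $$ (i, j))}"
        have oN: "openin (mat_topology adic n) N"
          unfolding N_def by (rule openin_mat_entries[of n adic "\<lambda>p. residue l (A $$ p)"]) (rule openin_residue)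
        have Nc: "cong_mat n l A B" if "B \<in> N" for B
          by (rule cong_mat_sym) (use that in \<open>simp add: N_def cong_mat_def residue_def\<close>)
        have "openin ?T (N \<inter> H)" using oN unfolding openin_subtopology by blast
        moreover have "A \<in> N \<inter> H" using A Hc residue_self unfolding N_def by auto
        moreover have "N \<inter> H \<subseteq> {x \<in> H. \<rho> x \<in> U}" using const Nc A by auto
        ultimately show "\<exists>T. openin ?T T \<and> A \<in> T \<and> T \<subseteq> {x \<in> H. \<rho> x \<in> U}" by blast
      qed
    qed
  qed
  then show ?thesis unfolding representation_def hom by blast
qed

end

section \<open>Levels of representations\<close>

text \<open>Simultaneous eigenvectors with pairwise distinct characters are linearly independent.\<close>

lemma distinct_eigencharacters_le_dim:
  fixes \<rho> :: "'g \<Rightarrow> complex mat"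
  assumes \<rho>: "\<And>h. h \<in> U \<Longrightarrow> \<rho> h \<in> carrier_mat d d"
    and w: "\<And>a. a < N \<Longrightarrow> w a \<in> carrier_vec d" "\<And>a. a < N \<Longrightarrow> w a \<noteq> 0\<^sub>v d"
    and ev: "\<And>a h. a < N \<Longrightarrow> h \<in> U \<Longrightarrow> \<rho> h *\<^sub>v w a = e a h \<cdot>\<^sub>v w a"
    and ne: "\<And>a b. a < N \<Longrightarrow> b < N \<Longrightarrow> a \<noteq> b \<Longrightarrow> \<exists>h\<in>U. e a h \<noteq> e b h"
  shows "N \<le> d"
proof -
  have indep: "\<forall>a\<in>A. x a = 0" if "finite A" "A \<subseteq> {..<N}" "\<forall>i<d. (\<Sum>a\<in>A. x a * w a $ i) = 0" for A and x :: "nat \<Rightarrow> complex"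
    using that
  proof (induction A arbitrary: x rule: finite_induct)
    case (insert b A)
    have b: "b < N" using insert.prems insert.hyps by auto
    have zero: "x a = 0" if a: "a \<in> A" for a
    proof -
      have aN: "a < N" "a \<noteq> b" using a insert.prems insert.hyps by auto
      obtain h where h: "h \<in> U" "e a h \<noteq> e b h" using ne[OF aN(1) b aN(2)] by blast
      have "(\<Sum>c\<in>A. (x c * (e c h - e b h)) * w c $ i) = 0" if i: "i < d" for i
      proof -
        have evi: "(\<Sum>j<d. \<rho> h $$ (i, j) * w c $ j) = e c h * w c $ i" if "c \<in> insert b A" for c
        proof -
          have cN: "c < N" using that insert.prems insert.hyps by auto
          have "(\<rho> h *\<^sub>v w c) $ i = (e c h \<cdot>\<^sub>v w c) $ i" using ev[OF cN h(1)] by simp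
          then show ?thesis using i \<rho>[OF h(1)] w(1)[OF cN] by (simp add: scalar_prod_def lessThan_atLeast0)
        qed
        have "0 = (\<Sum>j<d. \<rho> h $$ (i, j) * (\<Sum>c\<in>insert b A. x c * w c $ j))" using insert.prems by simp
        also have "\<dots> = (\<Sum>c\<in>insert b A. x c * (\<Sum>j<d. \<rho> h $$ (i, j) * w c $ j))"
          unfolding sum_distrib_left by (subst sum.swap) (simp add: mult_ac)
        also have "\<dots> = (\<Sum>c\<in>insert b A. x c * (e c h * w c $ i))" using evi by (intro sum.cong) auto
        finally have 1: "(\<Sum>c\<in>insert b A. x c * (e c h * w c $ i)) = 0" by simp
        have 2: "(\<Sum>c\<in>insert b A. e b h * (x c * w c $ i)) = 0"
          unfolding sum_distrib_left[symmetric] using insert.prems i by simp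
        have "(\<Sum>c\<in>insert b A. (x c * (e c h - e b h)) * w c $ i) = 0"
          using 1 2 by (simp add: algebra_simps sum_subtractf)
        then show ?thesis using insert.hyps h(1) by simp
      qed
      then have "\<forall>c\<in>A. x c * (e c h - e b h) = 0" using insert.prems by (intro insert.IH) auto
      then show ?thesis using a h by auto
    qed
    then have "x b * w b $ i = 0" if "i < d" for i
      using insert.prems(2) insert.hyps that by (auto simp: sum.neutral)
    moreover obtain i where "i < d" "w b $ i \<noteq> 0"
    proof -
      have "\<exists>i<d. w b $ i \<noteq> 0"
      proof (rule ccontr)
        assume "\<not> ?thesis"
        then have "w b = 0\<^sub>v d" using w(1)[OF b] by (intro eq_vecI) auto
        then show False using w(2)[OF b] by simp
      qed
      then show ?thesis using that by blast
    qed
    ultimately have "x b = 0" by auto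
    then show ?case using zero by auto
  qed simp
  define P where "P = Matrix.mat d N (\<lambda>(i, a). w a $ i)"
  have P: "P \<in> carrier_mat d N" by (simp add: P_def)
  show ?thesis
  proof (rule injective_mat_dim_le[OF P])
    fix x :: "complex vec" assume x: "x \<in> carrier_vec N" "P *\<^sub>v x = 0\<^sub>v d"
    have "(\<Sum>a\<in>{..<N}. x $ a * w a $ i) = 0" if i: "i < d" for i
    proof -
      have "(P *\<^sub>v x) $ i = 0" using x(2) i by simp
      then show ?thesis using i x(1) by (simp add: P_def scalar_prod_def lessThan_atLeast0 mult.commute)
    qed
    then have "\<forall>a\<in>{..<N}. x $ a = 0" by (intro indep) auto
    then show "x = 0\<^sub>v N" using x by (intro eq_vecI) auto
  qed
qed

text \<open>The elementary matrix \<open>1 + c e\<^sub>i\<^sub>j\<close>.\<close>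

definition elementary :: "nat \<Rightarrow> nat \<Rightarrow> nat \<Rightarrow> 'a :: comm_ring_1 \<Rightarrow> 'a mat" where
  "elementary n i j c = Matrix.mat n n (\<lambda>(p, q). (if p = q then 1 else 0) + (if p = i \<and> q = j then c else 0))"

text \<open>The matrix \<open>c e\<^sub>i\<^sub>j\<close> with a single entry \<open>c\<close>.\<close>

definition entry_mat :: "nat \<Rightarrow> nat \<Rightarrow> nat \<Rightarrow> 'a :: comm_ring_1 \<Rightarrow> 'a mat" where
  "entry_mat n i j c = Matrix.mat n n (\<lambda>(p, q). if p = i \<and> q = j then c else 0)"

lemma elementary_carrier: "elementary n i j c \<in> carrier_mat n n"
  by (simp add: elementary_def)

lemma entry_mat_carrier: "entry_mat n i j c \<in> carrier_mat n n"
  by (simp add: entry_mat_def)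

text \<open>Multiplication by an elementary matrix from the left is a row operation, from the right a column operation.\<close>

lemma elementary_mult:
  assumes A: "A \<in> carrier_mat n n" and "p < n" "q < n" "i < n" "j < n"
  shows "(elementary n i j c * A) $$ (p, q) = A $$ (p, q) + (if p = i then c * A $$ (j, q) else 0)"
    "(A * elementary n i j c) $$ (p, q) = A $$ (p, q) + (if q = j then c * A $$ (p, i) else 0)"
proof -
  have "(elementary n i j c * A) $$ (p, q) = (\<Sum>k<n. elementary n i j c $$ (p, k) * A $$ (k, q))"
    by (rule index_mult_mat_sum[OF elementary_carrier A assms(2,3)])
  also have "\<dots> = (\<Sum>k<n. (if p = k then A $$ (k, q) else 0) + (if k = j then (if p = i then c * A $$ (j, q) else 0) else 0))"
    using assms by (intro sum.cong) (auto simp: elementary_def algebra_simps)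
  also have "\<dots> = A $$ (p, q) + (if p = i then c * A $$ (j, q) else 0)"
    using assms by (simp add: sum.distrib)
  finally show "(elementary n i j c * A) $$ (p, q) = A $$ (p, q) + (if p = i then c * A $$ (j, q) else 0)" .
  have "(A * elementary n i j c) $$ (p, q) = (\<Sum>k<n. A $$ (p, k) * elementary n i j c $$ (k, q))"
    by (rule index_mult_mat_sum[OF A elementary_carrier assms(2,3)])
  also have "\<dots> = (\<Sum>k<n. (if k = q then A $$ (p, k) else 0) + (if k = i then (if q = j then c * A $$ (p, i) else 0) else 0))"
    using assms by (intro sum.cong) (auto simp: elementary_def algebra_simps)
  also have "\<dots> = A $$ (p, q) + (if q = j then c * A $$ (p, i) else 0)"
    using assms by (simp add: sum.distrib)
  finally show "(A * elementary n i j c) $$ (p, q) = A $$ (p, q) + (if q = j then c * A $$ (p, i) else 0)" .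
qed

lemma elementary_add:
  assumes "i < n" "j < n" "i \<noteq> j"
  shows "elementary n i j a * elementary n i j b = elementary n i j (a + b)"
proof (rule eq_matI)
  fix p q assume "p < dim_row (elementary n i j (a + b))" "q < dim_col (elementary n i j (a + b))"
  then have pq: "p < n" "q < n" using carrier_matD[OF elementary_carrier[of n i j "a + b"]] by auto
  show "(elementary n i j a * elementary n i j b) $$ (p, q) = elementary n i j (a + b) $$ (p, q)"
    unfolding elementary_mult(1)[OF elementary_carrier pq assms(1,2)]
    using pq assms by (auto simp: elementary_def)
qed (simp_all add: elementary_def)

lemma elementary_GL:
  assumes "i < n" "j < n" "i \<noteq> j"
  shows "elementary n i j c \<in> carrier (GL n)"
proof -
  have z: "elementary n i j 0 = 1\<^sub>m n" by (intro eq_matI) (auto simp: elementary_def)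
  show ?thesis unfolding GL_carrier_iff
    using elementary_add[OF assms, of c "- c"] elementary_add[OF assms, of "- c" c] elementary_carrier z
    by (metis add.left_inverse add.right_inverse)
qed

context complete_dvr
begin

text \<open>The continuous characters of the general linear group that are trivial on the special linear group.\<close>

definition det_char :: "nat \<Rightarrow> ('a mat \<Rightarrow> complex) \<Rightarrow> bool" where
  "det_char n \<chi> \<longleftrightarrow> \<chi> (1\<^sub>m n) = 1 \<and> (\<forall>g\<in>carrier (GL n). \<forall>h\<in>carrier (GL n). \<chi> (g * h) = \<chi> g * \<chi> h) \<and>
     (\<forall>g\<in>carrier (GL n). det g = 1 \<longrightarrow> \<chi> g = 1) \<and> (\<exists>l. \<forall>g\<in>cong_subgroup n l. \<chi> g = 1)"

lemma det_charD:
  assumes "det_char n \<chi>"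
  shows "\<chi> (1\<^sub>m n) = 1" "\<And>g h. g \<in> carrier (GL n) \<Longrightarrow> h \<in> carrier (GL n) \<Longrightarrow> \<chi> (g * h) = \<chi> g * \<chi> h"
    "\<And>g. g \<in> carrier (GL n) \<Longrightarrow> det g = 1 \<Longrightarrow> \<chi> g = 1" "\<exists>l. \<forall>g\<in>cong_subgroup n l. \<chi> g = 1"
  using assms unfolding det_char_def by auto

lemma det_char_nonzero: "det_char n \<chi> \<Longrightarrow> g \<in> carrier (GL n) \<Longrightarrow> \<chi> g \<noteq> 0"
proof -
  assume c: "det_char n \<chi>" and g: "g \<in> carrier (GL n)"
  interpret G: group "GL n :: 'a mat monoid" by (rule GL_group)
  have "\<chi> g * \<chi> (inv\<^bsub>GL n\<^esub> g) = 1"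
    using det_charD(2)[OF c g G.inv_closed[OF g]] det_charD(1)[OF c] GL_inv(3)[OF g] by simp
  then show ?thesis by auto
qed

lemma det_char_mult_inverse:
  assumes a: "det_char n \<chi>" and b: "det_char n \<psi>"
  shows "det_char n (\<lambda>g. \<chi> g * inverse (\<psi> g))"
proof -
  obtain l l' where l: "\<forall>g\<in>cong_subgroup n l. \<chi> g = 1" "\<forall>g\<in>cong_subgroup n l'. \<psi> g = 1"
    using det_charD(4)[OF a] det_charD(4)[OF b] by blast
  have "\<chi> g * inverse (\<psi> g) = 1" if "g \<in> cong_subgroup n (max l l')" for g
  proof -
    have "g \<in> cong_subgroup n l" "g \<in> cong_subgroup n l'"
      using that cong_subgroup_antimono[of l "max l l'" n] cong_subgroup_antimono[of l' "max l l'" n] by auto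
    then show ?thesis using l by simp
  qed
  then show ?thesis
    unfolding det_char_def using det_charD(1-3)[OF a] det_charD(1-3)[OF b]
    by (auto simp: inverse_mult_distrib)
qed

text \<open>A character on \<open>{g. det g \<equiv> 1}\<close> modulo \<open>\<pi>\<^sup>m\<close> that factors through the determinant modulo
  \<open>\<pi>\<^sup>l\<close> extends to the whole group: it is contained in an irreducible representation of the abelian
  quotient of the group by \<open>{g. det g \<equiv> 1}\<close> modulo \<open>\<pi>\<^sup>l\<close>.\<close>

lemma extend_det_char:
  assumes ml: "m \<le> l"
    and \<alpha>: "\<And>g h. g \<in> carrier (GL n) \<Longrightarrow> h \<in> carrier (GL n) \<Longrightarrow> \<pi> ^ m dvd det g - 1 \<Longrightarrow> \<pi> ^ m dvd det h - 1 \<Longrightarrow>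
          \<alpha> (g * h) = \<alpha> g * \<alpha> h"
    and triv: "\<And>g. g \<in> carrier (GL n) \<Longrightarrow> \<pi> ^ l dvd det g - 1 \<Longrightarrow> \<alpha> g = 1"
  obtains \<beta> where "det_char n \<beta>" "\<forall>g\<in>carrier (GL n). \<pi> ^ m dvd det g - 1 \<longrightarrow> \<beta> g = \<alpha> g"
proof -
  interpret G: group "GL n :: 'a mat monoid" by (rule GL_group)
  have mc: "A \<in> carrier_mat n n" if "A \<in> carrier (GL n)" for A :: "'a mat" using that GL_carrier_iff by blast
  have dm: "det (g * h) = det g * det h" if "g \<in> carrier (GL n)" "h \<in> carrier (GL n)" for g h :: "'a mat"
    by (rule det_mult[OF mc[OF that(1)] mc[OF that(2)]])
  have di: "det (inv\<^bsub>GL n\<^esub> g) * det g = 1" if "g \<in> carrier (GL n)" for g :: "'a mat"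
    by (rule det_GL_inv[OF that])
  define D where "D = (\<lambda>k. {g \<in> carrier (GL n :: 'a mat monoid). \<pi> ^ k dvd det g - 1})"
  have Dsub: "subgroup (D k) (GL n)" for k
  proof (rule G.subgroupI)
    show "D k \<subseteq> carrier (GL n)" by (auto simp: D_def)
    have "1\<^sub>m n \<in> D k" using G.one_closed by (simp add: D_def GL_one)
    then show "D k \<noteq> {}" by blast
    show "inv\<^bsub>GL n\<^esub> g \<in> D k" if g: "g \<in> D k" for g
    proof -
      have gG: "g \<in> carrier (GL n)" using g by (simp add: D_def)
      have "det (inv\<^bsub>GL n\<^esub> g) - 1 = - det (inv\<^bsub>GL n\<^esub> g) * (det g - 1)" using di[OF gG] by (simp add: algebra_simps)
      also have "\<pi> ^ k dvd \<dots>" using g by (intro dvd_mult) (simp add: D_def)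
      finally show ?thesis using gG by (simp add: D_def)
    qed
    show "g \<otimes>\<^bsub>GL n\<^esub> h \<in> D k" if g: "g \<in> D k" and h: "h \<in> D k" for g h
    proof -
      have gG: "g \<in> carrier (GL n)" "h \<in> carrier (GL n)" using g h by (auto simp: D_def)
      have "det (g * h) - 1 = det g * (det h - 1) + (det g - 1)" using dm[OF gG] by (simp add: algebra_simps)
      also have "\<pi> ^ k dvd \<dots>" using g h by (intro dvd_add dvd_mult) (simp_all add: D_def)
      finally have "\<pi> ^ k dvd det (g * h) - 1" .
      then show ?thesis using G.m_closed[OF gG] by (simp add: D_def GL_mult)
    qed
  qed
  have Dnorm: "D k \<lhd> GL n" for k
    unfolding G.normal_inv_iff
  proof (intro conjI ballI Dsub)
    fix x h assume x: "x \<in> carrier (GL n :: 'a mat monoid)" and h: "h \<in> D k"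
    have hG: "h \<in> carrier (GL n)" using h by (simp add: D_def)
    have xh: "x * h \<in> carrier (GL n)" using G.m_closed[OF x hG] by (simp add: GL_mult)
    have "det (x * h * inv\<^bsub>GL n\<^esub> x) = det h"
      using dm[OF xh G.inv_closed[OF x]] dm[OF x hG] di[OF x] by (simp add: mult_ac)
    then show "x \<otimes>\<^bsub>GL n\<^esub> h \<otimes>\<^bsub>GL n\<^esub> inv\<^bsub>GL n\<^esub> x \<in> D k"
      using h G.m_closed[OF G.m_closed[OF x hG] G.inv_closed[OF x]] by (simp add: D_def GL_mult)
  qed
  have KD: "cong_subgroup n l \<subseteq> D l"
  proof
    fix g assume g: "g \<in> cong_subgroup n l"
    have gG: "g \<in> carrier (GL n)" using g cong_subgroup_subset by blast
    have "\<pi> ^ l dvd det g - det (1\<^sub>m n)"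
      by (rule det_cong[OF mc[OF gG] one_carrier_mat]) (use g cong_subgroup_mem_iff[OF gG] in blast)
    then show "g \<in> D l" using gG by (simp add: D_def)
  qed
  have Dfin: "finite (lcosets_of (GL n) (D l))"
  proof -
    define F where "F = (\<lambda>C. l_coset (GL n) (SOME x. x \<in> C) (D l))"
    have "lcosets_of (GL n) (D l) \<subseteq> F ` lcosets_of (GL n) (cong_subgroup n l)"
    proof
      fix C assume "C \<in> lcosets_of (GL n) (D l)"
      then obtain g where g: "g \<in> carrier (GL n)" "C = l_coset (GL n) g (D l)" unfolding lcosets_of_def by auto
      define B where "B = l_coset (GL n) g (cong_subgroup n l)"
      have "g \<otimes>\<^bsub>GL n\<^esub> \<one>\<^bsub>GL n\<^esub> \<in> B"
        unfolding B_def l_coset_def using subgroup.one_closed[OF normal_imp_subgroup[OF cong_subgroup_normal]] by blast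
      then have "(SOME x. x \<in> B) \<in> B" by (rule someI)
      then obtain k where k: "k \<in> cong_subgroup n l" "(SOME x. x \<in> B) = g \<otimes>\<^bsub>GL n\<^esub> k"
        unfolding B_def l_coset_def by auto
      have kG: "k \<in> carrier (GL n)" using k cong_subgroup_subset by blast
      have "inv\<^bsub>GL n\<^esub> g \<otimes>\<^bsub>GL n\<^esub> (g \<otimes>\<^bsub>GL n\<^esub> k) = k" using g kG by (simp add: G.m_assoc[symmetric])
      then have "C = F B"
        unfolding F_def k(2) g(2) using G.lcoset_eq_iff[OF Dsub g(1), of "g \<otimes>\<^bsub>GL n\<^esub> k" l] k(1) KD g kG by auto
      then show "C \<in> F ` lcosets_of (GL n) (cong_subgroup n l)" using g(1) unfolding B_def lcosets_of_def by blast
    qed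
    then show ?thesis using cong_subgroup_index(1) by (meson finite_imageI finite_subset)
  qed
  define \<sigma> where "\<sigma> = (\<lambda>g. Matrix.mat 1 1 (\<lambda>_. \<alpha> g))"
  have one: "\<alpha> (1\<^sub>m n) = 1" using triv[OF G.one_closed] by (simp add: GL_one)
  have \<sigma>: "mat_rep ((GL n)\<lparr>carrier := D m\<rparr>) 1 \<sigma>"
    unfolding mat_rep_def
  proof (intro conjI ballI)
    show "\<sigma> g \<in> carrier_mat 1 1" for g by (simp add: \<sigma>_def)
    show "\<sigma> \<one>\<^bsub>(GL n)\<lparr>carrier := D m\<rparr>\<^esub> = 1\<^sub>m 1" using one by (auto simp: \<sigma>_def GL_one intro!: eq_matI)
    fix g h assume gh: "g \<in> carrier ((GL n)\<lparr>carrier := D m\<rparr>)" "h \<in> carrier ((GL n)\<lparr>carrier := D m\<rparr>)"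
    then have "\<alpha> (g * h) = \<alpha> g * \<alpha> h" by (intro \<alpha>) (auto simp: D_def)
    then show "\<sigma> (g \<otimes>\<^bsub>(GL n)\<lparr>carrier := D m\<rparr>\<^esub> h) = \<sigma> g * \<sigma> h"
      by (auto simp: \<sigma>_def GL_mult scalar_prod_def intro!: eq_matI)
  qed
  have \<sigma>t: "\<sigma> k = 1\<^sub>m 1" if "k \<in> D m" "k \<in> D l" for k
    using triv[of k] that by (auto simp: \<sigma>_def D_def intro!: eq_matI)
  obtain r \<tau> T where \<tau>: "mat_rep (GL n) r \<tau>" and irr: "mat_irreducible (carrier (GL n)) r \<tau>"
    and \<tau>D: "\<forall>k\<in>D l. \<tau> k = 1\<^sub>m r" and T: "intertwines (D m) r 1 \<tau> \<sigma> T" "T \<noteq> 0\<^sub>m 1 r"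
    by (rule G.irreducible_over_subgroup[OF Dnorm[of l] Dfin Dsub[of m] \<sigma>]) (use \<sigma>t in auto)
  note \<tau>c = mat_repD(1)[OF \<tau>] and r0 = mat_irreducibleD(1)[OF irr]
  have comm: "\<tau> g * \<tau> h = \<tau> h * \<tau> g" if g: "g \<in> carrier (GL n)" and h: "h \<in> carrier (GL n)" for g h
  proof -
    have gh: "g * h \<in> carrier (GL n)" "h * g \<in> carrier (GL n)"
      using G.m_closed[OF g h] G.m_closed[OF h g] by (simp_all add: GL_mult)
    define k where "k = inv\<^bsub>GL n\<^esub> (h * g) * (g * h)"
    have kG: "k \<in> carrier (GL n)" using G.m_closed[OF G.inv_closed[OF gh(2)] gh(1)] by (simp add: k_def GL_mult)
    have "det k = 1" unfolding k_def using dm[OF G.inv_closed[OF gh(2)] gh(1)] dm[OF g h] dm[OF h g] di[OF gh(2)]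
      by (simp add: mult_ac)
    then have k1: "\<tau> k = 1\<^sub>m r" using kG \<tau>D by (simp add: D_def)
    have "h * g * k = g * h" unfolding k_def
      using assoc_mult_mat[OF mc[OF gh(2)] mc[OF G.inv_closed[OF gh(2)]] mc[OF gh(1)]] GL_inv(3)[OF gh(2)]
        left_mult_one_mat[OF mc[OF gh(1)]] by simp
    then have "\<tau> (g * h) = \<tau> (h * g) * \<tau> k" using mat_repD(3)[OF \<tau> gh(2) kG] by (simp add: GL_mult)
    then have "\<tau> (g * h) = \<tau> (h * g)" unfolding k1 using right_mult_one_mat[OF \<tau>c[OF gh(2)]] by simp
    then show ?thesis using mat_repD(3)[OF \<tau> g h] mat_repD(3)[OF \<tau> h g] by (simp add: GL_mult)
  qed
  have "\<exists>c. \<tau> g = c \<cdot>\<^sub>m 1\<^sub>m r" if g: "g \<in> carrier (GL n)" for g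
    using schur_scalar[OF irr \<tau>c[OF g] comm[OF g]] by metis
  then obtain \<beta> where \<beta>: "\<And>g. g \<in> carrier (GL n) \<Longrightarrow> \<tau> g = \<beta> g \<cdot>\<^sub>m 1\<^sub>m r" by metis
  have \<beta>v: "\<beta> g = \<tau> g $$ (0, 0)" if "g \<in> carrier (GL n)" for g using \<beta>[OF that] r0 by simp
  have \<beta>1: "\<beta> g = 1" if "g \<in> D l" for g
    using \<beta>v[of g] \<tau>D that r0 by (auto simp: D_def)
  have "det_char n \<beta>"
    unfolding det_char_def
  proof (intro conjI ballI impI)
    show "\<beta> (1\<^sub>m n) = 1" using \<beta>1[OF subgroup.one_closed[OF Dsub]] by (simp add: GL_one)
    show "\<beta> (g * h) = \<beta> g * \<beta> h" if gh: "g \<in> carrier (GL n)" "h \<in> carrier (GL n)" for g h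
    proof -
      have ghG: "g * h \<in> carrier (GL n)" using G.m_closed[OF gh] by (simp add: GL_mult)
      have "\<tau> (g * h) = \<tau> g * \<tau> h" using mat_repD(3)[OF \<tau> gh] by (simp add: GL_mult)
      then have "\<tau> (g * h) $$ (0, 0) = (\<beta> g \<cdot>\<^sub>m 1\<^sub>m r * (\<beta> h \<cdot>\<^sub>m 1\<^sub>m r)) $$ (0, 0)" using \<beta> gh by simp
      also have "\<dots> = \<beta> g * \<beta> h"
        using mult_smult_assoc_mat[OF one_carrier_mat, of "\<beta> h \<cdot>\<^sub>m 1\<^sub>m r" r r "\<beta> g"] r0 by simp
      finally show ?thesis using \<beta>v[OF ghG] by simp
    qed
    show "\<beta> g = 1" if "g \<in> carrier (GL n)" "det g = 1" for g using \<beta>1[of g] that by (simp add: D_def)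
    show "\<exists>l. \<forall>g\<in>cong_subgroup n l. \<beta> g = 1" using \<beta>1 KD by blast
  qed
  moreover have "\<beta> g = \<alpha> g" if g: "g \<in> carrier (GL n)" "\<pi> ^ m dvd det g - 1" for g
  proof -
    have gD: "g \<in> D m" using g by (simp add: D_def)
    note Tc = intertwinesD(1)[OF T(1)]
    obtain j where j: "j < r" "T $$ (0, j) \<noteq> 0"
    proof -
      have "\<exists>j<r. T $$ (0, j) \<noteq> 0"
      proof (rule ccontr)
        assume "\<not> ?thesis"
        then have "T = 0\<^sub>m 1 r" using Tc by (intro eq_matI) auto
        then show False using T(2) by simp
      qed
      then show ?thesis using that by blast
    qed
    have "T * \<tau> g = \<beta> g \<cdot>\<^sub>m T" unfolding \<beta>[OF g(1)]
      using mult_smult_distrib[OF Tc one_carrier_mat, of "\<beta> g"] right_mult_one_mat[OF Tc] by simp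
    then have e: "\<beta> g \<cdot>\<^sub>m T = \<sigma> g * T" using intertwinesD(2)[OF T(1) gD] by (simp only:)
    have "\<beta> g * T $$ (0, j) = (\<beta> g \<cdot>\<^sub>m T) $$ (0, j)" using carrier_matD[OF Tc] j by simp
    also have "\<dots> = (\<sigma> g * T) $$ (0, j)" by (simp only: e)
    also have "\<dots> = \<alpha> g * T $$ (0, j)" using Tc j by (simp add: \<sigma>_def scalar_prod_def)
    finally show ?thesis using j by simp
  qed
  ultimately show thesis by (intro that[of \<beta>]) auto
qed

end

lemma (in group) conj_cancel:
  assumes "x \<in> carrier G" "c \<in> carrier G" "m \<in> carrier G"
  shows "inv x \<otimes> (x \<otimes> c \<otimes> m \<otimes> inv (x \<otimes> c)) \<otimes> x = c \<otimes> m \<otimes> inv c"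
proof -
  have h: "inv x \<otimes> (x \<otimes> y) = y" if "y \<in> carrier G" for y using assms(1) that by (simp add: m_assoc[symmetric])
  show ?thesis using assms by (simp add: inv_mult_group m_assoc h)
qed

context complete_dvr
begin

text \<open>The last layer of a representation of small dimension can be removed by a twist, if its level \<open>m + k\<close> exceeds
  \<open>2 k\<close>.  On the congruence subgroup of level \<open>m\<close>, which is abelian modulo level \<open>m + k\<close>, there is an eigencharacter; its
  values on \<open>1 + \<pi>\<^sup>m Y\<close> define an additive character \<open>\<Theta>\<close> in \<open>Y\<close>.  Since the dimension is less than
  \<open>|O / \<pi>\<^sup>k|\<close>, for any two indices \<open>i\<close> and \<open>j\<close> a nontrivial elementary matrix \<open>1 + c e\<^sub>i\<^sub>j\<close> with
  \<open>c\<close> dividing \<open>\<pi>\<^sup>k\<^sup>-\<^sup>1\<close> fixes \<open>\<Theta>\<close>.  Hence \<open>\<Theta>\<close> is a function of the trace on multiples of \<open>\<pi>\<^sup>k\<^sup>-\<^sup>1\<close>, and the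
  eigencharacter is a function of the determinant on the last layer.\<close>

lemma level_reduction:
  assumes n: "n > 0" and \<rho>: "mat_rep (GL n) d \<rho>" and irr: "mat_irreducible (carrier (GL n)) d \<rho>"
    and level: "\<And>g. g \<in> cong_subgroup n (m + k) \<Longrightarrow> \<rho> g = 1\<^sub>m d"
    and km: "0 < k" "k < m" and small: "d < residues_card k"
  obtains \<beta> where "det_char n \<beta>" "\<forall>g\<in>cong_subgroup n (m + k - 1). inverse (\<beta> g) \<cdot>\<^sub>m \<rho> g = 1\<^sub>m d"
proof -
  interpret G: group "GL n :: 'a mat monoid" by (rule GL_group)
  define l where "l = m + k"
  have l: "m \<le> l - 1" "l \<le> 2 * m" "0 < m" "l \<le> 2 * (l - 1)" "m + (k - 1) = l - 1" using km by (auto simp: l_def)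
  note \<rho>c = mat_repD(1)[OF \<rho>]
  have mc: "A \<in> carrier_mat n n" if "A \<in> carrier (GL n)" for A :: "'a mat" using that GL_carrier_iff by blast
  have \<rho>m: "\<rho> (g * h) = \<rho> g * \<rho> h" if "g \<in> carrier (GL n)" "h \<in> carrier (GL n)" for g h
    using mat_repD(3)[OF \<rho> that] by (simp add: GL_mult)
  define Km where "Km = cong_subgroup n m"
  have KmG: "h \<in> carrier (GL n)" if "h \<in> Km" for h using that cong_subgroup_subset unfolding Km_def by blast
  have Kms: "subgroup Km (GL n)" unfolding Km_def by (rule normal_imp_subgroup[OF cong_subgroup_normal])
  have Kmn: "Km \<lhd> GL n" unfolding Km_def by (rule cong_subgroup_normal)
  have \<rho>cong: "\<rho> B = \<rho> A" if A: "A \<in> carrier (GL n)" and B: "B \<in> carrier (GL n)" and c: "cong_mat n l A B" for A B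
  proof -
    define t where "t = inv\<^bsub>GL n\<^esub> A \<otimes>\<^bsub>GL n\<^esub> B"
    have t: "t \<in> cong_subgroup n l" unfolding t_def cong_subgroup_iff[OF A B] by (rule c)
    then have tG: "t \<in> carrier (GL n)" using cong_subgroup_subset by blast
    have "\<rho> t = 1\<^sub>m d" by (rule level) (use t in \<open>simp add: l_def\<close>)
    moreover have "B = A \<otimes>\<^bsub>GL n\<^esub> t" unfolding t_def using A B by (simp add: G.m_assoc[symmetric])
    ultimately show ?thesis using mat_repD(3)[OF \<rho> A tG] right_mult_one_mat[OF \<rho>c[OF A]] by simp
  qed
  \<comment> \<open>The elements of \<open>Km\<close> are the \<open>M Y\<close>, and \<open>M\<close> turns sums into products modulo level \<open>l\<close>.\<close>
  define M where "M = (\<lambda>Y :: 'a mat. Matrix.mat n n (\<lambda>(p, q). (if p = q then 1 else 0) + \<pi> ^ m * Y $$ (p, q)))"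
  have Mc: "M Y \<in> carrier_mat n n" for Y by (simp add: M_def)
  have Mi: "M Y $$ (p, q) = (if p = q then 1 else 0) + \<pi> ^ m * Y $$ (p, q)" if "p < n" "q < n" for Y p q
    using that by (simp add: M_def)
  have MK: "M Y \<in> Km" for Y
  proof -
    have c: "cong_mat n m (M Y) (1\<^sub>m n)" unfolding cong_mat_def by (auto simp: Mi)
    then show ?thesis unfolding Km_def cong_subgroup_def using cong_one_GL[OF Mc c l(3)] by simp
  qed
  have Kex: "\<exists>Y\<in>carrier_mat n n. h = M (\<pi> ^ r \<cdot>\<^sub>m Y)" if h: "h \<in> cong_subgroup n (m + r)" for h r
  proof -
    have hc: "h \<in> carrier_mat n n" and hm: "cong_mat n (m + r) h (1\<^sub>m n)" using h mc unfolding cong_subgroup_def by auto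
    have "\<forall>p\<in>{..<n} \<times> {..<n}. \<exists>y. h $$ p - 1\<^sub>m n $$ p = \<pi> ^ (m + r) * y" using hm unfolding cong_mat_def dvd_def by auto
    then obtain f where f: "\<forall>p\<in>{..<n} \<times> {..<n}. h $$ p - 1\<^sub>m n $$ p = \<pi> ^ (m + r) * f p" by metis
    have "h = M (\<pi> ^ r \<cdot>\<^sub>m Matrix.mat n n f)"
    proof (rule eq_matI)
      fix p q assume "p < dim_row (M (\<pi> ^ r \<cdot>\<^sub>m Matrix.mat n n f))" "q < dim_col (M (\<pi> ^ r \<cdot>\<^sub>m Matrix.mat n n f))"
      then have pq: "p < n" "q < n" using carrier_matD[OF Mc] by auto
      have "h $$ (p, q) - 1\<^sub>m n $$ (p, q) = \<pi> ^ (m + r) * f (p, q)" using f pq by blast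
      then show "h $$ (p, q) = M (\<pi> ^ r \<cdot>\<^sub>m Matrix.mat n n f) $$ (p, q)" using pq by (simp add: Mi power_add algebra_simps)
    qed (use hc carrier_matD[OF Mc] in auto)
    then show ?thesis by (intro bexI[of _ "Matrix.mat n n f"]) auto
  qed
  have Mmul: "cong_mat n l (M (Y + Z)) (M Y * M Z)" if Y: "Y \<in> carrier_mat n n" and Z: "Z \<in> carrier_mat n n" for Y Z
    unfolding cong_mat_def
  proof (intro allI impI)
    fix p q assume pq: "p < n" "q < n"
    have pp: "\<pi> ^ (2 * m) = \<pi> ^ m * \<pi> ^ m" by (simp add: power_add mult_2)
    have "(M Y * M Z) $$ (p, q) = (\<Sum>r<n. M Y $$ (p, r) * M Z $$ (r, q))" by (rule index_mult_mat_sum[OF Mc Mc pq])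
    also have "\<dots> = (\<Sum>r<n. (if p = r then M Z $$ (r, q) else 0) + (if r = q then \<pi> ^ m * Y $$ (p, r) else 0)
          + \<pi> ^ (2 * m) * (Y $$ (p, r) * Z $$ (r, q)))"
      unfolding pp using pq by (intro sum.cong refl) (auto simp: Mi algebra_simps)
    also have "\<dots> = M Z $$ (p, q) + \<pi> ^ m * Y $$ (p, q) + \<pi> ^ (2 * m) * (\<Sum>r<n. Y $$ (p, r) * Z $$ (r, q))"
      using pq by (simp add: sum.distrib sum_distrib_left)
    finally have "M (Y + Z) $$ (p, q) - (M Y * M Z) $$ (p, q) = - (\<pi> ^ (2 * m) * (\<Sum>r<n. Y $$ (p, r) * Z $$ (r, q)))"
      using pq Y Z by (simp add: Mi algebra_simps)
    moreover have "\<pi> ^ l dvd \<pi> ^ (2 * m)" using l by (intro le_imp_power_dvd)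
    ultimately show "\<pi> ^ l dvd M (Y + Z) $$ (p, q) - (M Y * M Z) $$ (p, q)" by (simp add: dvd_mult2)
  qed
  have MG: "M Y \<in> carrier (GL n)" for Y using MK KmG by blast
  have MMG: "M Y * M Z \<in> carrier (GL n)" for Y Z using G.m_closed[OF MG MG] by (simp add: GL_mult)
  have \<rho>M: "\<rho> (M (Y + Z)) = \<rho> (M Y) * \<rho> (M Z)" if "Y \<in> carrier_mat n n" "Z \<in> carrier_mat n n" for Y Z
    using \<rho>cong[OF MG MMG Mmul[OF that]] \<rho>m[OF MG MG] by simp
  have \<rho>comm: "\<rho> g * \<rho> h = \<rho> h * \<rho> g" if g: "g \<in> Km" and h: "h \<in> Km" for g h
  proof -
    obtain Y where Y: "Y \<in> carrier_mat n n" "g = M (\<pi> ^ 0 \<cdot>\<^sub>m Y)" using Kex[of g 0] g unfolding Km_def by auto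
    obtain Z where Z: "Z \<in> carrier_mat n n" "h = M (\<pi> ^ 0 \<cdot>\<^sub>m Z)" using Kex[of h 0] h unfolding Km_def by auto
    have c: "\<pi> ^ 0 \<cdot>\<^sub>m Y \<in> carrier_mat n n" "\<pi> ^ 0 \<cdot>\<^sub>m Z \<in> carrier_mat n n" using Y Z by auto
    show ?thesis unfolding Y(2) Z(2) \<rho>M[OF c, symmetric] \<rho>M[OF c(2,1), symmetric] comm_add_mat[OF c] ..
  qed
  have d0: "(carrier_vec d :: complex vec set) \<noteq> {0\<^sub>v d}"
  proof -
    have "unit_vec d 0 \<in> (carrier_vec d :: complex vec set)" "unit_vec d 0 \<noteq> (0\<^sub>v d :: complex vec)"
      using unit_vec_nonzero[of d 0] mat_irreducibleD(1)[OF irr] by auto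
    then show ?thesis by blast
  qed
  have full: "vec_subspace d (carrier_vec d :: complex vec set)" by (auto simp: vec_subspace_def)
  obtain v \<theta> where v: "v \<in> carrier_vec d" "v \<noteq> 0\<^sub>v d" and \<theta>0: "\<forall>g\<in>Km. \<rho> g *\<^sub>v v = \<theta> g \<cdot>\<^sub>v v"
  proof (rule common_eigenvector[OF _ full d0])
    show "\<rho> g \<in> carrier_mat d d" if "g \<in> Km" for g using \<rho>c[OF KmG[OF that]] .
    show "\<rho> g *\<^sub>v w \<in> carrier_vec d" if "g \<in> Km" "w \<in> carrier_vec d" for g w
      using \<rho>c[OF KmG[OF that(1)]] that(2) by simp
    show "\<rho> g *\<^sub>v (\<rho> h *\<^sub>v w) = \<rho> h *\<^sub>v (\<rho> g *\<^sub>v w)" if "g \<in> Km" "h \<in> Km" "w \<in> carrier_vec d" for g h w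
      using \<rho>comm[OF that(1,2)] assoc_mult_mat_vec[OF \<rho>c[OF KmG[OF that(1)]] \<rho>c[OF KmG[OF that(2)]] that(3)]
        assoc_mult_mat_vec[OF \<rho>c[OF KmG[OF that(2)]] \<rho>c[OF KmG[OF that(1)]] that(3)] by simp
  qed
  have \<theta>: "\<rho> g *\<^sub>v v = \<theta> g \<cdot>\<^sub>v v" if "g \<in> Km" for g using \<theta>0 that by blast
  obtain i0 where i0: "i0 < d" "v $ i0 \<noteq> 0"
  proof -
    have "\<exists>i<d. v $ i \<noteq> 0"
    proof (rule ccontr)
      assume "\<not> ?thesis"
      then have "v = 0\<^sub>v d" using v(1) by (intro eq_vecI) auto
      then show False using v(2) by simp
    qed
    then show ?thesis using that by blast
  qed
  have vcanc: "a = b" if "a \<cdot>\<^sub>v v = b \<cdot>\<^sub>v v" for a b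
  proof -
    have "(a \<cdot>\<^sub>v v) $ i0 = (b \<cdot>\<^sub>v v) $ i0" using that by simp
    then show ?thesis using i0 v(1) by simp
  qed
  have \<theta>cong: "\<theta> B = \<theta> A" if "A \<in> Km" "B \<in> Km" "cong_mat n l A B" for A B
    using \<rho>cong[OF KmG[OF that(1)] KmG[OF that(2)] that(3)] \<theta>[OF that(1)] \<theta>[OF that(2)] vcanc by simp
  have \<theta>mul: "\<theta> (A * B) = \<theta> A * \<theta> B" if A: "A \<in> Km" and B: "B \<in> Km" for A B
  proof (rule vcanc)
    have AB: "A * B \<in> Km" using subgroup.m_closed[OF Kms A B] by (simp add: GL_mult)
    have "\<theta> (A * B) \<cdot>\<^sub>v v = \<rho> A *\<^sub>v (\<rho> B *\<^sub>v v)"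
      using \<theta>[OF AB] \<rho>m[OF KmG[OF A] KmG[OF B]] assoc_mult_mat_vec[OF \<rho>c[OF KmG[OF A]] \<rho>c[OF KmG[OF B]] v(1)] by simp
    also have "\<dots> = (\<theta> A * \<theta> B) \<cdot>\<^sub>v v"
      unfolding \<theta>[OF B] mult_mat_vec[OF \<rho>c[OF KmG[OF A]] v(1)] \<theta>[OF A] by (simp add: smult_smult_assoc mult.commute)
    finally show "\<theta> (A * B) \<cdot>\<^sub>v v = (\<theta> A * \<theta> B) \<cdot>\<^sub>v v" .
  qed
  have oneK: "1\<^sub>m n \<in> Km" using subgroup.one_closed[OF Kms] by (simp add: GL_one)
  have \<theta>one: "\<theta> (1\<^sub>m n) = 1"
  proof (rule vcanc)
    have "\<rho> (1\<^sub>m n) = 1\<^sub>m d" using mat_repD(2)[OF \<rho>] by (simp add: GL_one)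
    then show "\<theta> (1\<^sub>m n) \<cdot>\<^sub>v v = 1 \<cdot>\<^sub>v v" using \<theta>[OF oneK] v(1) by simp
  qed
  define \<Theta> where "\<Theta> = (\<lambda>Y. \<theta> (M Y))"
  have \<Theta>add: "\<Theta> (Y + Z) = \<Theta> Y * \<Theta> Z" if "Y \<in> carrier_mat n n" "Z \<in> carrier_mat n n" for Y Z
  proof -
    have "M Y * M Z \<in> Km" using subgroup.m_closed[OF Kms MK MK] by (simp add: GL_mult)
    then show ?thesis unfolding \<Theta>_def using \<theta>cong[OF MK _ Mmul[OF that]] \<theta>mul[OF MK MK] by simp
  qed
  have \<Theta>0: "\<Theta> (0\<^sub>m n n) = 1"
  proof -
    have "M (0\<^sub>m n n) = 1\<^sub>m n" by (intro eq_matI) (auto simp: M_def)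
    then show ?thesis using \<theta>one by (simp add: \<Theta>_def)
  qed
  let ?E = "\<lambda>i j x. entry_mat n i j (x :: 'a)"
  note Ec = entry_mat_carrier
  have Eadd: "?E i j x + ?E i j y = ?E i j (x + y)" for i j x y by (intro eq_matI) (auto simp: entry_mat_def)
  have E0: "?E i j 0 = 0\<^sub>m n n" for i j by (intro eq_matI) (auto simp: entry_mat_def)
  have \<Theta>E: "\<Theta> (?E i j (x + y)) = \<Theta> (?E i j x) * \<Theta> (?E i j y)" for i j x y
    using \<Theta>add[OF Ec Ec, of i j x i j y] by (simp add: Eadd)
  have \<Theta>nz: "\<Theta> Y \<noteq> 0" if Y: "Y \<in> carrier_mat n n" for Y
  proof -
    have "Y + (- Y) = 0\<^sub>m n n" using Y by (intro eq_matI) auto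
    then have "\<Theta> Y * \<Theta> (- Y) = 1" using \<Theta>add[of Y "- Y"] Y \<Theta>0 by simp
    then show ?thesis by auto
  qed
  \<comment> \<open>As \<open>d\<close> is small, two of the conjugates of the eigencharacter under the one-parameter group of
    elementary matrices agree, so some nontrivial elementary matrix stabilizes it.\<close>
  have stab: "\<exists>c. c dvd \<pi> ^ (k - 1) \<and> (\<forall>Y Y'. elementary n i j c * M Y = M Y' * elementary n i j c \<longrightarrow> \<Theta> Y = \<Theta> Y')"
    if ij: "i < n" "j < n" "i \<noteq> j" for i j
  proof -
    define N where "N = residues_card k"
    obtain f where f: "bij_betw f {0..<N} (range (residue k))"
      using ex_bij_betw_nat_finite[OF finite_residues[of k]] unfolding N_def residues_card_def by blast
    define a where "a = (\<lambda>p. inv_into UNIV (residue k) (f p))"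
    have ra: "residue k (a p) = f p" if "p < N" for p
      unfolding a_def by (rule f_inv_into_f) (use bij_betwE[OF f] that in simp)
    have adist: "\<not> \<pi> ^ k dvd a p - a q" if "p < N" "q < N" "p \<noteq> q" for p q
    proof
      assume "\<pi> ^ k dvd a p - a q"
      then have "f p = f q" using ra that residue_eq_iff by metis
      then show False using f that by (auto simp: bij_betw_def inj_on_def)
    qed
    define e where "e = (\<lambda>c. elementary n i j (c :: 'a))"
    have eG: "e c \<in> carrier (GL n)" for c unfolding e_def by (rule elementary_GL[OF ij])
    have eadd: "e b \<otimes>\<^bsub>GL n\<^esub> e c = e (b + c)" for b c unfolding e_def by (simp add: GL_mult elementary_add[OF ij])
    have conjK: "inv\<^bsub>GL n\<^esub> g \<otimes>\<^bsub>GL n\<^esub> h \<otimes>\<^bsub>GL n\<^esub> g \<in> Km" if "h \<in> Km" "g \<in> carrier (GL n)" for g h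
      by (rule normal.inv_op_closed1[OF Kmn that(2,1)])
    define ch where "ch = (\<lambda>p h. \<theta> (inv\<^bsub>GL n\<^esub> (e (a p)) \<otimes>\<^bsub>GL n\<^esub> h \<otimes>\<^bsub>GL n\<^esub> e (a p)))"
    define w where "w = (\<lambda>p. \<rho> (e (a p)) *\<^sub>v v)"
    have "\<exists>p q. p < N \<and> q < N \<and> p \<noteq> q \<and> (\<forall>h\<in>Km. ch p h = ch q h)"
    proof (rule ccontr)
      assume no: "\<not> ?thesis"
      have "N \<le> d"
      proof (rule distinct_eigencharacters_le_dim[of Km \<rho> d N w ch])
        show "\<rho> h \<in> carrier_mat d d" if "h \<in> Km" for h using \<rho>c[OF KmG[OF that]] .
        show "w p \<in> carrier_vec d" for p unfolding w_def by (rule mult_mat_vec_carrier[OF \<rho>c[OF eG] v(1)])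
        show "w p \<noteq> 0\<^sub>v d" for p
        proof
          assume "w p = 0\<^sub>v d"
          then have "\<rho> (inv\<^bsub>GL n\<^esub> (e (a p))) *\<^sub>v w p = 0\<^sub>v d"
            using mat_mult_zero_vec[OF \<rho>c[OF G.inv_closed[OF eG[of "a p"]]]] by simp
          moreover have "\<rho> (inv\<^bsub>GL n\<^esub> (e (a p))) *\<^sub>v w p = (\<rho> (inv\<^bsub>GL n\<^esub> (e (a p))) * \<rho> (e (a p))) *\<^sub>v v"
            unfolding w_def by (rule assoc_mult_mat_vec[OF \<rho>c[OF G.inv_closed[OF eG]] \<rho>c[OF eG] v(1), symmetric])
          ultimately show False using G.mat_rep_inv[OF \<rho> eG[of "a p"]] v by simp
        qed
        show "\<rho> h *\<^sub>v w p = ch p h \<cdot>\<^sub>v w p" if h: "h \<in> Km" for p h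
        proof -
          define x where "x = inv\<^bsub>GL n\<^esub> (e (a p)) \<otimes>\<^bsub>GL n\<^esub> h \<otimes>\<^bsub>GL n\<^esub> e (a p)"
          have x: "x \<in> Km" unfolding x_def by (rule conjK[OF h eG])
          have eq: "h \<otimes>\<^bsub>GL n\<^esub> e (a p) = e (a p) \<otimes>\<^bsub>GL n\<^esub> x" unfolding x_def using KmG[OF h] by (simp add: eG G.m_assoc[symmetric])
          have "\<rho> h *\<^sub>v w p = (\<rho> h * \<rho> (e (a p))) *\<^sub>v v"
            unfolding w_def by (rule assoc_mult_mat_vec[OF \<rho>c[OF KmG[OF h]] \<rho>c[OF eG] v(1), symmetric])
          also have "\<rho> h * \<rho> (e (a p)) = \<rho> (e (a p)) * \<rho> x"
            using mat_repD(3)[OF \<rho> KmG[OF h] eG[of "a p"]] mat_repD(3)[OF \<rho> eG[of "a p"] KmG[OF x]] eq by simp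
          also have "(\<rho> (e (a p)) * \<rho> x) *\<^sub>v v = \<rho> (e (a p)) *\<^sub>v (\<rho> x *\<^sub>v v)"
            by (rule assoc_mult_mat_vec[OF \<rho>c[OF eG] \<rho>c[OF KmG[OF x]] v(1)])
          also have "\<dots> = \<theta> x \<cdot>\<^sub>v w p" unfolding \<theta>[OF x] w_def by (rule mult_mat_vec[OF \<rho>c[OF eG] v(1)])
          finally show ?thesis unfolding ch_def x_def .
        qed
        show "\<exists>h\<in>Km. ch p h \<noteq> ch q h" if "p < N" "q < N" "p \<noteq> q" for p q using no that by blast
      qed
      then show False using small unfolding N_def by simp
    qed
    then obtain p q where pq: "p < N" "q < N" "p \<noteq> q" and same: "\<And>h. h \<in> Km \<Longrightarrow> ch p h = ch q h" by blast
    define c where "c = a q - a p"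
    have eq: "e (a q) = e (a p) \<otimes>\<^bsub>GL n\<^esub> e c" unfolding eadd c_def by simp
    have "c dvd \<pi> ^ (k - 1)" unfolding c_def using adist[of q p] pq km by (intro dvd_power_of_not_dvd) auto
    moreover have "\<Theta> Y = \<Theta> Y'" if YY: "elementary n i j c * M Y = M Y' * elementary n i j c" for Y Y'
    proof -
      have YY': "e c \<otimes>\<^bsub>GL n\<^esub> M Y = M Y' \<otimes>\<^bsub>GL n\<^esub> e c" using YY by (simp add: e_def GL_mult)
      define h where "h = e (a q) \<otimes>\<^bsub>GL n\<^esub> M Y \<otimes>\<^bsub>GL n\<^esub> inv\<^bsub>GL n\<^esub> (e (a q))"
      have h: "h \<in> Km" unfolding h_def by (rule normal.inv_op_closed2[OF Kmn eG MK])
      have h': "inv\<^bsub>GL n\<^esub> x \<otimes>\<^bsub>GL n\<^esub> (x \<otimes>\<^bsub>GL n\<^esub> y) = y" if "x \<in> carrier (GL n)" "y \<in> carrier (GL n)" for x y :: "'a mat"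
        using that by (simp add: G.m_assoc[symmetric])
      have "ch q h = \<theta> (M Y)" unfolding ch_def h_def by (simp add: eG MG G.m_assoc h')
      moreover have "ch p h = \<theta> (e c \<otimes>\<^bsub>GL n\<^esub> M Y \<otimes>\<^bsub>GL n\<^esub> inv\<^bsub>GL n\<^esub> (e c))"
        unfolding ch_def h_def eq using G.conj_cancel[OF eG eG MG] by simp
      moreover have "e c \<otimes>\<^bsub>GL n\<^esub> M Y \<otimes>\<^bsub>GL n\<^esub> inv\<^bsub>GL n\<^esub> (e c) = M Y'" unfolding YY' by (simp add: eG MG G.m_assoc)
      ultimately show ?thesis unfolding \<Theta>_def using same[OF h] by simp
    qed
    ultimately show ?thesis by blast
  qed
  have offdiag: "\<Theta> (?E i j (\<pi> ^ (k - 1) * x)) = 1" and diag: "\<Theta> (?E i i (\<pi> ^ (k - 1) * x)) = \<Theta> (?E j j (\<pi> ^ (k - 1) * x))"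
    if ij: "i < n" "j < n" "i \<noteq> j" for i j x
  proof -
    obtain c where c: "c dvd \<pi> ^ (k - 1)"
      and st: "\<And>Y Y'. elementary n i j c * M Y = M Y' * elementary n i j c \<Longrightarrow> \<Theta> Y = \<Theta> Y'" using stab[OF ij] by blast
    obtain t where t: "\<pi> ^ (k - 1) = c * t" using c by (rule dvdE)
    \<comment> \<open>Conjugation by \<open>1 + c e\<^sub>i\<^sub>j\<close> adds \<open>c y e\<^sub>i\<^sub>j\<close> to \<open>y e\<^sub>j\<^sub>j\<close>.\<close>
    have off: "\<Theta> (?E i j (c * y)) = 1" for y
    proof -
      have "elementary n i j c * M (?E j j y) = M (?E j j y + ?E i j (c * y)) * elementary n i j c"
      proof (rule eq_matI)
        fix p q assume "p < dim_row (M (?E j j y + ?E i j (c * y)) * elementary n i j c)"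
          "q < dim_col (M (?E j j y + ?E i j (c * y)) * elementary n i j c)"
        then have pq: "p < n" "q < n" using carrier_matD[OF Mc] carrier_matD[OF elementary_carrier[of n i j c]] by auto
        show "(elementary n i j c * M (?E j j y)) $$ (p, q) = (M (?E j j y + ?E i j (c * y)) * elementary n i j c) $$ (p, q)"
          unfolding elementary_mult(1)[OF Mc pq ij(1,2)] elementary_mult(2)[OF Mc pq ij(1,2)]
          using pq ij by (auto simp: Mi entry_mat_def algebra_simps)
      qed (use carrier_matD[OF Mc] carrier_matD[OF elementary_carrier[of n i j c]] in auto)
      then have "\<Theta> (?E j j y) = \<Theta> (?E j j y + ?E i j (c * y))" by (rule st)
      then show ?thesis using \<Theta>add[OF Ec Ec, of j j y i j "c * y"] \<Theta>nz[OF Ec, of j j y] by simp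
    qed
    show "\<Theta> (?E i j (\<pi> ^ (k - 1) * x)) = 1" using off[of "t * x"] t by (simp add: mult.assoc)
    \<comment> \<open>Conjugation by \<open>1 + c e\<^sub>i\<^sub>j\<close> takes \<open>y e\<^sub>j\<^sub>i\<close> to
      \<open>y e\<^sub>j\<^sub>i + c y (e\<^sub>i\<^sub>i - e\<^sub>j\<^sub>j) - c\<^sup>2 y e\<^sub>i\<^sub>j\<close>.\<close>
    define y where "y = t * x"
    define z where "z = c * y"
    have z: "\<pi> ^ (k - 1) * x = z" using t by (simp add: z_def y_def mult.assoc)
    let ?Y = "?E j i y + (?E i i z + (?E j j (- z) + ?E i j (- (c * z))))"
    have "elementary n i j c * M (?E j i y) = M ?Y * elementary n i j c"
    proof (rule eq_matI)
      fix p q assume "p < dim_row (M ?Y * elementary n i j c)" "q < dim_col (M ?Y * elementary n i j c)"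
      then have pq: "p < n" "q < n" using carrier_matD[OF Mc] carrier_matD[OF elementary_carrier[of n i j c]] by auto
      show "(elementary n i j c * M (?E j i y)) $$ (p, q) = (M ?Y * elementary n i j c) $$ (p, q)"
        unfolding elementary_mult(1)[OF Mc pq ij(1,2)] elementary_mult(2)[OF Mc pq ij(1,2)]
        using pq ij by (auto simp: Mi entry_mat_def z_def algebra_simps)
    qed (use carrier_matD[OF Mc] carrier_matD[OF elementary_carrier[of n i j c]] in auto)
    then have "\<Theta> (?E j i y) = \<Theta> ?Y" by (rule st)
    also have "\<dots> = \<Theta> (?E j i y) * (\<Theta> (?E i i z) * (\<Theta> (?E j j (- z)) * \<Theta> (?E i j (- (c * z)))))"
      by (simp add: \<Theta>add Ec)
    also have "\<Theta> (?E i j (- (c * z))) = 1" using off[of "- z"] by simp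
    finally have "\<Theta> (?E i i z) * \<Theta> (?E j j (- z)) = 1" using \<Theta>nz[OF Ec, of j i y] by simp
    moreover have "\<Theta> (?E j j z) * \<Theta> (?E j j (- z)) = 1" using \<Theta>E[of j j z "- z"] by (simp add: E0 \<Theta>0)
    ultimately show "\<Theta> (?E i i (\<pi> ^ (k - 1) * x)) = \<Theta> (?E j j (\<pi> ^ (k - 1) * x))"
      unfolding z using \<Theta>nz[OF Ec, of j j "- z"] by (metis mult_cancel_right)
  qed
  have diag0: "\<Theta> (?E i i (\<pi> ^ (k - 1) * x)) = \<Theta> (?E 0 0 (\<pi> ^ (k - 1) * x))" if "i < n" for i x
    using diag[of i 0 x] that n by (cases "i = 0") auto
  have tr: "\<Theta> (Matrix.mat n n (\<lambda>p. if p \<in> J then \<pi> ^ (k - 1) * Z $$ p else 0))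
      = \<Theta> (?E 0 0 (\<pi> ^ (k - 1) * (\<Sum>p\<in>J. if fst p = snd p then Z $$ p else 0)))"
    if "finite J" "J \<subseteq> {..<n} \<times> {..<n}" for J and Z :: "'a mat"
    using that
  proof (induction J rule: finite_induct)
    case empty
    have "Matrix.mat n n (\<lambda>p. if p \<in> {} then \<pi> ^ (k - 1) * Z $$ p else 0) = 0\<^sub>m n n" by (intro eq_matI) auto
    then show ?case by (simp add: E0)
  next
    case (insert p J)
    let ?m = "\<lambda>J. Matrix.mat n n (\<lambda>p. if p \<in> J then \<pi> ^ (k - 1) * Z $$ p else 0)"
    obtain i j where p: "p = (i, j)" "i < n" "j < n" using insert.prems by auto
    have s: "?m (insert p J) = ?m J + ?E i j (\<pi> ^ (k - 1) * Z $$ p)"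
      using insert.hyps p by (intro eq_matI) (auto simp: entry_mat_def)
    have "\<Theta> (?m (insert p J)) = \<Theta> (?m J) * \<Theta> (?E i j (\<pi> ^ (k - 1) * Z $$ p))" unfolding s by (rule \<Theta>add[OF _ Ec]) simp
    also have "\<Theta> (?m J) = \<Theta> (?E 0 0 (\<pi> ^ (k - 1) * (\<Sum>p\<in>J. if fst p = snd p then Z $$ p else 0)))"
      using insert.IH insert.prems by simp
    also have "\<Theta> (?E i j (\<pi> ^ (k - 1) * Z $$ p)) = \<Theta> (?E 0 0 (\<pi> ^ (k - 1) * (if fst p = snd p then Z $$ p else 0)))"
      using offdiag[OF p(2,3)] diag0[OF p(2)] p by (cases "i = j") (auto simp: E0 \<Theta>0)
    finally show ?case
      unfolding \<Theta>E[symmetric] distrib_left[symmetric] sum.insert[OF insert.hyps] by (simp add: add.commute)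
  qed
  \<comment> \<open>So on the last layer the eigencharacter depends on the trace only, that is, on the determinant.\<close>
  define D where "D = (\<lambda>u :: 'a. Matrix.mat n n (\<lambda>(p, q). if p = q then (if p = 0 then u else 1) else 0))"
  have Dc: "D u \<in> carrier_mat n n" for u by (simp add: D_def)
  have DK: "D u \<in> cong_subgroup n r" if u: "\<pi> ^ r dvd u - 1" "u dvd 1" for u r
  proof -
    obtain u' where u': "1 = u * u'" using u(2) by (rule dvdE)
    have mul: "D a * D b = D (a * b)" for a b
    proof (rule eq_matI)
      fix p q assume "p < dim_row (D (a * b))" "q < dim_col (D (a * b))"
      then have pq: "p < n" "q < n" using carrier_matD[OF Dc] by auto
      have "(D a * D b) $$ (p, q) = (\<Sum>r<n. D a $$ (p, r) * D b $$ (r, q))" by (rule index_mult_mat_sum[OF Dc Dc pq])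
      also have "\<dots> = (\<Sum>r<n. if r = p then D a $$ (p, p) * D b $$ (p, q) else 0)"
        using pq by (intro sum.cong) (auto simp: D_def)
      finally show "(D a * D b) $$ (p, q) = D (a * b) $$ (p, q)" using pq by (simp add: D_def)
    qed (use carrier_matD[OF Dc] in auto)
    have "D 1 = 1\<^sub>m n" by (intro eq_matI) (auto simp: D_def)
    then have "D u \<in> carrier (GL n)" unfolding GL_carrier_iff
      using Dc mul[of u u'] mul[of u' u] u' by (metis mult.commute)
    then show ?thesis unfolding cong_subgroup_def cong_mat_def using u(1) by (auto simp: D_def)
  qed
  have Dmul: "D (a * b) = D a * D b" for a b
  proof (rule eq_matI)
    fix p q assume "p < dim_row (D a * D b)" "q < dim_col (D a * D b)"
    then have pq: "p < n" "q < n" using carrier_matD[OF Dc] by auto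
    have "(D a * D b) $$ (p, q) = (\<Sum>r<n. D a $$ (p, r) * D b $$ (r, q))" by (rule index_mult_mat_sum[OF Dc Dc pq])
    also have "\<dots> = (\<Sum>r<n. if r = p then D a $$ (p, p) * D b $$ (p, q) else 0)"
      using pq by (intro sum.cong) (auto simp: D_def)
    finally show "D (a * b) $$ (p, q) = (D a * D b) $$ (p, q)" using pq by (simp add: D_def)
  qed (use carrier_matD[OF Dc] in auto)
  have K1m: "cong_subgroup n (l - 1) \<subseteq> Km" unfolding Km_def using l by (intro cong_subgroup_antimono)
  have detu: "det g dvd 1" if "g \<in> carrier (GL n)" for g :: "'a mat" using GL_det_iff[OF mc[OF that]] that by blast
  define \<alpha> where "\<alpha> = (\<lambda>g. \<theta> (D (det g)))"
  obtain \<beta> where \<beta>: "det_char n \<beta>" and \<beta>\<alpha>: "\<forall>g\<in>carrier (GL n). \<pi> ^ (l - 1) dvd det g - 1 \<longrightarrow> \<beta> g = \<alpha> g"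
  proof (rule extend_det_char[of "l - 1" l n \<alpha>])
    fix g h :: "'a mat" assume gh: "g \<in> carrier (GL n)" "h \<in> carrier (GL n)" "\<pi> ^ (l - 1) dvd det g - 1" "\<pi> ^ (l - 1) dvd det h - 1"
    have "D (det g) \<in> Km" "D (det h) \<in> Km" using DK[OF gh(3) detu[OF gh(1)]] DK[OF gh(4) detu[OF gh(2)]] K1m by auto
    then show "\<alpha> (g * h) = \<alpha> g * \<alpha> h"
      unfolding \<alpha>_def det_mult[OF mc[OF gh(1)] mc[OF gh(2)]] Dmul by (rule \<theta>mul)
  next
    fix g :: "'a mat" assume g: "g \<in> carrier (GL n)" "\<pi> ^ l dvd det g - 1"
    have 1: "D (det g) \<in> cong_subgroup n l" by (rule DK[OF g(2) detu[OF g(1)]])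
    then have 2: "D (det g) \<in> Km" using cong_subgroup_antimono[of m l n] unfolding Km_def by (auto simp: l_def)
    have "\<theta> (1\<^sub>m n) = \<theta> (D (det g))" by (rule \<theta>cong[OF 2 oneK]) (use 1 in \<open>simp add: cong_subgroup_def\<close>)
    then show "\<alpha> g = 1" unfolding \<alpha>_def \<theta>one by simp
  qed auto
  have \<beta>\<theta>: "\<beta> h = \<theta> h" if h: "h \<in> cong_subgroup n (l - 1)" for h
  proof -
    have hG: "h \<in> carrier (GL n)" and hcong: "cong_mat n (l - 1) h (1\<^sub>m n)" using h unfolding cong_subgroup_def by auto
    have "h \<in> cong_subgroup n (m + (k - 1))" using h l(5) by simp
    then obtain Z where Z: "Z \<in> carrier_mat n n" "h = M (\<pi> ^ (k - 1) \<cdot>\<^sub>m Z)" using Kex by blast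
    define s where "s = (\<Sum>i<n. Z $$ (i, i))"
    define u where "u = 1 + \<pi> ^ (l - 1) * s"
    have "\<pi> ^ (k - 1) \<cdot>\<^sub>m Z = Matrix.mat n n (\<lambda>p. if p \<in> {..<n} \<times> {..<n} then \<pi> ^ (k - 1) * Z $$ p else 0)"
      using Z by (intro eq_matI) auto
    then have "\<theta> h = \<Theta> (?E 0 0 (\<pi> ^ (k - 1) * (\<Sum>p\<in>{..<n} \<times> {..<n}. if fst p = snd p then Z $$ p else 0)))"
      using tr[of "{..<n} \<times> {..<n}" Z] Z by (simp add: \<Theta>_def)
    also have "(\<Sum>p\<in>{..<n} \<times> {..<n}. if fst p = snd p then Z $$ p else 0) = (\<Sum>i<n. \<Sum>j<n. if i = j then Z $$ (i, j) else 0)"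
      unfolding sum.cartesian_product by (rule sum.cong) auto
    also have "\<dots> = s" unfolding s_def by (rule sum.cong) auto
    also have "\<Theta> (?E 0 0 (\<pi> ^ (k - 1) * s)) = \<theta> (D u)"
    proof -
      have "M (?E 0 0 (\<pi> ^ (k - 1) * s)) = D u"
        unfolding u_def l(5)[symmetric] power_add by (intro eq_matI) (auto simp: M_def D_def entry_mat_def)
      then show ?thesis by (simp add: \<Theta>_def)
    qed
    finally have \<theta>h: "\<theta> h = \<theta> (D u)" .
    have su: "1 + (\<Sum>i<n. h $$ (i, i) - 1) = u"
    proof -
      have "(\<Sum>i<n. h $$ (i, i) - 1) = (\<Sum>i<n. \<pi> ^ (l - 1) * Z $$ (i, i))"
        unfolding Z(2) l(5)[symmetric] power_add using Z(1) by (intro sum.cong) (auto simp: Mi)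
      then show ?thesis by (simp add: u_def s_def sum_distrib_left)
    qed
    have du: "\<pi> ^ l dvd det h - u"
      using det_trace_cong[OF mc[OF hG] hcong] l(4) unfolding su by (meson dvd_trans le_imp_power_dvd)
    have hd: "\<pi> ^ (l - 1) dvd det h - 1" using det_cong[OF mc[OF hG] one_carrier_mat hcong] by simp
    have DhK: "D (det h) \<in> Km" using DK[OF hd detu[OF hG]] K1m by blast
    have u1: "u dvd 1"
    proof (rule unit)
      have "\<pi> dvd \<pi> ^ (l - 1)" using l by (intro dvd_power) auto
      then have "\<pi> dvd \<pi> ^ (l - 1) * s" by (rule dvd_mult2)
      then show "\<not> \<pi> dvd u" using uniformizer_nonunit unfolding u_def by (metis add_diff_cancel_right' dvd_diff)
    qed
    have DuK: "D u \<in> Km" using DK[of "l - 1" u] u1 K1m by (auto simp: u_def)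
    have "cong_mat n l (D (det h)) (D u)" using du unfolding cong_mat_def by (auto simp: D_def)
    then have "\<theta> (D u) = \<theta> (D (det h))" by (rule \<theta>cong[OF DhK DuK])
    then show ?thesis using \<theta>h \<beta>\<alpha> hG hd unfolding \<alpha>_def by simp
  qed
  \<comment> \<open>After the twist, the vectors fixed by the last layer form a nonzero invariant subspace.\<close>
  define \<rho>2 where "\<rho>2 = (\<lambda>g. inverse (\<beta> g) \<cdot>\<^sub>m \<rho> g)"
  have \<rho>2: "mat_rep (GL n) d \<rho>2"
    unfolding \<rho>2_def
    by (rule mat_rep_smult[OF \<rho>]) (use det_charD(1,2)[OF \<beta>] in \<open>simp_all add: GL_one GL_mult\<close>)
  have irr2: "mat_irreducible (carrier (GL n)) d \<rho>2"
    unfolding \<rho>2_def by (rule mat_irreducible_smult[OF irr]) (use det_char_nonzero[OF \<beta>] in simp)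
  note \<rho>2c = mat_repD(1)[OF \<rho>2]
  define K1 where "K1 = cong_subgroup n (l - 1)"
  have K1G: "h \<in> carrier (GL n)" if "h \<in> K1" for h using that cong_subgroup_subset unfolding K1_def by blast
  define F where "F = {w \<in> carrier_vec d. \<forall>h\<in>K1. \<rho>2 h *\<^sub>v w = w}"
  have "vec_subspace d F"
    unfolding vec_subspace_def
  proof (intro conjI ballI allI)
    show "F \<subseteq> carrier_vec d" by (auto simp: F_def)
    have "\<rho>2 h *\<^sub>v 0\<^sub>v d = 0\<^sub>v d" if "h \<in> K1" for h by (rule mat_mult_zero_vec[OF \<rho>2c[OF K1G[OF that]]])
    then show "0\<^sub>v d \<in> F" by (simp add: F_def)
    show "x + y \<in> F" if "x \<in> F" "y \<in> F" for x y
      using that mult_add_distrib_mat_vec[OF \<rho>2c[OF K1G]] by (simp add: F_def)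
    show "c \<cdot>\<^sub>v x \<in> F" if "x \<in> F" for c x using that mult_mat_vec[OF \<rho>2c[OF K1G]] by (simp add: F_def)
  qed
  moreover have "\<rho>2 g *\<^sub>v w \<in> F" if g: "g \<in> carrier (GL n)" and w: "w \<in> F" for g w
  proof -
    have wc: "w \<in> carrier_vec d" using w by (simp add: F_def)
    have "\<rho>2 h *\<^sub>v (\<rho>2 g *\<^sub>v w) = \<rho>2 g *\<^sub>v w" if h: "h \<in> K1" for h
    proof -
      define t where "t = inv\<^bsub>GL n\<^esub> g \<otimes>\<^bsub>GL n\<^esub> h \<otimes>\<^bsub>GL n\<^esub> g"
      have t: "t \<in> K1" unfolding t_def K1_def by (rule normal.inv_op_closed1[OF cong_subgroup_normal g h[unfolded K1_def]])
      have "h \<otimes>\<^bsub>GL n\<^esub> g = g \<otimes>\<^bsub>GL n\<^esub> t" unfolding t_def using K1G[OF h] g by (simp add: G.m_assoc[symmetric])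
      then have "\<rho>2 h * \<rho>2 g = \<rho>2 g * \<rho>2 t" using mat_repD(3)[OF \<rho>2 K1G[OF h] g] mat_repD(3)[OF \<rho>2 g K1G[OF t]] by simp
      then have "\<rho>2 h *\<^sub>v (\<rho>2 g *\<^sub>v w) = \<rho>2 g *\<^sub>v (\<rho>2 t *\<^sub>v w)"
        using assoc_mult_mat_vec[OF \<rho>2c[OF K1G[OF h]] \<rho>2c[OF g] wc] assoc_mult_mat_vec[OF \<rho>2c[OF g] \<rho>2c[OF K1G[OF t]] wc] by simp
      then show ?thesis using w t by (simp add: F_def)
    qed
    then show ?thesis using \<rho>2c[OF g] wc by (simp add: F_def)
  qed
  moreover have "v \<in> F"
  proof -
    have "\<rho>2 h *\<^sub>v v = v" if h: "h \<in> K1" for h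
    proof -
      have hm: "h \<in> Km" using h K1m unfolding K1_def by blast
      have "\<rho>2 h *\<^sub>v v = inverse (\<beta> h) \<cdot>\<^sub>v (\<rho> h *\<^sub>v v)"
        unfolding \<rho>2_def using \<rho>c[OF KmG[OF hm]] v(1) by (intro eq_vecI) auto
      also have "\<dots> = (inverse (\<beta> h) * \<theta> h) \<cdot>\<^sub>v v" unfolding \<theta>[OF hm] by (simp add: smult_smult_assoc)
      also have "inverse (\<beta> h) * \<theta> h = 1"
        using \<beta>\<theta>[of h] h det_char_nonzero[OF \<beta> KmG[OF hm]] unfolding K1_def by simp
      finally show ?thesis by simp
    qed
    then show ?thesis using v by (simp add: F_def)
  qed
  ultimately have "F = carrier_vec d" using v(2) by (intro mat_irreducibleD(3)[OF irr2]) auto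
  then have inv_all: "\<rho>2 h *\<^sub>v w = w" if "h \<in> K1" "w \<in> carrier_vec d" for h w
    using that by (auto simp: F_def)
  have "\<rho>2 h = 1\<^sub>m d" if "h \<in> K1" for h
    by (rule mat_eqI_mult_vec[OF \<rho>2c[OF K1G[OF that]] one_carrier_mat]) (use inv_all[OF that] in simp)
  then show thesis using that[OF \<beta>] unfolding \<rho>2_def K1_def l_def by auto
qed

text \<open>A representation of dimension less than \<open>|O / \<pi>\<^sup>k|\<close> has, up to twist, level at most \<open>2 * k\<close>.\<close>

lemma twist_level_bound:
  assumes n: "n > 0" and \<rho>: "mat_rep (GL n) d \<rho>" and irr: "mat_irreducible (carrier (GL n)) d \<rho>"
    and smooth: "\<exists>l. \<forall>g\<in>cong_subgroup n l. \<rho> g = 1\<^sub>m d" and small: "d < residues_card k"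
  obtains \<chi> where "det_char n \<chi>" "\<forall>g\<in>cong_subgroup n (2 * k). \<chi> g \<cdot>\<^sub>m \<rho> g = 1\<^sub>m d"
proof -
  define Q where "Q = (\<lambda>l. \<exists>\<chi>. det_char n \<chi> \<and> (\<forall>g\<in>cong_subgroup n l. \<chi> g \<cdot>\<^sub>m \<rho> g = 1\<^sub>m d))"
  have one: "det_char n (\<lambda>_. 1)" by (simp add: det_char_def)
  obtain L where "\<forall>g\<in>cong_subgroup n L. \<rho> g = 1\<^sub>m d" using smooth by blast
  then have "Q L" unfolding Q_def using one by (intro exI[of _ "\<lambda>_. 1"]) (simp add: one_smult_mat)
  define l where "l = (LEAST l. Q l)"
  have "Q l" unfolding l_def using \<open>Q L\<close> by (rule LeastI)
  then obtain \<chi> where \<chi>: "det_char n \<chi>" "\<forall>g\<in>cong_subgroup n l. \<chi> g \<cdot>\<^sub>m \<rho> g = 1\<^sub>m d" unfolding Q_def by blast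
  have "l \<le> 2 * k"
  proof (rule ccontr)
    assume "\<not> l \<le> 2 * k"
    define m where "m = l - k"
    have km: "k < m" "m + k = l" using \<open>\<not> l \<le> 2 * k\<close> by (auto simp: m_def)
    have "k > 0"
    proof (rule ccontr)
      assume "\<not> 0 < k"
      then show False using small mat_irreducibleD(1)[OF irr] residues_card_0 by simp
    qed
    have r: "mat_rep (GL n) d (\<lambda>g. \<chi> g \<cdot>\<^sub>m \<rho> g)"
      by (rule mat_rep_smult[OF \<rho>]) (use det_charD(1,2)[OF \<chi>(1)] in \<open>simp_all add: GL_one GL_mult\<close>)
    have i: "mat_irreducible (carrier (GL n)) d (\<lambda>g. \<chi> g \<cdot>\<^sub>m \<rho> g)"
      by (rule mat_irreducible_smult[OF irr]) (rule det_char_nonzero[OF \<chi>(1)])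
    obtain \<beta> where \<beta>: "det_char n \<beta>" "\<forall>g\<in>cong_subgroup n (m + k - 1). inverse (\<beta> g) \<cdot>\<^sub>m (\<chi> g \<cdot>\<^sub>m \<rho> g) = 1\<^sub>m d"
      by (rule level_reduction[OF n r i _ \<open>k > 0\<close> km(1) small]) (use \<chi>(2) km in auto)
    have "Q (l - 1)" unfolding Q_def
    proof (intro exI conjI)
      show "det_char n (\<lambda>g. \<chi> g * inverse (\<beta> g))" by (rule det_char_mult_inverse[OF \<chi>(1) \<beta>(1)])
      show "\<forall>g\<in>cong_subgroup n (l - 1). (\<chi> g * inverse (\<beta> g)) \<cdot>\<^sub>m \<rho> g = 1\<^sub>m d"
        using \<beta>(2) km(2) by (simp add: smult_smult_mat mult.commute)
    qed
    then have "l \<le> l - 1" unfolding l_def by (rule Least_le)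
    then show False using \<open>\<not> l \<le> 2 * k\<close> by simp
  qed
  then show thesis using that[OF \<chi>(1)] \<chi>(2) cong_subgroup_antimono[of l "2 * k" n] by blast
qed

end

section \<open>Counting twist isoclasses\<close>

lemma (in group) card_noniso_irreducibles_le_index:
  assumes K: "K \<lhd> G" and fin: "finite (lcosets_of G K)"
    and Q: "\<And>\<sigma>. \<sigma> \<in> Q \<Longrightarrow> mat_rep G d \<sigma>" "\<And>\<sigma>. \<sigma> \<in> Q \<Longrightarrow> mat_irreducible (carrier G) d \<sigma>"
      "\<And>\<sigma> k. \<sigma> \<in> Q \<Longrightarrow> k \<in> K \<Longrightarrow> \<sigma> k = 1\<^sub>m d"
    and noniso: "\<And>\<sigma> \<tau> T. \<sigma> \<in> Q \<Longrightarrow> \<tau> \<in> Q \<Longrightarrow> \<sigma> \<noteq> \<tau> \<Longrightarrow> intertwines (carrier G) d d \<sigma> \<tau> T \<Longrightarrow> T = 0\<^sub>m d d"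
  shows "finite Q \<and> card Q \<le> card (lcosets_of G K)"
proof (rule finite_if_finite_subsets_card_bdd)
  fix Y assume Y: "Y \<subseteq> Q" "finite Y"
  obtain f where f: "bij_betw f {0..<card Y} Y" using ex_bij_betw_nat_finite[OF Y(2)] by blast
  have fX: "f a \<in> Q" if "a < card Y" for a using bij_betwE[OF f] that Y(1) by auto
  show "card Y \<le> card (lcosets_of G K)"
  proof (rule noniso_irreducibles_le_index[OF K fin, of "card Y" "\<lambda>_. d" f])
    fix a b T assume ab: "a < card Y" "b < card Y" "a \<noteq> b" and T: "intertwines (carrier G) d d (f a) (f b) T"
    have "f a \<noteq> f b" using ab f by (auto simp: bij_betw_def inj_on_def)
    then show "T = 0\<^sub>m d d" using noniso[OF fX[OF ab(1)] fX[OF ab(2)]] T by blast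
  qed (use Q fX in auto)
qed

lemma mat_irreducible_1:
  assumes "\<And>g. g \<in> U \<Longrightarrow> \<psi> g \<in> carrier_mat 1 1"
  shows "mat_irreducible U 1 \<psi>"
  unfolding mat_irreducible_def
proof (intro conjI ballI allI impI)
  fix W assume "vec_subspace 1 W \<and> (\<forall>g\<in>U. \<forall>w\<in>W. \<psi> g *\<^sub>v w \<in> W)"
  then have W: "W \<subseteq> carrier_vec 1" "0\<^sub>v 1 \<in> W" "\<And>c x. x \<in> W \<Longrightarrow> c \<cdot>\<^sub>v x \<in> W" unfolding vec_subspace_def by auto
  show "W = {0\<^sub>v 1} \<or> W = carrier_vec 1"
  proof (rule disjCI)
    assume "W \<noteq> carrier_vec 1"
    then obtain x where x: "x \<in> carrier_vec 1" "x \<notin> W" using W(1) by blast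
    have "w = 0\<^sub>v 1" if w: "w \<in> W" for w
    proof (rule ccontr)
      assume "w \<noteq> 0\<^sub>v 1"
      then have "w $ 0 \<noteq> 0" using w W(1) by (auto intro!: eq_vecI)
      then have "x = (x $ 0 / w $ 0) \<cdot>\<^sub>v w" using x w W(1) by (intro eq_vecI) auto
      then show False using W(3)[OF w] x(2) by metis
    qed
    then show "W = {0\<^sub>v 1}" using W(2) by blast
  qed
qed (use assms in auto)

lemma (in group) finite_characters:
  assumes K: "K \<lhd> G" and fin: "finite (lcosets_of G K)"
  shows "finite ((\<lambda>\<psi>. restrict (\<lambda>g. \<psi> g $$ (0, 0)) (carrier G)) ` {\<psi>. mat_rep G 1 \<psi> \<and> (\<forall>k\<in>K. \<psi> k = 1\<^sub>m 1)})"
    (is "finite (?F ` ?A)")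
proof -
  have "\<exists>Q. Q \<subseteq> ?A \<and> inj_on ?F Q \<and> ?F ` ?A = ?F ` Q" by (rule iffD1[OF subset_image_inj subset_refl])
  then obtain Q where Q: "Q \<subseteq> ?A" "inj_on ?F Q" "?F ` ?A = ?F ` Q" by (elim exE conjE)
  have QA: "mat_rep G 1 \<psi>" "\<forall>k\<in>K. \<psi> k = 1\<^sub>m 1" if "\<psi> \<in> Q" for \<psi> using subsetD[OF Q(1) that] by auto
  have "finite Q \<and> card Q \<le> card (lcosets_of G K)"
  proof (rule card_noniso_irreducibles_le_index[OF K fin])
    show "mat_irreducible (carrier G) 1 \<psi>" if "\<psi> \<in> Q" for \<psi>
      by (rule mat_irreducible_1[OF mat_repD(1)[OF QA(1)[OF that]]])
    fix \<psi> \<phi> T assume \<psi>: "\<psi> \<in> Q" and \<phi>: "\<phi> \<in> Q" and ne: "\<psi> \<noteq> \<phi>" and T: "intertwines (carrier G) 1 1 \<psi> \<phi> T"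
    note Tc = intertwinesD(1)[OF T]
    show "T = 0\<^sub>m 1 1"
    proof (rule ccontr)
      assume "T \<noteq> 0\<^sub>m 1 1"
      then have T0: "T $$ (0, 0) \<noteq> 0" using Tc by (auto intro!: eq_matI)
      have "\<psi> g $$ (0, 0) = \<phi> g $$ (0, 0)" if g: "g \<in> carrier G" for g
      proof -
        note c = mat_repD(1)[OF QA(1)[OF \<psi>] g] mat_repD(1)[OF QA(1)[OF \<phi>] g]
        have "(T * \<psi> g) $$ (0, 0) = (\<phi> g * T) $$ (0, 0)" using intertwinesD(2)[OF T g] by simp
        then show ?thesis
          using index_mult_mat_sum[OF Tc c(1), of 0 0] index_mult_mat_sum[OF c(2) Tc, of 0 0] T0 by (simp add: mult.commute)
      qed
      then have "?F \<psi> = ?F \<phi>" by (intro restrict_ext) simp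
      then show False using inj_onD[OF Q(2) _ \<psi> \<phi>] ne by blast
    qed
  qed (use QA in auto)
  then show ?thesis unfolding Q(3) by blast
qed

text \<open>If every irreducible representation of dimension \<open>d\<close> has a twist that is trivial on \<open>K l\<close>, then every class has such
  a member, and these members are pairwise nonisomorphic irreducible representations of \<open>G / K l\<close>.\<close>

lemma (in twist_setting) num_twist_isoclasses_le:
  assumes level: "\<And>\<rho>. \<rho> \<in> irreps G TG d \<Longrightarrow> \<exists>\<chi>. smooth_char \<chi> \<and> (\<forall>k\<in>K l. \<chi> k \<cdot>\<^sub>m \<rho> k = 1\<^sub>m d)"
  shows "num_classes (twist_isoclasses G TG d) \<le> of_nat (card (lcosets_of G (K l)))"
proof -
  let ?C = "twist_isoclasses G TG d"
  have "\<exists>\<sigma>. \<sigma> \<in> B \<and> \<sigma> \<in> irreps G TG d \<and> (\<forall>k\<in>K l. \<sigma> k = 1\<^sub>m d)" if B: "B \<in> ?C" for B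
  proof -
    obtain \<rho> where \<rho>: "\<rho> \<in> B" "\<rho> \<in> irreps G TG d"
      using B in_quotient_imp_non_empty[OF equiv_twist] in_quotient_imp_subset[OF equiv_twist]
      unfolding twist_isoclasses_def by blast
    obtain \<chi> where \<chi>: "smooth_char \<chi>" "\<forall>k\<in>K l. \<chi> k \<cdot>\<^sub>m \<rho> k = 1\<^sub>m d" using level[OF \<rho>(2)] by blast
    define \<sigma> where "\<sigma> = (\<lambda>g. \<chi> g \<cdot>\<^sub>m \<rho> g)"
    have r: "mat_rep G d \<sigma>" unfolding \<sigma>_def by (rule mat_rep_smult[OF irreps_GD(1)[OF \<rho>(2)] smooth_charD[OF \<chi>(1)]])
    have i: "mat_irreducible (carrier G) d \<sigma>"
      unfolding \<sigma>_def by (rule mat_irreducible_smult[OF irreps_GD(3)[OF \<rho>(2)] smooth_char_nonzero[OF \<chi>(1)]])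
    have t: "\<forall>k\<in>K l. \<sigma> k = 1\<^sub>m d" unfolding \<sigma>_def by (rule \<chi>(2))
    have \<sigma>: "\<sigma> \<in> irreps G TG d" unfolding irreps_G_iff using r i t by blast
    have "twist_equivalent G TG d \<rho> \<sigma>"
    proof (rule twist_equivalentI[OF smooth_char_inverse[OF \<chi>(1)]])
      show "1\<^sub>m d \<in> carrier (GL d)" using group.is_monoid[OF GL_group] monoid.one_closed GL_one by metis
      fix g assume g: "g \<in> carrier G"
      show \<sigma>g: "\<sigma> g \<in> carrier_mat d d" using mat_repD(1)[OF r g] .
      show "1\<^sub>m d * \<rho> g = inverse (\<chi> g) \<cdot>\<^sub>m (\<sigma> g * 1\<^sub>m d)"
        unfolding right_mult_one_mat[OF \<sigma>g] left_mult_one_mat[OF irreps_GD(4)[OF \<rho>(2) g]]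
        unfolding \<sigma>_def smult_smult_mat using smooth_char_nonzero[OF \<chi>(1) g] by (simp add: one_smult_mat)
    qed
    then have "\<sigma> \<in> B"
      using in_quotient_imp_closed[OF equiv_twist B[unfolded twist_isoclasses_def] \<rho>(1)] \<rho>(2) \<sigma> by blast
    then show ?thesis using \<sigma> t by blast
  qed
  then have "\<exists>f. \<forall>B\<in>?C. f B \<in> B \<and> f B \<in> irreps G TG d \<and> (\<forall>k\<in>K l. f B k = 1\<^sub>m d)" by (intro bchoice ballI)
  then obtain f where f: "\<forall>B\<in>?C. f B \<in> B \<and> f B \<in> irreps G TG d \<and> (\<forall>k\<in>K l. f B k = 1\<^sub>m d)" by (rule exE)
  have same: "A = B" if A: "A \<in> ?C" and B: "B \<in> ?C" and T: "intertwines (carrier G) d d (f A) (f B) T" "T \<noteq> 0\<^sub>m d d" for A B T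
  proof -
    have fA: "f A \<in> A" "f A \<in> irreps G TG d" and fB: "f B \<in> B" "f B \<in> irreps G TG d" using f A B by blast+
    obtain R where R: "intertwines (carrier G) d d (f B) (f A) R" "R * T = 1\<^sub>m d" "T * R = 1\<^sub>m d"
      by (rule schur_inverse[OF irreps_GD(3)[OF fA(2)] irreps_GD(3)[OF fB(2)] T])
    have TG: "T \<in> carrier (GL d)"
      unfolding GL_carrier_iff using intertwinesD(1)[OF T(1)] intertwinesD(1)[OF R(1)] R(2,3) by blast
    have "twist_equivalent G TG d (f A) (f B)"
    proof (rule twist_equivalentI[OF smooth_char_one TG irreps_GD(4)[OF fB(2)]])
      show "T * f A g = 1 \<cdot>\<^sub>m (f B g * T)" if "g \<in> carrier G" for g
        using intertwinesD(2)[OF T(1) that] by (simp add: one_smult_mat)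
    qed
    then show ?thesis
      using quotient_eqI[OF equiv_twist A[unfolded twist_isoclasses_def] B[unfolded twist_isoclasses_def] fA(1) fB(1)] fA(2) fB(2)
      by blast
  qed
  have d: "d > 0" if "B \<in> ?C" for B using f that irreps_GD(5) by blast
  have inj: "inj_on f ?C"
  proof (rule inj_onI)
    fix A B assume AB: "A \<in> ?C" "B \<in> ?C" "f A = f B"
    have c: "f A g \<in> carrier_mat d d" if "g \<in> carrier G" for g using f AB(1) irreps_GD(4)[OF _ that] by blast
    have i: "intertwines (carrier G) d d (f A) (f B) (1\<^sub>m d)"
      unfolding intertwines_def AB(3)[symmetric] using left_mult_one_mat[OF c] right_mult_one_mat[OF c] by simp
    have "(1\<^sub>m d :: complex mat) $$ (0, 0) \<noteq> 0\<^sub>m d d $$ (0, 0)" using d[OF AB(1)] by simp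
    then have "(1\<^sub>m d :: complex mat) \<noteq> 0\<^sub>m d d" by metis
    then show "A = B" by (rule same[OF AB(1,2) i])
  qed
  have "finite (f ` ?C) \<and> card (f ` ?C) \<le> card (lcosets_of G (K l))"
  proof (rule card_noniso_irreducibles_le_index[OF K_normal K_finite])
    fix \<sigma> assume "\<sigma> \<in> f ` ?C"
    then have \<sigma>: "\<sigma> \<in> irreps G TG d" "\<forall>k\<in>K l. \<sigma> k = 1\<^sub>m d" using f by blast+
    show "mat_rep G d \<sigma>" "mat_irreducible (carrier G) d \<sigma>" using irreps_GD(1,3)[OF \<sigma>(1)] .
    show "\<sigma> k = 1\<^sub>m d" if "k \<in> K l" for k using \<sigma>(2) that by blast
    fix \<tau> T assume "\<tau> \<in> f ` ?C" "\<sigma> \<noteq> \<tau>" "intertwines (carrier G) d d \<sigma> \<tau> T"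
    then show "T = 0\<^sub>m d d" using \<open>\<sigma> \<in> f ` ?C\<close> same by blast
  qed
  then have "finite ?C" "card ?C \<le> card (lcosets_of G (K l))"
    using inj finite_imageD card_image by (blast, metis)
  then show ?thesis unfolding num_classes_def by (simp add: emeasure_count_space_finite)
qed

lemma dirichlet_series_finite:
  assumes "\<And>i. i > 0 \<Longrightarrow> a i \<le> ennreal (C * real i ^ m)" "C \<ge> 0"
  shows "dirichlet_series a (real m + 2) < \<infinity>"
proof -
  have "a (Suc i) * ennreal (real (Suc i) powr - (real m + 2)) \<le> ennreal (C * inverse (real (Suc i) ^ 2))" for i
  proof -
    have eq: "real (Suc i) ^ m * real (Suc i) powr - (real m + 2) = inverse (real (Suc i) ^ 2)"
    proof -
      define x where "x = real (Suc i)"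
      have x: "x > 0" by (simp add: x_def)
      have "x ^ m * x powr - (real m + 2) = x powr real m * x powr - (real m + 2)" using x by (simp only: powr_realpow)
      also have "\<dots> = x powr - 2" unfolding powr_add[symmetric] by simp
      also have "\<dots> = inverse (x ^ 2)" using x powr_realpow[OF x, of 2] by (simp add: powr_minus)
      finally show ?thesis unfolding x_def .
    qed
    have "a (Suc i) * ennreal (real (Suc i) powr - (real m + 2))
        \<le> ennreal (C * real (Suc i) ^ m) * ennreal (real (Suc i) powr - (real m + 2))"
      by (intro mult_right_mono assms) auto
    also have "\<dots> = ennreal (C * real (Suc i) ^ m * real (Suc i) powr - (real m + 2))"
      using assms(2) by (intro ennreal_mult[symmetric]) auto
    also have "\<dots> = ennreal (C * inverse (real (Suc i) ^ 2))" unfolding mult.assoc eq ..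
    finally show ?thesis .
  qed
  then have "dirichlet_series a (real m + 2) \<le> suminf (\<lambda>i. ennreal (C * inverse (real (Suc i) ^ 2)))"
    unfolding dirichlet_series_def by (intro suminf_le) auto
  also have "\<dots> < \<infinity>"
  proof -
    have "summable (\<lambda>i. C * inverse (real (Suc i) ^ 2))"
      by (intro summable_mult iffD2[OF summable_Suc_iff[of "\<lambda>i. inverse (real i ^ 2)"]] inverse_power_summable) simp
    then show ?thesis using assms(2) by (subst suminf_ennreal2) auto
  qed
  finally show ?thesis .
qed

section \<open>The general linear group\<close>

context complete_dvr
begin

lemma unit_representatives:
  obtains e :: nat and r where "\<forall>i<e. r i dvd (1 :: 'a)" "\<forall>u. u dvd 1 \<longrightarrow> (\<exists>i<e. \<pi> ^ N dvd r i - u)"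
proof -
  let ?U = "residue N ` {u. u dvd 1}"
  have "finite ?U" by (rule finite_subset[OF _ finite_residues[of N]]) auto
  then obtain f where f: "bij_betw f {0..<card ?U} ?U" using ex_bij_betw_nat_finite by blast
  define r where "r = (\<lambda>i. inv_into {u. u dvd 1} (residue N) (f i))"
  have 1: "r i dvd 1" if "i < card ?U" for i
    using inv_into_into[of "f i" "residue N" "{u. u dvd 1}"] bij_betwE[OF f] that unfolding r_def by auto
  have "\<exists>i<card ?U. \<pi> ^ N dvd r i - u" if u: "u dvd 1" for u
  proof -
    have "residue N u \<in> f ` {0..<card ?U}" using f u unfolding bij_betw_def by simp
    then obtain i where i: "i < card ?U" "f i = residue N u" by auto
    have "residue N (r i) = residue N u"
      unfolding r_def i(2)[symmetric] by (rule f_inv_into_f) (use bij_betwE[OF f] i(1) in simp)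
    then show ?thesis using i(1) unfolding residue_eq_iff by blast
  qed
  then show thesis using 1 by (intro that[where e = "card ?U" and r = r]) auto
qed

lemma SL_carrier: "carrier (SL n) = {A \<in> carrier (GL n). det A = 1}" and SL_eq: "SL n = (GL n)\<lparr>carrier := carrier (SL n)\<rparr>"
  by (simp_all add: SL_def)

lemma SL_subgroup: "subgroup (carrier (SL n)) (GL n :: 'a mat monoid)"
proof -
  interpret G: group "GL n :: 'a mat monoid" by (rule GL_group)
  show ?thesis
  proof (rule G.subgroupI)
    show "carrier (SL n) \<noteq> ({} :: 'a mat set)" using G.one_closed by (auto simp: SL_carrier GL_one)
    show "inv\<^bsub>GL n\<^esub> a \<in> carrier (SL n)" if "a \<in> carrier (SL n)" for a :: "'a mat"
      using that det_GL_inv[of a n] G.inv_closed[of a] by (simp add: SL_carrier)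
    show "a \<otimes>\<^bsub>GL n\<^esub> b \<in> carrier (SL n)" if "a \<in> carrier (SL n)" "b \<in> carrier (SL n)" for a b :: "'a mat"
      using that det_GL_mult[of a n b] G.m_closed[of a b] by (simp add: SL_carrier)
  qed (auto simp: SL_carrier)
qed

text \<open>The scalar matrices and the special linear group generate a subgroup of finite index, as the
  \<open>n\<close>-th powers have finite index in the unit group.\<close>

lemma GL_finite_index_decomposition:
  assumes n: "n > 0" "of_nat n \<noteq> (0 :: 'a)"
  obtains e :: nat and \<gamma> where "\<forall>i<e. \<gamma> i \<in> carrier (GL n :: 'a mat monoid)"
    "\<forall>g\<in>carrier (GL n :: 'a mat monoid). \<exists>i<e. \<exists>z\<in>carrier (GL n). \<exists>s\<in>carrier (SL n).
       g = \<gamma> i \<otimes>\<^bsub>GL n\<^esub> z \<otimes>\<^bsub>GL n\<^esub> s \<and> (\<forall>h\<in>carrier (GL n). z \<otimes>\<^bsub>GL n\<^esub> h = h \<otimes>\<^bsub>GL n\<^esub> z)"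
proof -
  interpret G: group "GL n :: 'a mat monoid" by (rule GL_group)
  obtain N where N: "\<And>u :: 'a. \<pi> ^ N dvd u - 1 \<Longrightarrow> \<exists>w. w ^ n = u" by (rule nth_roots[OF n(2)]) blast
  obtain e :: nat and r where r: "\<forall>i<e. r i dvd (1 :: 'a)" "\<forall>u. u dvd 1 \<longrightarrow> (\<exists>i<e. \<pi> ^ N dvd r i - u)"
    by (rule unit_representatives[of N])
  define \<gamma> where "\<gamma> = (\<lambda>i. multrow_mat n 0 (r i))"
  have \<gamma>c: "\<gamma> i \<in> carrier_mat n n" and \<gamma>d: "det (\<gamma> i) = r i" for i
    unfolding \<gamma>_def using n det_multrow_mat[of 0 n "r i"] by auto
  have \<gamma>: "\<gamma> i \<in> carrier (GL n)" if "i < e" for i using GL_det_iff[OF \<gamma>c] \<gamma>d r(1) that by simp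
  have "\<exists>i<e. \<exists>z\<in>carrier (GL n). \<exists>s\<in>carrier (SL n).
       g = \<gamma> i \<otimes>\<^bsub>GL n\<^esub> z \<otimes>\<^bsub>GL n\<^esub> s \<and> (\<forall>h\<in>carrier (GL n). z \<otimes>\<^bsub>GL n\<^esub> h = h \<otimes>\<^bsub>GL n\<^esub> z)"
    if g: "g \<in> carrier (GL n)" for g :: "'a mat"
  proof -
    have gc: "g \<in> carrier_mat n n" using g GL_carrier_iff by blast
    have gu: "det g dvd 1" using GL_det_iff[OF gc] g by simp
    obtain i where i: "i < e" "\<pi> ^ N dvd r i - det g" using r(2) gu by blast
    have "r i dvd 1" using r(1) i(1) by simp
    then obtain v where v: "1 = r i * v" by (rule dvdE)
    have "\<pi> ^ N dvd - ((r i - det g) * v)" using i(2) by simp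
    also have "- ((r i - det g) * v) = det g * v - 1" using v by (simp add: algebra_simps)
    finally obtain w where w: "w ^ n = det g * v" using N by blast
    have dg: "det g = r i * w ^ n" unfolding w using v by (simp add: mult.left_commute[of "r i"] mult.commute[of v])
    have wu: "w ^ n dvd 1" by (rule dvd_trans[OF _ gu]) (simp add: dg)
    define z where "z = w \<cdot>\<^sub>m (1\<^sub>m n :: 'a mat)"
    have zc: "z \<in> carrier_mat n n" and zd: "det z = w ^ n" by (simp_all add: z_def det_smult)
    have z: "z \<in> carrier (GL n)" using GL_det_iff[OF zc] zd wu by simp
    have zh: "z * h = h * z" if h: "h \<in> carrier_mat n n" for h
      unfolding z_def using mult_smult_assoc_mat[OF one_carrier_mat h, of w] mult_smult_distrib[OF h one_carrier_mat, of w] h by simp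
    define s where "s = inv\<^bsub>GL n\<^esub> (\<gamma> i \<otimes>\<^bsub>GL n\<^esub> z) \<otimes>\<^bsub>GL n\<^esub> g"
    have \<gamma>z: "\<gamma> i \<otimes>\<^bsub>GL n\<^esub> z \<in> carrier (GL n)" using \<gamma>[OF i(1)] z by simp
    have s: "s \<in> carrier (GL n)" unfolding s_def using \<gamma>z g by simp
    have gs: "g = \<gamma> i \<otimes>\<^bsub>GL n\<^esub> z \<otimes>\<^bsub>GL n\<^esub> s" unfolding s_def using \<gamma>z g by (simp add: G.m_assoc[symmetric])
    have "det (\<gamma> i \<otimes>\<^bsub>GL n\<^esub> z) = det g" using det_GL_mult[OF \<gamma>[OF i(1)] z] \<gamma>d zd dg by simp
    then have "det s = 1" unfolding s_def using det_GL_mult[OF G.inv_closed[OF \<gamma>z] g] det_GL_inv[OF \<gamma>z] by simp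
    then have sS: "s \<in> carrier (SL n)" using s by (simp add: SL_carrier)
    have "\<forall>h\<in>carrier (GL n). z \<otimes>\<^bsub>GL n\<^esub> h = h \<otimes>\<^bsub>GL n\<^esub> z" using zh by (simp add: GL_mult GL_carrier_iff)
    then show ?thesis using i(1) z sS gs by blast
  qed
  then show thesis using \<gamma> by (intro that[of e \<gamma>]) auto
qed

lemma representation_GL_iff:
  assumes max: "dvr_max_ideal (class_ring :: 'a ring) = {x. \<pi> dvd x}"
  shows "representation (GL n :: 'a mat monoid) (GL_topology n) d \<rho> \<longleftrightarrow>
    mat_rep (GL n) d \<rho> \<and> (\<exists>l. \<forall>k\<in>cong_subgroup n l. \<rho> k = 1\<^sub>m d)"
proof -
  interpret G: group "GL n :: 'a mat monoid" by (rule GL_group)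
  have "carrier (GL n) \<inter> cong_subgroup n l = cong_subgroup n l" for l using cong_subgroup_subset by blast
  then show ?thesis
    using representation_iff_trivial_on_cong_subgroup[OF G.subgroup_self, of d \<rho>]
    by (simp add: GL_topology_def max adic_def)
qed

lemma representation_SL_iff:
  assumes max: "dvr_max_ideal (class_ring :: 'a ring) = {x. \<pi> dvd x}"
  shows "representation ((GL n :: 'a mat monoid)\<lparr>carrier := carrier (SL n)\<rparr>) (SL_topology n) d \<rho> \<longleftrightarrow>
    mat_rep ((GL n)\<lparr>carrier := carrier (SL n)\<rparr>) d \<rho> \<and> (\<exists>l. \<forall>k\<in>carrier (SL n) \<inter> cong_subgroup n l. \<rho> k = 1\<^sub>m d)"
proof -
  have "carrier (GL n) \<inter> carrier (SL n) = (carrier (SL n) :: 'a mat set)" by (auto simp: SL_carrier)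
  then have "SL_topology n = subtopology (mat_topology adic n) (carrier (SL n))"
    by (simp add: SL_topology_def GL_topology_def max adic_def subtopology_subtopology)
  then show ?thesis using representation_iff_trivial_on_cong_subgroup[OF SL_subgroup, of n d \<rho>] by simp
qed

text \<open>By the bound on levels for dimension 1, a character is up to a twist by a character trivial on \<open>SL n\<close> a
  character of the quotient by the congruence subgroup of level 2.\<close>

lemma finite_SL_restrictions:
  assumes n: "n > 0" and max: "dvr_max_ideal (class_ring :: 'a ring) = {x. \<pi> dvd x}"
  shows "finite ((\<lambda>\<psi>. restrict (\<lambda>g. \<psi> g $$ (0, 0)) (carrier (SL n))) ` {\<psi>. representation (GL n :: 'a mat monoid) (GL_topology n) 1 \<psi>})"
    (is "finite (?R ` ?A)")
proof -
  interpret G: group "GL n :: 'a mat monoid" by (rule GL_group)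
  let ?F = "\<lambda>\<psi>. restrict (\<lambda>g :: 'a mat. \<psi> g $$ (0, 0)) (carrier (GL n))"
  let ?B = "{\<psi> :: 'a mat \<Rightarrow> complex mat. mat_rep (GL n) 1 \<psi> \<and> (\<forall>k\<in>cong_subgroup n (2 * 1). \<psi> k = 1\<^sub>m 1)}"
  have "?R \<psi> \<in> (\<lambda>f. restrict f (carrier (SL n))) ` ?F ` ?B" if \<psi>: "\<psi> \<in> ?A" for \<psi>
  proof -
    have rep: "mat_rep (GL n) 1 \<psi>" and smooth: "\<exists>l. \<forall>g\<in>cong_subgroup n l. \<psi> g = 1\<^sub>m 1"
      using \<psi> unfolding mem_Collect_eq representation_GL_iff[OF max] by (rule conjunct1, rule conjunct2)
    obtain \<chi> where \<chi>: "det_char n \<chi>" "\<forall>g\<in>cong_subgroup n (2 * 1). \<chi> g \<cdot>\<^sub>m \<psi> g = 1\<^sub>m 1"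
      by (rule twist_level_bound[OF n rep mat_irreducible_1[OF mat_repD(1)[OF rep]] smooth residues_card_gt])
    define \<phi> where "\<phi> = (\<lambda>g. \<chi> g \<cdot>\<^sub>m \<psi> g)"
    have "mat_rep (GL n) 1 \<phi>"
      unfolding \<phi>_def by (rule mat_rep_smult[OF rep]) (use det_charD(1,2)[OF \<chi>(1)] in \<open>simp_all add: GL_one GL_mult\<close>)
    then have \<phi>: "\<phi> \<in> ?B" using \<chi>(2) by (simp add: \<phi>_def)
    have "?R \<psi> = restrict (?F \<phi>) (carrier (SL n))"
    proof (rule restrict_ext)
      fix g :: "'a mat" assume "g \<in> carrier (SL n)"
      then have g: "g \<in> carrier (GL n)" "det g = 1" by (auto simp: SL_carrier)
      then show "\<psi> g $$ (0, 0) = ?F \<phi> g"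
        using det_charD(3)[OF \<chi>(1)] carrier_matD[OF mat_repD(1)[OF rep g(1)]] by (simp add: \<phi>_def)
    qed
    then show ?thesis using \<phi> by blast
  qed
  moreover have "finite (?F ` ?B)" by (rule G.finite_characters[OF cong_subgroup_normal cong_subgroup_index(1)])
  ultimately show ?thesis by (meson finite_imageI finite_subset image_subsetI)
qed

lemma GL_twist_setting:
  assumes n: "n > 0" "of_nat n \<noteq> (0 :: 'a)" and max: "dvr_max_ideal (class_ring :: 'a ring) = {x. \<pi> dvd x}"
  obtains \<gamma> e where "twist_setting (GL n :: 'a mat monoid) (GL_topology n) (carrier (SL n)) (SL_topology n) (cong_subgroup n) \<gamma> e"
proof -
  interpret G: group "GL n :: 'a mat monoid" by (rule GL_group)
  obtain e :: nat and \<gamma> where \<gamma>: "\<forall>i<e. \<gamma> i \<in> carrier (GL n :: 'a mat monoid)"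
    and dec: "\<forall>g\<in>carrier (GL n :: 'a mat monoid). \<exists>i<e. \<exists>z\<in>carrier (GL n). \<exists>s\<in>carrier (SL n).
       g = \<gamma> i \<otimes>\<^bsub>GL n\<^esub> z \<otimes>\<^bsub>GL n\<^esub> s \<and> (\<forall>h\<in>carrier (GL n). z \<otimes>\<^bsub>GL n\<^esub> h = h \<otimes>\<^bsub>GL n\<^esub> z)"
    by (rule GL_finite_index_decomposition[OF n])
  have "twist_setting (GL n :: 'a mat monoid) (GL_topology n) (carrier (SL n)) (SL_topology n) (cong_subgroup n) \<gamma> e"
  proof (intro twist_setting.intro twist_setting_axioms.intro)
    show "group (GL n :: 'a mat monoid)" by (rule GL_group)
    show "inv\<^bsub>GL n\<^esub> (h \<otimes>\<^bsub>GL n\<^esub> g) \<otimes>\<^bsub>GL n\<^esub> (g \<otimes>\<^bsub>GL n\<^esub> h) \<in> carrier (SL n)"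
      if g: "g \<in> carrier (GL n)" and h: "h \<in> carrier (GL n)" for g h :: "'a mat"
    proof -
      have hg: "h \<otimes>\<^bsub>GL n\<^esub> g \<in> carrier (GL n)" and gh: "g \<otimes>\<^bsub>GL n\<^esub> h \<in> carrier (GL n)" using g h by simp_all
      have "det (g \<otimes>\<^bsub>GL n\<^esub> h) = det (h \<otimes>\<^bsub>GL n\<^esub> g)" unfolding det_GL_mult[OF g h] det_GL_mult[OF h g] by (rule mult.commute)
      then have "det (inv\<^bsub>GL n\<^esub> (h \<otimes>\<^bsub>GL n\<^esub> g) \<otimes>\<^bsub>GL n\<^esub> (g \<otimes>\<^bsub>GL n\<^esub> h)) = 1"
        using det_GL_mult[OF G.inv_closed[OF hg] gh] det_GL_inv[OF hg] by simp
      then show ?thesis using hg gh by (simp add: SL_carrier)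
    qed
  qed (fact representation_GL_iff[OF max] representation_SL_iff[OF max] cong_subgroup_normal cong_subgroup_index(1)
      cong_subgroup_antimono SL_subgroup \<gamma>[rule_format] bspec[OF dec] finite_SL_restrictions[OF n(1) max])+
  then show thesis by (rule that)
qed

text \<open>With \<open>k\<close> least such that \<open>d < |O / \<pi>\<^sup>k|\<close>, the order of \<open>O / \<pi>\<^sup>k\<close> is at most \<open>q d\<close>, where \<open>q\<close> is
  the order of the residue field; so the index of the congruence subgroup of level \<open>2 k\<close> is at most
  \<open>(q d)\<close> to the power \<open>2 n\<^sup>2\<close>.\<close>

lemma twist_zeta_converges:
  assumes ts: "twist_setting (GL n :: 'a mat monoid) (GL_topology n) (carrier (SL n)) (SL_topology n) (cong_subgroup n) \<gamma> e"
    and n: "n > 0"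
  shows "\<exists>s. twist_zeta (GL n :: 'a mat monoid) (GL_topology n) s < \<infinity>"
proof -
  interpret T: twist_setting "GL n :: 'a mat monoid" "GL_topology n" "carrier (SL n)" "SL_topology n" "cong_subgroup n" \<gamma> e by (rule ts)
  define q where "q = residues_card 1"
  have bound: "num_classes (twist_isoclasses (GL n :: 'a mat monoid) (GL_topology n) d) \<le> ennreal (real (q ^ (2 * n * n)) * real d ^ (2 * n * n))"
    if d: "d > 0" for d
  proof -
    define k where "k = (LEAST k. d < residues_card k)"
    have small: "d < residues_card k" unfolding k_def by (rule LeastI[of _ d]) (rule residues_card_gt)
    then have k: "k > 0" using d residues_card_0 by (cases "k = 0") auto
    have "\<not> d < residues_card (k - 1)" using k unfolding k_def by (intro not_less_Least) simp
    then have "residues_card k \<le> d * q"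
      using residues_card_add[of "k - 1" 1] k unfolding q_def by (simp add: le_trans[OF _ mult_le_mono1])
    then have "residues_card (2 * k) \<le> (d * q) * (d * q)"
      using residues_card_add[of k k] by (simp add: mult_2 le_trans[OF _ mult_le_mono])
    then have "residues_card (2 * k) ^ (n * n) \<le> ((d * q) * (d * q)) ^ (n * n)" by (rule power_mono) simp
    also have "((d * q) * (d * q)) ^ (n * n) = q ^ (2 * n * n) * d ^ (2 * n * n)"
    proof -
      have "((d * q) * (d * q)) ^ (n * n) = (q ^ (n * n) * q ^ (n * n)) * (d ^ (n * n) * d ^ (n * n))"
        by (simp only: power_mult_distrib mult_ac)
      then show ?thesis by (simp only: power_add[symmetric] mult_2 distrib_right)
    qed
    finally have card: "card (lcosets_of (GL n :: 'a mat monoid) (cong_subgroup n (2 * k))) \<le> q ^ (2 * n * n) * d ^ (2 * n * n)"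
      using cong_subgroup_index(2)[of n "2 * k"] by simp
    have "num_classes (twist_isoclasses (GL n :: 'a mat monoid) (GL_topology n) d)
        \<le> of_nat (card (lcosets_of (GL n :: 'a mat monoid) (cong_subgroup n (2 * k))))"
    proof (rule T.num_twist_isoclasses_le)
      fix \<rho> assume \<rho>: "\<rho> \<in> irreps (GL n :: 'a mat monoid) (GL_topology n) d"
      obtain \<chi> where \<chi>: "det_char n \<chi>" "\<forall>g\<in>cong_subgroup n (2 * k). \<chi> g \<cdot>\<^sub>m \<rho> g = 1\<^sub>m d"
        by (rule twist_level_bound[OF n T.irreps_GD(1)[OF \<rho>] T.irreps_GD(3)[OF \<rho>] T.irreps_GD(2)[OF \<rho>] small])
      have "T.smooth_char \<chi>" unfolding T.smooth_char_def using \<chi>(1) unfolding det_char_def by (simp add: GL_one GL_mult)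
      then show "\<exists>\<chi>. T.smooth_char \<chi> \<and> (\<forall>g\<in>cong_subgroup n (2 * k). \<chi> g \<cdot>\<^sub>m \<rho> g = 1\<^sub>m d)" using \<chi>(2) by blast
    qed
    also have "\<dots> \<le> of_nat (q ^ (2 * n * n) * d ^ (2 * n * n))" using card by (rule of_nat_mono)
    also have "\<dots> = ennreal (real (q ^ (2 * n * n)) * real d ^ (2 * n * n))"
      unfolding ennreal_of_nat_eq_real_of_nat by simp
    finally show ?thesis .
  qed
  have "twist_zeta (GL n :: 'a mat monoid) (GL_topology n) (real (2 * n * n) + 2) < \<infinity>"
    unfolding twist_zeta_def by (rule dirichlet_series_finite[OF bound]) auto
  then show ?thesis by blast
qed

end

theorem proposition3p4:
  fixes n :: nat
  assumes "complete_dvr_finite_residue_field (class_ring :: 'a :: idom ring)"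
    and "n \<ge> 1"
    and "\<not> CHAR('a) dvd n"
  defines "\<zeta>\<^sub>S\<^sub>L \<equiv> rep_zeta (SL n :: 'a mat monoid) (SL_topology n)"
    and "\<zeta>\<^sub>G\<^sub>L \<equiv> twist_zeta (GL n :: 'a mat monoid) (GL_topology n)"
  shows "(\<exists>s. \<zeta>\<^sub>G\<^sub>L s < \<infinity>) \<and>
    abscissa_of_convergence \<zeta>\<^sub>G\<^sub>L = abscissa_of_convergence \<zeta>\<^sub>S\<^sub>L"
proof -
  obtain \<pi> :: 'a where \<pi>: "complete_dvr \<pi>" and max: "dvr_max_ideal (class_ring :: 'a ring) = {x. \<pi> dvd x}"
    by (rule complete_dvr_exists[OF assms(1)])
  interpret complete_dvr \<pi> by (rule \<pi>)
  have n: "n > 0" "of_nat n \<noteq> (0 :: 'a)" using assms(2,3) by (auto simp: of_nat_eq_0_iff_char_dvd)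
  obtain \<gamma> e where ts: "twist_setting (GL n :: 'a mat monoid) (GL_topology n) (carrier (SL n)) (SL_topology n) (cong_subgroup n) \<gamma> e"
    by (rule GL_twist_setting[OF n max])
  have "\<zeta>\<^sub>G\<^sub>L s < \<infinity> \<longleftrightarrow> \<zeta>\<^sub>S\<^sub>L s < \<infinity>" for s
    unfolding \<zeta>\<^sub>G\<^sub>L_def \<zeta>\<^sub>S\<^sub>L_def using twist_setting.twist_zeta_finite_iff[OF ts, of s] unfolding SL_eq[symmetric] .
  moreover have "\<exists>s. \<zeta>\<^sub>G\<^sub>L s < \<infinity>" unfolding \<zeta>\<^sub>G\<^sub>L_def by (rule twist_zeta_converges[OF ts n(1)])
  ultimately show ?thesis unfolding abscissa_of_convergence_def by simp
qed

end
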